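(* Let $d\in\mathbb N$, let $(P_{i,n})_{i,n\in\mathbb N}$ be polynomials of degree at most $d$, let $\vec X=(X_j)_{j\in\mathbb N}$ be a sequence of independent and identically distributed real random variables that are centered, have unit variance, and admit moments of every order, and let $\vec F_n=(F_{i,n})_{i\in\mathbb N}$ be the infinite random vector given by $F_{i,n}=P_{i,n}(\vec X)$, $i,n\in\mathbb N$. Assume that $(\vec F_n)_n$ converges in law. Then there exist polynomials $(Q_i)_{i\in\mathbb N}$ of degree at most $d$ and an infinite random vector $\vec Y=(Y_j)_j$ with independent entries such that, for every $j$, the law of $Y_j$ is either the law of $X_1$ or $\mathcal N(0,1)$, and $$\vec F_n\xrightarrow[n\to\infty]{\text{law}}(Q_i(\vec Y))_{i\in\mathbb N}.$$
   Context: Convergence in law of infinite random vectors means convergence in law of all finite-dimensional marginals. Polynomials may involve countably many variables: for a sequence $\vec Z=(Z_j)$ of independent, centered, unit-variance random variables with finite moments of all orders, "$P(\vec Z)$ with $\deg P\le d$" means an element of the $L^2(\mathbf P)$-closure of the linear space of ordinary polynomials of total degree at most $d$ in finitely many of the $Z_j$. *)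

theory Defs
  imports "HOL-Probability.Probability" "HOL-Library.Poly_Mapping"
begin

text \<open>Real polynomials in the variables \<open>z 0, z 1, \<dots>\<close>: a monomial is a finitely supported
  exponent function, a polynomial a finitely supported coefficient function on monomials.\<close>

type_synonym rpoly = "(nat \<Rightarrow>\<^sub>0 nat) \<Rightarrow>\<^sub>0 real"

definition eval_rpoly :: "rpoly \<Rightarrow> (nat \<Rightarrow> real) \<Rightarrow> real" where
  "eval_rpoly p z =
     (\<Sum>m\<in>Poly_Mapping.keys p. Poly_Mapping.lookup p m *
        (\<Prod>j\<in>Poly_Mapping.keys m. z j ^ Poly_Mapping.lookup m j))"

definition degree_le :: "nat \<Rightarrow> rpoly \<Rightarrow> bool" where
  "degree_le d p \<longleftrightarrow>
     (\<forall>m\<in>Poly_Mapping.keys p. (\<Sum>j\<in>Poly_Mapping.keys m. Poly_Mapping.lookup m j) \<le> d)"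

text \<open>The random variables of the form \<open>P(Z)\<close> with \<open>deg P \<le> d\<close>, where \<open>P\<close> may involve countably
  many variables: the \<open>L\<^sup>2\<close>-closure of the ordinary polynomials of degree at most \<open>d\<close> in \<open>Z\<close>.\<close>

definition poly_chaos :: "'a measure \<Rightarrow> (nat \<Rightarrow> 'a \<Rightarrow> real) \<Rightarrow> nat \<Rightarrow> ('a \<Rightarrow> real) set" where
  "poly_chaos M Z d =
     {F \<in> borel_measurable M.
        integrable M (\<lambda>\<omega>. (F \<omega>)\<^sup>2) \<and>
        (\<forall>\<epsilon>>0. \<exists>p. degree_le d p \<and>
           (\<integral>\<^sup>+\<omega>. ennreal ((F \<omega> - eval_rpoly p (\<lambda>j. Z j \<omega>))\<^sup>2) \<partial>M) < ennreal \<epsilon>)}"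

definition marginal_law ::
  "'a measure \<Rightarrow> (nat \<Rightarrow> 'a \<Rightarrow> real) \<Rightarrow> nat set \<Rightarrow> (nat \<Rightarrow> real) measure" where
  "marginal_law M F I = distr M (Pi\<^sub>M I (\<lambda>_. borel)) (\<lambda>\<omega>. \<lambda>i\<in>I. F i \<omega>)"

text \<open>Weak convergence on \<open>\<real>\<^sup>I\<close>, the latter being the set of extensional functions on \<open>I\<close>.\<close>

definition weak_conv_on ::
  "nat set \<Rightarrow> (nat \<Rightarrow> (nat \<Rightarrow> real) measure) \<Rightarrow> (nat \<Rightarrow> real) measure \<Rightarrow> bool" where
  "weak_conv_on I \<mu> \<nu> \<longleftrightarrow>
     (\<forall>g. continuous_map (product_topology (\<lambda>_. euclideanreal) I) euclideanreal g \<longrightarrow>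
          bounded (g ` (I \<rightarrow>\<^sub>E UNIV)) \<longrightarrow>
          (\<lambda>n. \<integral>x. g x \<partial>\<mu> n) \<longlonglongrightarrow> (\<integral>x. g x \<partial>\<nu>))"

text \<open>Convergence in law of infinite random vectors; \<open>F i n\<close> is the \<open>i\<close>-th entry of the
  \<open>n\<close>-th vector.\<close>

definition converges_in_law_to ::
  "'a measure \<Rightarrow> (nat \<Rightarrow> nat \<Rightarrow> 'a \<Rightarrow> real) \<Rightarrow> 'b measure \<Rightarrow> (nat \<Rightarrow> 'b \<Rightarrow> real) \<Rightarrow> bool" where
  "converges_in_law_to M F N G \<longleftrightarrow>
     (\<forall>I. finite I \<longrightarrow>
        weak_conv_on I (\<lambda>n. marginal_law M (\<lambda>i. F i n) I) (marginal_law N G I))"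

definition converges_in_law ::
  "'a measure \<Rightarrow> (nat \<Rightarrow> nat \<Rightarrow> 'a \<Rightarrow> real) \<Rightarrow> bool" where
  "converges_in_law M F \<longleftrightarrow>
     (\<exists>\<mu> :: (nat \<Rightarrow> real) measure.
        prob_space \<mu> \<and> sets \<mu> = sets (Pi\<^sub>M UNIV (\<lambda>_. borel)) \<and>
        converges_in_law_to M F \<mu> (\<lambda>i x. x i))"

end

(*
  Approximating in L^2, one may take F_i,n to be honest polynomials of the X_j; convergence in law and
  hypercontractivity (Paley-Zygmund) make them bounded in L^2.  Fix a nonprincipal ultrafilter U on the
  indices n.  Every L^2-bounded sequence of polynomials of degree at most k is approximated, in L^2 along
  U, by polynomials in two kinds of generators: coordinate sequences X_(J n), and sequences R_n of some
  degree k that are asymptotically orthogonal to all products of lower degree sequences and to all powers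
  of coordinate sequences.  Indeed, the minimal distance is attained by saturation, and the difference to
  the minimiser is itself a generator of the second kind.

  Sequences of the second kind are jointly Gaussian in the limit and independent of the coordinate
  sequences: the orthogonality makes the contractions of their multilinear expansions and the influences
  small, the Lindeberg method replaces the X_j by Gaussian variables, and the moments of the resulting
  Gaussian polynomial satisfy asymptotically the Gaussian recursion obtained by integration by parts.

  Hence countably many generators converge jointly along U to linear forms in independent variables with
  law X_0 or N(0,1), the Gaussian part being realised by a Cholesky factorisation of its covariance.
  The approximating polynomials in these limits form L^2-Cauchy sequences, and their limits G_i have the
  characteristic functions of the given limit law.
*)

theory Submission
  imports Defs
begin

section \<open>Polynomial functions\<close>

text \<open>Limits along an ultrafilter exist for all bounded families at once; the closest-point
  argument needs this, since it ranges over uncountably many approximants. As the convergence in law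
  is given, a limit along the ultrafilter already identifies the limit law. Constants in the moment
  inequalities depend on the degree and the law only, never on the number of variables. The main
  obstacle is to extract small contraction norms from orthogonality to products, because common
  variables of two factors interfere. Testing with factors in complementary sets of coordinates
  avoids this, and averaging over all such splittings loses only a power of 2 fixed by the degree.
  The law of the X_j may have finite support, making some powers depend linearly on lower ones;
  expansions in orthonormal polynomials therefore hold almost everywhere and may skip degrees.
  Derivatives of square-free polynomials are again square-free, so that integration by parts stays
  algebraic. Laws are compared through characteristic functions: the bounded substitutes c sin(v/c)
  map into a compact cube, where Stone-Weierstrass applies.\<close>

inductive polp :: "'i set \<Rightarrow> nat \<Rightarrow> (('i \<Rightarrow> real) \<Rightarrow> real) \<Rightarrow> bool" for S where
  "polp S k (\<lambda>_. c)"
| "polp S k A \<Longrightarrow> i \<in> S \<Longrightarrow> polp S (Suc k) (\<lambda>x. x i * A x)"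
| "polp S k A \<Longrightarrow> polp S k B \<Longrightarrow> polp S k (\<lambda>x. A x + B x)"

text \<open>Set form of the predicate. \<open>k\<close> is only an upper bound for the degree, since
  constants occur at every \<open>k\<close>, and products are built one variable at a time, so that
  inductions have a single multiplicative case.\<close>

definition pol :: "'i set \<Rightarrow> nat \<Rightarrow> (('i \<Rightarrow> real) \<Rightarrow> real) set" where
  "pol S k = {A. polp S k A}"

lemma polI:
  shows polI_const: "(\<lambda>_. c) \<in> pol S k"
    and polI_var: "A \<in> pol S k \<Longrightarrow> i \<in> S \<Longrightarrow> (\<lambda>x. x i * A x) \<in> pol S (Suc k)"
    and polI_add: "A \<in> pol S k \<Longrightarrow> B \<in> pol S k \<Longrightarrow> (\<lambda>x. A x + B x) \<in> pol S k"
  by (auto simp: pol_def intro: polp.intros)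

lemmas pol_const = polI_const and pol_var = polI_var and pol_add = polI_add

lemma pol_induct [consumes 1, case_names pol_const pol_var pol_add]:
  assumes "A \<in> pol S k"
    and "\<And>c k. R k (\<lambda>_. c)"
    and "\<And>A k i. A \<in> pol S k \<Longrightarrow> i \<in> S \<Longrightarrow> R k A \<Longrightarrow> R (Suc k) (\<lambda>x. x i * A x)"
    and "\<And>A k B. A \<in> pol S k \<Longrightarrow> B \<in> pol S k \<Longrightarrow> R k A \<Longrightarrow> R k B \<Longrightarrow> R k (\<lambda>x. A x + B x)"
  shows "R k A"
  using assms(1) unfolding pol_def mem_Collect_eq
  by (induction rule: polp.induct) (use assms(2-) in \<open>auto simp: pol_def\<close>)

lemma pol_mono: "A \<in> pol S k \<Longrightarrow> S \<subseteq> T \<Longrightarrow> k \<le> k' \<Longrightarrow> A \<in> pol T k'"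
proof (induction arbitrary: k' rule: pol_induct)
  case (pol_var A k i)
  then obtain k'' where "k' = Suc k''" "k \<le> k''" by (cases k') auto
  with pol_var show ?case by (auto intro!: polI_var)
qed (auto intro: polI)

lemma pol_scale: "A \<in> pol S k \<Longrightarrow> (\<lambda>x. c * A x) \<in> pol S k"
proof (induction rule: pol_induct)
  case (pol_var A k i)
  have "(\<lambda>x. x i * (c * A x)) \<in> pol S (Suc k)" by (intro polI_var pol_var)
  then show ?case by (simp add: mult.left_commute)
next
  case (pol_add A k B)
  then show ?case by (simp add: distrib_left polI_add)
qed (auto intro: polI)

lemma pol_mult: "A \<in> pol S a \<Longrightarrow> B \<in> pol S b \<Longrightarrow> (\<lambda>x. A x * B x) \<in> pol S (a + b)"
proof (induction rule: pol_induct)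
  case (pol_const c k)
  then show ?case by (intro pol_scale) (auto intro: pol_mono)
next
  case (pol_var A k i)
  then have "(\<lambda>x. x i * (A x * B x)) \<in> pol S (Suc (k + b))" by (intro polI_var) auto
  then show ?case by (simp add: mult.assoc)
next
  case (pol_add A k B')
  then show ?case by (simp add: distrib_right polI_add)
qed

lemma pol_coord: "i \<in> S \<Longrightarrow> k \<ge> 1 \<Longrightarrow> (\<lambda>x. x i) \<in> pol S k"
  using pol_var[OF pol_const[of 1 S 0], of i] by (auto intro: pol_mono)

lemma pol_diff: "A \<in> pol S k \<Longrightarrow> B \<in> pol S k \<Longrightarrow> (\<lambda>x. A x - B x) \<in> pol S k"
  using pol_add[of A S k "\<lambda>x. (-1) * B x"] pol_scale[of B S k "-1"] by simp

lemma pol_sum: "(\<And>t. t \<in> T \<Longrightarrow> A t \<in> pol S k) \<Longrightarrow> (\<lambda>x. \<Sum>t\<in>T. A t x) \<in> pol S k"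
  by (induction T rule: infinite_finite_induct) (auto intro: polI)

lemma pol_power: "A \<in> pol S k \<Longrightarrow> (\<lambda>x. A x ^ n) \<in> pol S (n * k)"
  by (induction n) (auto intro: pol_mult pol_const)

lemma pol_prod: "(\<And>t. t \<in> T \<Longrightarrow> A t \<in> pol S (w t)) \<Longrightarrow> (\<lambda>x. \<Prod>t\<in>T. A t x) \<in> pol S (\<Sum>t\<in>T. w t)"
  by (induction T rule: infinite_finite_induct) (auto intro: pol_const pol_mult)

lemma pol_comp:
  assumes "A \<in> pol S k" "\<And>i. i \<in> S \<Longrightarrow> V i \<in> pol T w"
  shows "(\<lambda>x. A (\<lambda>i. V i x)) \<in> pol T (k * w)"
  using assms(1)
proof (induction rule: pol_induct)
  case (pol_var A k i)
  then show ?case using pol_mult[OF assms(2)[of i] pol_var(3)] by simp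
qed (auto intro: polI)

lemma pol_dep: "A \<in> pol S k \<Longrightarrow> (\<And>i. i \<in> S \<Longrightarrow> x i = y i) \<Longrightarrow> A x = A y"
  by (induction rule: pol_induct) auto

text \<open>Every derivation mentions finitely many variables, even when \<open>S\<close> is
  infinite; this allows the later passage to finite index sets.\<close>

lemma pol_finite: "A \<in> pol S k \<Longrightarrow> \<exists>T. finite T \<and> T \<subseteq> S \<and> A \<in> pol T k"
proof (induction rule: pol_induct)
  case (pol_const c k)
  then show ?case by (intro exI[of _ "{}"]) (auto intro: polI)
next
  case (pol_var A k i)
  then obtain T where "finite T" "T \<subseteq> S" "A \<in> pol T k" by auto
  then show ?case using pol_var
    by (intro exI[of _ "insert i T"]) (auto intro!: polI_var intro: pol_mono)
next
  case (pol_add A k B)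
  then obtain T T' where "finite T" "T \<subseteq> S" "A \<in> pol T k" "finite T'" "T' \<subseteq> S" "B \<in> pol T' k" by auto
  then show ?case
    by (intro exI[of _ "T \<union> T'"]) (auto intro!: polI_add intro: pol_mono)
qed

lemma pol_UNIV_I: "A \<in> pol S k \<Longrightarrow> A \<in> pol UNIV k"
  by (auto intro: pol_mono)

lemma pol_poly: "i \<in> S \<Longrightarrow> degree p \<le> k \<Longrightarrow> (\<lambda>x. poly p (x i)) \<in> pol S k"
proof -
  assume a: "i \<in> S" "degree p \<le> k"
  have "(\<lambda>x. \<Sum>l\<le>degree p. coeff p l * x i ^ l) \<in> pol S k"
  proof (intro pol_sum pol_scale)
    fix l assume "l \<in> {..degree p}"
    with a show "(\<lambda>x. x i ^ l) \<in> pol S k"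
      using pol_power[OF pol_coord[OF a(1), of 1], of l] by (auto intro: pol_mono)
  qed
  then show ?thesis by (simp add: poly_altdef)
qed

lemma pol_measurable: "A \<in> pol S k \<Longrightarrow> (\<And>i. i \<in> S \<Longrightarrow> V i \<in> borel_measurable M) \<Longrightarrow>
    (\<lambda>w. A (\<lambda>i. V i w)) \<in> borel_measurable M"
  by (induction rule: pol_induct) auto

lemma pol_degree_0: "A \<in> pol S k \<Longrightarrow> k = 0 \<Longrightarrow> \<exists>c. A = (\<lambda>_. c)"
  by (induction rule: pol_induct) auto

section \<open>Polynomial functions and formal polynomials\<close>

definition mon_eval :: "(nat \<Rightarrow>\<^sub>0 nat) \<Rightarrow> (nat \<Rightarrow> real) \<Rightarrow> real" where
  "mon_eval m z = (\<Prod>j\<in>Poly_Mapping.keys m. z j ^ Poly_Mapping.lookup m j)"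

definition mon_deg :: "(nat \<Rightarrow>\<^sub>0 nat) \<Rightarrow> nat" where
  "mon_deg m = (\<Sum>j\<in>Poly_Mapping.keys m. Poly_Mapping.lookup m j)"

lemma eval_rpoly_superset:
  assumes "finite K" "Poly_Mapping.keys p \<subseteq> K"
  shows "eval_rpoly p z = (\<Sum>m\<in>K. Poly_Mapping.lookup p m * mon_eval m z)"
  unfolding eval_rpoly_def mon_eval_def[symmetric]
  by (rule sum.mono_neutral_left) (use assms in \<open>auto simp: in_keys_iff\<close>)

lemma eval_rpoly_pol:
  assumes "degree_le d p" shows "eval_rpoly p \<in> pol UNIV d"
proof -
  have "(\<lambda>z. \<Sum>m\<in>Poly_Mapping.keys p. Poly_Mapping.lookup p m * mon_eval m z) \<in> pol UNIV d"
  proof (intro pol_sum pol_scale)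
    fix m assume m: "m \<in> Poly_Mapping.keys p"
    have "(\<lambda>z. \<Prod>j\<in>Poly_Mapping.keys m. z j ^ Poly_Mapping.lookup m j) \<in> pol UNIV (mon_deg m)"
      unfolding mon_deg_def
      using pol_power[OF pol_coord[of _ UNIV 1]] by (intro pol_prod) simp
    moreover have "mon_deg m \<le> d" using assms m by (auto simp: degree_le_def mon_deg_def)
    ultimately show "mon_eval m \<in> pol UNIV d" unfolding mon_eval_def[abs_def] by (auto intro: pol_mono)
  qed
  then show ?thesis unfolding eval_rpoly_def[abs_def] mon_eval_def .
qed

lemma mon_eval_superset:
  assumes "finite K" "Poly_Mapping.keys m \<subseteq> K"
  shows "mon_eval m z = (\<Prod>j\<in>K. z j ^ Poly_Mapping.lookup m j)"
    "mon_deg m = (\<Sum>j\<in>K. Poly_Mapping.lookup m j)"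
  unfolding mon_eval_def mon_deg_def
  by (rule prod.mono_neutral_left sum.mono_neutral_left; use assms in \<open>auto simp: in_keys_iff\<close>)+

lemma mon_add_single:
  "mon_eval (m + Poly_Mapping.single i 1) z = z i * mon_eval m z"
  "mon_deg (m + Poly_Mapping.single i 1) = Suc (mon_deg m)"
proof -
  let ?K = "insert i (Poly_Mapping.keys m)" and ?m = "m + Poly_Mapping.single i 1"
  have K: "finite ?K" "Poly_Mapping.keys m \<subseteq> ?K" "Poly_Mapping.keys ?m \<subseteq> ?K"
    using Poly_Mapping.keys_add[of m "Poly_Mapping.single i 1"] by auto
  have l: "Poly_Mapping.lookup ?m j = Poly_Mapping.lookup m j + (if j = i then 1 else 0)" for j
    by (simp add: lookup_add lookup_single when_def)
  show "mon_eval ?m z = z i * mon_eval m z"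
    unfolding mon_eval_superset(1)[OF K(1,2)] mon_eval_superset(1)[OF K(1,3)] l
  proof -
    have "(\<Prod>j\<in>?K. z j ^ (Poly_Mapping.lookup m j + (if j = i then 1 else 0))) =
        (\<Prod>j\<in>?K. (if j = i then z i else 1) * z j ^ Poly_Mapping.lookup m j)"
      by (rule prod.cong) auto
    also have "\<dots> = (\<Prod>j\<in>?K. if j = i then z i else 1) * (\<Prod>j\<in>?K. z j ^ Poly_Mapping.lookup m j)"
      by (rule prod.distrib)
    also have "(\<Prod>j\<in>?K. if j = i then z i else 1) = z i"
      by (subst prod.delta) auto
    finally show "(\<Prod>j\<in>?K. z j ^ (Poly_Mapping.lookup m j + (if j = i then 1 else 0))) =
        z i * (\<Prod>j\<in>?K. z j ^ Poly_Mapping.lookup m j)" .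
  qed
  show "mon_deg ?m = Suc (mon_deg m)"
    unfolding mon_eval_superset(2)[OF K(1,2)] mon_eval_superset(2)[OF K(1,3)] l
    by (simp add: sum.distrib)
qed

lemma mon_eval_0[simp]: "mon_eval 0 z = 1" "mon_deg 0 = 0"
  by (auto simp: mon_eval_def mon_deg_def)

lemma eval_rpoly_add: "eval_rpoly (p + q) z = eval_rpoly p z + eval_rpoly q z"
  using Poly_Mapping.keys_add[of p q]
  by (subst (1 2 3) eval_rpoly_superset[of "Poly_Mapping.keys p \<union> Poly_Mapping.keys q"])
     (auto simp: lookup_add distrib_right sum.distrib)

lemma degree_le_add: "degree_le d p \<Longrightarrow> degree_le d q \<Longrightarrow> degree_le d (p + q)"
  unfolding degree_le_def using Poly_Mapping.keys_add[of p q] by blast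

lemma eval_rpoly_single: "eval_rpoly (Poly_Mapping.single m c) z = c * mon_eval m z"
  by (subst eval_rpoly_superset[of "{m}"]) auto

lemma degree_le_single: "mon_deg m \<le> d \<Longrightarrow> degree_le d (Poly_Mapping.single m c)"
  by (auto simp: degree_le_def mon_deg_def)

text \<open>Each monomial is shifted separately and the results are added; the claim for partial
  sums over subsets \<open>K'\<close> of the support makes this an induction, and additivity of
  evaluation takes care of the supports.\<close>

lemma eval_rpoly_mult_var:
  assumes "degree_le d p"
  shows "\<exists>q. degree_le (Suc d) q \<and> (\<forall>z. eval_rpoly q z = z i * eval_rpoly p z)"
proof -
  define K where "K = Poly_Mapping.keys p"
  have "\<exists>q. degree_le (Suc d) q \<and> (\<forall>z. eval_rpoly q z =
      z i * (\<Sum>m\<in>K'. Poly_Mapping.lookup p m * mon_eval m z))" if "finite K'" "K' \<subseteq> K" for K'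
    using that
  proof (induction rule: finite_induct)
    case empty
    show ?case by (rule exI[of _ 0]) (auto simp: degree_le_def eval_rpoly_def)
  next
    case (insert m K')
    then obtain q where q: "degree_le (Suc d) q" "\<And>z. eval_rpoly q z =
      z i * (\<Sum>m\<in>K'. Poly_Mapping.lookup p m * mon_eval m z)" by auto
    have "mon_deg m \<le> d" using assms insert by (auto simp: degree_le_def mon_deg_def K_def)
    then have "degree_le (Suc d) (Poly_Mapping.single (m + Poly_Mapping.single i 1) (Poly_Mapping.lookup p m))"
      by (intro degree_le_single) (simp add: mon_add_single(2)[of m i, simplified])
    then show ?case using q insert
      by (intro exI[of _ "Poly_Mapping.single (m + Poly_Mapping.single i 1) (Poly_Mapping.lookup p m) + q"])
         (auto intro!: degree_le_add simp: eval_rpoly_add eval_rpoly_single mon_add_single(1)[of m i, simplified] algebra_simps)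
  qed
  from this[of K] show ?thesis
    by (auto simp: K_def eval_rpoly_superset[of "Poly_Mapping.keys p" p])
qed

text \<open>Together with \<open>eval_rpoly_pol\<close> this identifies \<open>pol UNIV k\<close>
  with the ordinary polynomials that occur in \<open>poly_chaos\<close>.\<close>

lemma pol_rpoly:
  "A \<in> pol S k \<Longrightarrow> \<exists>p. degree_le k p \<and> (\<forall>z. eval_rpoly p z = A z)"
proof (induction rule: pol_induct)
  case (pol_const c k)
  then show ?case
    by (intro exI[of _ "Poly_Mapping.single 0 c"]) (auto simp: eval_rpoly_single degree_le_single)
next
  case (pol_var A k i)
  then obtain p where "degree_le k p" "\<And>z. eval_rpoly p z = A z" by auto
  with eval_rpoly_mult_var[of k p i] show ?case by auto
next
  case (pol_add A k B)
  then obtain p q where "degree_le k p" "\<And>z. eval_rpoly p z = A z" "degree_le k q" "\<And>z. eval_rpoly q z = B z" by auto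
  then show ?case by (intro exI[of _ "p + q"]) (auto simp: degree_le_add eval_rpoly_add)
qed

section \<open>Product spaces\<close>

text \<open>Dependence on the coordinates in \<open>S\<close> for arbitrary functions: besides
  polynomials it has to cover exponentials of them, to which independence is applied as
  well.\<close>

definition dep :: "'i set \<Rightarrow> (('i \<Rightarrow> 'r) \<Rightarrow> 'b) \<Rightarrow> bool" where
  "dep S A \<longleftrightarrow> (\<forall>x y. (\<forall>i\<in>S. x i = y i) \<longrightarrow> A x = A y)"

lemma depD: "dep S A \<Longrightarrow> (\<And>i. i \<in> S \<Longrightarrow> x i = y i) \<Longrightarrow> A x = A y"
  by (auto simp: dep_def)

lemma pol_imp_dep: "A \<in> pol S k \<Longrightarrow> dep S A"
  by (auto simp: dep_def intro: pol_dep)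

text \<open>Independent coordinates over an arbitrary index type. Instances are the sequence of the
  X_j, the enlarged space with Gaussian variables, and the space of the limit variables.\<close>

locale prodspace =
  fixes D :: "'i \<Rightarrow> real measure"
  assumes prob_D: "\<And>i. prob_space (D i)"
    and sets_D[measurable_cong]: "\<And>i. sets (D i) = sets borel"
    and moments_D: "\<And>i k. integrable (D i) (\<lambda>x. x ^ k)"
begin

abbreviation "P \<equiv> PiM UNIV D"
abbreviation E :: "(('i \<Rightarrow> real) \<Rightarrow> 'b::{banach, second_countable_topology}) \<Rightarrow> 'b" where "E A \<equiv> integral\<^sup>L P A"

sublocale D: product_prob_space D UNIV
  by (rule product_prob_spaceI) (rule prob_D)

lemma space_D[simp]: "space (D i) = UNIV"
  using sets_eq_imp_space_eq[OF sets_D] by simp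

lemma space_P[simp]: "space P = UNIV"
  by (simp add: space_PiM)

lemma coord_measurable[measurable]: "(\<lambda>x. x i) \<in> borel_measurable P"
proof -
  have "(\<lambda>x. x i) \<in> measurable P (D i)" by simp
  then show ?thesis using measurable_cong_sets[OF refl sets_D] by blast
qed

lemma distr_coord: "distr P (D i) (\<lambda>x. x i) = D i"
  by (rule D.PiM_component) simp

lemma E_coord:
  fixes g :: "real \<Rightarrow> 'b::{banach, second_countable_topology}"
  assumes "g \<in> borel_measurable borel"
  shows "E (\<lambda>x. g (x i)) = integral\<^sup>L (D i) g" "integrable P (\<lambda>x. g (x i)) = integrable (D i) g"
proof -
  have g: "g \<in> borel_measurable (D i)" using assms measurable_cong_sets[OF sets_D refl] by blast
  show "E (\<lambda>x. g (x i)) = integral\<^sup>L (D i) g"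
    using integral_distr[of "\<lambda>x. x i" P "D i" g] g by (simp add: distr_coord)
  show "integrable P (\<lambda>x. g (x i)) = integrable (D i) g"
    using integrable_distr_eq[of "\<lambda>x. x i" P "D i" g] g by (simp add: distr_coord)
qed

lemma AE_coord: "AE y in D i. Q y \<Longrightarrow> AE x in P. Q (x i)"
  by (rule AE_PiM_component) (auto simp: prob_D)

lemma indep_coords: "D.P.indep_vars D (\<lambda>i x. x i) UNIV"
proof (subst D.P.indep_vars_iff_distr_eq_PiM)
  have "distr P (PiM UNIV D) (\<lambda>x. \<lambda>i\<in>UNIV. x i) = distr P P (\<lambda>x. x)"
    by (simp add: restrict_def)
  also have "\<dots> = P" by simp
  also have "\<dots> = PiM UNIV (\<lambda>i. distr P (D i) (\<lambda>x. x i))" by (simp add: distr_coord)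
  finally show "distr P (PiM UNIV D) (\<lambda>x. \<lambda>i\<in>UNIV. x i) = PiM UNIV (\<lambda>i. distr P (D i) (\<lambda>x. x i))" .
qed auto

text \<open>The restrictions to \<open>S\<close> and \<open>T\<close> are independent.
  \<open>ext\<close> fills the missing coordinates with 0; a function that depends on
  \<open>S\<close> only is unchanged by restriction followed by \<open>ext\<close>, hence is a
  measurable function of the restriction.\<close>

lemma fac:
  fixes A B :: "('i \<Rightarrow> real) \<Rightarrow> 'b::{real_normed_field, banach, second_countable_topology}"
  assumes "dep S A" "dep T B" "S \<inter> T = {}" and iA: "integrable P A" and iB: "integrable P B"
  shows "E (\<lambda>x. A x * B x) = E A * E B" "integrable P (\<lambda>x. A x * B x)"
proof -
  define ext where "ext = (\<lambda>S (x::'i \<Rightarrow> real) i. if i \<in> S then x i else 0)"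
  have ext: "ext S \<in> measurable (PiM S D) P" for S
  proof (rule measurable_PiM_single')
    fix i
    show "(\<lambda>x. ext S x i) \<in> measurable (PiM S D) (D i)"
    proof (cases "i \<in> S")
      case True
      then have "(\<lambda>x. x i) \<in> measurable (PiM S D) (D i)" by simp
      then show ?thesis using True by (simp add: ext_def)
    qed (simp add: ext_def)
  qed (auto simp: ext_def)
  have r: "D.P.indep_var (PiM S D) (\<lambda>x. restrict x S) (PiM T D) (\<lambda>x. restrict x T)"
    using D.P.indep_var_restrict[OF indep_coords assms(3)] by simp
  have [measurable]: "A \<in> borel_measurable P" "B \<in> borel_measurable P" using iA iB by auto
  have "D.P.indep_var borel ((A \<circ> ext S) \<circ> (\<lambda>x. restrict x S)) borel ((B \<circ> ext T) \<circ> (\<lambda>x. restrict x T))"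
    by (rule D.P.indep_var_compose[OF r]) (intro measurable_comp[OF ext]; simp)+
  moreover have "(A \<circ> ext S) \<circ> (\<lambda>x. restrict x S) = A"
    using assms(1) by (auto simp: ext_def fun_eq_iff intro!: depD[of S A])
  moreover have "(B \<circ> ext T) \<circ> (\<lambda>x. restrict x T) = B"
    using assms(2) by (auto simp: ext_def fun_eq_iff intro!: depD[of T B])
  ultimately have "D.P.indep_var borel A borel B" by simp
  from D.P.indep_var_lebesgue_integral[OF this iA iB] D.P.indep_var_integrable[OF this iA iB]
  show "E (\<lambda>x. A x * B x) = E A * E B" "integrable P (\<lambda>x. A x * B x)" by auto
qed

lemma pol_meas: "A \<in> pol S k \<Longrightarrow> A \<in> borel_measurable P"
  using pol_measurable[of A S k "\<lambda>i x. x i" P] by simp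

text \<open>Treating even powers for all \<open>q\<close> at once closes the induction: for a
  product, u v \<le> u^2 + v^2 leads from the exponent 2q to the exponent 4q of each factor.\<close>

lemma pol_integrable_even: "A \<in> pol S k \<Longrightarrow> integrable P (\<lambda>x. A x ^ (2 * q))"
proof (induction arbitrary: q rule: pol_induct)
  case (pol_const c k)
  then show ?case by simp
next
  case (pol_var A k i)
  have [measurable]: "A \<in> borel_measurable P" using pol_var by (auto intro: pol_meas)
  have "integrable P (\<lambda>x. x i ^ (2 * (2 * q)))"
    using E_coord(2)[of "\<lambda>y. y ^ (2 * (2 * q))" i] moments_D by auto
  then have "integrable P (\<lambda>x. x i ^ (2 * (2 * q)) + A x ^ (2 * (2 * q)))"
    using pol_var.IH by (intro Bochner_Integration.integrable_add)
  then show ?case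
  proof (rule Bochner_Integration.integrable_bound)
    show "AE x in P. norm ((x i * A x) ^ (2 * q)) \<le> norm (x i ^ (2 * (2 * q)) + A x ^ (2 * (2 * q)))"
    proof (rule AE_I2)
      fix x
      have sq: "a ^ (2 * (2 * q)) = (a ^ (2 * q))\<^sup>2" for a :: real
        by (metis power_mult mult.commute)
      define u v where "u = x i ^ (2 * q)" and "v = A x ^ (2 * q)"
      have "0 \<le> u" "0 \<le> v" by (auto simp: u_def v_def zero_le_even_power)
      then have "0 \<le> u * v" by simp
      moreover have "2 * u * v \<le> u\<^sup>2 + v\<^sup>2" by (rule sum_squares_bound)
      ultimately have "\<bar>u * v\<bar> \<le> \<bar>u\<^sup>2 + v\<^sup>2\<bar>" by linarith
      then show "norm ((x i * A x) ^ (2 * q)) \<le> norm (x i ^ (2 * (2 * q)) + A x ^ (2 * (2 * q)))"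
        unfolding sq power_mult_distrib real_norm_def u_def v_def .
    qed
  qed measurable
next
  case (pol_add A k B)
  have [measurable]: "A \<in> borel_measurable P" "B \<in> borel_measurable P" using pol_add by (auto intro: pol_meas)
  have "integrable P (\<lambda>x. 2 ^ (2 * q) * (A x ^ (2 * q) + B x ^ (2 * q)))"
    using pol_add.IH by (intro integrable_mult_right Bochner_Integration.integrable_add)
  then show ?case
  proof (rule Bochner_Integration.integrable_bound)
    show "AE x in P. norm ((A x + B x) ^ (2 * q)) \<le> norm (2 ^ (2 * q) * (A x ^ (2 * q) + B x ^ (2 * q)))"
    proof (rule AE_I2)
      fix x
      have "\<bar>A x + B x\<bar> \<le> 2 * max \<bar>A x\<bar> \<bar>B x\<bar>" by auto
      then have "\<bar>A x + B x\<bar> ^ (2 * q) \<le> (2 * max \<bar>A x\<bar> \<bar>B x\<bar>) ^ (2 * q)" by (intro power_mono) auto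
      also have "\<dots> = 2 ^ (2 * q) * (max \<bar>A x\<bar> \<bar>B x\<bar>) ^ (2 * q)" by (rule power_mult_distrib)
      also have "(max \<bar>A x\<bar> \<bar>B x\<bar>) ^ (2 * q) \<le> \<bar>A x\<bar> ^ (2 * q) + \<bar>B x\<bar> ^ (2 * q)"
        by (auto simp: max_def)
      finally have "\<bar>A x + B x\<bar> ^ (2 * q) \<le> 2 ^ (2 * q) * (\<bar>A x\<bar> ^ (2 * q) + \<bar>B x\<bar> ^ (2 * q))" by simp
      moreover have "\<bar>a\<bar> ^ (2 * q) = a ^ (2 * q)" for a :: real
        by (rule power_even_abs) simp
      ultimately have "\<bar>A x + B x\<bar> ^ (2 * q) \<le> 2 ^ (2 * q) * (A x ^ (2 * q) + B x ^ (2 * q))" by simp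
      then show "norm ((A x + B x) ^ (2 * q)) \<le> norm (2 ^ (2 * q) * (A x ^ (2 * q) + B x ^ (2 * q)))"
        unfolding real_norm_def power_abs by linarith
    qed
  qed measurable
qed

lemma pol_integrable: "A \<in> pol S k \<Longrightarrow> integrable P A"
proof -
  assume A: "A \<in> pol S k"
  have [measurable]: "A \<in> borel_measurable P" using A by (rule pol_meas)
  have "integrable P (\<lambda>x. 1 + A x ^ (2 * 1))"
    using pol_integrable_even[OF A, of 1] by (intro Bochner_Integration.integrable_add) auto
  then show ?thesis
  proof (rule Bochner_Integration.integrable_bound)
    show "AE x in P. norm (A x) \<le> norm (1 + A x ^ (2 * 1))"
    proof (rule AE_I2)
      fix x
      have "2 * \<bar>A x\<bar> * 1 \<le> \<bar>A x\<bar>\<^sup>2 + 1\<^sup>2" by (rule sum_squares_bound)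
      then show "norm (A x) \<le> norm (1 + A x ^ (2 * 1))" by simp
    qed
  qed measurable
qed

lemma pol_integrable_mult: "A \<in> pol S k \<Longrightarrow> B \<in> pol T l \<Longrightarrow> integrable P (\<lambda>x. A x * B x)"
  using pol_integrable[OF pol_mult[of A UNIV k B l]] pol_UNIV_I by blast

lemma pol_integrable_power: "A \<in> pol S k \<Longrightarrow> integrable P (\<lambda>x. A x ^ n)"
  by (rule pol_integrable[OF pol_power])

lemma fac_pol: "A \<in> pol S k \<Longrightarrow> B \<in> pol T l \<Longrightarrow> S \<inter> T = {} \<Longrightarrow> E (\<lambda>x. A x * B x) = E A * E B"
  by (rule fac(1)[OF pol_imp_dep pol_imp_dep]) (auto intro: pol_integrable)

end

section \<open>Multilinear forms in orthonormal ensembles\<close>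

text \<open>Index sets of multilinear monomials: pairs of a block and an index within it, each block
  being used at most once. The empty set indexes the constant monomial.\<close>

definition Kset :: "('j \<Rightarrow> nat set) \<Rightarrow> 'j set \<Rightarrow> ('j \<times> nat) set set" where
  "Kset \<Lambda> S = {m. m \<subseteq> Sigma S \<Lambda> \<and> inj_on fst m}"

definition mprod :: "('v \<Rightarrow> 'a \<Rightarrow> real) \<Rightarrow> 'v set \<Rightarrow> 'a \<Rightarrow> real" where
  "mprod \<zeta> m x = (\<Prod>v\<in>m. \<zeta> v x)"

text \<open>Index \<open>l\<close> of a block will stand for a polynomial of degree at most
  \<open>l\<close>, so the weight bounds the degree of a monomial.\<close>

definition weight :: "('j \<times> nat) set \<Rightarrow> nat" where
  "weight m = (\<Sum>v\<in>m. snd v)"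

lemma finite_Kset: "finite S \<Longrightarrow> (\<And>j. j \<in> S \<Longrightarrow> finite (\<Lambda> j)) \<Longrightarrow> finite (Kset \<Lambda> S)"
  by (rule finite_subset[of _ "Pow (Sigma S \<Lambda>)"]) (auto simp: Kset_def)

lemma Kset_finite_mem: "m \<in> Kset \<Lambda> S \<Longrightarrow> finite S \<Longrightarrow> (\<And>j. j \<in> S \<Longrightarrow> finite (\<Lambda> j)) \<Longrightarrow> finite m"
  by (rule finite_subset[of _ "Sigma S \<Lambda>"]) (auto simp: Kset_def)

lemma Kset_mono: "S \<subseteq> T \<Longrightarrow> Kset \<Lambda> S \<subseteq> Kset \<Lambda> T"
  by (auto simp: Kset_def)

lemma Kset_empty[simp]: "Kset \<Lambda> {} = {{}}"
  by (auto simp: Kset_def)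

lemma empty_in_Kset[simp]: "{} \<in> Kset \<Lambda> S"
  by (auto simp: Kset_def)

lemma Kset_insertI: "m \<in> Kset \<Lambda> S \<Longrightarrow> j \<notin> S \<Longrightarrow> l \<in> \<Lambda> j \<Longrightarrow> insert (j, l) m \<in> Kset \<Lambda> (insert j S)"
  unfolding Kset_def by (force simp: inj_on_def)

lemma Kset_notin: "m \<in> Kset \<Lambda> S \<Longrightarrow> j \<notin> S \<Longrightarrow> (j, l) \<notin> m"
  by (auto simp: Kset_def)

lemma Kset_subset: "m \<in> Kset \<Lambda> S \<Longrightarrow> m' \<subseteq> m \<Longrightarrow> m' \<in> Kset \<Lambda> S"
  by (auto simp: Kset_def inj_on_def)

lemma Kset_insert:
  assumes "j \<notin> S"
  shows "Kset \<Lambda> (insert j S) = Kset \<Lambda> S \<union> (\<Union>l\<in>\<Lambda> j. insert (j, l) ` Kset \<Lambda> S)"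
proof (intro equalityI subsetI)
  fix m assume m: "m \<in> Kset \<Lambda> (insert j S)"
  show "m \<in> Kset \<Lambda> S \<union> (\<Union>l\<in>\<Lambda> j. insert (j, l) ` Kset \<Lambda> S)"
  proof (cases "\<exists>l. (j, l) \<in> m")
    case True
    then obtain l where l: "(j, l) \<in> m" by auto
    have "m - {(j, l)} \<in> Kset \<Lambda> S"
    proof -
      have "i \<in> S" if "(i, a) \<in> m" "(i, a) \<noteq> (j, l)" for i a
      proof -
        have "i \<noteq> j" using m l that inj_onD[of fst m "(i, a)" "(j, l)"] by (auto simp: Kset_def)
        then show ?thesis using m that by (auto simp: Kset_def)
      qed
      then show ?thesis using m by (auto simp: Kset_def inj_on_def)
    qed
    moreover have "m = insert (j, l) (m - {(j, l)})" using l by auto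
    moreover have "l \<in> \<Lambda> j" using m l by (auto simp: Kset_def)
    ultimately show ?thesis by blast
  next
    case False
    then show ?thesis using m by (auto simp: Kset_def)
  qed
qed (use assms in \<open>auto intro: Kset_insertI Kset_mono[THEN subsetD]\<close>)

text \<open>An index set either avoids block \<open>j\<close> or arises from one that does by adding
  a single pair over \<open>j\<close>. The inductions over blocks rest on this splitting.\<close>

lemma sum_Kset_insert:
  fixes g :: "('j \<times> nat) set \<Rightarrow> 'c::comm_monoid_add"
  assumes "j \<notin> S" "finite S" and fin: "\<And>i. i \<in> insert j S \<Longrightarrow> finite (\<Lambda> i)"
  shows "(\<Sum>m\<in>Kset \<Lambda> (insert j S). g m) = (\<Sum>m\<in>Kset \<Lambda> S. g m) + (\<Sum>l\<in>\<Lambda> j. \<Sum>m\<in>Kset \<Lambda> S. g (insert (j, l) m))"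
proof -
  have fK: "finite (Kset \<Lambda> S)" using assms by (intro finite_Kset) auto
  have ni: "m \<in> Kset \<Lambda> S \<Longrightarrow> (j, l) \<notin> m" for m l using assms(1) by (rule Kset_notin[rotated])
  have "(\<Sum>m\<in>Kset \<Lambda> (insert j S). g m) = (\<Sum>m\<in>Kset \<Lambda> S. g m) + (\<Sum>m\<in>(\<Union>l\<in>\<Lambda> j. insert (j, l) ` Kset \<Lambda> S). g m)"
    unfolding Kset_insert[OF assms(1)]
    by (rule sum.union_disjoint) (use fK fin ni in auto)
  also have "(\<Sum>m\<in>(\<Union>l\<in>\<Lambda> j. insert (j, l) ` Kset \<Lambda> S). g m) = (\<Sum>l\<in>\<Lambda> j. \<Sum>m\<in>insert (j, l) ` Kset \<Lambda> S. g m)"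
  proof (rule sum.UNION_disjoint)
    show "\<forall>l\<in>\<Lambda> j. \<forall>l'\<in>\<Lambda> j. l \<noteq> l' \<longrightarrow> insert (j, l) ` Kset \<Lambda> S \<inter> insert (j, l') ` Kset \<Lambda> S = {}"
    proof (intro ballI impI)
      fix l l' :: nat assume "l \<noteq> l'"
      then have "insert (j, l) m \<noteq> insert (j, l') m'" if "m \<in> Kset \<Lambda> S" "m' \<in> Kset \<Lambda> S" for m m'
        using ni[OF that(1)] ni[OF that(2)] by blast
      then show "insert (j, l) ` Kset \<Lambda> S \<inter> insert (j, l') ` Kset \<Lambda> S = {}" by blast
    qed
  qed (use fK fin in auto)
  also have "\<dots> = (\<Sum>l\<in>\<Lambda> j. \<Sum>m\<in>Kset \<Lambda> S. g (insert (j, l) m))"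
  proof (rule sum.cong[OF refl])
    fix l
    have "inj_on (insert (j, l)) (Kset \<Lambda> S)"
      by (rule inj_onI) (use ni in \<open>metis insert_ident\<close>)
    then show "(\<Sum>m\<in>insert (j, l) ` Kset \<Lambda> S. g m) = (\<Sum>m\<in>Kset \<Lambda> S. g (insert (j, l) m))"
      by (simp add: sum.reindex)
  qed
  finally show ?thesis .
qed

lemma mprod_empty[simp]: "mprod \<zeta> {} x = 1"
  by (simp add: mprod_def)

lemma mprod_insert: "finite m \<Longrightarrow> v \<notin> m \<Longrightarrow> mprod \<zeta> (insert v m) x = \<zeta> v x * mprod \<zeta> m x"
  by (simp add: mprod_def)

lemma mprod_Un: "finite m \<Longrightarrow> finite m' \<Longrightarrow> m \<inter> m' = {} \<Longrightarrow> mprod \<zeta> (m \<union> m') x = mprod \<zeta> m x * mprod \<zeta> m' x"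
  by (simp add: mprod_def prod.union_disjoint)

text \<open>The integral of (f - t g)^2 is a nonnegative quadratic in t; evaluate it at its
  minimum.\<close>

lemma integral_Cauchy_Schwarz:
  fixes f g :: "'a \<Rightarrow> real"
  assumes [measurable]: "f \<in> borel_measurable M" "g \<in> borel_measurable M"
    and "integrable M (\<lambda>x. (f x)\<^sup>2)" "integrable M (\<lambda>x. (g x)\<^sup>2)"
  shows "(\<integral>x. f x * g x \<partial>M)\<^sup>2 \<le> (\<integral>x. (f x)\<^sup>2 \<partial>M) * (\<integral>x. (g x)\<^sup>2 \<partial>M)"
    "integrable M (\<lambda>x. f x * g x)"
proof -
  have "integrable M (\<lambda>x. (f x)\<^sup>2 + (g x)\<^sup>2)" using assms by (intro Bochner_Integration.integrable_add)
  then show i: "integrable M (\<lambda>x. f x * g x)"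
  proof (rule Bochner_Integration.integrable_bound)
    show "AE x in M. norm (f x * g x) \<le> norm ((f x)\<^sup>2 + (g x)\<^sup>2)"
    proof (rule AE_I2)
      fix x
      have "2 * \<bar>f x\<bar> * \<bar>g x\<bar> \<le> \<bar>f x\<bar>\<^sup>2 + \<bar>g x\<bar>\<^sup>2" by (rule sum_squares_bound)
      moreover have "0 \<le> \<bar>f x\<bar> * \<bar>g x\<bar>" by simp
      ultimately show "norm (f x * g x) \<le> norm ((f x)\<^sup>2 + (g x)\<^sup>2)"
        unfolding real_norm_def abs_mult power2_abs by linarith
    qed
  qed measurable
  define a b c where "a = (\<integral>x. (f x)\<^sup>2 \<partial>M)" and "b = (\<integral>x. f x * g x \<partial>M)" and "c = (\<integral>x. (g x)\<^sup>2 \<partial>M)"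
  have q: "0 \<le> a - 2 * t * b + t\<^sup>2 * c" for t
  proof -
    have "0 \<le> (\<integral>x. (f x - t * g x)\<^sup>2 \<partial>M)" by (rule integral_nonneg_AE) simp
    also have "\<dots> = (\<integral>x. (f x)\<^sup>2 - 2 * t * (f x * g x) + t\<^sup>2 * (g x)\<^sup>2 \<partial>M)"
      by (rule Bochner_Integration.integral_cong) (auto simp: power2_eq_square algebra_simps)
    also have "\<dots> = a - 2 * t * b + t\<^sup>2 * c"
      using assms i by (simp add: a_def b_def c_def)
    finally show ?thesis .
  qed
  have c0: "0 \<le> c" unfolding c_def by (rule integral_nonneg_AE) simp
  have "b\<^sup>2 \<le> a * c"
  proof (cases "c = 0")
    case True
    have "b = 0"
    proof (rule ccontr)
      assume "b \<noteq> 0"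
      \<comment> \<open>With c = 0 the quadratic is linear in t and takes the value -1 here.\<close>
      then show False using q[of "(a + 1) / (2 * b)"] True by (simp add: field_simps)
    qed
    then show ?thesis using True by simp
  next
    case False
    then have "c > 0" using c0 by simp
    have "0 \<le> a - 2 * (b / c) * b + (b / c)\<^sup>2 * c" by (rule q)
    also have "\<dots> = a - b\<^sup>2 / c" using False by (simp add: power2_eq_square field_simps)
    finally show ?thesis using \<open>c > 0\<close> by (simp add: field_simps)
  qed
  then show "(\<integral>x. f x * g x \<partial>M)\<^sup>2 \<le> (\<integral>x. (f x)\<^sup>2 \<partial>M) * (\<integral>x. (g x)\<^sup>2 \<partial>M)"
    by (simp add: a_def b_def c_def)
qed

text \<open>Cauchy-Schwarz for finite sums, applied twice.\<close>

lemma sum_pow4_le: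
  fixes r :: "'a \<Rightarrow> real"
  shows "(\<Sum>l\<in>L. r l) ^ 4 \<le> real (card L) ^ 3 * (\<Sum>l\<in>L. r l ^ 4)"
proof -
  have "((\<Sum>l\<in>L. r l)\<^sup>2)\<^sup>2 \<le> (real (card L) * (\<Sum>l\<in>L. (r l)\<^sup>2))\<^sup>2"
    using sum_squared_le_sum_of_squares[of r L] by (intro power_mono) (auto simp: mult.commute)
  also have "\<dots> = (real (card L))\<^sup>2 * (\<Sum>l\<in>L. (r l)\<^sup>2)\<^sup>2" by (rule power_mult_distrib)
  also have "\<dots> \<le> (real (card L))\<^sup>2 * (real (card L) * (\<Sum>l\<in>L. ((r l)\<^sup>2)\<^sup>2))"
    using sum_squared_le_sum_of_squares[of "\<lambda>l. (r l)\<^sup>2" L] by (intro mult_left_mono) (auto simp: mult.commute)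
  finally show ?thesis by (simp add: power4_eq_xxxx power2_eq_square power3_eq_cube mult_ac)
qed

context prodspace begin

lemma prob_UNIV[simp]: "D.P.prob UNIV = 1"
  using D.P.prob_space by simp

lemma pol_Cauchy_Schwarz:
  assumes "A \<in> pol S k" "B \<in> pol T l"
  shows "(E (\<lambda>x. A x * B x))\<^sup>2 \<le> E (\<lambda>x. (A x)\<^sup>2) * E (\<lambda>x. (B x)\<^sup>2)"
    "\<bar>E (\<lambda>x. A x * B x)\<bar> \<le> sqrt (E (\<lambda>x. (A x)\<^sup>2)) * sqrt (E (\<lambda>x. (B x)\<^sup>2))"
proof -
  show *: "(E (\<lambda>x. A x * B x))\<^sup>2 \<le> E (\<lambda>x. (A x)\<^sup>2) * E (\<lambda>x. (B x)\<^sup>2)"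
    by (rule integral_Cauchy_Schwarz)
       (use assms pol_meas pol_integrable_power in blast)+
  have "sqrt ((E (\<lambda>x. A x * B x))\<^sup>2) \<le> sqrt (E (\<lambda>x. (A x)\<^sup>2) * E (\<lambda>x. (B x)\<^sup>2))"
    using * by (rule real_sqrt_le_mono)
  then show "\<bar>E (\<lambda>x. A x * B x)\<bar> \<le> sqrt (E (\<lambda>x. (A x)\<^sup>2)) * sqrt (E (\<lambda>x. (B x)\<^sup>2))"
    by (simp add: real_sqrt_mult)
qed

end

text \<open>For each block a finite orthonormal family of centred functions with bounded fourth
  moments. The abstraction covers the orthonormal polynomials of the X_j as well as mixtures with
  Gaussian blocks, so that hypercontractivity and the local Lindeberg estimate are proved once.
  \<open>w\<close> bounds both the size of a family and the degree of its members.\<close>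

locale ensemble = prodspace D for D :: "'i \<Rightarrow> real measure" +
  fixes Blk :: "'j \<Rightarrow> 'i set" and \<zeta> :: "'j \<times> nat \<Rightarrow> ('i \<Rightarrow> real) \<Rightarrow> real"
    and \<Lambda> :: "'j \<Rightarrow> nat set" and w :: nat and \<kappa> :: real
  assumes Blk_disj: "\<And>j j'. j \<noteq> j' \<Longrightarrow> Blk j \<inter> Blk j' = {}"
    and fin_\<Lambda>: "\<And>j. finite (\<Lambda> j)" and card_\<Lambda>: "\<And>j. card (\<Lambda> j) \<le> w"
    and \<zeta>_pol: "\<And>j l. l \<in> \<Lambda> j \<Longrightarrow> \<zeta> (j, l) \<in> pol (Blk j) w"
    and \<zeta>_mean: "\<And>j l. l \<in> \<Lambda> j \<Longrightarrow> E (\<zeta> (j, l)) = 0"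
    and \<zeta>_orth: "\<And>j l l'. l \<in> \<Lambda> j \<Longrightarrow> l' \<in> \<Lambda> j \<Longrightarrow> E (\<lambda>x. \<zeta> (j, l) x * \<zeta> (j, l') x) = of_bool (l = l')"
    and \<zeta>_4: "\<And>j l. l \<in> \<Lambda> j \<Longrightarrow> E (\<lambda>x. \<zeta> (j, l) x ^ 4) \<le> \<kappa>"
begin

lemma Blk_Un_disj: "j \<notin> S \<Longrightarrow> Blk j \<inter> \<Union> (Blk ` S) = {}"
proof -
  assume "j \<notin> S"
  then have "Blk j \<inter> Blk i = {}" if "i \<in> S" for i using that by (intro Blk_disj) auto
  then show ?thesis by blast
qed

lemma mprod_pol:
  assumes "m \<in> Kset \<Lambda> S" "finite S"
  shows "mprod \<zeta> m \<in> pol (\<Union> (Blk ` S)) (card m * w)"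
proof -
  have "(\<lambda>x. \<Prod>v\<in>m. \<zeta> v x) \<in> pol (\<Union> (Blk ` S)) (\<Sum>v\<in>m. w)"
  proof (rule pol_prod)
    fix v assume "v \<in> m"
    then obtain j l where "v = (j, l)" "j \<in> S" "l \<in> \<Lambda> j" using assms by (auto simp: Kset_def)
    then show "\<zeta> v \<in> pol (\<Union> (Blk ` S)) w" using \<zeta>_pol[of l j] by (auto intro: pol_mono)
  qed
  then show ?thesis by (simp add: mprod_def[abs_def])
qed

definition ml :: "(('j \<times> nat) set \<Rightarrow> real) \<Rightarrow> 'j set \<Rightarrow> ('i \<Rightarrow> real) \<Rightarrow> real" where
  "ml f S x = (\<Sum>m\<in>Kset \<Lambda> S. f m * mprod \<zeta> m x)"

lemma ml_pol: "finite S \<Longrightarrow> \<exists>k. ml f S \<in> pol (\<Union> (Blk ` S)) k"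
proof -
  assume S: "finite S"
  have "ml f S \<in> pol (\<Union> (Blk ` S)) (Max (card ` Kset \<Lambda> S) * w)"
    unfolding ml_def[abs_def]
  proof (intro pol_sum pol_scale)
    fix m assume m: "m \<in> Kset \<Lambda> S"
    have "card m \<le> Max (card ` Kset \<Lambda> S)"
      using m finite_Kset[OF S fin_\<Lambda>] by (intro Max_ge) auto
    then show "mprod \<zeta> m \<in> pol (\<Union> (Blk ` S)) (Max (card ` Kset \<Lambda> S) * w)"
      using mprod_pol[OF m S] by (auto intro: pol_mono mult_le_mono1)
  qed
  then show ?thesis by blast
qed

lemma ml_insert:
  assumes "finite S" "j \<notin> S"
  shows "ml f (insert j S) x = ml f S x + (\<Sum>l\<in>\<Lambda> j. \<zeta> (j, l) x * ml (\<lambda>m. f (insert (j, l) m)) S x)"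
proof -
  have "mprod \<zeta> (insert (j, l) m) x = \<zeta> (j, l) x * mprod \<zeta> m x" if "m \<in> Kset \<Lambda> S" for m l
    using Kset_finite_mem[OF that assms(1) fin_\<Lambda>] Kset_notin[OF that assms(2)] by (intro mprod_insert)
  then show ?thesis
    unfolding ml_def by (subst sum_Kset_insert) (use assms fin_\<Lambda> in \<open>auto simp: sum_distrib_left algebra_simps intro!: sum.cong\<close>)
qed

text \<open>Induction over blocks: independence splits off the factors of block \<open>j\<close>. A
  single such factor has mean zero, two of them give a Kronecker symbol.\<close>

lemma mprod_orth:
  assumes "finite S" "m \<in> Kset \<Lambda> S" "m' \<in> Kset \<Lambda> S"
  shows "E (\<lambda>x. mprod \<zeta> m x * mprod \<zeta> m' x) = of_bool (m = m')"
  using assms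
proof (induction S arbitrary: m m' rule: finite_induct)
  case empty
  then show ?case by (simp add: D.P.prob_space)
next
  case (insert j S)
  have dj: "Blk j \<inter> \<Union> (Blk ` S) = {}" using insert.hyps(2) by (rule Blk_Un_disj)
  have f: "finite m" if "m \<in> Kset \<Lambda> S" for m using Kset_finite_mem[OF that insert.hyps(1) fin_\<Lambda>] .
  have ni: "(j, l) \<notin> m" if "m \<in> Kset \<Lambda> S" for m l using Kset_notin[OF that insert.hyps(2)] .
  have mp: "mprod \<zeta> m \<in> pol (\<Union> (Blk ` S)) (card m * w)" if "m \<in> Kset \<Lambda> S" for m
    using mprod_pol[OF that insert.hyps(1)] .
  have one: "E (\<lambda>x. mprod \<zeta> (insert (j, l) m) x * mprod \<zeta> m' x) = 0" if "m \<in> Kset \<Lambda> S" "m' \<in> Kset \<Lambda> S" "l \<in> \<Lambda> j" for m m' l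
  proof -
    have "E (\<lambda>x. \<zeta> (j, l) x * (mprod \<zeta> m x * mprod \<zeta> m' x)) = E (\<zeta> (j, l)) * E (\<lambda>x. mprod \<zeta> m x * mprod \<zeta> m' x)"
      by (rule fac_pol[OF \<zeta>_pol pol_mult[OF mp mp] dj]) (use that in auto)
    then show ?thesis using that \<zeta>_mean by (simp add: mprod_insert f ni mult.assoc)
  qed
  have two: "E (\<lambda>x. mprod \<zeta> (insert (j, l) m) x * mprod \<zeta> (insert (j, l') m') x) = of_bool (l = l') * of_bool (m = m')"
    if "m \<in> Kset \<Lambda> S" "m' \<in> Kset \<Lambda> S" "l \<in> \<Lambda> j" "l' \<in> \<Lambda> j" for m m' l l'
  proof -
    have "E (\<lambda>x. (\<zeta> (j, l) x * \<zeta> (j, l') x) * (mprod \<zeta> m x * mprod \<zeta> m' x)) =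
        E (\<lambda>x. \<zeta> (j, l) x * \<zeta> (j, l') x) * E (\<lambda>x. mprod \<zeta> m x * mprod \<zeta> m' x)"
      by (rule fac_pol[OF pol_mult[OF \<zeta>_pol \<zeta>_pol] pol_mult[OF mp mp] dj]) (use that in auto)
    moreover have "mprod \<zeta> (insert (j, l) m) x * mprod \<zeta> (insert (j, l') m') x =
        (\<zeta> (j, l) x * \<zeta> (j, l') x) * (mprod \<zeta> m x * mprod \<zeta> m' x)" for x
      using that by (simp add: mprod_insert f ni)
    ultimately show ?thesis using that \<zeta>_orth insert.IH by simp
  qed
  have c: "m \<in> Kset \<Lambda> S \<or> (\<exists>l m0. l \<in> \<Lambda> j \<and> m0 \<in> Kset \<Lambda> S \<and> m = insert (j, l) m0)" if "m \<in> Kset \<Lambda> (insert j S)" for m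
    using that unfolding Kset_insert[OF insert.hyps(2)] by blast
  from c[OF insert.prems(1)] c[OF insert.prems(2)] consider
      "m \<in> Kset \<Lambda> S" "m' \<in> Kset \<Lambda> S"
    | m0 l where "m = insert (j, l) m0" "m0 \<in> Kset \<Lambda> S" "l \<in> \<Lambda> j" "m' \<in> Kset \<Lambda> S"
    | m0' l' where "m \<in> Kset \<Lambda> S" "m' = insert (j, l') m0'" "m0' \<in> Kset \<Lambda> S" "l' \<in> \<Lambda> j"
    | m0 l m0' l' where "m = insert (j, l) m0" "m0 \<in> Kset \<Lambda> S" "l \<in> \<Lambda> j" "m' = insert (j, l') m0'" "m0' \<in> Kset \<Lambda> S" "l' \<in> \<Lambda> j"
    by (elim disjE exE conjE) metis+
  then show ?case
  proof cases
    case 1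
    then show ?thesis by (rule insert.IH)
  next
    case 2
    then have "m \<noteq> m'" using ni by auto
    then show ?thesis using one 2 by simp
  next
    case 3
    then have "m \<noteq> m'" using ni by auto
    then show ?thesis using one[of m0' m l'] 3 by (simp add: mult.commute)
  next
    case 4
    have "(m = m') = (l = l' \<and> m0 = m0')"
    proof
      assume mm: "m = m'"
      have "l = l'" using mm 4 ni by auto
      then show "l = l' \<and> m0 = m0'" using mm 4 ni by (metis insert_ident)
    qed (use 4 in auto)
    then show ?thesis using two[OF 4(2,5,3,6)] 4(1,4) by simp
  qed
qed

lemma ml_inner:
  assumes "finite S"
  shows "E (\<lambda>x. ml f S x * ml g S x) = (\<Sum>m\<in>Kset \<Lambda> S. f m * g m)"
proof -
  have fK: "finite (Kset \<Lambda> S)" using assms by (intro finite_Kset fin_\<Lambda>)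
  have int: "integrable P (\<lambda>x. mprod \<zeta> m x * mprod \<zeta> m' x)" if "m \<in> Kset \<Lambda> S" "m' \<in> Kset \<Lambda> S" for m m'
    using pol_integrable_mult[OF mprod_pol[OF that(1) assms] mprod_pol[OF that(2) assms]] .
  have "E (\<lambda>x. ml f S x * ml g S x) = E (\<lambda>x. \<Sum>m\<in>Kset \<Lambda> S. \<Sum>m'\<in>Kset \<Lambda> S. (f m * g m') * (mprod \<zeta> m x * mprod \<zeta> m' x))"
    by (simp add: ml_def sum_product mult_ac)
  also have "\<dots> = (\<Sum>m\<in>Kset \<Lambda> S. \<Sum>m'\<in>Kset \<Lambda> S. (f m * g m') * of_bool (m = m'))"
    using int by (simp add: Bochner_Integration.integral_sum mprod_orth[OF assms])
  also have "\<dots> = (\<Sum>m\<in>Kset \<Lambda> S. f m * g m)"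
    using fK by (simp add: of_bool_def if_distrib sum.delta cong: if_cong)
  finally show ?thesis .
qed

text \<open>Induction over blocks. With block \<open>j\<close> split off, the form is A + R, where R
  is linear in the functions of that block. If N and n denote the weighted square sums belonging to
  A and to the coefficients of R, then E (A + R)^4 \<le> N^2 + 8 N n + 3 \<kappa> w^3 n^2, and the
  two conditions on \<open>B\<close> compare this coefficientwise with (N + B n)^2.\<close>

lemma ml_hyper4:
  assumes B: "B \<ge> 4" "B\<^sup>2 \<ge> 3 * \<kappa> * real w ^ 3" and S: "finite S"
  shows "E (\<lambda>x. ml f S x ^ 4) \<le> (\<Sum>m\<in>Kset \<Lambda> S. B ^ card m * (f m)\<^sup>2)\<^sup>2"
  using S
proof (induction S arbitrary: f rule: finite_induct)
  case empty
  then show ?case by (simp add: ml_def D.P.prob_space power_mult[symmetric])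
next
  case (insert j S)
  define f' where "f' = (\<lambda>l m. f (insert (j, l) m))"
  define A R where "A = ml f S" and "R = (\<lambda>x. \<Sum>l\<in>\<Lambda> j. \<zeta> (j, l) x * ml (f' l) S x)"
  let ?m = "\<lambda>l. ml (f' l) S"
  define N where "N = (\<lambda>f. \<Sum>m\<in>Kset \<Lambda> S. B ^ card m * (f m)\<^sup>2)"
  have N0: "0 \<le> N g" for g unfolding N_def using B by (intro sum_nonneg) auto
  have IH: "E (\<lambda>x. ml g S x ^ 4) \<le> (N g)\<^sup>2" for g using insert.IH unfolding N_def .
  have dj: "Blk j \<inter> \<Union> (Blk ` S) = {}" using insert.hyps(2) by (rule Blk_Un_disj)
  obtain ka where A: "A \<in> pol (\<Union> (Blk ` S)) ka" using ml_pol[OF insert.hyps(1)] unfolding A_def by blast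
  have "\<forall>l. \<exists>k. ?m l \<in> pol (\<Union> (Blk ` S)) k" using ml_pol[OF insert.hyps(1)] by blast
  then obtain kk where kk: "\<And>l. ?m l \<in> pol (\<Union> (Blk ` S)) (kk l)" by metis
  have Rl: "(\<lambda>x. \<zeta> (j, l) x * ?m l x) \<in> pol UNIV (w + kk l)" if "l \<in> \<Lambda> j" for l
    using pol_mult[OF pol_UNIV_I[OF \<zeta>_pol[OF that]] pol_UNIV_I[OF kk]] .
  define kr where "kr = (\<Sum>l\<in>\<Lambda> j. w + kk l)"
  have R: "R \<in> pol UNIV kr" unfolding R_def kr_def
  proof (rule pol_sum)
    fix t assume t: "t \<in> \<Lambda> j"
    have "w + kk t \<le> (\<Sum>l\<in>\<Lambda> j. w + kk l)" using t fin_\<Lambda> by (intro member_le_sum) auto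
    then show "(\<lambda>x. \<zeta> (j, t) x * ml (f' t) S x) \<in> pol UNIV (\<Sum>l\<in>\<Lambda> j. w + kk l)"
      using Rl[OF t] by (auto intro: pol_mono)
  qed
  have A': "A \<in> pol UNIV ka" using A by (rule pol_UNIV_I)
  have AR: "integrable P (\<lambda>x. A x ^ a * R x ^ b)" for a b
    by (rule pol_integrable_mult[OF pol_power[OF A'] pol_power[OF R]])
  have iA: "integrable P (\<lambda>x. A x ^ a)" and iR: "integrable P (\<lambda>x. R x ^ a)" for a
    using pol_integrable_power A' R by blast+
  have "E (\<lambda>x. ml f (insert j S) x ^ 4) = E (\<lambda>x. (A x + R x) ^ 4)"
    by (simp add: ml_insert[OF insert.hyps] A_def R_def f'_def)
  also have "\<dots> \<le> E (\<lambda>x. A x ^ 4 + 4 * (A x ^ 3 * R x) + 8 * (A x ^ 2 * R x ^ 2) + 3 * R x ^ 4)"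
  proof (rule integral_mono)
    show "integrable P (\<lambda>x. (A x + R x) ^ 4)"
      by (rule pol_integrable_power[of _ UNIV "max ka kr"]) (intro pol_add; use A' R in \<open>auto intro: pol_mono\<close>)
    show "integrable P (\<lambda>x. A x ^ 4 + 4 * (A x ^ 3 * R x) + 8 * (A x ^ 2 * R x ^ 2) + 3 * R x ^ 4)"
      using AR[of 3 1] AR[of 2 2] iA iR by auto
    fix x
    have "(A x + R x) ^ 4 = A x ^ 4 + 4 * (A x ^ 3 * R x) + 6 * (A x ^ 2 * R x ^ 2) + 4 * (A x * R x ^ 3) + R x ^ 4"
      by (simp add: power4_eq_xxxx power3_eq_cube power2_eq_square algebra_simps)
    \<comment> \<open>The term with R^3 is absorbed by its even neighbours; the term A^3 R will have
      mean zero.\<close>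
    moreover have "4 * (A x * R x ^ 3) \<le> 2 * (A x ^ 2 * R x ^ 2) + 2 * R x ^ 4"
    proof -
      have "0 \<le> 2 * ((A x - R x) * R x)\<^sup>2" by simp
      also have "\<dots> = 2 * (A x ^ 2 * R x ^ 2) + 2 * R x ^ 4 - 4 * (A x * R x ^ 3)"
        by (simp add: power4_eq_xxxx power3_eq_cube power2_eq_square algebra_simps)
      finally show ?thesis by simp
    qed
    ultimately show "(A x + R x) ^ 4 \<le> A x ^ 4 + 4 * (A x ^ 3 * R x) + 8 * (A x ^ 2 * R x ^ 2) + 3 * R x ^ 4"
      by simp
  qed
  also have "\<dots> = E (\<lambda>x. A x ^ 4) + 4 * E (\<lambda>x. A x ^ 3 * R x) + 8 * E (\<lambda>x. A x ^ 2 * R x ^ 2) + 3 * E (\<lambda>x. R x ^ 4)"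
    using AR[of 3 1] AR[of 2 2] iA iR by simp
  also have "E (\<lambda>x. A x ^ 3 * R x) = 0"
  proof -
    have t: "E (\<lambda>x. \<zeta> (j, l) x * (A x ^ 3 * ?m l x)) = 0" if "l \<in> \<Lambda> j" for l
      using fac_pol[OF \<zeta>_pol[OF that] pol_mult[OF pol_power[OF A] kk] dj] \<zeta>_mean[OF that] by simp
    have i: "integrable P (\<lambda>x. \<zeta> (j, l) x * (A x ^ 3 * ?m l x))" if "l \<in> \<Lambda> j" for l
      by (rule pol_integrable_mult[OF \<zeta>_pol[OF that] pol_mult[OF pol_power[OF A] kk]])
    have "E (\<lambda>x. A x ^ 3 * R x) = E (\<lambda>x. \<Sum>l\<in>\<Lambda> j. \<zeta> (j, l) x * (A x ^ 3 * ?m l x))"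
      by (simp add: R_def sum_distrib_left mult_ac)
    also have "\<dots> = 0" using t i by (simp add: Bochner_Integration.integral_sum)
    finally show ?thesis .
  qed
  \<comment> \<open>Orthonormality leaves the diagonal terms only, and each is bounded by
    Cauchy-Schwarz and the induction hypothesis.\<close>
  also have "E (\<lambda>x. A x ^ 2 * R x ^ 2) \<le> N f * (\<Sum>l\<in>\<Lambda> j. N (f' l))"
  proof -
    have t: "E (\<lambda>x. (\<zeta> (j, l) x * \<zeta> (j, l') x) * (A x ^ 2 * (?m l x * ml (f' l') S x))) =
        of_bool (l = l') * E (\<lambda>x. A x ^ 2 * (?m l x * ml (f' l') S x))" if "l \<in> \<Lambda> j" "l' \<in> \<Lambda> j" for l l'
      using fac_pol[OF pol_mult[OF \<zeta>_pol[OF that(1)] \<zeta>_pol[OF that(2)]] pol_mult[OF pol_power[OF A, of 2] pol_mult[OF kk[of l] kk[of l']]] dj]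
        \<zeta>_orth[OF that] by simp
    have i: "integrable P (\<lambda>x. (\<zeta> (j, l) x * \<zeta> (j, l') x) * (A x ^ 2 * (?m l x * ml (f' l') S x)))" if "l \<in> \<Lambda> j" "l' \<in> \<Lambda> j" for l l'
      by (rule pol_integrable_mult[OF pol_mult[OF \<zeta>_pol[OF that(1)] \<zeta>_pol[OF that(2)]] pol_mult[OF pol_power[OF A, of 2] pol_mult[OF kk[of l] kk[of l']]]])
    have "E (\<lambda>x. A x ^ 2 * R x ^ 2) = E (\<lambda>x. \<Sum>l\<in>\<Lambda> j. \<Sum>l'\<in>\<Lambda> j. (\<zeta> (j, l) x * \<zeta> (j, l') x) * (A x ^ 2 * (?m l x * ml (f' l') S x)))"
      by (simp add: R_def power2_eq_square sum_product sum_distrib_left mult_ac)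
    also have "\<dots> = (\<Sum>l\<in>\<Lambda> j. \<Sum>l'\<in>\<Lambda> j. of_bool (l = l') * E (\<lambda>x. A x ^ 2 * (?m l x * ml (f' l') S x)))"
      using i by (simp add: Bochner_Integration.integral_sum t)
    also have "\<dots> = (\<Sum>l\<in>\<Lambda> j. E (\<lambda>x. A x ^ 2 * (?m l x * ?m l x)))"
      using fin_\<Lambda>[of j] by (simp add: of_bool_def if_distrib[of "\<lambda>t. t * _"] sum.delta cong: if_cong)
    also have "\<dots> \<le> (\<Sum>l\<in>\<Lambda> j. N f * N (f' l))"
    proof (rule sum_mono)
      fix l assume "l \<in> \<Lambda> j"
      have "(E (\<lambda>x. A x ^ 2 * ?m l x ^ 2))\<^sup>2 \<le> E (\<lambda>x. (A x ^ 2)\<^sup>2) * E (\<lambda>x. (?m l x ^ 2)\<^sup>2)"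
        by (rule pol_Cauchy_Schwarz(1)[OF pol_power[OF A] pol_power[OF kk]])
      also have "\<dots> = E (\<lambda>x. A x ^ 4) * E (\<lambda>x. ?m l x ^ 4)" by (simp add: power_mult[symmetric])
      also have "\<dots> \<le> (N f)\<^sup>2 * (N (f' l))\<^sup>2"
        unfolding A_def by (intro mult_mono IH) (auto intro!: integral_nonneg_AE)
      finally have "(E (\<lambda>x. A x ^ 2 * ?m l x ^ 2))\<^sup>2 \<le> (N f * N (f' l))\<^sup>2" by (simp add: power_mult_distrib)
      then have "E (\<lambda>x. A x ^ 2 * ?m l x ^ 2) \<le> N f * N (f' l)"
        by (rule power2_le_imp_le) (use N0 in auto)
      then show "E (\<lambda>x. A x ^ 2 * (?m l x * ?m l x)) \<le> N f * N (f' l)" by (simp add: power2_eq_square)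
    qed
    finally show ?thesis by (simp add: sum_distrib_left)
  qed
  also have "E (\<lambda>x. R x ^ 4) \<le> \<kappa> * real w ^ 3 * (\<Sum>l\<in>\<Lambda> j. N (f' l))\<^sup>2"
  proof (cases "\<Lambda> j = {}")
    case True
    then show ?thesis by (simp add: R_def)
  next
    case False
    then obtain l0 where l0: "l0 \<in> \<Lambda> j" by auto
    have \<kappa>0: "\<kappa> \<ge> 0" by (rule order_trans[OF _ \<zeta>_4[OF l0]]) (auto intro!: integral_nonneg_AE)
    have t: "E (\<lambda>x. (\<zeta> (j, l) x * ?m l x) ^ 4) \<le> \<kappa> * (N (f' l))\<^sup>2" if "l \<in> \<Lambda> j" for l
    proof -
      have "E (\<lambda>x. (\<zeta> (j, l) x * ?m l x) ^ 4) = E (\<lambda>x. \<zeta> (j, l) x ^ 4) * E (\<lambda>x. ?m l x ^ 4)"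
        unfolding power_mult_distrib by (rule fac_pol[OF pol_power[OF \<zeta>_pol[OF that]] pol_power[OF kk] dj])
      also have "\<dots> \<le> \<kappa> * (N (f' l))\<^sup>2"
        by (intro mult_mono \<zeta>_4 that IH \<kappa>0) (auto intro!: integral_nonneg_AE)
      finally show ?thesis .
    qed
    have il: "integrable P (\<lambda>x. (\<zeta> (j, l) x * ?m l x) ^ 4)" if "l \<in> \<Lambda> j" for l
      by (rule pol_integrable_power[OF Rl[OF that]])
    have "E (\<lambda>x. R x ^ 4) \<le> E (\<lambda>x. real (card (\<Lambda> j)) ^ 3 * (\<Sum>l\<in>\<Lambda> j. (\<zeta> (j, l) x * ?m l x) ^ 4))"
      by (rule integral_mono) (use iR il in \<open>auto simp: R_def intro!: sum_pow4_le\<close>)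
    also have "\<dots> = real (card (\<Lambda> j)) ^ 3 * (\<Sum>l\<in>\<Lambda> j. E (\<lambda>x. (\<zeta> (j, l) x * ?m l x) ^ 4))"
      using il by (simp add: Bochner_Integration.integral_sum)
    also have "\<dots> \<le> real w ^ 3 * (\<Sum>l\<in>\<Lambda> j. \<kappa> * (N (f' l))\<^sup>2)"
      using card_\<Lambda>[of j] t \<kappa>0 by (intro mult_mono sum_mono power_mono sum_nonneg integral_nonneg_AE) auto
    also have "\<dots> = \<kappa> * real w ^ 3 * (\<Sum>l\<in>\<Lambda> j. (N (f' l))\<^sup>2)" by (simp add: sum_distrib_left mult_ac)
    also have "\<dots> \<le> \<kappa> * real w ^ 3 * (\<Sum>l\<in>\<Lambda> j. N (f' l))\<^sup>2"
    proof (intro mult_left_mono)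
      have "(\<Sum>l\<in>\<Lambda> j. (N (f' l))\<^sup>2) \<le> (\<Sum>l\<in>\<Lambda> j. N (f' l) * (\<Sum>l\<in>\<Lambda> j. N (f' l)))"
        unfolding power2_eq_square using N0 fin_\<Lambda>
        by (intro sum_mono mult_left_mono member_le_sum) auto
      then show "(\<Sum>l\<in>\<Lambda> j. (N (f' l))\<^sup>2) \<le> (\<Sum>l\<in>\<Lambda> j. N (f' l))\<^sup>2"
        by (simp add: power2_eq_square sum_distrib_right)
    qed (use \<kappa>0 in auto)
    finally show ?thesis .
  qed
  also have "E (\<lambda>x. A x ^ 4) \<le> (N f)\<^sup>2" unfolding A_def by (rule IH)
  finally have 1: "E (\<lambda>x. ml f (insert j S) x ^ 4) \<le>
      (N f)\<^sup>2 + 8 * (N f * (\<Sum>l\<in>\<Lambda> j. N (f' l))) + 3 * (\<kappa> * real w ^ 3 * (\<Sum>l\<in>\<Lambda> j. N (f' l))\<^sup>2)" by simp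
  define n where "n = (\<Sum>l\<in>\<Lambda> j. N (f' l))"
  have n0: "n \<ge> 0" unfolding n_def by (intro sum_nonneg N0)
  have "8 * (N f * n) \<le> 2 * B * (N f * n)" using B N0 n0 by (intro mult_right_mono) auto
  moreover have "3 * (\<kappa> * real w ^ 3 * n\<^sup>2) \<le> B\<^sup>2 * n\<^sup>2" using mult_right_mono[OF B(2), of "n\<^sup>2"] by (simp add: mult.assoc)
  ultimately have "E (\<lambda>x. ml f (insert j S) x ^ 4) \<le> (N f)\<^sup>2 + 2 * B * (N f * n) + B\<^sup>2 * n\<^sup>2"
    using 1 unfolding n_def[symmetric] by linarith
  also have "\<dots> = (N f + B * n)\<^sup>2" by (simp add: power2_eq_square algebra_simps)
  also have "N f + B * n = (\<Sum>m\<in>Kset \<Lambda> (insert j S). B ^ card m * (f m)\<^sup>2)"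
  proof -
    have eq: "B * N (f' l) = (\<Sum>m\<in>Kset \<Lambda> S. B ^ card (insert (j, l) m) * (f (insert (j, l) m))\<^sup>2)" for l
      unfolding N_def f'_def sum_distrib_left
    proof (intro sum.cong refl)
      fix m assume m: "m \<in> Kset \<Lambda> S"
      show "B * (B ^ card m * (f (insert (j, l) m))\<^sup>2) = B ^ card (insert (j, l) m) * (f (insert (j, l) m))\<^sup>2"
        using Kset_notin[OF m insert.hyps(2)] Kset_finite_mem[OF m insert.hyps(1) fin_\<Lambda>] by simp
    qed
    have Nf: "N f = (\<Sum>m\<in>Kset \<Lambda> S. B ^ card m * (f m)\<^sup>2)" by (simp add: N_def)
    have "B * n = (\<Sum>l\<in>\<Lambda> j. B * N (f' l))" by (simp only: n_def sum_distrib_left)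
    then show ?thesis
      unfolding eq Nf sum_Kset_insert[OF insert.hyps(2,1) fin_\<Lambda>] by simp
  qed
  finally show ?case .
qed

end

section \<open>Orthonormal polynomials and hypercontractivity\<close>

text \<open>Orthonormal polynomials up to degree \<open>L\<close> for a law that may have finite
  support: an index is absent from \<open>\<Lambda>\<close> when the corresponding power is almost
  everywhere a combination of lower ones. Index 0, the constant, is kept apart because the others
  are to be centred. The last clause is filtered by degree, so that expansions respect
  degrees.\<close>

definition onb :: "real measure \<Rightarrow> nat \<Rightarrow> (nat \<Rightarrow> real poly) \<Rightarrow> nat set \<Rightarrow> bool" where
  "onb D0 L e \<Lambda> \<longleftrightarrow> \<Lambda> \<subseteq> {1..L} \<and> e 0 = 1 \<and> (\<forall>l. degree (e l) \<le> l) \<and>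
     (\<forall>l\<in>insert 0 \<Lambda>. \<forall>l'\<in>insert 0 \<Lambda>. (\<integral>x. poly (e l) x * poly (e l') x \<partial>D0) = of_bool (l = l')) \<and>
     (\<forall>q a. degree q \<le> a \<longrightarrow> a \<le> L \<longrightarrow>
        (\<exists>c. AE x in D0. poly q x = (\<Sum>l\<in>insert 0 \<Lambda> \<inter> {..a}. c l * poly (e l) x)))"

lemma poly_meas[measurable]: "poly (p :: real poly) \<in> borel_measurable borel"
  by (intro borel_measurable_continuous_onI continuous_intros)

lemma poly_integrable:
  fixes p :: "real poly"
  assumes "\<And>k. integrable M (\<lambda>x. x ^ k)"
  shows "integrable M (\<lambda>x. poly p x)"
  unfolding poly_altdef using assms by (intro Bochner_Integration.integrable_sum integrable_mult_right)

text \<open>Gram-Schmidt, one power at a time; \<open>r\<close> is the residual of x^(L+1) and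
  \<open>n2\<close> its squared norm.\<close>

lemma onb_exists:
  assumes prob: "prob_space D0" and sets: "sets D0 = sets borel" and mom: "\<And>k. integrable D0 (\<lambda>x::real. x ^ k)"
  shows "\<exists>e \<Lambda>. onb D0 L e \<Lambda>"
proof (induction L)
  case 0
  have "onb D0 0 (\<lambda>_. 1) {}"
    unfolding onb_def
  proof (intro conjI allI impI ballI)
    fix q :: "real poly" and a :: nat assume "degree q \<le> a" "a \<le> 0"
    then have "degree q = 0" by simp
    then have "poly q x = coeff q 0" for x by (simp add: poly_altdef)
    then show "\<exists>c. AE x in D0. poly q x = (\<Sum>l\<in>insert 0 {} \<inter> {..a}. c l * poly 1 x)"
      by (intro exI[of _ "\<lambda>_. coeff q 0"]) simp
  qed (auto simp: prob_space.prob_space[OF prob])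
  then show ?case by blast
next
  case (Suc L)
  then obtain e \<Lambda> where "onb D0 L e \<Lambda>" by blast
  then have \<Lambda>: "\<Lambda> \<subseteq> {1..L}" and e0: "e 0 = 1" and deg: "\<And>l. degree (e l) \<le> l"
    and orth: "\<And>l l'. l \<in> insert 0 \<Lambda> \<Longrightarrow> l' \<in> insert 0 \<Lambda> \<Longrightarrow> (\<integral>x. poly (e l) x * poly (e l') x \<partial>D0) = of_bool (l = l')"
    and expd: "\<And>q a. degree q \<le> a \<Longrightarrow> a \<le> L \<Longrightarrow>
        (\<exists>c. AE x in D0. poly q x = (\<Sum>l\<in>insert 0 \<Lambda> \<inter> {..a}. c l * poly (e l) x))"
    unfolding onb_def by auto
  define I where "I = insert 0 \<Lambda>"
  have I: "finite I" "I \<subseteq> {..L}" using \<Lambda> finite_subset[OF \<Lambda>] by (auto simp: I_def)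
  note int = poly_integrable[of D0, OF mom]
  have int2: "integrable D0 (\<lambda>x. poly p x * poly q x)" for p q using int[of "p * q"] by simp
  define q0 where "q0 = monom (1::real) (Suc L)"
  define c where "c = (\<lambda>l. \<integral>x. poly q0 x * poly (e l) x \<partial>D0)"
  define r where "r = q0 - (\<Sum>l\<in>I. smult (c l) (e l))"
  have pr: "poly r x = poly q0 x - (\<Sum>l\<in>I. c l * poly (e l) x)" for x by (simp add: r_def poly_sum)
  have dr: "degree r \<le> Suc L" unfolding r_def
  proof (intro degree_diff_le degree_sum_le I)
    show "degree q0 \<le> Suc L" by (simp add: q0_def degree_monom_le)
    fix l assume "l \<in> I"
    then have "l \<le> Suc L" using I(2) by auto
    then show "degree (smult (c l) (e l)) \<le> Suc L"
      by (meson order_trans degree_smult_le deg)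
  qed
  have ro: "(\<integral>x. poly r x * poly (e l) x \<partial>D0) = 0" if "l \<in> I" for l
  proof -
    have "(\<integral>x. poly r x * poly (e l) x \<partial>D0) = (\<integral>x. poly q0 x * poly (e l) x - (\<Sum>l'\<in>I. c l' * (poly (e l') x * poly (e l) x)) \<partial>D0)"
      by (intro Bochner_Integration.integral_cong refl) (simp add: pr left_diff_distrib sum_distrib_right mult.assoc)
    also have "\<dots> = c l - (\<Sum>l'\<in>I. c l' * of_bool (l' = l))"
      using int2 orth that by (simp add: c_def I_def Bochner_Integration.integral_sum)
    also have "\<dots> = 0" using that I(1) by (simp add: of_bool_def if_distrib sum.delta cong: if_cong)
    finally show ?thesis .
  qed
  define n2 where "n2 = (\<integral>x. poly r x * poly r x \<partial>D0)"
  have n20: "n2 \<ge> 0" unfolding n2_def by (intro integral_nonneg_AE) auto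
  \<comment> \<open>For \<open>n2 = 0\<close> the factor \<open>1 / sqrt n2\<close> is 0, so the new
    polynomial is 0; its index then stays outside \<open>\<Lambda>'\<close>.\<close>
  define e' where "e' = e(Suc L := smult (1 / sqrt n2) r)"
  define \<Lambda>' where "\<Lambda>' = (if n2 = 0 then \<Lambda> else insert (Suc L) \<Lambda>)"
  have e'l: "e' l = e l" if "l \<le> L" for l using that by (simp add: e'_def)
  have e'I: "e' l = e l" if "l \<in> I" for l using that I(2) e'l by auto
  have rr: "\<exists>\<rho>. AE x in D0. poly r x = (if n2 = 0 then 0 else \<rho> * poly (e' (Suc L)) x)"
  proof (cases "n2 = 0")
    case True
    have "AE x in D0. poly r x * poly r x = 0"
      using True integral_nonneg_eq_0_iff_AE[OF int2[of r r]] by (auto simp: n2_def)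
    then show ?thesis using True by (auto elim!: AE_mp)
  next
    case False
    then show ?thesis by (intro exI[of _ "sqrt n2"]) (use n20 in \<open>auto simp: e'_def\<close>)
  qed
  then obtain \<rho> where \<rho>: "AE x in D0. poly r x = (if n2 = 0 then 0 else \<rho> * poly (e' (Suc L)) x)" by blast
  have "onb D0 (Suc L) e' \<Lambda>'"
    unfolding onb_def
  proof (intro conjI allI impI ballI)
    show "\<Lambda>' \<subseteq> {1..Suc L}" using \<Lambda> by (auto simp: \<Lambda>'_def)
    show "e' 0 = 1" by (simp add: e'_def e0)
    show "degree (e' l) \<le> l" for l using deg dr by (auto simp: e'_def)
  next
    fix l l' assume l: "l \<in> insert 0 \<Lambda>'" and l': "l' \<in> insert 0 \<Lambda>'"
    have *: "(\<integral>x. poly (e' l) x * poly (e' (Suc L)) x \<partial>D0) = 0" if "l \<in> I" for l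
    proof -
      have "(\<integral>x. poly (e' l) x * poly (e' (Suc L)) x \<partial>D0) = (\<integral>x. (1 / sqrt n2) * (poly r x * poly (e l) x) \<partial>D0)"
        unfolding e'I[OF that] by (intro Bochner_Integration.integral_cong refl) (simp add: e'_def mult_ac)
      also have "\<dots> = 0" using ro[OF that] by simp
      finally show ?thesis .
    qed
    have **: "n2 \<noteq> 0 \<Longrightarrow> (\<integral>x. poly (e' (Suc L)) x * poly (e' (Suc L)) x \<partial>D0) = 1"
    proof -
      assume "n2 \<noteq> 0"
      then have "n2 > 0" using n20 by simp
      have "(\<integral>x. poly (e' (Suc L)) x * poly (e' (Suc L)) x \<partial>D0) = (\<integral>x. (1 / sqrt n2 * (1 / sqrt n2)) * (poly r x * poly r x) \<partial>D0)"
        by (intro Bochner_Integration.integral_cong refl) (simp add: e'_def mult_ac)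
      also have "\<dots> = (1 / sqrt n2 * (1 / sqrt n2)) * n2" by (simp only: integral_mult_right_zero n2_def)
      also have "\<dots> = 1" using \<open>n2 > 0\<close> by (simp add: field_simps real_sqrt_mult[symmetric] del: real_sqrt_mult)
      finally show ?thesis .
    qed
    have ni: "Suc L \<notin> I" using I by auto
    have cc: "l \<in> I \<or> (l = Suc L \<and> n2 \<noteq> 0)" "l' \<in> I \<or> (l' = Suc L \<and> n2 \<noteq> 0)"
      using l l' by (auto simp: \<Lambda>'_def I_def split: if_splits)
    then show "(\<integral>x. poly (e' l) x * poly (e' l') x \<partial>D0) = of_bool (l = l')"
      using orth[folded I_def, of l l'] * ** ni *[of l'] by (auto simp: e'I mult.commute)
  next
    fix q :: "real poly" and a assume q: "degree q \<le> a" "a \<le> Suc L"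
    show "\<exists>c. AE x in D0. poly q x = (\<Sum>l\<in>insert 0 \<Lambda>' \<inter> {..a}. c l * poly (e' l) x)"
    proof (cases "a \<le> L")
      case True
      then obtain c where c: "AE x in D0. poly q x = (\<Sum>l\<in>insert 0 \<Lambda> \<inter> {..a}. c l * poly (e l) x)" using expd[OF q(1)] by blast
      have "insert 0 \<Lambda>' \<inter> {..a} = insert 0 \<Lambda> \<inter> {..a}" using True by (auto simp: \<Lambda>'_def)
      moreover have "(\<Sum>l\<in>insert 0 \<Lambda> \<inter> {..a}. c l * poly (e l) x) = (\<Sum>l\<in>insert 0 \<Lambda> \<inter> {..a}. c l * poly (e' l) x)" for x
        using True by (intro sum.cong) (auto simp: e'l)
      ultimately show ?thesis using c by auto
    next
      case False
      then have a: "a = Suc L" using q by simp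
      \<comment> \<open>Subtracting t x^(L+1) brings the degree down to \<open>L\<close>, and
        x^(L+1) itself is \<open>r\<close> plus a combination of the old basis.\<close>
      define t where "t = coeff q (Suc L)"
      define q' where "q' = q - smult t q0"
      have "degree q' \<le> L"
      proof (rule degree_le, intro allI impI)
        fix i assume "L < i"
        then show "coeff q' i = 0" using q a
          by (cases "i = Suc L") (auto simp: q'_def q0_def t_def coeff_eq_0)
      qed
      then obtain c' where c': "AE x in D0. poly q' x = (\<Sum>l\<in>insert 0 \<Lambda> \<inter> {..L}. c' l * poly (e l) x)" using expd[of q' L] by blast
      have IL: "insert 0 \<Lambda> \<inter> {..L} = I" using I(2) by (auto simp: I_def)
      define cc where "cc = (\<lambda>l. if l = Suc L then t * \<rho> else c' l + t * c l)"
      have pq: "poly q x = poly q' x + t * poly r x + (\<Sum>l\<in>I. (t * c l) * poly (e l) x)" for x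
        by (simp add: q'_def pr right_diff_distrib sum_distrib_left mult.assoc)
      have e2: "insert 0 \<Lambda>' \<inter> {..a} = (if n2 = 0 then I else insert (Suc L) I)"
        using I a \<Lambda> by (auto simp: \<Lambda>'_def I_def)
      have ni: "Suc L \<notin> I" using I by auto
      have "AE x in D0. poly q x = (\<Sum>l\<in>insert 0 \<Lambda>' \<inter> {..a}. cc l * poly (e' l) x)"
        using c' \<rho>
      proof (eventually_elim)
        case (elim x)
        have s: "(\<Sum>l\<in>I. cc l * poly (e' l) x) = (\<Sum>l\<in>I. c' l * poly (e l) x) + (\<Sum>l\<in>I. (t * c l) * poly (e l) x)"
          unfolding sum.distrib[symmetric]
          by (intro sum.cong refl) (use ni in \<open>auto simp: cc_def e'I distrib_right\<close>)
        show ?case unfolding pq e2 using elim s ni I(1) by (auto simp: IL cc_def)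
      qed
      then show ?thesis by blast
    qed
  qed
  then show ?case by blast
qed

section \<open>Expansion of polynomials in products of orthonormal polynomials\<close>

locale onbspace = prodspace D for D :: "'i \<Rightarrow> real measure" +
  fixes e :: "'i \<Rightarrow> nat \<Rightarrow> real poly" and \<Lambda> :: "'i \<Rightarrow> nat set" and L :: nat and \<kappa> :: real
  assumes onb: "\<And>i. onb (D i) L (e i) (\<Lambda> i)"
    and \<kappa>: "\<And>i l. l \<in> \<Lambda> i \<Longrightarrow> (\<integral>y. poly (e i l) y ^ 4 \<partial>D i) \<le> \<kappa>"
begin

definition xi :: "'i \<times> nat \<Rightarrow> ('i \<Rightarrow> real) \<Rightarrow> real" where
  "xi v x = poly (e (fst v) (snd v)) (x (fst v))"

lemma \<Lambda>_sub: "\<Lambda> i \<subseteq> {1..L}" and e_0: "e i 0 = 1" and e_deg: "degree (e i l) \<le> l"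
  and e_orth: "l \<in> insert 0 (\<Lambda> i) \<Longrightarrow> l' \<in> insert 0 (\<Lambda> i) \<Longrightarrow> (\<integral>y. poly (e i l) y * poly (e i l') y \<partial>D i) = of_bool (l = l')"
  and e_exp: "degree q \<le> a \<Longrightarrow> a \<le> L \<Longrightarrow> (\<exists>c. AE y in D i. poly q y = (\<Sum>l\<in>insert 0 (\<Lambda> i) \<inter> {..a}. c l * poly (e i l) y))"
  using onb[of i] unfolding onb_def by auto

lemma xi_pol: "xi (i, l) \<in> pol {i} l"
  unfolding xi_def[abs_def] using e_deg by (auto intro: pol_poly)

sublocale ensemble D "\<lambda>i. {i}" xi \<Lambda> L \<kappa>
proof
  show "finite (\<Lambda> j)" for j using \<Lambda>_sub finite_subset by blast
  show "card (\<Lambda> j) \<le> L" for j using card_mono[OF _ \<Lambda>_sub[of j]] by simp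
  fix j l assume l: "l \<in> \<Lambda> j"
  then have "l \<le> L" using \<Lambda>_sub by force
  then show "xi (j, l) \<in> pol {j} L" using xi_pol by (auto intro: pol_mono)
  have "E (xi (j, l)) = (\<integral>y. poly (e j 0) y * poly (e j l) y \<partial>D j)"
    unfolding xi_def[abs_def] by (simp add: E_coord e_0)
  also have "\<dots> = 0" using e_orth[of 0 j l] l \<Lambda>_sub[of j] by auto
  finally show "E (xi (j, l)) = 0" .
  show "E (\<lambda>x. xi (j, l) x ^ 4) \<le> \<kappa>"
    unfolding xi_def using E_coord(1)[of "\<lambda>y. poly (e j l) y ^ 4" j] \<kappa>[OF l] by simp
  fix l' assume l': "l' \<in> \<Lambda> j"
  show "E (\<lambda>x. xi (j, l) x * xi (j, l') x) = of_bool (l = l')"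
    unfolding xi_def using E_coord(1)[of "\<lambda>y. poly (e j l) y * poly (e j l') y" j] e_orth l l' by simp
qed auto

definition Kw :: "nat \<Rightarrow> ('i \<times> nat) set set" where
  "Kw k = {m. (\<exists>S. finite S \<and> m \<in> Kset \<Lambda> S) \<and> weight m \<le> k}"

text \<open>Equality is required almost everywhere only, because powers may be linearly dependent
  under the law.\<close>

definition xspan :: "nat \<Rightarrow> (('i \<Rightarrow> real) \<Rightarrow> real) set" where
  "xspan k = {A. \<exists>MM f. finite MM \<and> MM \<subseteq> Kw k \<and> (AE x in P. A x = (\<Sum>m\<in>MM. f m * mprod xi m x))}"

lemma xspan_cong: "A \<in> xspan k \<Longrightarrow> AE x in P. A x = B x \<Longrightarrow> B \<in> xspan k"
proof -
  assume "A \<in> xspan k" and AB: "AE x in P. A x = B x"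
  then obtain MM f where M: "finite MM" "MM \<subseteq> Kw k" and A: "AE x in P. A x = (\<Sum>m\<in>MM. f m * mprod xi m x)" by (auto simp: xspan_def)
  have "AE x in P. B x = (\<Sum>m\<in>MM. f m * mprod xi m x)" using AB A by eventually_elim simp
  then show ?thesis using M by (auto simp: xspan_def)
qed

lemma xspan_mprod: "m \<in> Kw k \<Longrightarrow> mprod xi m \<in> xspan k"
  unfolding xspan_def by (intro CollectI exI[of _ "{m}"] exI[of _ "\<lambda>_. 1"]) auto

lemma xspan_scale: "A \<in> xspan k \<Longrightarrow> (\<lambda>x. c * A x) \<in> xspan k"
proof -
  assume "A \<in> xspan k"
  then obtain MM f where M: "finite MM" "MM \<subseteq> Kw k" and A: "AE x in P. A x = (\<Sum>m\<in>MM. f m * mprod xi m x)" by (auto simp: xspan_def)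
  from A have "AE x in P. c * A x = (\<Sum>m\<in>MM. (c * f m) * mprod xi m x)"
    by eventually_elim (simp add: sum_distrib_left mult.assoc)
  then show ?thesis using M by (auto simp: xspan_def intro!: exI[of _ MM] exI[of _ "\<lambda>m. c * f m"])
qed

lemma xspan_add: "A \<in> xspan k \<Longrightarrow> B \<in> xspan k \<Longrightarrow> (\<lambda>x. A x + B x) \<in> xspan k"
proof -
  assume "A \<in> xspan k" "B \<in> xspan k"
  then obtain MM f NN g where M: "finite MM" "MM \<subseteq> Kw k" and A: "AE x in P. A x = (\<Sum>m\<in>MM. f m * mprod xi m x)"
    and N: "finite NN" "NN \<subseteq> Kw k" and B: "AE x in P. B x = (\<Sum>m\<in>NN. g m * mprod xi m x)" by (auto simp: xspan_def)
  define h where "h = (\<lambda>m. (if m \<in> MM then f m else 0) + (if m \<in> NN then g m else 0))"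
  have 1: "(\<Sum>m\<in>MM. f m * mprod xi m x) = (\<Sum>m\<in>MM \<union> NN. (if m \<in> MM then f m else 0) * mprod xi m x)" for x
    using M N by (intro sum.mono_neutral_cong_left) auto
  have 2: "(\<Sum>m\<in>NN. g m * mprod xi m x) = (\<Sum>m\<in>MM \<union> NN. (if m \<in> NN then g m else 0) * mprod xi m x)" for x
    using M N by (intro sum.mono_neutral_cong_left) auto
  have "AE x in P. A x + B x = (\<Sum>m\<in>MM \<union> NN. h m * mprod xi m x)"
    using A B by eventually_elim (simp add: h_def sum.distrib distrib_right 1 2)
  then show ?thesis using M N by (auto simp: xspan_def intro!: exI[of _ "MM \<union> NN"] exI[of _ h])
qed

lemma xspan_sum: "(\<And>t. t \<in> T \<Longrightarrow> A t \<in> xspan k) \<Longrightarrow> (\<lambda>x. \<Sum>t\<in>T. A t x) \<in> xspan k"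
proof (induction T rule: infinite_finite_induct)
  case (insert t T)
  then show ?case using xspan_add[of "A t" k "\<lambda>x. \<Sum>t\<in>T. A t x"] by simp
qed (auto simp: xspan_def intro!: exI[of _ "{}"])

lemma Kw_insert:
  assumes "m \<in> Kw k" "\<And>l. (i, l) \<notin> m" "l \<in> \<Lambda> i"
  shows "insert (i, l) m \<in> Kw (k + l)"
proof -
  from assms obtain S where S: "finite S" "m \<in> Kset \<Lambda> S" "weight m \<le> k" by (auto simp: Kw_def)
  have "m \<in> Kset \<Lambda> (S - {i})" using S assms(2) by (auto simp: Kset_def)
  then have "insert (i, l) m \<in> Kset \<Lambda> (insert i (S - {i}))" using assms(3) by (intro Kset_insertI) auto
  moreover have "finite m" using Kset_finite_mem[OF S(2,1) fin_\<Lambda>] .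
  ultimately show ?thesis using S assms(2) by (auto simp: Kw_def weight_def intro!: exI[of _ "insert i (S - {i})"])
qed

text \<open>Multiplication by x_i changes only the factor of coordinate \<open>i\<close>: x e_l has
  degree at most l + 1 and expands into the basis polynomials of index at most l + 1, so the weight
  grows by at most 1. The bound by \<open>L\<close> guarantees that this expansion is
  available.\<close>

lemma xspan_var_mprod:
  assumes m: "m \<in> Kw k" and k: "Suc k \<le> L"
  shows "(\<lambda>x. x i * mprod xi m x) \<in> xspan (Suc k)"
proof -
  from m obtain S where S: "finite S" "m \<in> Kset \<Lambda> S" "weight m \<le> k" by (auto simp: Kw_def)
  have fm: "finite m" using Kset_finite_mem[OF S(2,1) fin_\<Lambda>] .
  \<comment> \<open>A monomial that avoids coordinate \<open>i\<close> is treated as having the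
    factor \<open>e i 0\<close>, which is 1.\<close>
  have "\<exists>l m0. l \<in> insert 0 (\<Lambda> i) \<and> m0 \<in> Kw (k - l) \<and> l \<le> k \<and> (\<forall>l. (i, l) \<notin> m0) \<and> (\<forall>x. mprod xi m x = poly (e i l) (x i) * mprod xi m0 x)"
  proof (cases "\<exists>l. (i, l) \<in> m")
    case False
    then show ?thesis using m by (intro exI[of _ 0] exI[of _ m]) (auto simp: e_0)
  next
    case True
    then obtain l where l: "(i, l) \<in> m" by auto
    have "weight m = l + weight (m - {(i, l)})" unfolding weight_def using fm l by (simp add: sum.remove)
    moreover have "m - {(i, l)} \<in> Kset \<Lambda> S" using S(2) by (rule Kset_subset) auto
    ultimately have "m - {(i, l)} \<in> Kw (k - l)" "l \<le> k" using S by (auto simp: Kw_def)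
    moreover have "(i, l') \<notin> m - {(i, l)}" for l'
      using S(2) l inj_onD[of fst m "(i, l)" "(i, l')"] by (auto simp: Kset_def)
    moreover have "mprod xi m x = poly (e i l) (x i) * mprod xi (m - {(i, l)}) x" for x
      unfolding mprod_def using fm l by (simp add: prod.remove xi_def)
    moreover have "l \<in> \<Lambda> i" using S(2) l by (auto simp: Kset_def)
    ultimately show ?thesis by blast
  qed
  then obtain l m0 where l: "l \<in> insert 0 (\<Lambda> i)" "l \<le> k" and m0: "m0 \<in> Kw (k - l)" "\<And>l. (i, l) \<notin> m0"
    and mm: "\<And>x. mprod xi m x = poly (e i l) (x i) * mprod xi m0 x" by blast
  define q where "q = [:0, 1:] * e i l"
  have "degree q \<le> Suc l" unfolding q_def using degree_mult_le[of "[:0, 1:]" "e i l"] e_deg[of i l] by simp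
  then obtain c where c: "AE y in D i. poly q y = (\<Sum>l'\<in>insert 0 (\<Lambda> i) \<inter> {..Suc l}. c l' * poly (e i l') y)"
    using e_exp[of q "Suc l" i] k l(2) by auto
  have fm0: "finite m0" using m0(1) fin_\<Lambda> by (auto simp: Kw_def dest: Kset_finite_mem)
  have "(\<lambda>x. \<Sum>l'\<in>insert 0 (\<Lambda> i) \<inter> {..Suc l}. c l' * (poly (e i l') (x i) * mprod xi m0 x)) \<in> xspan (Suc k)"
  proof (intro xspan_sum xspan_scale)
    fix l' assume l': "l' \<in> insert 0 (\<Lambda> i) \<inter> {..Suc l}"
    show "(\<lambda>x. poly (e i l') (x i) * mprod xi m0 x) \<in> xspan (Suc k)"
    proof (cases "l' = 0")
      case True
      have "m0 \<in> Kw (Suc k)" using m0(1) by (auto simp: Kw_def)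
      then show ?thesis using True xspan_mprod by (simp add: e_0)
    next
      case False
      then have "l' \<in> \<Lambda> i" "l' \<le> Suc l" using l' by auto
      then have "insert (i, l') m0 \<in> Kw (Suc k)" using Kw_insert[OF m0, of l'] l(2) by (auto simp: Kw_def)
      from xspan_mprod[OF this] show ?thesis by (simp add: mprod_insert[OF fm0 m0(2), abs_def] xi_def)
    qed
  qed
  moreover have "AE x in P. (\<Sum>l'\<in>insert 0 (\<Lambda> i) \<inter> {..Suc l}. c l' * (poly (e i l') (x i) * mprod xi m0 x)) = x i * mprod xi m x"
    using AE_coord[OF c]
  proof eventually_elim
    case (elim x)
    have "x i * mprod xi m x = poly q (x i) * mprod xi m0 x" by (simp add: mm q_def)
    also have "\<dots> = (\<Sum>l'\<in>insert 0 (\<Lambda> i) \<inter> {..Suc l}. c l' * (poly (e i l') (x i) * mprod xi m0 x))"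
      unfolding elim by (simp add: sum_distrib_right mult.assoc)
    finally show ?case by simp
  qed
  ultimately show ?thesis by (rule xspan_cong)
qed

lemma pol_xspan: "A \<in> pol T k \<Longrightarrow> k \<le> L \<Longrightarrow> A \<in> xspan k"
proof (induction rule: pol_induct)
  case (pol_const c k)
  have "{} \<in> Kw k" by (auto simp: Kw_def weight_def intro!: exI[of _ "{}"])
  from xspan_scale[OF xspan_mprod[OF this], of c] show ?case by simp
next
  case (pol_var A k i)
  then have "A \<in> xspan k" by simp
  then obtain MM f where M: "finite MM" "MM \<subseteq> Kw k" and A: "AE x in P. A x = (\<Sum>m\<in>MM. f m * mprod xi m x)" by (auto simp: xspan_def)
  have "(\<lambda>x. \<Sum>m\<in>MM. f m * (x i * mprod xi m x)) \<in> xspan (Suc k)"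
    by (intro xspan_sum xspan_scale xspan_var_mprod) (use M pol_var in auto)
  moreover have "AE x in P. (\<Sum>m\<in>MM. f m * (x i * mprod xi m x)) = x i * A x"
    using A by eventually_elim (simp add: sum_distrib_left mult_ac)
  ultimately show ?case by (rule xspan_cong)
next
  case (pol_add A k B)
  then show ?case by (auto intro: xspan_add)
qed

text \<open>Fourier coefficients with respect to the orthonormal monomials.\<close>

definition cf :: "(('i \<Rightarrow> real) \<Rightarrow> real) \<Rightarrow> ('i \<times> nat) set \<Rightarrow> real" where
  "cf A m = E (\<lambda>x. A x * mprod xi m x)"

lemma xi_mprod_pol:
  assumes "m \<in> Kset \<Lambda> S" "finite S"
  shows "mprod xi m \<in> pol S (weight m)"
proof -
  have "(\<lambda>x. \<Prod>v\<in>m. xi v x) \<in> pol S (\<Sum>v\<in>m. snd v)"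
  proof (rule pol_prod)
    fix v assume "v \<in> m"
    then have "fst v \<in> S" using assms by (auto simp: Kset_def)
    then show "xi v \<in> pol S (snd v)" using xi_pol[of "fst v" "snd v"] by (auto intro: pol_mono)
  qed
  then show ?thesis by (simp add: mprod_def[abs_def] weight_def)
qed

text \<open>Orthonormality makes the coefficients independent of the finite set of coordinates in
  which a representation is written. They can therefore be regarded as one function on index sets,
  supported on weights up to \<open>k\<close>, valid for every larger finite set of
  coordinates.\<close>

lemma expansion:
  assumes A: "A \<in> pol UNIV k" and k: "k \<le> L"
  obtains S where "finite S"
    "\<And>S'. finite S' \<Longrightarrow> S \<subseteq> S' \<Longrightarrow> AE x in P. A x = ml (cf A) S' x"
    "\<And>S' m. finite S' \<Longrightarrow> m \<in> Kset \<Lambda> S' \<Longrightarrow> weight m > k \<Longrightarrow> cf A m = 0"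
proof -
  from pol_xspan[OF A k] obtain MM f where M: "finite MM" "MM \<subseteq> Kw k"
    and AE: "AE x in P. A x = (\<Sum>m\<in>MM. f m * mprod xi m x)" by (auto simp: xspan_def)
  have fin: "finite m" if "m \<in> MM" for m
    using that M(2) fin_\<Lambda> by (auto simp: Kw_def dest: Kset_finite_mem)
  define S where "S = (\<Union>m\<in>MM. fst ` m)"
  have S: "finite S" unfolding S_def using M(1) fin by auto
  define g where "g = (\<lambda>m. if m \<in> MM then f m else 0)"
  have MS: "MM \<subseteq> Kset \<Lambda> S" using M(2) by (force simp: Kw_def Kset_def S_def)
  have ex: "AE x in P. A x = ml g S' x" if "finite S'" "S \<subseteq> S'" for S'
  proof -
    have "(\<Sum>m\<in>MM. f m * mprod xi m x) = ml g S' x" for x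
      unfolding ml_def using that MS Kset_mono[OF that(2), of \<Lambda>]
      by (intro sum.mono_neutral_cong_left finite_Kset fin_\<Lambda>) (auto simp: g_def)
    then show ?thesis using AE by simp
  qed
  have cfg: "cf A m = g m" if "finite S'" "S \<subseteq> S'" "m \<in> Kset \<Lambda> S'" for S' m
  proof -
    \<comment> \<open>The monomial is written as a form with an indicator as coefficients, so that
      \<open>ml_inner\<close> reads off its coefficient.\<close>
    have 1: "ml (\<lambda>m'. of_bool (m' = m)) S' x = mprod xi m x" for x
      unfolding ml_def using that finite_Kset[OF that(1) fin_\<Lambda>]
      by (simp add: of_bool_def if_distrib[of "\<lambda>t. t * _"] sum.delta' cong: if_cong)
    have [measurable]: "ml g S' \<in> borel_measurable P" "A \<in> borel_measurable P" "mprod xi m \<in> borel_measurable P"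
      using ml_pol[OF that(1)] A xi_mprod_pol[OF that(3,1)] by (auto intro: pol_meas)
    have "cf A m = E (\<lambda>x. ml g S' x * ml (\<lambda>m'. of_bool (m' = m)) S' x)"
      unfolding cf_def 1 by (rule integral_cong_AE) (measurable, use ex[OF that(1,2)] in \<open>auto elim!: AE_mp\<close>)
    also have "\<dots> = (\<Sum>m'\<in>Kset \<Lambda> S'. g m' * of_bool (m' = m))" by (rule ml_inner[OF that(1)])
    also have "\<dots> = g m" using that finite_Kset[OF that(1) fin_\<Lambda>] by (simp add: of_bool_def if_distrib sum.delta' cong: if_cong)
    finally show ?thesis .
  qed
  show thesis
  proof (rule that[OF S])
    fix S' assume S': "finite S'" "S \<subseteq> S'"
    have "ml g S' x = ml (cf A) S' x" for x unfolding ml_def by (intro sum.cong refl) (simp add: cfg[OF S'])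
    then show "AE x in P. A x = ml (cf A) S' x" using ex[OF S'] by simp
  next
    fix S' m assume S': "finite S'" and m: "m \<in> Kset \<Lambda> S'" "weight m > k"
    have "m \<in> Kset \<Lambda> (S \<union> S')" using m(1) Kset_mono[of S' "S \<union> S'" \<Lambda>] by auto
    then have "cf A m = g m" using S S' by (intro cfg[of "S \<union> S'"]) auto
    moreover have "m \<notin> MM" using m(2) M(2) by (auto simp: Kw_def)
    ultimately show "cf A m = 0" by (simp add: g_def)
  qed
qed

lemma card_le_weight:
  assumes "m \<in> Kset \<Lambda> S" shows "card m \<le> weight m"
proof -
  have "(\<Sum>v\<in>m. 1) \<le> (\<Sum>v\<in>m. snd v)"
  proof (rule sum_mono)
    fix v assume "v \<in> m"
    then have "snd v \<in> \<Lambda> (fst v)" using assms by (auto simp: Kset_def)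
    then show "1 \<le> snd v" using \<Lambda>_sub[of "fst v"] by auto
  qed
  then show ?thesis by (simp add: weight_def)
qed

text \<open>The weights B^(card m) are at most B^k, because coefficients vanish for weight above
  \<open>k\<close> and the cardinality is at most the weight; Parseval then returns the second
  moment. The constant does not involve the number of variables.\<close>

lemma hyper4:
  assumes k: "k \<le> L"
  shows "\<exists>C\<ge>0. \<forall>A\<in>pol UNIV k. E (\<lambda>x. A x ^ 4) \<le> C * (E (\<lambda>x. (A x)\<^sup>2))\<^sup>2"
proof -
  \<comment> \<open>Being at least 4, \<open>B\<close> is at most its own square, so one lower bound
    by 3 |\<kappa>| L^3 settles the second condition of \<open>ml_hyper4\<close>.\<close>
  define B where "B = 4 + 3 * \<bar>\<kappa>\<bar> * real L ^ 3"
  have B4: "B \<ge> 4" by (simp add: B_def)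
  have "3 * \<kappa> * real L ^ 3 \<le> 3 * \<bar>\<kappa>\<bar> * real L ^ 3" by (intro mult_right_mono) auto
  also have "\<dots> \<le> B" by (simp add: B_def)
  also have "\<dots> \<le> B\<^sup>2" using B4 by (simp add: power2_eq_square)
  finally have B2: "B\<^sup>2 \<ge> 3 * \<kappa> * real L ^ 3" .
  show ?thesis
  proof (intro exI[of _ "(B ^ k)\<^sup>2"] conjI ballI)
    fix A :: "('i \<Rightarrow> real) \<Rightarrow> real" assume A: "A \<in> pol UNIV k"
    from expansion[OF A k] obtain S where S: "finite S" and ex: "AE x in P. A x = ml (cf A) S x"
      and z: "\<And>m. m \<in> Kset \<Lambda> S \<Longrightarrow> weight m > k \<Longrightarrow> cf A m = 0" by (metis order_refl)
    have [measurable]: "ml (cf A) S \<in> borel_measurable P" "A \<in> borel_measurable P"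
      using ml_pol[OF S] A by (auto intro: pol_meas)
    have "E (\<lambda>x. A x ^ 4) = E (\<lambda>x. ml (cf A) S x ^ 4)"
      by (rule integral_cong_AE) (measurable, use ex in \<open>auto elim!: AE_mp\<close>)
    also have "\<dots> \<le> (\<Sum>m\<in>Kset \<Lambda> S. B ^ card m * (cf A m)\<^sup>2)\<^sup>2" by (rule ml_hyper4[OF B4 B2 S])
    also have "\<dots> \<le> (\<Sum>m\<in>Kset \<Lambda> S. B ^ k * (cf A m)\<^sup>2)\<^sup>2"
    proof (intro power_mono sum_mono sum_nonneg)
      fix m assume m: "m \<in> Kset \<Lambda> S"
      show "B ^ card m * (cf A m)\<^sup>2 \<le> B ^ k * (cf A m)\<^sup>2"
        using z[OF m] card_le_weight[OF m] B4 by (cases "weight m > k") (auto intro!: mult_right_mono power_increasing)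
    qed (use B4 in auto)
    also have "\<dots> = (B ^ k)\<^sup>2 * (\<Sum>m\<in>Kset \<Lambda> S. cf A m * cf A m)\<^sup>2"
      by (simp add: sum_distrib_left[symmetric] power_mult_distrib power2_eq_square)
    also have "(\<Sum>m\<in>Kset \<Lambda> S. cf A m * cf A m) = E (\<lambda>x. (A x)\<^sup>2)"
      unfolding ml_inner[OF S, symmetric] power2_eq_square
      by (rule integral_cong_AE) (measurable, use ex in \<open>auto elim!: AE_mp\<close>)
    finally show "E (\<lambda>x. A x ^ 4) \<le> (B ^ k)\<^sup>2 * (E (\<lambda>x. (A x)\<^sup>2))\<^sup>2" .
  qed simp
qed

end

text \<open>The basis is chosen as a function of the law, so equal laws share it; finitely many laws
  admit a common bound for the fourth moments.\<close>

lemma (in prodspace) obtain_onbspace: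
  assumes fin: "finite (range D)"
  obtains e \<Lambda> \<kappa> where "onbspace D e \<Lambda> L \<kappa>" "\<And>i j. D i = D j \<Longrightarrow> e i = e j \<and> \<Lambda> i = \<Lambda> j"
proof -
  have "\<forall>d\<in>range D. \<exists>p. onb d L (fst p) (snd p)"
    using onb_exists[OF prob_D sets_D moments_D] by auto
  then obtain p where p: "\<And>i. onb (D i) L (fst (p (D i))) (snd (p (D i)))" by (metis rangeI)
  define e where "e = (\<lambda>i. fst (p (D i)))"
  define \<Lambda> where "\<Lambda> = (\<lambda>i. snd (p (D i)))"
  define \<kappa> where "\<kappa> = (\<Sum>d\<in>range D. \<Sum>l\<le>L. \<integral>y. poly (fst (p d) l) y ^ 4 \<partial>d)"
  have "onbspace D e \<Lambda> L \<kappa>"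
  proof
    show "onb (D i) L (e i) (\<Lambda> i)" for i using p by (simp add: e_def \<Lambda>_def)
    fix i l assume "l \<in> \<Lambda> i"
    then have "l \<le> L" using p[of i] by (auto simp: onb_def \<Lambda>_def)
    then have "(\<integral>y. poly (e i l) y ^ 4 \<partial>D i) \<le> (\<Sum>l\<le>L. \<integral>y. poly (e i l) y ^ 4 \<partial>D i)"
      by (intro member_le_sum) (auto intro!: integral_nonneg_AE)
    also have "\<dots> \<le> \<kappa>" unfolding \<kappa>_def e_def
      by (rule member_le_sum[of "D i" "range D" "\<lambda>d. \<Sum>l\<le>L. \<integral>y. poly (fst (p d) l) y ^ 4 \<partial>d"])
         (use fin in \<open>auto intro!: sum_nonneg integral_nonneg_AE\<close>)
    finally show "(\<integral>y. poly (e i l) y ^ 4 \<partial>D i) \<le> \<kappa>" .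
  qed
  then show thesis using that by (auto simp: e_def \<Lambda>_def)
qed

context prodspace begin

lemma hypercontractive:
  assumes "finite (range D)"
  obtains C where "C \<ge> 0" "\<And>A. A \<in> pol UNIV k \<Longrightarrow> E (\<lambda>x. A x ^ 4) \<le> C * (E (\<lambda>x. (A x)\<^sup>2))\<^sup>2"
proof -
  obtain e \<Lambda> \<kappa> where "onbspace D e \<Lambda> k \<kappa>" using obtain_onbspace[OF assms] by metis
  then interpret onbspace D e \<Lambda> k \<kappa> .
  from hyper4[of k] show thesis using that by auto
qed

text \<open>Cauchy-Schwarz, followed by hypercontractivity for each factor. In L^2, multiplication
  of polynomials of bounded degree is thus continuous.\<close>

lemma pol_mult_L2:
  assumes "finite (range D)"
  obtains C where "C \<ge> 0" "\<And>A B. A \<in> pol UNIV k \<Longrightarrow> B \<in> pol UNIV k \<Longrightarrow>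
     E (\<lambda>x. (A x * B x)\<^sup>2) \<le> C * E (\<lambda>x. (A x)\<^sup>2) * E (\<lambda>x. (B x)\<^sup>2)"
proof -
  obtain C where C: "C \<ge> 0" "\<And>A. A \<in> pol UNIV k \<Longrightarrow> E (\<lambda>x. A x ^ 4) \<le> C * (E (\<lambda>x. (A x)\<^sup>2))\<^sup>2"
    using hypercontractive[OF assms] by metis
  have "E (\<lambda>x. (A x * B x)\<^sup>2) \<le> C * E (\<lambda>x. (A x)\<^sup>2) * E (\<lambda>x. (B x)\<^sup>2)"
    if A: "A \<in> pol UNIV k" and B: "B \<in> pol UNIV k" for A B
  proof -
    have n: "E (\<lambda>x. (A x)\<^sup>2) \<ge> 0" "E (\<lambda>x. (B x)\<^sup>2) \<ge> 0" by (auto intro!: integral_nonneg_AE)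
    have "(E (\<lambda>x. (A x)\<^sup>2 * (B x)\<^sup>2))\<^sup>2 \<le> E (\<lambda>x. ((A x)\<^sup>2)\<^sup>2) * E (\<lambda>x. ((B x)\<^sup>2)\<^sup>2)"
      by (rule pol_Cauchy_Schwarz(1)[OF pol_power[OF A] pol_power[OF B]])
    also have "\<dots> = E (\<lambda>x. A x ^ 4) * E (\<lambda>x. B x ^ 4)" by (simp add: power_mult[symmetric])
    also have "\<dots> \<le> (C * (E (\<lambda>x. (A x)\<^sup>2))\<^sup>2) * (C * (E (\<lambda>x. (B x)\<^sup>2))\<^sup>2)"
      by (intro mult_mono C A B) (use C(1) in \<open>auto intro!: integral_nonneg_AE\<close>)
    also have "\<dots> = (C * E (\<lambda>x. (A x)\<^sup>2) * E (\<lambda>x. (B x)\<^sup>2))\<^sup>2" by (simp add: power2_eq_square mult_ac)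
    finally have "E (\<lambda>x. (A x)\<^sup>2 * (B x)\<^sup>2) \<le> C * E (\<lambda>x. (A x)\<^sup>2) * E (\<lambda>x. (B x)\<^sup>2)"
      by (rule power2_le_imp_le) (use C(1) n in auto)
    then show ?thesis by (simp add: power_mult_distrib)
  qed
  then show thesis using that C(1) by blast
qed

text \<open>Repeated squaring: hypercontractivity for A^2 doubles the order of the moments under
  control, which yields all orders 2^s and then all orders below. The form 1 + A^2 is convenient
  because its powers increase with the exponent.\<close>

lemma pol_moment_bound:
  assumes fin: "finite (range D)"
  shows "\<exists>C. \<forall>A\<in>pol UNIV k. E (\<lambda>x. (A x)\<^sup>2) \<le> B \<longrightarrow> E (\<lambda>x. (1 + (A x)\<^sup>2) ^ n) \<le> C"
proof -
  have pw: "\<exists>C. \<forall>A\<in>pol UNIV k. E (\<lambda>x. (A x)\<^sup>2) \<le> B \<longrightarrow> E (\<lambda>x. A x ^ (2 ^ Suc s)) \<le> C" for k s and B :: real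
  proof (induction s arbitrary: k B)
    case 0
    then show ?case by (intro exI[of _ B]) auto
  next
    case (Suc s)
    obtain C where C: "C \<ge> 0" "\<And>A. A \<in> pol UNIV k \<Longrightarrow> E (\<lambda>x. A x ^ 4) \<le> C * (E (\<lambda>x. (A x)\<^sup>2))\<^sup>2"
      using hypercontractive[OF fin] by metis
    obtain C' where C': "\<And>A. A \<in> pol UNIV (2 * k) \<Longrightarrow> E (\<lambda>x. (A x)\<^sup>2) \<le> C * B\<^sup>2 \<Longrightarrow> E (\<lambda>x. A x ^ (2 ^ Suc s)) \<le> C'"
      using Suc[of "2 * k" "C * B\<^sup>2"] by blast
    have "E (\<lambda>x. A x ^ (2 ^ Suc (Suc s))) \<le> C'" if A: "A \<in> pol UNIV k" and b: "E (\<lambda>x. (A x)\<^sup>2) \<le> B" for A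
    proof -
      have "0 \<le> E (\<lambda>x. (A x)\<^sup>2)" by (auto intro!: integral_nonneg_AE)
      then have "E (\<lambda>x. ((A x)\<^sup>2)\<^sup>2) \<le> C * B\<^sup>2"
        using C(2)[OF A] C(1) b by (auto simp: power_mult[symmetric] intro!: order_trans[OF C(2)[OF A]] mult_left_mono power_mono)
      from C'[OF pol_power[OF A] this] show ?thesis by (simp add: power_mult[symmetric])
    qed
    then show ?case by blast
  qed
  obtain C0 where C0: "\<And>A. A \<in> pol UNIV k \<Longrightarrow> E (\<lambda>x. (A x)\<^sup>2) \<le> B \<Longrightarrow> E (\<lambda>x. A x ^ (2 ^ Suc 1)) \<le> C0"
    using pw[of k B 1] by blast
  obtain C where C: "\<And>A. A \<in> pol UNIV (2 * k) \<Longrightarrow> E (\<lambda>x. (A x)\<^sup>2) \<le> 2 + 2 * C0 \<Longrightarrow> E (\<lambda>x. A x ^ (2 ^ Suc n)) \<le> C"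
    using pw[of "2 * k" "2 + 2 * C0" n] by blast
  have "E (\<lambda>x. (1 + (A x)\<^sup>2) ^ n) \<le> C" if A: "A \<in> pol UNIV k" and b: "E (\<lambda>x. (A x)\<^sup>2) \<le> B" for A
  proof -
    have A2: "(\<lambda>x. 1 + (A x)\<^sup>2) \<in> pol UNIV (2 * k)" by (intro pol_add pol_const pol_power A)
    have "E (\<lambda>x. (1 + (A x)\<^sup>2)\<^sup>2) \<le> E (\<lambda>x. 2 + 2 * A x ^ 4)"
    proof (rule integral_mono)
      fix x have "2 * 1 * (A x)\<^sup>2 \<le> 1\<^sup>2 + ((A x)\<^sup>2)\<^sup>2" by (rule sum_squares_bound)
      then show "(1 + (A x)\<^sup>2)\<^sup>2 \<le> 2 + 2 * A x ^ 4" by (simp add: power2_sum power_mult[symmetric])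
    qed (use pol_integrable_power[OF A2] pol_integrable_power[OF A] in auto)
    also have "\<dots> \<le> 2 + 2 * C0" using C0[OF A b] pol_integrable_power[OF A] by simp
    finally have "E (\<lambda>x. (1 + (A x)\<^sup>2) ^ (2 ^ Suc n)) \<le> C" by (rule C[OF A2])
    moreover have "E (\<lambda>x. (1 + (A x)\<^sup>2) ^ n) \<le> E (\<lambda>x. (1 + (A x)\<^sup>2) ^ (2 ^ Suc n))"
    proof (rule integral_mono)
      fix x have "n \<le> 2 ^ Suc n" using less_exp[of n] unfolding power_Suc by linarith
      then show "(1 + (A x)\<^sup>2) ^ n \<le> (1 + (A x)\<^sup>2) ^ (2 ^ Suc n)" by (intro power_increasing) auto
    qed (use pol_integrable_power[OF A2] in auto)
    ultimately show ?thesis by simp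
  qed
  then show ?thesis by blast
qed

end

section \<open>Moments of multilinear Gaussian polynomials\<close>

text \<open>Gaussian integration by parts for a single monomial; the general case is reduced to it
  coefficient by coefficient.\<close>

lemma std_normal_moment_rec:
  "(\<integral>x. x ^ Suc (Suc k) \<partial>std_normal_distribution) = real (Suc k) * (\<integral>x. x ^ k \<partial>std_normal_distribution)"
proof (cases "even k")
  case True
  then obtain j where j: "k = 2 * j" by (auto elim: evenE)
  have "(\<integral>x. x ^ (2 * Suc j) \<partial>std_normal_distribution) = fact (2 * Suc j) / (2 ^ Suc j * fact (Suc j))"
    by (rule std_normal_distribution_even_moments(1))
  also have "\<dots> = real (Suc k) * (fact (2 * j) / (2 ^ j * fact j))"
  proof -
    have "fact (2 * Suc j) = (2 * real j + 2) * ((2 * real j + 1) * fact (2 * j))"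
      by (simp add: algebra_simps)
    moreover have "(2::real) ^ Suc j * fact (Suc j) = (2 * real j + 2) * (2 ^ j * fact j)"
      by (simp add: algebra_simps)
    moreover have "2 * real j + 2 \<noteq> 0" by linarith
    ultimately show ?thesis by (simp add: j mult_divide_mult_cancel_left del: fact_Suc power_Suc mult_Suc_right)
  qed
  finally show ?thesis using std_normal_distribution_even_moments(1)[of j] by (simp add: j)
next
  case False
  then show ?thesis by (simp add: integral_std_normal_distribution_moment_odd del: power_Suc)
qed

lemma sum_power2_le_card:
  fixes a :: "'a \<Rightarrow> real"
  shows "(\<Sum>i\<in>I. a i)\<^sup>2 \<le> real (card I) * (\<Sum>i\<in>I. (a i)\<^sup>2)"
  using sum_squared_le_sum_of_squares[of a I] by (simp add: mult.commute)

text \<open>The setting of a polynomial F that is square-free in finitely many independent standard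
  normal variables labelled by \<open>V\<close>, of degree at most \<open>d\<close> and without
  constant term; \<open>f m\<close> is the coefficient of the product over \<open>m\<close>.\<close>

locale gauss = prodspace D for D :: "'i \<Rightarrow> real measure" +
  fixes c :: "'v \<Rightarrow> 'i" and V :: "'v set" and f :: "'v set \<Rightarrow> real" and d :: nat
  assumes finV: "finite V" and inj_c: "inj_on c V"
    and normal: "\<And>v. v \<in> V \<Longrightarrow> D (c v) = std_normal_distribution"
    and f_supp: "\<And>m. f m \<noteq> 0 \<Longrightarrow> m \<subseteq> V \<and> m \<noteq> {} \<and> card m \<le> d"
begin

definition xm :: "'v set \<Rightarrow> ('i \<Rightarrow> real) \<Rightarrow> real" where "xm m x = (\<Prod>v\<in>m. x (c v))"

text \<open>The mixed partial derivative of F in the variables of \<open>\<alpha>\<close>, explicit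
  because F is square-free; \<open>dF {}\<close> is F itself.\<close>

definition dF :: "'v set \<Rightarrow> ('i \<Rightarrow> real) \<Rightarrow> real" where
  "dF \<alpha> x = (\<Sum>m\<in>{m \<in> Pow V. \<alpha> \<subseteq> m}. f m * xm (m - \<alpha>) x)"

text \<open>The mixed partial derivative of F^q in the variables of \<open>\<beta>\<close>,
  introduced by the Leibniz rule; \<open>rep_dpow\<close> shows that it deserves the name.\<close>

primrec dpow :: "nat \<Rightarrow> 'v set \<Rightarrow> ('i \<Rightarrow> real) \<Rightarrow> real" where
  "dpow 0 \<beta> x = of_bool (\<beta> = {})"
| "dpow (Suc q) \<beta> x = (\<Sum>S\<in>Pow \<beta>. dF S x * dpow q (\<beta> - S) x)"

lemma f_empty: "f {} = 0" using f_supp by blast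

lemma fin_sub: "m \<subseteq> V \<Longrightarrow> finite m" using finV finite_subset by blast

lemma E_normal_power: "v \<in> V \<Longrightarrow> E (\<lambda>x. x (c v) ^ k) = (\<integral>y. y ^ k \<partial>std_normal_distribution)"
  using E_coord(1)[of "\<lambda>y. y ^ k" "c v"] normal[of v] by simp

lemma c_disj: "m \<subseteq> V \<Longrightarrow> v \<in> V \<Longrightarrow> v \<notin> m \<Longrightarrow> c v \<notin> c ` m"
  using inj_c by (auto dest: inj_onD)

lemma xm_pol: "finite m \<Longrightarrow> xm m \<in> pol (c ` m) (card m)"
proof -
  have "(\<lambda>x. \<Prod>v\<in>m. x (c v)) \<in> pol (c ` m) (\<Sum>v\<in>m. 1)"
    by (rule pol_prod) (auto intro: pol_coord)
  then show ?thesis by (simp add: xm_def[abs_def])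
qed

lemma xm_insert: "finite m \<Longrightarrow> v \<notin> m \<Longrightarrow> xm (insert v m) x = x (c v) * xm m x"
  by (simp add: xm_def)

lemma xm_sq: "m \<subseteq> V \<Longrightarrow> E (\<lambda>x. xm m x * xm m x) = 1"
proof -
  assume "m \<subseteq> V"
  then have "finite m" by (rule fin_sub)
  then show ?thesis using \<open>m \<subseteq> V\<close>
  proof (induction rule: finite_induct)
    case empty
    then show ?case by (simp add: xm_def)
  next
    case (insert v m)
    have "E (\<lambda>x. (x (c v) ^ 2) * (xm m x * xm m x)) = E (\<lambda>x. x (c v) ^ 2) * E (\<lambda>x. xm m x * xm m x)"
      by (rule fac_pol[OF pol_power[OF pol_coord[of "c v" "{c v}" 1]] pol_mult[OF xm_pol xm_pol]])
         (use insert c_disj[of m v] in auto)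
    moreover have "E (\<lambda>x. x (c v) ^ 2) = 1"
      using E_normal_power[of v 2] insert std_normal_distribution_even_moments(1)[of 1] by simp
    ultimately show ?case using insert by (simp add: xm_insert power2_eq_square mult_ac)
  qed
qed

lemma xm_orth1:
  assumes "m \<subseteq> V" "m' \<subseteq> V" "v \<in> m" "v \<notin> m'"
  shows "E (\<lambda>x. xm m x * xm m' x) = 0"
proof -
  have f: "finite (m - {v})" "finite m'" using assms fin_sub by auto
  have "E (\<lambda>x. x (c v) ^ 1 * (xm (m - {v}) x * xm m' x)) = E (\<lambda>x. x (c v) ^ 1) * E (\<lambda>x. xm (m - {v}) x * xm m' x)"
  proof (rule fac_pol[OF pol_power[OF pol_coord[of "c v" "{c v}" 1]] pol_mult[OF pol_mono[OF xm_pol] pol_mono[OF xm_pol]]])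
    show "{c v} \<inter> (c ` (V - {v})) = {}" using c_disj[of "V - {v}" v] assms by auto
  qed (use f assms in auto)
  also have "E (\<lambda>x. x (c v) ^ 1) = 0"
    using E_normal_power[of v 1] subsetD[OF assms(1,3)] integral_std_normal_distribution_moment_odd[of 1] by simp
  finally have "E (\<lambda>x. x (c v) * (xm (m - {v}) x * xm m' x)) = 0" by simp
  moreover have "xm m x = x (c v) * xm (m - {v}) x" for x
    using xm_insert[OF f(1), of v x] assms by (simp add: insert_absorb)
  ultimately show ?thesis by (simp add: mult.assoc)
qed

lemma xm_orth:
  assumes "m \<subseteq> V" "m' \<subseteq> V"
  shows "E (\<lambda>x. xm m x * xm m' x) = of_bool (m = m')"
proof (cases "m = m'")
  case True
  then show ?thesis using xm_sq[OF assms(1)] by simp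
next
  case False
  then consider v where "v \<in> m" "v \<notin> m'" | v where "v \<in> m'" "v \<notin> m" by blast
  then have "E (\<lambda>x. xm m x * xm m' x) = 0"
  proof cases
    case 1
    then show ?thesis using xm_orth1 assms by blast
  next
    case 2
    then show ?thesis using xm_orth1[of m' m v] assms by (simp add: mult.commute)
  qed
  then show ?thesis using False by simp
qed

text \<open>Parseval for square-free monomials in standard normal variables.\<close>

lemma xm_comb_sq:
  assumes "MM \<subseteq> Pow V"
  shows "E (\<lambda>x. (\<Sum>m\<in>MM. b m * xm m x)\<^sup>2) = (\<Sum>m\<in>MM. (b m)\<^sup>2)"
proof -
  have fM: "finite MM" using assms finV by (meson finite_Pow_iff finite_subset)
  have int: "integrable P (\<lambda>x. xm m x * xm m' x)" if "m \<in> MM" "m' \<in> MM" for m m'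
    using that assms fin_sub by (intro pol_integrable_mult[OF xm_pol xm_pol]) auto
  have "E (\<lambda>x. (\<Sum>m\<in>MM. b m * xm m x)\<^sup>2) = E (\<lambda>x. \<Sum>m\<in>MM. \<Sum>m'\<in>MM. (b m * b m') * (xm m x * xm m' x))"
    by (simp add: power2_eq_square sum_product mult_ac)
  also have "\<dots> = (\<Sum>m\<in>MM. \<Sum>m'\<in>MM. (b m * b m') * of_bool (m = m'))"
    using int assms by (simp add: Bochner_Integration.integral_sum) (intro sum.cong refl; auto simp: xm_orth subset_eq)
  also have "\<dots> = (\<Sum>m\<in>MM. (b m)\<^sup>2)"
    using fM by (simp add: of_bool_def if_distrib sum.delta power2_eq_square cong: if_cong)
  finally show ?thesis .
qed

text \<open>\<open>A'\<close> is the partial derivative of \<open>A\<close> in the variable of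
  \<open>v\<close>: \<open>A\<close> is written as a polynomial in that variable with coefficients
  in the remaining ones. The uniform bounds \<open>K\<close> and \<open>N\<close> allow expectations
  to be taken term by term.\<close>

definition rep :: "'v \<Rightarrow> (('i \<Rightarrow> real) \<Rightarrow> real) \<Rightarrow> (('i \<Rightarrow> real) \<Rightarrow> real) \<Rightarrow> bool" where
  "rep v A A' \<longleftrightarrow> (\<exists>p K N. (\<forall>x. A x = poly (p x) (x (c v)) \<and> A' x = poly (pderiv (p x)) (x (c v)))
     \<and> (\<forall>k. (\<lambda>x. coeff (p x) k) \<in> pol (UNIV - {c v}) K) \<and> (\<forall>x. degree (p x) \<le> N))"

lemma rep_add: "rep v A A' \<Longrightarrow> rep v B B' \<Longrightarrow> rep v (\<lambda>x. A x + B x) (\<lambda>x. A' x + B' x)"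
proof -
  assume "rep v A A'" "rep v B B'"
  then obtain p K N p' K' N' where
    p: "\<And>x. A x = poly (p x) (x (c v))" "\<And>x. A' x = poly (pderiv (p x)) (x (c v))"
       "\<And>k. (\<lambda>x. coeff (p x) k) \<in> pol (UNIV - {c v}) K" "\<And>x. degree (p x) \<le> N" and
    p': "\<And>x. B x = poly (p' x) (x (c v))" "\<And>x. B' x = poly (pderiv (p' x)) (x (c v))"
       "\<And>k. (\<lambda>x. coeff (p' x) k) \<in> pol (UNIV - {c v}) K'" "\<And>x. degree (p' x) \<le> N'"
    unfolding rep_def by metis
  show ?thesis unfolding rep_def
  proof (rule exI[of _ "\<lambda>x. p x + p' x"], rule exI[of _ "max K K'"], rule exI[of _ "max N N'"], intro conjI allI)
    show "(\<lambda>x. coeff (p x + p' x) k) \<in> pol (UNIV - {c v}) (max K K')" for k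
      unfolding coeff_add by (intro pol_add pol_mono[OF p(3)] pol_mono[OF p'(3)]) auto
    show "degree (p x + p' x) \<le> max N N'" for x
      using p(4)[of x] p'(4)[of x] by (intro degree_add_le) auto
  qed (auto simp: p p' pderiv_add)
qed

lemma rep_mult: "rep v A A' \<Longrightarrow> rep v B B' \<Longrightarrow> rep v (\<lambda>x. A x * B x) (\<lambda>x. A' x * B x + A x * B' x)"
proof -
  assume "rep v A A'" "rep v B B'"
  then obtain p K N p' K' N' where
    p: "\<And>x. A x = poly (p x) (x (c v))" "\<And>x. A' x = poly (pderiv (p x)) (x (c v))"
       "\<And>k. (\<lambda>x. coeff (p x) k) \<in> pol (UNIV - {c v}) K" "\<And>x. degree (p x) \<le> N" and
    p': "\<And>x. B x = poly (p' x) (x (c v))" "\<And>x. B' x = poly (pderiv (p' x)) (x (c v))"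
       "\<And>k. (\<lambda>x. coeff (p' x) k) \<in> pol (UNIV - {c v}) K'" "\<And>x. degree (p' x) \<le> N'"
    unfolding rep_def by metis
  show ?thesis unfolding rep_def
  proof (rule exI[of _ "\<lambda>x. p x * p' x"], rule exI[of _ "K + K'"], rule exI[of _ "N + N'"], intro conjI allI)
    show "(\<lambda>x. coeff (p x * p' x) k) \<in> pol (UNIV - {c v}) (K + K')" for k
      unfolding coeff_mult by (intro pol_sum pol_mult p p')
    show "degree (p x * p' x) \<le> N + N'" for x
      using degree_mult_le[of "p x" "p' x"] p(4)[of x] p'(4)[of x] by linarith
  qed (auto simp: p p' pderiv_mult)
qed

lemma rep_const: "rep v (\<lambda>_. a) (\<lambda>_. 0)"
  unfolding rep_def by (intro exI[of _ "\<lambda>_. [:a:]"] exI[of _ 0]) (auto intro: pol_const)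

lemma rep_sum: "(\<And>t. t \<in> T \<Longrightarrow> rep v (A t) (A' t)) \<Longrightarrow> rep v (\<lambda>x. \<Sum>t\<in>T. A t x) (\<lambda>x. \<Sum>t\<in>T. A' t x)"
  by (induction T rule: infinite_finite_induct) (auto intro: rep_const rep_add)

text \<open>After expansion of \<open>A\<close> in powers of the variable of \<open>v\<close>,
  independence leaves Gaussian moments as factors, and the moment recursion acts on them as
  differentiation does.\<close>

lemma IBP1:
  assumes v: "v \<in> V" and r: "rep v A A'" and B: "B \<in> pol (UNIV - {c v}) kb"
  shows "E (\<lambda>x. x (c v) * B x * A x) = E (\<lambda>x. B x * A' x)"
proof -
  from r obtain p K N where
    p: "\<And>x. A x = poly (p x) (x (c v))" "\<And>x. A' x = poly (pderiv (p x)) (x (c v))"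
       "\<And>k. (\<lambda>x. coeff (p x) k) \<in> pol (UNIV - {c v}) K" "\<And>x. degree (p x) \<le> N" unfolding rep_def by metis
  define \<mu> where "\<mu> k = (\<integral>y. y ^ k \<partial>std_normal_distribution)" for k
  define a where "a k = E (\<lambda>x. B x * coeff (p x) k)" for k
  have fc: "E (\<lambda>x. x (c v) ^ j * (B x * coeff (p x) k)) = \<mu> j * a k" for j k
    unfolding a_def \<mu>_def using E_normal_power[OF v, of j]
    by (subst fac_pol[OF pol_power[OF pol_coord[of "c v" "{c v}" 1]] pol_mult[OF B p(3)]]) auto
  have int: "integrable P (\<lambda>x. x (c v) ^ j * (B x * coeff (p x) k))" for j k
    by (rule pol_integrable_mult[OF pol_power[OF pol_coord[of "c v" UNIV 1]] pol_mult[OF B p(3)]]) auto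
  have pa: "poly q y = (\<Sum>k\<le>n. coeff q k * y ^ k)" if "degree q \<le> n" for q :: "real poly" and y n
    unfolding poly_altdef by (rule sum.mono_neutral_left) (use that in \<open>auto simp: coeff_eq_0\<close>)
  have "E (\<lambda>x. x (c v) * B x * A x) = E (\<lambda>x. \<Sum>k\<le>Suc N. x (c v) ^ Suc k * (B x * coeff (p x) k))"
    by (intro Bochner_Integration.integral_cong refl)
       (simp add: p(1) pa[OF le_SucI[OF p(4)]] sum_distrib_left mult_ac del: sum.atMost_Suc)
  also have "\<dots> = (\<Sum>k\<le>Suc N. \<mu> (Suc k) * a k)"
    using int by (simp add: Bochner_Integration.integral_sum fc del: sum.atMost_Suc power_Suc)
  \<comment> \<open>The term k = 0 carries the first Gaussian moment and vanishes; the others are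
    shifted by one to meet the coefficients of the derivative.\<close>
  also have "\<dots> = \<mu> 1 * a 0 + (\<Sum>k\<le>N. \<mu> (Suc (Suc k)) * a (Suc k))"
    by (subst sum.atMost_Suc_shift) simp
  also have "\<mu> 1 = 0" unfolding \<mu>_def by (rule integral_std_normal_distribution_moment_odd) simp
  also have "0 * a 0 + (\<Sum>k\<le>N. \<mu> (Suc (Suc k)) * a (Suc k)) = (\<Sum>k\<le>N. real (Suc k) * (\<mu> k * a (Suc k)))"
    unfolding \<mu>_def std_normal_moment_rec by (simp add: mult.assoc)
  also have "\<dots> = E (\<lambda>x. \<Sum>k\<le>N. real (Suc k) * (x (c v) ^ k * (B x * coeff (p x) (Suc k))))"
    using int by (simp add: Bochner_Integration.integral_sum fc)
  also have "\<dots> = E (\<lambda>x. B x * A' x)"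
  proof (intro Bochner_Integration.integral_cong refl)
    fix x
    have "degree (pderiv (p x)) \<le> N" using degree_pderiv[of "p x"] p(4)[of x] by simp
    then show "(\<Sum>k\<le>N. real (Suc k) * (x (c v) ^ k * (B x * coeff (p x) (Suc k)))) = B x * A' x"
      by (simp add: p(2) pa coeff_pderiv sum_distrib_left mult_ac)
  qed
  finally show ?thesis .
qed

text \<open>A square-free polynomial is affine in each variable; its slope collects the index sets
  that contain \<open>v\<close>.\<close>

lemma rep_dF:
  assumes v: "v \<in> V" "v \<notin> \<alpha>" and \<alpha>: "\<alpha> \<subseteq> V"
  shows "rep v (dF \<alpha>) (dF (insert v \<alpha>))"
proof -
  define a where "a x = (\<Sum>m\<in>{m \<in> Pow V. \<alpha> \<subseteq> m \<and> v \<notin> m}. f m * xm (m - \<alpha>) x)" for x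
  have spl: "dF \<alpha> x = a x + x (c v) * dF (insert v \<alpha>) x" for x
  proof -
    have "{m \<in> Pow V. \<alpha> \<subseteq> m} = {m \<in> Pow V. \<alpha> \<subseteq> m \<and> v \<notin> m} \<union> {m \<in> Pow V. insert v \<alpha> \<subseteq> m}" by auto
    then have "dF \<alpha> x = a x + (\<Sum>m\<in>{m \<in> Pow V. insert v \<alpha> \<subseteq> m}. f m * xm (m - \<alpha>) x)"
      unfolding dF_def a_def using finV by (simp only:) (rule sum.union_disjoint; auto)
    also have "(\<Sum>m\<in>{m \<in> Pow V. insert v \<alpha> \<subseteq> m}. f m * xm (m - \<alpha>) x) = x (c v) * dF (insert v \<alpha>) x"
      unfolding dF_def sum_distrib_left
    proof (intro sum.cong refl)
      fix m assume "m \<in> {m \<in> Pow V. insert v \<alpha> \<subseteq> m}"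
      then have m: "m - \<alpha> = insert v (m - insert v \<alpha>)" "finite (m - insert v \<alpha>)" using v fin_sub by auto
      show "f m * xm (m - \<alpha>) x = x (c v) * (f m * xm (m - insert v \<alpha>) x)"
        unfolding m(1) by (subst xm_insert) (use m(2) in auto)
    qed
    finally show ?thesis .
  qed
  have xp: "xm m \<in> pol (UNIV - {c v}) (card V)" if "m \<subseteq> V" "v \<notin> m" for m
  proof (rule pol_mono[OF xm_pol[OF fin_sub[OF that(1)]]])
    show "c ` m \<subseteq> UNIV - {c v}" using c_disj[OF that(1) v(1) that(2)] by blast
    show "card m \<le> card V" by (rule card_mono[OF finV that(1)])
  qed
  have pa: "a \<in> pol (UNIV - {c v}) (card V)" unfolding a_def[abs_def]
    by (intro pol_sum pol_scale xp) auto
  have pb: "dF (insert v \<alpha>) \<in> pol (UNIV - {c v}) (card V)" unfolding dF_def[abs_def]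
    by (intro pol_sum pol_scale xp) auto
  show ?thesis unfolding rep_def
  proof (rule exI[of _ "\<lambda>x. [:a x, dF (insert v \<alpha>) x:]"], rule exI[of _ "card V"], rule exI[of _ 1], intro conjI allI)
    show "(\<lambda>x. coeff [:a x, dF (insert v \<alpha>) x:] k) \<in> pol (UNIV - {c v}) (card V)" for k
      using pa pb pol_const[of 0] by (cases k; cases "k - 1") (auto simp: coeff_pCons split: nat.splits)
  qed (auto simp: spl pderiv_pCons)
qed

text \<open>The subsets of \<open>insert v \<beta>\<close> are those of \<open>\<beta>\<close>, with
  or without \<open>v\<close> added; this matches the product rule applied to every term of the
  Leibniz sum.\<close>

lemma rep_dpow:
  assumes v: "v \<in> V" "v \<notin> \<beta>" and \<beta>: "\<beta> \<subseteq> V"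
  shows "rep v (dpow q \<beta>) (dpow q (insert v \<beta>))"
  using v(2) \<beta>
proof (induction q arbitrary: \<beta>)
  case 0
  then show ?case by (simp add: rep_const)
next
  case (Suc q)
  have fb: "finite \<beta>" using Suc.prems fin_sub by auto
  have r: "rep v (\<lambda>x. \<Sum>S\<in>Pow \<beta>. dF S x * dpow q (\<beta> - S) x)
     (\<lambda>x. \<Sum>S\<in>Pow \<beta>. dF (insert v S) x * dpow q (\<beta> - S) x + dF S x * dpow q (insert v (\<beta> - S)) x)"
    by (intro rep_sum rep_mult rep_dF Suc.IH v(1)) (use Suc.prems in auto)
  have eq: "(\<Sum>S\<in>Pow \<beta>. dF (insert v S) x * dpow q (\<beta> - S) x + dF S x * dpow q (insert v (\<beta> - S)) x)
     = dpow (Suc q) (insert v \<beta>) x" for x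
  proof -
    have i: "inj_on (insert v) (Pow \<beta>)" using Suc.prems by (auto simp: inj_on_def)
    have "dpow (Suc q) (insert v \<beta>) x = (\<Sum>S\<in>Pow \<beta>. dF S x * dpow q (insert v \<beta> - S) x)
        + (\<Sum>S\<in>insert v ` Pow \<beta>. dF S x * dpow q (insert v \<beta> - S) x)"
      unfolding dpow.simps Pow_insert
      by (rule sum.union_disjoint) (use fb Suc.prems in auto)
    also have "(\<Sum>S\<in>insert v ` Pow \<beta>. dF S x * dpow q (insert v \<beta> - S) x) = (\<Sum>S\<in>Pow \<beta>. dF (insert v S) x * dpow q (\<beta> - S) x)"
      unfolding sum.reindex[OF i] o_def
    proof (intro sum.cong refl)
      fix S assume "S \<in> Pow \<beta>"
      then have "insert v \<beta> - insert v S = \<beta> - S" using Suc.prems by auto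
      then show "dF (insert v S) x * dpow q (insert v \<beta> - insert v S) x = dF (insert v S) x * dpow q (\<beta> - S) x" by simp
    qed
    also have "(\<Sum>S\<in>Pow \<beta>. dF S x * dpow q (insert v \<beta> - S) x) = (\<Sum>S\<in>Pow \<beta>. dF S x * dpow q (insert v (\<beta> - S)) x)"
    proof (intro sum.cong refl)
      fix S assume "S \<in> Pow \<beta>"
      then have "insert v \<beta> - S = insert v (\<beta> - S)" using Suc.prems by auto
      then show "dF S x * dpow q (insert v \<beta> - S) x = dF S x * dpow q (insert v (\<beta> - S)) x" by simp
    qed
    finally show ?thesis by (simp add: sum.distrib add.commute)
  qed
  have e1: "(\<lambda>x. \<Sum>S\<in>Pow \<beta>. dF S x * dpow q (\<beta> - S) x) = dpow (Suc q) \<beta>"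
    by (rule ext) simp
  have e2: "(\<lambda>x. \<Sum>S\<in>Pow \<beta>. dF (insert v S) x * dpow q (\<beta> - S) x + dF S x * dpow q (insert v (\<beta> - S)) x)
     = dpow (Suc q) (insert v \<beta>)"
    by (rule ext) (rule eq)
  show ?case using r unfolding e1 e2 .
qed

text \<open>The variables of \<open>m\<close> are moved one by one from the monomial to the
  derivative; disjointness keeps any variable from being differentiated twice.\<close>

lemma IBP:
  assumes "m \<subseteq> V" "\<beta> \<subseteq> V" "m \<inter> \<beta> = {}"
  shows "E (\<lambda>x. xm m x * dpow q \<beta> x) = E (dpow q (\<beta> \<union> m))"
proof -
  have "finite m" using assms fin_sub by auto
  then show ?thesis using assms
  proof (induction m arbitrary: \<beta> rule: finite_induct)
    case empty
    then show ?case by (simp add: xm_def)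
  next
    case (insert v m)
    have v: "v \<in> V" "v \<notin> \<beta>" and m: "m \<subseteq> V" using insert.prems by auto
    have "xm m \<in> pol (UNIV - {c v}) (card m)"
    proof (rule pol_mono[OF xm_pol[OF insert.hyps(1)]])
      show "c ` m \<subseteq> UNIV - {c v}" using c_disj[OF m v(1) insert.hyps(2)] by blast
    qed simp
    then have "E (\<lambda>x. x (c v) * xm m x * dpow q \<beta> x) = E (\<lambda>x. xm m x * dpow q (insert v \<beta>) x)"
      using insert.prems by (intro IBP1[OF v(1) rep_dpow[OF v]]) auto
    also have "\<dots> = E (dpow q (insert v \<beta> \<union> m))"
      using insert by (intro insert.IH) auto
    finally show ?case using insert.hyps by (simp add: xm_insert)
  qed
qed

section \<open>The approximate moment recursion\<close>

definition "Q x = (\<Sum>S\<in>Pow V. (dF S x)\<^sup>2)"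
definition "\<sigma>2 = (\<Sum>m\<in>Pow V. (f m)\<^sup>2)"
text \<open>Contraction form of F over the proper splittings of its index sets. The two improper
  splittings are left out because they produce the main terms; smallness of this form is what makes
  F nearly Gaussian.\<close>

definition "T u w = (\<Sum>m\<in>Pow V. \<Sum>S\<in>Pow m - {{}, m}. f m * u S * w (m - S))"
text \<open>The coefficients of F paired with the derivatives of F^q; by integration by parts its
  mean is the moment of order q + 1 (\<open>E_F_power\<close>). \<open>G1\<close> is the case q =
  1.\<close>

definition "\<Gamma> q x = (\<Sum>m\<in>Pow V. f m * dpow q m x)"
definition "G1 x = (\<Sum>m\<in>Pow V. f m * dF m x)"
definition "cross q x = T (\<lambda>S. dF S x) (\<lambda>S. dpow q S x)"

lemma dF_pol: "dF \<alpha> \<in> pol UNIV d"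
  unfolding dF_def[abs_def]
proof (rule pol_sum)
  fix m assume "m \<in> {m \<in> Pow V. \<alpha> \<subseteq> m}"
  then have "finite m" using fin_sub by auto
  show "(\<lambda>x. f m * xm (m - \<alpha>) x) \<in> pol UNIV d"
  proof (cases "f m = 0")
    case True
    then show ?thesis by (simp add: pol_const)
  next
    case False
    have "card (m - \<alpha>) \<le> d" using f_supp[OF False] card_mono[OF \<open>finite m\<close>, of "m - \<alpha>"] by auto
    then show ?thesis using \<open>finite m\<close> by (intro pol_scale pol_mono[OF xm_pol]) auto
  qed
qed

lemma dpow_pol: "finite \<beta> \<Longrightarrow> dpow q \<beta> \<in> pol UNIV (q * d)"
proof (induction q arbitrary: \<beta>)
  case 0
  then show ?case by (simp add: pol_const)
next
  case (Suc q)
  then show ?case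
    unfolding dpow.simps by (auto intro!: pol_sum pol_mult dF_pol)
qed

lemma dpow_empty: "dpow q {} x = dF {} x ^ q"
  by (induction q) auto

lemma F_eq: "dF {} x = (\<Sum>m\<in>Pow V. f m * xm m x)"
  by (simp add: dF_def Pow_def)

lemma E_F_power: "E (\<lambda>x. dF {} x ^ Suc q) = E (\<Gamma> q)"
proof -
  have i: "integrable P (\<lambda>x. xm m x * dpow q {} x)" "integrable P (dpow q m)" if "m \<in> Pow V" for m
    using that fin_sub by (auto intro!: pol_integrable_mult[OF xm_pol dpow_pol] pol_integrable[OF dpow_pol])
  have "E (\<lambda>x. dF {} x ^ Suc q) = E (\<lambda>x. \<Sum>m\<in>Pow V. f m * (xm m x * dpow q {} x))"
    by (simp add: dpow_empty F_eq[symmetric] sum_distrib_right[symmetric] mult.assoc[symmetric])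
  also have "\<dots> = (\<Sum>m\<in>Pow V. f m * E (dpow q m))"
    using i IBP[of _ "{}"] by (simp add: Bochner_Integration.integral_sum)
  also have "\<dots> = E (\<Gamma> q)" unfolding \<Gamma>_def using i by (simp add: Bochner_Integration.integral_sum)
  finally show ?thesis .
qed

lemma sum_Pow_split:
  assumes "finite m" "m \<noteq> {}"
  shows "(\<Sum>S\<in>Pow m. h S) = h {} + h m + (\<Sum>S\<in>Pow m - {{}, m}. h S :: real)"
proof -
  have "(\<Sum>S\<in>Pow m. h S) = (\<Sum>S\<in>Pow m - {{}, m}. h S) + (\<Sum>S\<in>{{}, m}. h S)"
    by (rule sum.subset_diff) (use assms in auto)
  then show ?thesis using assms by simp
qed

text \<open>In the Leibniz sum, no derivative falling on the first factor gives F times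
  \<open>\<Gamma> q\<close>, all of them falling on it gives F^q times \<open>G1\<close>, and the
  proper splittings make up \<open>cross\<close>.\<close>

lemma \<Gamma>_Suc: "\<Gamma> (Suc q) x = dF {} x * \<Gamma> q x + dF {} x ^ q * G1 x + cross q x"
proof -
  have "\<Gamma> (Suc q) x = (\<Sum>m\<in>Pow V. f m * (dF {} x * dpow q m x) + f m * (dF m x * dpow q {} x) +
     (\<Sum>S\<in>Pow m - {{}, m}. f m * dF S x * dpow q (m - S) x))"
    unfolding \<Gamma>_def
  proof (intro sum.cong refl)
    fix m assume "m \<in> Pow V"
    then have fm: "finite m" using fin_sub by auto
    show "f m * dpow (Suc q) m x = f m * (dF {} x * dpow q m x) + f m * (dF m x * dpow q {} x) +
     (\<Sum>S\<in>Pow m - {{}, m}. f m * dF S x * dpow q (m - S) x)"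
    proof (cases "m = {}")
      case True
      then show ?thesis using f_empty by simp
    next
      case False
      show ?thesis unfolding dpow.simps sum_Pow_split[OF fm False]
        by (simp add: distrib_left sum_distrib_left mult.assoc)
    qed
  qed
  then show ?thesis
    by (simp add: sum.distrib \<Gamma>_def G1_def cross_def T_def dpow_empty sum_distrib_left mult_ac)
qed

text \<open>The recursion unrolled. The q + 1 equal main terms are the origin of the factor in the
  Gaussian moment recursion.\<close>

lemma \<Gamma>_eq: "\<Gamma> (Suc q) x = real (Suc q) * (dF {} x ^ q * G1 x) + (\<Sum>i\<le>q. dF {} x ^ (q - i) * cross i x)"
proof (induction q)
  case 0
  have "\<Gamma> 0 x = 0" unfolding \<Gamma>_def using f_empty by (intro sum.neutral) auto
  then show ?case by (simp add: \<Gamma>_Suc)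
next
  case (Suc q)
  have "(\<Sum>i\<le>q. dF {} x ^ (Suc q - i) * cross i x) = dF {} x * (\<Sum>i\<le>q. dF {} x ^ (q - i) * cross i x)"
    unfolding sum_distrib_left by (intro sum.cong refl) (auto simp: Suc_diff_le)
  then show ?case by (subst \<Gamma>_Suc) (simp add: Suc algebra_simps)
qed

lemma Q_nonneg: "Q x \<ge> 0" unfolding Q_def by (intro sum_nonneg) auto

lemma F_le_Q: "(dF {} x)\<^sup>2 \<le> Q x"
  unfolding Q_def by (rule member_le_sum[of "{}"]) (use finV in auto)

text \<open>Derivatives of order above \<open>d\<close> never meet a nonzero coefficient of F.
  Cutting them off limits a Leibniz sum to 2^d terms and makes the next bound independent of the
  size of \<open>V\<close>.\<close>

definition "trunc q S x = (if card S \<le> d then dpow q S x else 0)"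

lemma trunc_bound: "(\<Sum>\<beta>\<in>Pow V. (trunc q \<beta> x)\<^sup>2) \<le> (2 ^ d * Q x) ^ q"
proof (induction q)
  case 0
  have "(\<Sum>\<beta>\<in>Pow V. (trunc 0 \<beta> x)\<^sup>2) = (\<Sum>\<beta>\<in>Pow V. of_bool (\<beta> = {}))"
    by (intro sum.cong refl) (auto simp: trunc_def)
  also have "\<dots> = 1" using finV by (simp add: of_bool_def sum.delta)
  finally show ?case by simp
next
  case (Suc q)
  have 1: "(trunc (Suc q) \<beta> x)\<^sup>2 \<le> 2 ^ d * (\<Sum>S\<in>Pow \<beta>. (dF S x)\<^sup>2 * (trunc q (\<beta> - S) x)\<^sup>2)" if \<beta>: "\<beta> \<in> Pow V" for \<beta>
  proof (cases "card \<beta> \<le> d")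
    case True
    have fb: "finite \<beta>" using \<beta> fin_sub by auto
    have t: "dpow q (\<beta> - S) x = trunc q (\<beta> - S) x" for S
      using True card_mono[OF fb, of "\<beta> - S"] by (auto simp: trunc_def)
    have "(trunc (Suc q) \<beta> x)\<^sup>2 = (\<Sum>S\<in>Pow \<beta>. dF S x * trunc q (\<beta> - S) x)\<^sup>2"
      using True unfolding trunc_def[of "Suc q"] by (simp add: t)
    also have "\<dots> \<le> real (card (Pow \<beta>)) * (\<Sum>S\<in>Pow \<beta>. (dF S x * trunc q (\<beta> - S) x)\<^sup>2)"
      by (rule sum_power2_le_card)
    also have "\<dots> \<le> 2 ^ d * (\<Sum>S\<in>Pow \<beta>. (dF S x * trunc q (\<beta> - S) x)\<^sup>2)"
      using True by (intro mult_right_mono sum_nonneg) (auto simp: card_Pow[OF fb])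
    finally show ?thesis by (simp add: power_mult_distrib)
  next
    case False
    have "(trunc (Suc q) \<beta> x)\<^sup>2 = 0" using False by (simp add: trunc_def)
    then show ?thesis by (simp add: sum_nonneg)
  qed
  have "(\<Sum>\<beta>\<in>Pow V. (trunc (Suc q) \<beta> x)\<^sup>2) \<le> (\<Sum>\<beta>\<in>Pow V. 2 ^ d * (\<Sum>S\<in>Pow \<beta>. (dF S x)\<^sup>2 * (trunc q (\<beta> - S) x)\<^sup>2))"
    by (intro sum_mono 1)
  also have "\<dots> = 2 ^ d * (\<Sum>\<beta>\<in>Pow V. \<Sum>S\<in>Pow \<beta>. (dF S x)\<^sup>2 * (trunc q (\<beta> - S) x)\<^sup>2)"
    by (simp add: sum_distrib_left)
  also have "(\<Sum>\<beta>\<in>Pow V. \<Sum>S\<in>Pow \<beta>. (dF S x)\<^sup>2 * (trunc q (\<beta> - S) x)\<^sup>2) =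
     (\<Sum>(\<beta>, S)\<in>Sigma (Pow V) Pow. (dF S x)\<^sup>2 * (trunc q (\<beta> - S) x)\<^sup>2)"
    by (rule sum.Sigma) (use finV fin_sub in auto)
  \<comment> \<open>The map sending (\<beta>, S) to (S, \<beta> - S) is injective, so the sum over
    nested pairs is dominated by a full product of two sums.\<close>
  also have "(\<Sum>(\<beta>, S)\<in>Sigma (Pow V) Pow. (dF S x)\<^sup>2 * (trunc q (\<beta> - S) x)\<^sup>2)
     = (\<Sum>(S, \<beta>)\<in>(\<lambda>(\<beta>, S). (S, \<beta> - S)) ` Sigma (Pow V) Pow. (dF S x)\<^sup>2 * (trunc q \<beta> x)\<^sup>2)"
    by (subst sum.reindex) (auto simp: inj_on_def intro!: sum.cong)
  also have "\<dots> \<le> (\<Sum>(S, \<beta>)\<in>Pow V \<times> Pow V. (dF S x)\<^sup>2 * (trunc q \<beta> x)\<^sup>2)"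
    by (rule sum_mono2) (use finV in auto)
  also have "\<dots> = Q x * (\<Sum>\<beta>\<in>Pow V. (trunc q \<beta> x)\<^sup>2)"
    by (simp add: Q_def sum_product sum.cartesian_product)
  also have "\<dots> \<le> Q x * (2 ^ d * Q x) ^ q" using Suc Q_nonneg by (intro mult_left_mono)
  finally show ?case by (simp add: mult_ac)
qed

lemma cross_trunc: "cross q x = T (\<lambda>S. dF S x) (\<lambda>S. trunc q S x)"
  unfolding cross_def T_def
proof (intro sum.cong refl)
  fix m S assume m: "m \<in> Pow V" "S \<in> Pow m - {{}, m}"
  have "card (m - S) \<le> card m" using m fin_sub by (intro card_mono) auto
  then show "f m * dF S x * dpow q (m - S) x = f m * dF S x * trunc q (m - S) x"
    using f_supp[of m] by (cases "f m = 0") (auto simp: trunc_def)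
qed

lemma E_dF_sq: "\<alpha> \<subseteq> V \<Longrightarrow> E (\<lambda>x. (dF \<alpha> x)\<^sup>2) = (\<Sum>m\<in>{m \<in> Pow V. \<alpha> \<subseteq> m}. (f m)\<^sup>2)"
proof -
  assume \<alpha>: "\<alpha> \<subseteq> V"
  let ?M = "{m \<in> Pow V. \<alpha> \<subseteq> m}"
  have inj: "inj_on (\<lambda>m. m - \<alpha>) ?M" by (auto simp: inj_on_def)
  have 1: "dF \<alpha> x = (\<Sum>m\<in>(\<lambda>m. m - \<alpha>) ` ?M. f (m \<union> \<alpha>) * xm m x)" for x
    unfolding dF_def sum.reindex[OF inj] o_def by (intro sum.cong refl) (auto simp: Un_absorb2)
  have "E (\<lambda>x. (dF \<alpha> x)\<^sup>2) = (\<Sum>m\<in>(\<lambda>m. m - \<alpha>) ` ?M. (f (m \<union> \<alpha>))\<^sup>2)"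
    unfolding 1 by (rule xm_comb_sq) auto
  also have "\<dots> = (\<Sum>m\<in>?M. (f m)\<^sup>2)"
    unfolding sum.reindex[OF inj] o_def by (intro sum.cong refl) (auto simp: Un_absorb2)
  finally show ?thesis .
qed

text \<open>By Parseval each squared coefficient is counted once for every subset of its index set,
  that is, at most 2^d times.\<close>

lemma E_Q: "E Q \<le> 2 ^ d * \<sigma>2"
proof -
  have "E Q = (\<Sum>S\<in>Pow V. E (\<lambda>x. (dF S x)\<^sup>2))"
    unfolding Q_def[abs_def] using pol_integrable_power[OF dF_pol] by (intro Bochner_Integration.integral_sum) auto
  also have "\<dots> = (\<Sum>S\<in>Pow V. \<Sum>m\<in>{m \<in> Pow V. S \<subseteq> m}. (f m)\<^sup>2)"
    by (intro sum.cong refl E_dF_sq) auto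
  also have "\<dots> = (\<Sum>m\<in>Pow V. \<Sum>S\<in>{S \<in> Pow V. S \<subseteq> m}. (f m)\<^sup>2)"
    by (rule sum.swap_restrict) (use finV in auto)
  also have "\<dots> \<le> (\<Sum>m\<in>Pow V. 2 ^ d * (f m)\<^sup>2)"
  proof (rule sum_mono)
    fix m assume m: "m \<in> Pow V"
    then have e: "{S \<in> Pow V. S \<subseteq> m} = Pow m" by auto
    have fm: "finite m" using m fin_sub by auto
    show "(\<Sum>S\<in>{S \<in> Pow V. S \<subseteq> m}. (f m)\<^sup>2) \<le> 2 ^ d * (f m)\<^sup>2"
      unfolding e using f_supp[of m] by (cases "f m = 0") (auto simp: card_Pow[OF fm] intro!: mult_right_mono)
  qed
  finally show ?thesis by (simp add: \<sigma>2_def sum_distrib_left)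
qed

lemma Q_pol: "Q \<in> pol UNIV (2 * d)"
  unfolding Q_def[abs_def] by (intro pol_sum pol_power dF_pol)

lemma E_Q_sq:
  assumes C: "C \<ge> 0" "\<And>A B. A \<in> pol UNIV d \<Longrightarrow> B \<in> pol UNIV d \<Longrightarrow>
     E (\<lambda>x. (A x * B x)\<^sup>2) \<le> C * E (\<lambda>x. (A x)\<^sup>2) * E (\<lambda>x. (B x)\<^sup>2)"
  shows "E (\<lambda>x. (Q x)\<^sup>2) \<le> C * (2 ^ d * \<sigma>2)\<^sup>2"
proof -
  have EQ: "E Q = (\<Sum>S\<in>Pow V. E (\<lambda>x. (dF S x)\<^sup>2))"
    unfolding Q_def[abs_def] using pol_integrable_power[OF dF_pol] by (intro Bochner_Integration.integral_sum) auto
  have i: "integrable P (\<lambda>x. (dF S x * dF S' x)\<^sup>2)" for S S'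
    by (rule pol_integrable_power[OF pol_mult[OF dF_pol dF_pol]])
  have "E (\<lambda>x. (Q x)\<^sup>2) = E (\<lambda>x. \<Sum>S\<in>Pow V. \<Sum>S'\<in>Pow V. (dF S x * dF S' x)\<^sup>2)"
    by (simp add: Q_def power2_eq_square sum_product mult_ac)
  also have "\<dots> = (\<Sum>S\<in>Pow V. \<Sum>S'\<in>Pow V. E (\<lambda>x. (dF S x * dF S' x)\<^sup>2))"
    using i by (simp add: Bochner_Integration.integral_sum)
  also have "\<dots> \<le> (\<Sum>S\<in>Pow V. \<Sum>S'\<in>Pow V. C * E (\<lambda>x. (dF S x)\<^sup>2) * E (\<lambda>x. (dF S' x)\<^sup>2))"
    by (intro sum_mono C dF_pol)
  also have "\<dots> = C * (E Q)\<^sup>2"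
  proof -
    have "(\<Sum>S\<in>Pow V. \<Sum>S'\<in>Pow V. C * a S * a S') = C * (\<Sum>S\<in>Pow V. a S)\<^sup>2" for a :: "'v set \<Rightarrow> real"
      unfolding power2_eq_square sum_product by (simp add: sum_distrib_left mult.assoc)
    then show ?thesis unfolding EQ .
  qed
  also have "\<dots> \<le> C * (2 ^ d * \<sigma>2)\<^sup>2"
    using E_Q C(1) by (intro mult_left_mono power_mono) (auto intro!: integral_nonneg_AE Q_nonneg)
  finally show ?thesis .
qed

text \<open>After exchanging the sums, the diagonal gives the variance and the rest is the
  contraction of F with itself.\<close>

lemma G1_eq: "G1 x = \<sigma>2 + T f (\<lambda>S. xm S x)"
proof -
  have "G1 x = (\<Sum>m\<in>Pow V. \<Sum>m'\<in>{m' \<in> Pow V. m \<subseteq> m'}. f m * (f m' * xm (m' - m) x))"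
    by (simp add: G1_def dF_def sum_distrib_left)
  also have "\<dots> = (\<Sum>m'\<in>Pow V. \<Sum>m\<in>{m \<in> Pow V. m \<subseteq> m'}. f m * (f m' * xm (m' - m) x))"
    by (rule sum.swap_restrict) (use finV in auto)
  also have "\<dots> = (\<Sum>m'\<in>Pow V. (f m')\<^sup>2 + (\<Sum>S\<in>Pow m' - {{}, m'}. f m' * f S * xm (m' - S) x))"
  proof (intro sum.cong refl)
    fix m' assume m': "m' \<in> Pow V"
    then have e: "{S \<in> Pow V. S \<subseteq> m'} = Pow m'" by auto
    have fm: "finite m'" using m' fin_sub by auto
    show "(\<Sum>m\<in>{m \<in> Pow V. m \<subseteq> m'}. f m * (f m' * xm (m' - m) x)) =
       (f m')\<^sup>2 + (\<Sum>S\<in>Pow m' - {{}, m'}. f m' * f S * xm (m' - S) x)"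
    proof (cases "m' = {}")
      case True
      then show ?thesis using e f_empty by simp
    next
      case False
      show ?thesis unfolding e sum_Pow_split[OF fm False]
        by (simp add: f_empty xm_def power2_eq_square mult_ac)
    qed
  qed
  also have "\<dots> = \<sigma>2 + T f (\<lambda>S. xm S x)" by (simp add: sum.distrib \<sigma>2_def T_def)
  finally show ?thesis .
qed

lemma T_linear: "T u w = (\<Sum>\<beta>\<in>Pow V. T u (\<lambda>S. of_bool (S = \<beta>)) * w \<beta>)"
proof -
  have "(\<Sum>\<beta>\<in>Pow V. T u (\<lambda>S. of_bool (S = \<beta>)) * w \<beta>) =
     (\<Sum>\<beta>\<in>Pow V. \<Sum>m\<in>Pow V. \<Sum>S\<in>Pow m - {{}, m}. f m * u S * (of_bool (m - S = \<beta>) * w \<beta>))"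
    by (simp add: T_def sum_distrib_right mult.assoc)
  also have "\<dots> = (\<Sum>m\<in>Pow V. \<Sum>\<beta>\<in>Pow V. \<Sum>S\<in>Pow m - {{}, m}. f m * u S * (of_bool (m - S = \<beta>) * w \<beta>))"
    by (rule sum.swap)
  also have "\<dots> = (\<Sum>m\<in>Pow V. \<Sum>S\<in>Pow m - {{}, m}. \<Sum>\<beta>\<in>Pow V. f m * u S * (of_bool (m - S = \<beta>) * w \<beta>))"
    by (intro sum.cong refl sum.swap)
  also have "\<dots> = T u w" unfolding T_def
  proof (intro sum.cong refl)
    fix m S assume m: "m \<in> Pow V" "S \<in> Pow m - {{}, m}"
    have "(\<Sum>\<beta>\<in>Pow V. f m * u S * (of_bool (m - S = \<beta>) * w \<beta>)) = f m * u S * (\<Sum>\<beta>\<in>Pow V. if m - S = \<beta> then w \<beta> else 0)"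
      unfolding sum_distrib_left by (intro sum.cong refl) auto
    also have "(\<Sum>\<beta>\<in>Pow V. if m - S = \<beta> then w \<beta> else 0) = w (m - S)"
      using finV m by (subst sum.delta') auto
    finally show "(\<Sum>\<beta>\<in>Pow V. f m * u S * (of_bool (m - S = \<beta>) * w \<beta>)) = f m * u S * w (m - S)" .
  qed
  finally show ?thesis by simp
qed

context
  fixes \<epsilon> :: real
  assumes eps: "\<epsilon> \<ge> 0"
    and tb: "\<And>u w. \<bar>T u w\<bar> \<le> \<epsilon> * sqrt (\<Sum>S\<in>Pow V. (u S)\<^sup>2) * sqrt (\<Sum>S\<in>Pow V. (w S)\<^sup>2)"
begin

text \<open>Duality: if b is the coefficient vector of \<open>G1 x - \<sigma>2\<close>, then its
  squared norm equals T f b, and the operator bound forces the norm of b below \<epsilon> times the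
  standard deviation.\<close>

lemma E_G1: "E (\<lambda>x. (G1 x - \<sigma>2)\<^sup>2) \<le> \<epsilon>\<^sup>2 * \<sigma>2"
proof -
  define b where "b \<beta> = T f (\<lambda>S. of_bool (S = \<beta>))" for \<beta>
  define n where "n = (\<Sum>\<beta>\<in>Pow V. (b \<beta>)\<^sup>2)"
  have n0: "n \<ge> 0" unfolding n_def by (intro sum_nonneg) auto
  have s0: "\<sigma>2 \<ge> 0" unfolding \<sigma>2_def by (intro sum_nonneg) auto
  have "E (\<lambda>x. (G1 x - \<sigma>2)\<^sup>2) = E (\<lambda>x. (\<Sum>\<beta>\<in>Pow V. b \<beta> * xm \<beta> x)\<^sup>2)"
    by (simp add: G1_eq T_linear[of f "\<lambda>S. xm S _"] b_def)
  also have "\<dots> = n" unfolding n_def by (rule xm_comb_sq) auto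
  also have "n \<le> \<epsilon>\<^sup>2 * \<sigma>2"
  proof -
    have "n = T f b" unfolding T_linear[of f b] n_def b_def by (simp add: power2_eq_square)
    also have "\<dots> \<le> \<epsilon> * sqrt \<sigma>2 * sqrt n" using tb[of f b] by (simp add: \<sigma>2_def n_def)
    finally have "sqrt n * sqrt n \<le> (\<epsilon> * sqrt \<sigma>2) * sqrt n" using n0 by simp
    then have "sqrt n \<le> \<epsilon> * sqrt \<sigma>2"
      using n0 eps s0 by (cases "n = 0") (simp, metis mult_right_le_imp_le real_sqrt_gt_zero order_le_imp_less_or_eq)
    then have "(sqrt n)\<^sup>2 \<le> (\<epsilon> * sqrt \<sigma>2)\<^sup>2" using n0 by (intro power_mono) auto
    then show ?thesis using n0 s0 by (simp add: power_mult_distrib)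
  qed
  finally show ?thesis .
qed

text \<open>Every factor is dominated by a power of R = 1 + Q^2, since Q, the sum of the squares of
  all derivatives, bounds F^2 as well. The estimate is crude, but R is a polynomial whose moments
  hypercontractivity controls.\<close>

lemma cross_bound: "\<bar>dF {} x ^ i * cross q x\<bar> \<le> \<epsilon> * (2 * (2 ^ d) ^ q) * (1 + (Q x)\<^sup>2) ^ (i + 1 + q)"
proof -
  define R where "R = 1 + (Q x)\<^sup>2"
  have R1: "R \<ge> 1" by (simp add: R_def)
  have QR: "Q x \<le> R" using sum_squares_bound[of "Q x" 1] Q_nonneg[of x] by (simp add: R_def)
  have sq: "sqrt t \<le> 1 + t" if "t \<ge> 0" for t :: real
  proof -
    have "2 * sqrt t * 1 \<le> (sqrt t)\<^sup>2 + 1\<^sup>2" by (rule sum_squares_bound)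
    then show ?thesis using that by simp
  qed
  have sQ: "sqrt (Q x) \<le> R"
  proof -
    have "Q x \<le> R * R" using QR R1 mult_left_mono[of 1 R R] by linarith
    then show ?thesis using R1 by (intro real_le_lsqrt) (auto simp: power2_eq_square)
  qed
  have "\<bar>dF {} x\<bar> \<le> sqrt (Q x)" using F_le_Q[of x] by (metis real_sqrt_abs real_sqrt_le_iff)
  then have F: "\<bar>dF {} x\<bar> ^ i \<le> R ^ i" using sQ by (intro power_mono) auto
  have "sqrt (\<Sum>\<beta>\<in>Pow V. (trunc q \<beta> x)\<^sup>2) \<le> sqrt ((2 ^ d * Q x) ^ q)"
    by (intro real_sqrt_le_mono trunc_bound)
  also have "\<dots> \<le> 1 + (2 ^ d * Q x) ^ q" using Q_nonneg by (intro sq) auto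
  also have "(2 ^ d * Q x) ^ q \<le> (2 ^ d * R) ^ q" using QR Q_nonneg by (intro power_mono mult_left_mono) auto
  also have "(1::real) \<le> (2 ^ d * R) ^ q"
  proof (rule one_le_power)
    have "1 * 1 \<le> 2 ^ d * R" using R1 by (intro mult_mono) auto
    then show "1 \<le> 2 ^ d * R" by simp
  qed
  finally have W: "sqrt (\<Sum>\<beta>\<in>Pow V. (trunc q \<beta> x)\<^sup>2) \<le> 2 * (2 ^ d) ^ q * R ^ q" by (simp add: power_mult_distrib mult_ac)
  have "\<bar>cross q x\<bar> \<le> \<epsilon> * sqrt (Q x) * sqrt (\<Sum>\<beta>\<in>Pow V. (trunc q \<beta> x)\<^sup>2)"
    unfolding cross_trunc Q_def by (rule tb)
  also have "\<dots> \<le> \<epsilon> * R * (2 * (2 ^ d) ^ q * R ^ q)"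
    using sQ W eps R1 Q_nonneg by (intro mult_mono) (auto intro: sum_nonneg)
  finally have "\<bar>dF {} x\<bar> ^ i * \<bar>cross q x\<bar> \<le> R ^ i * (\<epsilon> * R * (2 * (2 ^ d) ^ q * R ^ q))"
    using F R1 by (intro mult_mono) auto
  also have "\<dots> = \<epsilon> * (2 * (2 ^ d) ^ q) * R ^ (i + 1 + q)" by (simp add: power_add mult_ac)
  finally show ?thesis by (simp add: abs_mult power_abs R_def)
qed

text \<open>One part of the error comes from replacing \<open>G1\<close> by the variance, the other
  from the cross terms; both are linear in \<open>\<epsilon>\<close>. The exponents that occur are q
  and q + 1, both covered by the range up to 2q + 1.\<close>

lemma moment_rec:
  assumes C: "\<And>n. n \<le> Suc (2 * q) \<Longrightarrow> E (\<lambda>x. (1 + (Q x)\<^sup>2) ^ n) \<le> C" and B: "\<sigma>2 \<le> B"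
  shows "\<bar>E (\<lambda>x. dF {} x ^ Suc (Suc q)) - real (Suc q) * \<sigma>2 * E (\<lambda>x. dF {} x ^ q)\<bar>
     \<le> \<epsilon> * (real (Suc q) * (sqrt C * sqrt B) + real (Suc q) * (2 * (2 ^ d) ^ q * C))"
proof -
  have s0: "\<sigma>2 \<ge> 0" unfolding \<sigma>2_def by (intro sum_nonneg) auto
  have C0: "C \<ge> 0" using C[of 0] by simp
  have G1p: "G1 \<in> pol UNIV d" unfolding G1_def[abs_def] by (intro pol_sum pol_scale dF_pol)
  have crp: "cross i \<in> pol UNIV (d + i * d)" for i unfolding cross_def[abs_def] T_def
  proof (intro pol_sum)
    fix m S assume "m \<in> Pow V" "S \<in> Pow m - {{}, m}"
    then have "finite (m - S)" using fin_sub by auto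
    from pol_mult[OF pol_scale[OF dF_pol, of "f m"] dpow_pol[OF this]]
    show "(\<lambda>x. f m * dF S x * dpow i (m - S) x) \<in> pol UNIV (d + i * d)" by simp
  qed
  have iG: "integrable P (\<lambda>x. dF {} x ^ q * G1 x)" by (rule pol_integrable_mult[OF pol_power[OF dF_pol] G1p])
  have iC: "integrable P (\<lambda>x. dF {} x ^ j * cross i x)" for i j by (rule pol_integrable_mult[OF pol_power[OF dF_pol] crp])
  have iQ: "integrable P (\<lambda>x. (1 + (Q x)\<^sup>2) ^ n)" for n
    by (rule pol_integrable_power[of _ UNIV "2 * (2 * d)"]) (intro pol_add pol_const pol_power Q_pol)
  have "E (\<lambda>x. dF {} x ^ Suc (Suc q)) = E (\<lambda>x. real (Suc q) * (dF {} x ^ q * G1 x) + (\<Sum>i\<le>q. dF {} x ^ (q - i) * cross i x))"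
    unfolding E_F_power \<Gamma>_eq[abs_def] ..
  also have "\<dots> = real (Suc q) * E (\<lambda>x. dF {} x ^ q * G1 x) + (\<Sum>i\<le>q. E (\<lambda>x. dF {} x ^ (q - i) * cross i x))"
    using iG iC by (simp add: Bochner_Integration.integral_sum del: sum.atMost_Suc)
  finally have 1: "E (\<lambda>x. dF {} x ^ Suc (Suc q)) = real (Suc q) * E (\<lambda>x. dF {} x ^ q * G1 x) + (\<Sum>i\<le>q. E (\<lambda>x. dF {} x ^ (q - i) * cross i x))" .
  have G1s: "(\<lambda>x. G1 x - \<sigma>2) \<in> pol UNIV d" by (intro pol_diff G1p pol_const)
  have "E (\<lambda>x. dF {} x ^ q * G1 x) - \<sigma>2 * E (\<lambda>x. dF {} x ^ q) = E (\<lambda>x. dF {} x ^ q * (G1 x - \<sigma>2))"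
    using iG pol_integrable_power[OF dF_pol] by (simp add: right_diff_distrib mult.commute)
  also have "\<bar>\<dots>\<bar> \<le> sqrt (E (\<lambda>x. (dF {} x ^ q)\<^sup>2)) * sqrt (E (\<lambda>x. (G1 x - \<sigma>2)\<^sup>2))"
    by (rule pol_Cauchy_Schwarz(2)[OF pol_power[OF dF_pol] G1s])
  also have "\<dots> \<le> sqrt C * sqrt (\<epsilon>\<^sup>2 * B)"
  proof (intro mult_mono real_sqrt_le_mono)
    have "E (\<lambda>x. (dF {} x ^ q)\<^sup>2) \<le> E (\<lambda>x. (1 + (Q x)\<^sup>2) ^ q)"
    proof (rule integral_mono)
      show "integrable P (\<lambda>x. (dF {} x ^ q)\<^sup>2)" by (rule pol_integrable_power[OF pol_power[OF dF_pol]])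
      fix x
      have "(dF {} x)\<^sup>2 \<le> 1 + (Q x)\<^sup>2" using F_le_Q[of x] sum_squares_bound[of "Q x" 1] Q_nonneg[of x] by simp
      then have "((dF {} x)\<^sup>2) ^ q \<le> (1 + (Q x)\<^sup>2) ^ q" by (intro power_mono) auto
      then show "(dF {} x ^ q)\<^sup>2 \<le> (1 + (Q x)\<^sup>2) ^ q" by (simp add: power_mult[symmetric] mult.commute)
    qed (rule iQ)
    also have "\<dots> \<le> C" by (rule C) simp
    finally show "E (\<lambda>x. (dF {} x ^ q)\<^sup>2) \<le> C" .
    show "E (\<lambda>x. (G1 x - \<sigma>2)\<^sup>2) \<le> \<epsilon>\<^sup>2 * B"
      using E_G1 mult_left_mono[OF B, of "\<epsilon>\<^sup>2"] by simp
  qed (auto intro!: integral_nonneg_AE C0)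
  also have "\<dots> = \<epsilon> * (sqrt C * sqrt B)" using eps by (simp add: real_sqrt_mult)
  finally have 2: "\<bar>E (\<lambda>x. dF {} x ^ q * G1 x) - \<sigma>2 * E (\<lambda>x. dF {} x ^ q)\<bar> \<le> \<epsilon> * (sqrt C * sqrt B)" .
  have 3: "\<bar>E (\<lambda>x. dF {} x ^ (q - i) * cross i x)\<bar> \<le> \<epsilon> * (2 * (2 ^ d) ^ q * C)" if i: "i \<le> q" for i
  proof -
    have "\<bar>E (\<lambda>x. dF {} x ^ (q - i) * cross i x)\<bar> \<le> E (\<lambda>x. \<bar>dF {} x ^ (q - i) * cross i x\<bar>)"
      by (rule integral_abs_bound)
    also have "\<dots> \<le> E (\<lambda>x. \<epsilon> * (2 * (2 ^ d) ^ i) * (1 + (Q x)\<^sup>2) ^ (q - i + 1 + i))"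
      by (rule integral_mono[OF integrable_abs[OF iC] integrable_mult_right[OF iQ] cross_bound])
    also have "\<dots> = \<epsilon> * (2 * (2 ^ d) ^ i) * E (\<lambda>x. (1 + (Q x)\<^sup>2) ^ (q - i + 1 + i))" by simp
    also have "\<dots> \<le> \<epsilon> * (2 * (2 ^ d) ^ q) * C"
      using eps i C0 by (intro mult_mono mult_left_mono C power_increasing integral_nonneg_AE) auto
    finally show ?thesis by (simp add: mult_ac)
  qed
  have "\<bar>E (\<lambda>x. dF {} x ^ Suc (Suc q)) - real (Suc q) * \<sigma>2 * E (\<lambda>x. dF {} x ^ q)\<bar>
     = \<bar>real (Suc q) * (E (\<lambda>x. dF {} x ^ q * G1 x) - \<sigma>2 * E (\<lambda>x. dF {} x ^ q)) + (\<Sum>i\<le>q. E (\<lambda>x. dF {} x ^ (q - i) * cross i x))\<bar>"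
    unfolding 1 by (simp add: algebra_simps)
  also have "\<dots> \<le> real (Suc q) * \<bar>E (\<lambda>x. dF {} x ^ q * G1 x) - \<sigma>2 * E (\<lambda>x. dF {} x ^ q)\<bar> + (\<Sum>i\<le>q. \<bar>E (\<lambda>x. dF {} x ^ (q - i) * cross i x)\<bar>)"
    by (rule order_trans[OF abs_triangle_ineq add_mono]) (auto simp: abs_mult intro: sum_abs)
  also have "\<dots> \<le> real (Suc q) * (\<epsilon> * (sqrt C * sqrt B)) + (\<Sum>i\<le>q. \<epsilon> * (2 * (2 ^ d) ^ q * C))"
    using 2 3 by (intro add_mono mult_left_mono sum_mono) auto
  also have "\<dots> = \<epsilon> * (real (Suc q) * (sqrt C * sqrt B) + real (Suc q) * (2 * (2 ^ d) ^ q * C))"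
    by (simp add: algebra_simps)
  finally show ?thesis .
qed

end

end

section \<open>Central limit theorem for multilinear forms\<close>

text \<open>The variances may oscillate, so the comparison is with the Gaussian value at the same
  index. Both sides are replaced by Taylor polynomials; at order 2k the Gaussian remainder is of
  size (\<sigma>^2/2)^k / k!, small uniformly in the index, and the other remainder differs from it
  by a moment error.\<close>

lemma (in prob_space) char_of_gaussian_moments:
  fixes X :: "'n \<Rightarrow> 'a \<Rightarrow> real" and \<sigma> :: "'n \<Rightarrow> real"
  assumes int: "\<And>n k. integrable M (\<lambda>x. X n x ^ k)"
    and \<sigma>: "\<And>n. \<sigma> n \<ge> 0" "\<And>n. (\<sigma> n)\<^sup>2 \<le> B"
    and mom: "\<And>k. ((\<lambda>n. expectation (\<lambda>x. X n x ^ k) - \<sigma> n ^ k * (\<integral>y. y ^ k \<partial>std_normal_distribution)) \<longlongrightarrow> 0) F"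
  shows "((\<lambda>n. (\<integral>x. iexp (X n x) \<partial>M) - exp (- (\<sigma> n)\<^sup>2 / 2)) \<longlongrightarrow> 0) F"
proof (rule tendstoI)
  fix r :: real assume r: "r > 0"
  have [measurable]: "X n \<in> borel_measurable M" for n using int[of n 1] by auto
  define \<mu> where "\<mu> k = (\<integral>y. y ^ k \<partial>std_normal_distribution)" for k
  define \<Delta> where "\<Delta> k n = expectation (\<lambda>x. X n x ^ k) - \<sigma> n ^ k * \<mu> k" for k n
  have \<Delta>: "(\<Delta> k \<longlongrightarrow> 0) F" for k using mom[of k] by (simp add: \<Delta>_def[abs_def] \<mu>_def)
  have B0: "B \<ge> 0 \<or> (\<forall>n::'n. False)" using \<sigma>(2) by (meson order_trans zero_le_power2)
  have "(\<lambda>k. inverse (fact k) * (\<bar>B\<bar> / 2) ^ k) \<longlonglongrightarrow> 0"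
    by (rule summable_LIMSEQ_zero[OF summable_exp])
  then have "\<forall>\<^sub>F k in sequentially. inverse (fact k) * (\<bar>B\<bar> / 2) ^ k < r / 8"
    using r by (intro order_tendstoD) auto
  then obtain k where k: "inverse (fact k) * (\<bar>B\<bar> / 2) ^ k < r / 8" by (auto simp: eventually_sequentially)
  \<comment> \<open>An even order, so that the absolute moment in the remainder is an ordinary
    moment.\<close>
  define n0 where "n0 = 2 * k"
  have key: "cmod ((\<integral>x. iexp (X n x) \<partial>M) - exp (- (\<sigma> n)\<^sup>2 / 2)) \<le> (\<Sum>j\<le>n0. \<bar>\<Delta> j n\<bar>) + 2 * \<bar>\<Delta> n0 n\<bar> + r / 2" for n
  proof -
    define s where "s a = (\<Sum>j\<le>n0. ((\<i> * 1) ^ j / fact j) * complex_of_real (a j))" for a :: "nat \<Rightarrow> real"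
    have ev: "\<bar>y\<bar> ^ n0 = y ^ n0" for y :: real unfolding n0_def by (rule power_even_abs) simp
    have \<mu>n: "\<mu> n0 / fact n0 = inverse (2 ^ k * fact k)"
      unfolding \<mu>_def n0_def std_normal_distribution_even_moments(1) by (simp add: field_simps)
    have \<mu>0: "\<mu> n0 \<ge> 0" unfolding \<mu>_def n0_def std_normal_distribution_even_moments(1) by simp
    have sm: "\<sigma> n ^ n0 * \<mu> n0 / fact n0 \<le> r / 8"
    proof -
      have "\<sigma> n ^ n0 * \<mu> n0 / fact n0 = ((\<sigma> n)\<^sup>2) ^ k * inverse (2 ^ k * fact k)"
        using \<mu>n by (simp add: n0_def power_mult[symmetric] times_divide_eq_right[symmetric] del: times_divide_eq_right)
      also have "\<dots> \<le> \<bar>B\<bar> ^ k * inverse (2 ^ k * fact k)"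
        using \<sigma>(2)[of n] by (intro mult_right_mono power_mono) auto
      also have "\<dots> = inverse (fact k) * (\<bar>B\<bar> / 2) ^ k" by (simp add: power_divide field_simps)
      finally show ?thesis using k by linarith
    qed
    have 1: "cmod ((\<integral>x. iexp (X n x) \<partial>M) - s (\<lambda>j. expectation (\<lambda>x. X n x ^ j))) \<le> 2 / fact n0 * expectation (\<lambda>x. X n x ^ n0)"
    proof -
      have "cmod (char (distr M borel (X n)) 1 - (\<Sum>j\<le>n0. ((\<i> * 1) ^ j / fact j) * complex_of_real (expectation (\<lambda>x. X n x ^ j)))) \<le>
        (2 * \<bar>1\<bar> ^ n0 / fact n0) * expectation (\<lambda>x. \<bar>X n x\<bar> ^ n0)"
        using char_approx1'[of n0 "X n" "distr M borel (X n)" 1] int by simp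
      moreover have "char (distr M borel (X n)) 1 = (\<integral>x. iexp (X n x) \<partial>M)"
        unfolding char_def by (subst integral_distr) auto
      ultimately show ?thesis by (simp add: s_def ev)
    qed
    have 2: "cmod (exp (- (\<sigma> n)\<^sup>2 / 2) - s (\<lambda>j. \<sigma> n ^ j * \<mu> j)) \<le> 2 / fact n0 * (\<sigma> n ^ n0 * \<mu> n0)"
    proof -
      have "cmod (char std_normal_distribution (\<sigma> n) - (\<Sum>j\<le>n0. ((\<i> * \<sigma> n) ^ j / fact j) * complex_of_real (\<mu> j))) \<le>
        (2 * \<bar>\<sigma> n\<bar> ^ n0 / fact n0) * (\<integral>y. \<bar>y\<bar> ^ n0 \<partial>std_normal_distribution)"
        using real_distribution.char_approx1[OF real_dist_normal_dist, of n0 "\<sigma> n"] integrable_std_normal_distribution_moment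
        by (simp add: \<mu>_def)
      moreover have "(\<Sum>j\<le>n0. ((\<i> * \<sigma> n) ^ j / fact j) * complex_of_real (\<mu> j)) = s (\<lambda>j. \<sigma> n ^ j * \<mu> j)"
        unfolding s_def by (intro sum.cong refl) (simp add: power_mult_distrib)
      ultimately show ?thesis unfolding char_std_normal_distribution using \<sigma>(1)[of n] by (simp add: ev \<mu>_def[symmetric] mult_ac)
    qed
    have 3: "cmod (s (\<lambda>j. expectation (\<lambda>x. X n x ^ j)) - s (\<lambda>j. \<sigma> n ^ j * \<mu> j)) \<le> (\<Sum>j\<le>n0. \<bar>\<Delta> j n\<bar>)"
    proof -
      have "s (\<lambda>j. expectation (\<lambda>x. X n x ^ j)) - s (\<lambda>j. \<sigma> n ^ j * \<mu> j) = (\<Sum>j\<le>n0. ((\<i> * 1) ^ j / fact j) * complex_of_real (\<Delta> j n))"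
        unfolding s_def \<Delta>_def sum_subtractf[symmetric] by (intro sum.cong refl) (simp add: algebra_simps)
      also have "cmod \<dots> \<le> (\<Sum>j\<le>n0. \<bar>\<Delta> j n\<bar>)"
      proof (rule order_trans[OF norm_sum sum_mono])
        fix j
        have "cmod (((\<i> * 1) ^ j / fact j) * complex_of_real (\<Delta> j n)) = \<bar>\<Delta> j n\<bar> / fact j"
          by (simp add: norm_mult norm_divide norm_power)
        also have "\<dots> \<le> \<bar>\<Delta> j n\<bar> / 1" by (intro divide_left_mono) (auto simp: fact_ge_1)
        finally show "cmod (((\<i> * 1) ^ j / fact j) * complex_of_real (\<Delta> j n)) \<le> \<bar>\<Delta> j n\<bar>" by simp
      qed
      finally show ?thesis .
    qed
    have 4: "2 / fact n0 * expectation (\<lambda>x. X n x ^ n0) \<le> 2 / fact n0 * (\<sigma> n ^ n0 * \<mu> n0) + 2 * \<bar>\<Delta> n0 n\<bar>"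
    proof -
      have "2 / fact n0 * expectation (\<lambda>x. X n x ^ n0) = 2 / fact n0 * (\<sigma> n ^ n0 * \<mu> n0) + 2 / fact n0 * \<Delta> n0 n"
        by (simp add: \<Delta>_def algebra_simps)
      also have "2 / fact n0 * \<Delta> n0 n \<le> 2 / fact n0 * \<bar>\<Delta> n0 n\<bar>" by (intro mult_left_mono) auto
      also have "\<dots> \<le> 2 * \<bar>\<Delta> n0 n\<bar>" by (intro mult_right_mono) (auto simp: field_simps fact_ge_1)
      finally show ?thesis by simp
    qed
    have "2 / fact n0 * (\<sigma> n ^ n0 * \<mu> n0) \<le> r / 4" using sm by (simp add: field_simps)
    moreover have "cmod ((\<integral>x. iexp (X n x) \<partial>M) - exp (- (\<sigma> n)\<^sup>2 / 2)) \<le>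
       cmod ((\<integral>x. iexp (X n x) \<partial>M) - s (\<lambda>j. expectation (\<lambda>x. X n x ^ j))) +
       cmod (s (\<lambda>j. expectation (\<lambda>x. X n x ^ j)) - s (\<lambda>j. \<sigma> n ^ j * \<mu> j)) +
       cmod (exp (- (\<sigma> n)\<^sup>2 / 2) - s (\<lambda>j. \<sigma> n ^ j * \<mu> j))"
      by norm
    ultimately show ?thesis using 1 2 3 4 by linarith
  qed
  have "((\<lambda>n. (\<Sum>j\<le>n0. \<bar>\<Delta> j n\<bar>) + 2 * \<bar>\<Delta> n0 n\<bar> + r / 2) \<longlongrightarrow> (\<Sum>j\<le>n0. \<bar>0::real\<bar>) + 2 * \<bar>0\<bar> + r / 2) F"
    by (intro tendsto_intros \<Delta>)
  then have "((\<lambda>n. (\<Sum>j\<le>n0. \<bar>\<Delta> j n\<bar>) + 2 * \<bar>\<Delta> n0 n\<bar> + r / 2) \<longlongrightarrow> r / 2) F" by simp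
  then have "\<forall>\<^sub>F n in F. (\<Sum>j\<le>n0. \<bar>\<Delta> j n\<bar>) + 2 * \<bar>\<Delta> n0 n\<bar> + r / 2 < r"
    by (rule order_tendstoD(2)) (use r in simp)
  then show "\<forall>\<^sub>F n in F. dist ((\<integral>x. iexp (X n x) \<partial>M) - exp (- (\<sigma> n)\<^sup>2 / 2)) 0 < r"
    by eventually_elim (use key in \<open>auto simp: dist_norm intro: le_less_trans\<close>)
qed

section \<open>Influences and the Lindeberg replacement\<close>

definition infl :: "('j \<Rightarrow> nat set) \<Rightarrow> (('j \<times> nat) set \<Rightarrow> real) \<Rightarrow> 'j set \<Rightarrow> 'j \<Rightarrow> real" where
  "infl \<Lambda> f S j = (\<Sum>m\<in>Kset \<Lambda> S. if j \<in> fst ` m then (f m)\<^sup>2 else 0)"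

context prodspace begin

lemma integrable_iexp_mult:
  assumes [measurable]: "A \<in> borel_measurable P" and B: "integrable P B"
  shows "integrable P (\<lambda>x. iexp (A x) * complex_of_real (B x))"
proof (rule Bochner_Integration.integrable_bound[OF B])
  have [measurable]: "B \<in> borel_measurable P" using B by auto
  show "(\<lambda>x. iexp (A x) * complex_of_real (B x)) \<in> borel_measurable P" by measurable
qed (auto simp: norm_mult)

lemma integrable_iexp:
  assumes [measurable]: "A \<in> borel_measurable P"
  shows "integrable P (\<lambda>x. iexp (A x))"
  using integrable_iexp_mult[OF assms, of "\<lambda>_. 1"] by simp

end

context ensemble begin

text \<open>Second-order Taylor expansion in the contribution R of block \<open>j\<close>. The
  linear term vanishes because the block is centred and independent of the rest, and orthonormality
  determines the quadratic one. The approximating value thus ignores the law of block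
  \<open>j\<close>, and two ensembles that differ only there can be compared through it.\<close>

lemma lindeberg_local:
  fixes f :: "('j \<times> nat) set \<Rightarrow> real"
  assumes S: "finite S" and j: "j \<notin> S"
  defines "Al \<equiv> \<lambda>l. ml (\<lambda>m. f (insert (j, l) m)) S"
  defines "R \<equiv> \<lambda>x. ml f (insert j S) x - ml f S x"
  shows "cmod (E (\<lambda>x. iexp (ml f (insert j S) x)) -
      (E (\<lambda>x. iexp (ml f S x)) - (1/2) * (\<Sum>l\<in>\<Lambda> j. E (\<lambda>x. iexp (ml f S x) * complex_of_real ((Al l x)\<^sup>2)))))
     \<le> E (\<lambda>x. \<bar>R x\<bar> ^ 3) / 6"
proof -
  let ?U = "\<Union> (Blk ` S)"
  define A where "A = ml f S"
  have dj: "Blk j \<inter> ?U = {}" using j by (rule Blk_Un_disj)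
  obtain ka where A: "A \<in> pol ?U ka" using ml_pol[OF S] unfolding A_def by blast
  have "\<forall>l. \<exists>k. Al l \<in> pol ?U k" using ml_pol[OF S] unfolding Al_def by blast
  then obtain kk where kk: "\<And>l. Al l \<in> pol ?U (kk l)" by metis
  have Req: "R x = (\<Sum>l\<in>\<Lambda> j. \<zeta> (j, l) x * Al l x)" for x by (simp add: R_def Al_def ml_insert[OF S j])
  obtain kr where F: "ml f (insert j S) \<in> pol UNIV kr" using ml_pol[of "insert j S" f] S pol_UNIV_I by blast
  have Rp: "R \<in> pol UNIV (max kr ka)" unfolding R_def A_def[symmetric]
    by (intro pol_diff pol_mono[OF F] pol_mono[OF A]) auto
  have [measurable]: "A \<in> borel_measurable P" "R \<in> borel_measurable P" "\<And>l. Al l \<in> borel_measurable P"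
    using A Rp kk by (auto intro: pol_meas)
  have z[measurable]: "\<zeta> (j, l) \<in> borel_measurable P" if "l \<in> \<Lambda> j" for l using pol_meas[OF \<zeta>_pol[OF that]] .
  have dA: "dep ?U (\<lambda>x. iexp (A x) * complex_of_real (B x))" if "B \<in> pol ?U k" for B k
    using pol_imp_dep[OF A] pol_imp_dep[OF that] unfolding dep_def by metis
  have dz: "dep (Blk j) (\<lambda>x. complex_of_real (B x))" if "B \<in> pol (Blk j) k" for B k
    using pol_imp_dep[OF that] unfolding dep_def by metis
  have fc: "E (\<lambda>x. complex_of_real (Z x) * (iexp (A x) * complex_of_real (B x))) = complex_of_real (E Z) * E (\<lambda>x. iexp (A x) * complex_of_real (B x))"
     "integrable P (\<lambda>x. complex_of_real (Z x) * (iexp (A x) * complex_of_real (B x)))"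
    if Z: "Z \<in> pol (Blk j) k" and B: "B \<in> pol ?U k'" for Z B k k'
  proof -
    have i: "integrable P (\<lambda>x. complex_of_real (Z x))" "integrable P (\<lambda>x. iexp (A x) * complex_of_real (B x))"
      using pol_integrable[OF Z] integrable_iexp_mult[OF _ pol_integrable[OF B]] by auto
    from fac[OF dz[OF Z] dA[OF B] dj i]
    show "E (\<lambda>x. complex_of_real (Z x) * (iexp (A x) * complex_of_real (B x))) = complex_of_real (E Z) * E (\<lambda>x. iexp (A x) * complex_of_real (B x))"
     "integrable P (\<lambda>x. complex_of_real (Z x) * (iexp (A x) * complex_of_real (B x)))" by auto
  qed
  have iR: "integrable P (\<lambda>x. iexp (A x) * complex_of_real (R x ^ n))" for n
    by (intro integrable_iexp_mult pol_integrable_power[OF Rp]) simp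
  have 1: "E (\<lambda>x. iexp (A x) * complex_of_real (R x)) = 0"
  proof -
    have "E (\<lambda>x. iexp (A x) * complex_of_real (R x)) = E (\<lambda>x. \<Sum>l\<in>\<Lambda> j. complex_of_real (\<zeta> (j, l) x) * (iexp (A x) * complex_of_real (Al l x)))"
      by (simp add: Req sum_distrib_left mult_ac)
    also have "\<dots> = (\<Sum>l\<in>\<Lambda> j. E (\<lambda>x. complex_of_real (\<zeta> (j, l) x) * (iexp (A x) * complex_of_real (Al l x))))"
      by (rule Bochner_Integration.integral_sum) (rule fc(2)[OF \<zeta>_pol kk])
    also have "\<dots> = 0"
      by (intro sum.neutral ballI) (subst fc(1)[OF \<zeta>_pol kk], auto simp: \<zeta>_mean)
    finally show ?thesis .
  qed
  have 2: "E (\<lambda>x. iexp (A x) * complex_of_real ((R x)\<^sup>2)) = (\<Sum>l\<in>\<Lambda> j. E (\<lambda>x. iexp (A x) * complex_of_real ((Al l x)\<^sup>2)))"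
  proof -
    have "E (\<lambda>x. iexp (A x) * complex_of_real ((R x)\<^sup>2)) =
       E (\<lambda>x. \<Sum>l\<in>\<Lambda> j. \<Sum>l'\<in>\<Lambda> j. complex_of_real (\<zeta> (j, l) x * \<zeta> (j, l') x) * (iexp (A x) * complex_of_real (Al l x * Al l' x)))"
      by (simp add: Req power2_eq_square sum_product sum_distrib_left mult_ac)
    also have "\<dots> = (\<Sum>l\<in>\<Lambda> j. \<Sum>l'\<in>\<Lambda> j. E (\<lambda>x. complex_of_real (\<zeta> (j, l) x * \<zeta> (j, l') x) * (iexp (A x) * complex_of_real (Al l x * Al l' x))))"
      by (subst Bochner_Integration.integral_sum Bochner_Integration.integral_sum,
          intro Bochner_Integration.integrable_sum fc(2)[OF pol_mult[OF \<zeta>_pol \<zeta>_pol] pol_mult[OF kk kk]]; (assumption)?)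
         (intro sum.cong refl Bochner_Integration.integral_sum fc(2)[OF pol_mult[OF \<zeta>_pol \<zeta>_pol] pol_mult[OF kk kk]]; assumption)
    also have "\<dots> = (\<Sum>l\<in>\<Lambda> j. \<Sum>l'\<in>\<Lambda> j. if l' = l then E (\<lambda>x. iexp (A x) * complex_of_real (Al l x * Al l' x)) else 0)"
      by (intro sum.cong refl, subst fc(1)[OF pol_mult[OF \<zeta>_pol \<zeta>_pol] pol_mult[OF kk kk]]) (auto simp: \<zeta>_orth)
    also have "\<dots> = (\<Sum>l\<in>\<Lambda> j. E (\<lambda>x. iexp (A x) * complex_of_real ((Al l x)\<^sup>2)))"
      using fin_\<Lambda>[of j] by (simp add: sum.delta power2_eq_square)
    finally show ?thesis .
  qed
  have ap: "cmod (iexp y - (1 + \<i> * y - (y\<^sup>2) / 2)) \<le> \<bar>y\<bar> ^ 3 / 6" for y :: real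
  proof -
    have "(\<Sum>k\<le>2. (\<i> * y) ^ k / fact k) = 1 + \<i> * y - (y\<^sup>2) / 2"
      by (simp add: numeral_2_eq_2 power_mult_distrib)
    then show ?thesis using iexp_approx1[of y 2] by (simp add: numeral_3_eq_3 fact_numeral)
  qed
  have int1: "integrable P (\<lambda>x. iexp (ml f (insert j S) x))" "integrable P (\<lambda>x. iexp (A x))"
    using integrable_iexp[OF pol_meas[OF F]] integrable_iexp[OF pol_meas[OF A]] by auto
  have int2: "integrable P (\<lambda>x. iexp (A x) * (1 + \<i> * R x - (R x)\<^sup>2 / 2))"
  proof -
    have "integrable P (\<lambda>x. iexp (A x) + \<i> * (iexp (A x) * complex_of_real (R x ^ 1)) - (1/2) * (iexp (A x) * complex_of_real (R x ^ 2)))"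
      by (intro Bochner_Integration.integrable_diff Bochner_Integration.integrable_add integrable_mult_right iR int1)
    then show ?thesis by (simp add: algebra_simps)
  qed
  have "E (\<lambda>x. iexp (A x) * (1 + \<i> * R x - (R x)\<^sup>2 / 2)) =
     E (\<lambda>x. iexp (A x) + \<i> * (iexp (A x) * complex_of_real (R x)) - (1/2) * (iexp (A x) * complex_of_real ((R x)\<^sup>2)))"
    by (intro Bochner_Integration.integral_cong refl) (simp add: algebra_simps)
  also have "\<dots> = E (\<lambda>x. iexp (A x)) - (1/2) * (\<Sum>l\<in>\<Lambda> j. E (\<lambda>x. iexp (A x) * complex_of_real ((Al l x)\<^sup>2)))"
  proof -
    have ib: "integrable P (\<lambda>x. iexp (A x) * complex_of_real (R x))" using iR[of 1] by simp
    show ?thesis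
      by (simp only: Bochner_Integration.integral_diff Bochner_Integration.integral_add integral_mult_right_zero
          Bochner_Integration.integrable_add integrable_mult_right int1 ib iR[of 2] 1 2) simp
  qed
  finally have eq: "E (\<lambda>x. iexp (ml f (insert j S) x)) -
      (E (\<lambda>x. iexp (A x)) - (1/2) * (\<Sum>l\<in>\<Lambda> j. E (\<lambda>x. iexp (A x) * complex_of_real ((Al l x)\<^sup>2))))
     = E (\<lambda>x. iexp (ml f (insert j S) x) - iexp (A x) * (1 + \<i> * R x - (R x)\<^sup>2 / 2))"
    using int1 int2 by simp
  have "cmod (E (\<lambda>x. iexp (ml f (insert j S) x) - iexp (A x) * (1 + \<i> * R x - (R x)\<^sup>2 / 2))) \<le> E (\<lambda>x. cmod (iexp (ml f (insert j S) x) - iexp (A x) * (1 + \<i> * R x - (R x)\<^sup>2 / 2)))"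
    by (rule integral_norm_bound)
  also have "\<dots> \<le> E (\<lambda>x. \<bar>R x\<bar> ^ 3 / 6)"
  proof (rule integral_mono)
    show "integrable P (\<lambda>x. cmod (iexp (ml f (insert j S) x) - iexp (A x) * (1 + \<i> * R x - (R x)\<^sup>2 / 2)))"
      using int1 int2 by (intro integrable_norm Bochner_Integration.integrable_diff)
    show "integrable P (\<lambda>x. \<bar>R x\<bar> ^ 3 / 6)"
      using integrable_abs[OF pol_integrable_power[OF Rp, of 3]] by (simp add: power_abs)
    fix x
    have "ml f (insert j S) x = A x + R x" by (simp add: A_def R_def)
    then have "iexp (ml f (insert j S) x) = iexp (A x) * iexp (R x)" by (simp add: exp_add[symmetric] algebra_simps)
    then have "iexp (ml f (insert j S) x) - iexp (A x) * (1 + \<i> * R x - (R x)\<^sup>2 / 2) = iexp (A x) * (iexp (R x) - (1 + \<i> * R x - (R x)\<^sup>2 / 2))"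
      by (simp add: algebra_simps)
    then show "cmod (iexp (ml f (insert j S) x) - iexp (A x) * (1 + \<i> * R x - (R x)\<^sup>2 / 2)) \<le> \<bar>R x\<bar> ^ 3 / 6"
      using ap[of "R x"] by (simp add: norm_mult)
  qed
  finally show ?thesis unfolding A_def[symmetric] eq by simp
qed

text \<open>The difference is the part of the form whose index sets use \<open>j\<close>, so its
  second moment is the influence of \<open>j\<close>; Cauchy-Schwarz and hypercontractivity then
  give the third moment from the second and the fourth.\<close>

lemma third_moment:
  assumes S: "finite S" and j: "j \<notin> S" and f: "\<And>m. f m \<noteq> 0 \<Longrightarrow> card m \<le> d"
    and B: "B \<ge> 4" "B\<^sup>2 \<ge> 3 * \<kappa> * real w ^ 3"
  shows "E (\<lambda>x. \<bar>ml f (insert j S) x - ml f S x\<bar> ^ 3) \<le> sqrt (infl \<Lambda> f (insert j S) j) * (B ^ d * infl \<Lambda> f (insert j S) j)"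
proof -
  define g where "g m = (if j \<in> fst ` m then f m else 0)" for m
  define I where "I = infl \<Lambda> f (insert j S) j"
  have I0: "I \<ge> 0" unfolding I_def infl_def by (intro sum_nonneg) auto
  have fin: "finite (insert j S)" using S by simp
  have "ml g S x = 0" for x unfolding ml_def by (intro sum.neutral) (use j in \<open>auto simp: g_def Kset_def\<close>)
  moreover have "ml (\<lambda>m. g (insert (j, l) m)) S = ml (\<lambda>m. f (insert (j, l) m)) S" for l
    by (simp add: g_def)
  ultimately have R: "ml f (insert j S) x - ml f S x = ml g (insert j S) x" for x
    by (simp add: ml_insert[OF S j])
  obtain k where p: "ml g (insert j S) \<in> pol UNIV k" using ml_pol[OF fin, of g] pol_UNIV_I by blast
  have [measurable]: "ml g (insert j S) \<in> borel_measurable P" using pol_meas[OF p] .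
  have "infl \<Lambda> f (insert j S) j = (\<Sum>m\<in>Kset \<Lambda> (insert j S). g m * g m)"
    unfolding infl_def by (intro sum.cong refl) (simp add: g_def power2_eq_square)
  then have 2: "E (\<lambda>x. (ml g (insert j S) x)\<^sup>2) = I"
    using ml_inner[OF fin, of g g] by (simp add: power2_eq_square I_def)
  have "E (\<lambda>x. ml g (insert j S) x ^ 4) \<le> (\<Sum>m\<in>Kset \<Lambda> (insert j S). B ^ card m * (g m)\<^sup>2)\<^sup>2"
    by (rule ml_hyper4[OF B fin])
  also have "\<dots> \<le> (B ^ d * I)\<^sup>2"
  proof (intro power_mono sum_nonneg)
    have "(\<Sum>m\<in>Kset \<Lambda> (insert j S). B ^ card m * (g m)\<^sup>2) \<le> (\<Sum>m\<in>Kset \<Lambda> (insert j S). B ^ d * (g m)\<^sup>2)"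
    proof (rule sum_mono)
      fix m
      show "B ^ card m * (g m)\<^sup>2 \<le> B ^ d * (g m)\<^sup>2"
        using f[of m] B(1) by (cases "g m = 0") (auto simp: g_def intro!: mult_right_mono power_increasing split: if_splits)
    qed
    also have "\<dots> = B ^ d * I" unfolding I_def infl_def sum_distrib_left by (intro sum.cong refl) (simp add: g_def)
    finally show "(\<Sum>m\<in>Kset \<Lambda> (insert j S). B ^ card m * (g m)\<^sup>2) \<le> B ^ d * I" .
  qed (use B(1) in auto)
  finally have 4: "E (\<lambda>x. ml g (insert j S) x ^ 4) \<le> (B ^ d * I)\<^sup>2" .
  have "(E (\<lambda>x. \<bar>ml g (insert j S) x\<bar> * (ml g (insert j S) x)\<^sup>2))\<^sup>2 \<le> E (\<lambda>x. (\<bar>ml g (insert j S) x\<bar>)\<^sup>2) * E (\<lambda>x. ((ml g (insert j S) x)\<^sup>2)\<^sup>2)"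
    using pol_integrable_power[OF p] pol_integrable_power[OF p, of 4] by (intro integral_Cauchy_Schwarz(1)) (auto simp: power_mult[symmetric])
  also have "\<dots> = I * E (\<lambda>x. ml g (insert j S) x ^ 4)" using 2 by (simp add: power_mult[symmetric])
  also have "\<dots> \<le> I * (B ^ d * I)\<^sup>2" using I0 4 by (intro mult_left_mono)
  also have "\<dots> = (sqrt I * (B ^ d * I))\<^sup>2" using I0 by (simp add: power_mult_distrib)
  finally have "E (\<lambda>x. \<bar>ml g (insert j S) x\<bar> * (ml g (insert j S) x)\<^sup>2) \<le> sqrt I * (B ^ d * I)"
    by (rule power2_le_imp_le) (use I0 B(1) in auto)
  moreover have "\<bar>y\<bar> ^ 3 = \<bar>y\<bar> * y\<^sup>2" for y :: real by (simp add: power3_eq_cube power2_eq_square abs_mult)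
  ultimately show ?thesis unfolding R I_def by simp
qed

end

text \<open>The space carrying both the original variables and the Gaussian variables replacing them.\<close>

definition DD :: "real measure \<Rightarrow> 'j + 'j \<times> nat \<Rightarrow> real measure" where
  "DD \<mu> = case_sum (\<lambda>_. \<mu>) (\<lambda>_. std_normal_distribution)"

text \<open>Blocks in \<open>R\<close> use one independent Gaussian coordinate for each pair (j, l),
  the others keep the orthonormal polynomials of the original variable; \<open>R\<close> grows from
  the empty set to all blocks.\<close>

definition zR :: "(nat \<Rightarrow> real poly) \<Rightarrow> 'j set \<Rightarrow> 'j \<times> nat \<Rightarrow> ('j + 'j \<times> nat \<Rightarrow> real) \<Rightarrow> real" where
  "zR e R v x = (if fst v \<in> R then x (Inr v) else poly (e (snd v)) (x (Inl (fst v))))"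

definition blkR :: "'j \<Rightarrow> ('j + 'j \<times> nat) set" where
  "blkR j = insert (Inl j) (Inr ` ({j} \<times> UNIV))"

locale iidlaw =
  fixes \<mu> :: "real measure" and e :: "nat \<Rightarrow> real poly" and \<Lambda> :: "nat set" and L :: nat and \<kappa> :: real
  assumes onbsp: "onbspace (\<lambda>_::nat. \<mu>) (\<lambda>_. e) (\<lambda>_. \<Lambda>) L \<kappa>"
begin

sublocale X: onbspace "\<lambda>_::nat. \<mu>" "\<lambda>_. e" "\<lambda>_. \<Lambda>" L \<kappa> by (rule onbsp)

lemma prodspace_DD: "prodspace (DD \<mu> :: nat + nat \<times> nat \<Rightarrow> real measure)"
proof (rule prodspace.intro)
  fix i :: "nat + nat \<times> nat"
  show "prob_space (DD \<mu> i)"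
    using X.prob_D real_distribution.axioms(1)[OF real_dist_normal_dist] by (cases i) (auto simp: DD_def)
  show "sets (DD \<mu> i) = sets borel"
    using X.sets_D by (cases i) (auto simp: DD_def)
  fix k :: nat
  show "integrable (DD \<mu> i) (\<lambda>x. x ^ k)"
    using X.moments_D integrable_std_normal_distribution_moment by (cases i) (auto simp: DD_def)
qed

sublocale Z: prodspace "DD \<mu> :: nat + nat \<times> nat \<Rightarrow> real measure"
  by (rule prodspace_DD)

lemma fin_range_DD: "finite (range (DD \<mu> :: nat + nat \<times> nat \<Rightarrow> real measure))"
  by (rule finite_subset[of _ "{\<mu>, std_normal_distribution}"]) (auto simp: DD_def split: sum.splits)

text \<open>\<open>max L 1\<close> makes room for the degree 1 of a Gaussian coordinate and
  \<open>max \<kappa> 3\<close> for its fourth moment.\<close>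

lemma ensemble_zR: "ensemble (DD \<mu>) blkR (zR e R) (\<lambda>_::nat. \<Lambda>) (max L 1) (max \<kappa> 3)"
proof
  have mom: "(\<integral>y. y ^ 1 \<partial>std_normal_distribution) = 0" "(\<integral>y. y ^ 2 \<partial>std_normal_distribution) = 1"
     "(\<integral>y. y ^ 4 \<partial>std_normal_distribution) = 3"
    using integral_std_normal_distribution_moment_odd[of 1] std_normal_distribution_even_moments(1)[of 1]
      std_normal_distribution_even_moments(1)[of 2] by (auto simp: fact_numeral)
  have g: "Z.E (\<lambda>x. x (Inr v) ^ k) = (\<integral>y. y ^ k \<partial>std_normal_distribution)" for v k
    using Z.E_coord(1)[of "\<lambda>y. y ^ k" "Inr v"] by (simp add: DD_def)
  have p: "Z.E (\<lambda>x. h (x (Inl j))) = X.E (\<lambda>x. h (x j))" if "h \<in> borel_measurable borel" for h :: "real \<Rightarrow> real" and j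
    using Z.E_coord(1)[OF that, of "Inl j"] X.E_coord(1)[OF that, of j] by (simp add: DD_def)
  show "finite \<Lambda>" using X.fin_\<Lambda> .
  show "card \<Lambda> \<le> max L 1" using X.card_\<Lambda> by simp
  show "blkR j \<inter> blkR j' = {}" if "j \<noteq> j'" for j j' :: nat using that by (auto simp: blkR_def)
  fix j :: nat and l assume l: "l \<in> \<Lambda>"
  have "degree (e l) \<le> max L 1" using X.e_deg[of l] X.\<Lambda>_sub l by force
  then show "zR e R (j, l) \<in> pol (blkR j) (max L 1)"
    unfolding zR_def[abs_def] by (cases "j \<in> R") (auto simp: blkR_def intro!: pol_coord pol_poly)
  show "Z.E (zR e R (j, l)) = 0"
    unfolding zR_def[abs_def] using g[of "(j, l)" 1] mom p[of "poly (e l)" j] X.\<zeta>_mean[OF l, of j]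
    by (cases "j \<in> R") (auto simp: X.xi_def[abs_def])
  show "Z.E (\<lambda>x. zR e R (j, l) x ^ 4) \<le> max \<kappa> 3"
    unfolding zR_def[abs_def] using g[of "(j, l)" 4] mom p[of "\<lambda>y. poly (e l) y ^ 4" j] X.\<zeta>_4[OF l, of j]
    by (cases "j \<in> R") (auto simp: X.xi_def[abs_def])
  fix l' assume l': "l' \<in> \<Lambda>"
  show "Z.E (\<lambda>x. zR e R (j, l) x * zR e R (j, l') x) = of_bool (l = l')"
  proof (cases "j \<in> R")
    case False
    then show ?thesis unfolding zR_def[abs_def] using p[of "\<lambda>y. poly (e l) y * poly (e l') y" j] X.\<zeta>_orth[OF l l', of j]
      by (auto simp: X.xi_def[abs_def])
  next
    case True
    show ?thesis
    proof (cases "l = l'")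
      case True
      then show ?thesis using \<open>j \<in> R\<close> g[of "(j, l)" 2] mom by (simp add: zR_def power2_eq_square)
    next
      case False
      have "Z.E (\<lambda>x. x (Inr (j, l)) * x (Inr (j, l'))) = Z.E (\<lambda>x. x (Inr (j, l))) * Z.E (\<lambda>x. x (Inr (j, l')))"
        by (rule Z.fac_pol[OF pol_coord[of _ "{Inr (j, l)}" 1] pol_coord[of _ "{Inr (j, l')}" 1]]) (use False in auto)
      then show ?thesis using \<open>j \<in> R\<close> g[of "(j, l)" 1] mom False by (simp add: zR_def)
    qed
  qed
qed

definition FR :: "(('j \<times> nat) set \<Rightarrow> real) \<Rightarrow> 'j set \<Rightarrow> 'j set \<Rightarrow> ('j + 'j \<times> nat \<Rightarrow> real) \<Rightarrow> real" where
  "FR f S R x = (\<Sum>m\<in>Kset (\<lambda>_. \<Lambda>) S. f m * mprod (zR e R) m x)"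

lemma FR_cong: "(\<And>j. j \<in> S \<Longrightarrow> (j \<in> R) = (j \<in> R')) \<Longrightarrow> FR f S R = FR f S R'"
  unfolding FR_def[abs_def]
proof (intro ext sum.cong refl arg_cong2[where f = "(*)"])
  fix x m assume "\<And>j. j \<in> S \<Longrightarrow> (j \<in> R) = (j \<in> R')" "m \<in> Kset (\<lambda>_. \<Lambda>) S"
  then show "mprod (zR e R) m x = mprod (zR e R') m x"
    unfolding mprod_def by (intro prod.cong refl) (auto simp: zR_def Kset_def)
qed

text \<open>Blocks are exchanged one at a time; each exchange costs the local error twice, hence 1/3
  in place of 1/6.\<close>

lemma lindeberg:
  assumes f: "\<And>m. f m \<noteq> 0 \<Longrightarrow> card m \<le> d"
    and B: "B \<ge> 4" "B\<^sup>2 \<ge> 3 * max \<kappa> 3 * real (max L 1) ^ 3" and S: "finite S" and R: "R \<subseteq> S"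
  shows "cmod (Z.E (\<lambda>x. iexp (FR f S R x)) - Z.E (\<lambda>x. iexp (FR f S {} x)))
     \<le> (\<Sum>j\<in>R. sqrt (infl (\<lambda>_::nat. \<Lambda>) f S j) * (B ^ d * infl (\<lambda>_. \<Lambda>) f S j) / 3)"
proof -
  have "finite R" using R S finite_subset by auto
  then show ?thesis using R
  proof (induction rule: finite_induct)
    case empty
    then show ?case by simp
  next
    case (insert j R)
    interpret E1: ensemble "DD \<mu>" blkR "zR e R" "\<lambda>_::nat. \<Lambda>" "max L 1" "max \<kappa> 3" by (rule ensemble_zR)
    interpret E2: ensemble "DD \<mu>" blkR "zR e (insert j R)" "\<lambda>_::nat. \<Lambda>" "max L 1" "max \<kappa> 3" by (rule ensemble_zR)
    define S' where "S' = S - {j}"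
    have S': "finite S'" "j \<notin> S'" "insert j S' = S" using S insert.prems by (auto simp: S'_def)
    have m1: "E1.ml g T = FR g T R" and m2: "E2.ml g T = FR g T (insert j R)" for g T
      by (auto simp: fun_eq_iff E1.ml_def E2.ml_def FR_def)
    \<comment> \<open>Away from block \<open>j\<close> both ensembles give the same form, hence
      share the intermediate value \<open>Zv\<close>.\<close>
    have eq: "FR g S' (insert j R) = FR g S' R" for g
      by (rule FR_cong) (use S' in auto)
    define I where "I = infl (\<lambda>_. \<Lambda>) f S j"
    define Zv where "Zv = Z.E (\<lambda>x. iexp (FR f S' R x)) - (1/2) * (\<Sum>l\<in>\<Lambda>. Z.E (\<lambda>x. iexp (FR f S' R x) * complex_of_real ((FR (\<lambda>m. f (insert (j, l) m)) S' R x)\<^sup>2)))"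
    have "cmod (Z.E (\<lambda>x. iexp (FR f S R x)) - Zv) \<le> Z.E (\<lambda>x. \<bar>FR f S R x - FR f S' R x\<bar> ^ 3) / 6"
      using E1.lindeberg_local[OF S'(1,2), of f] unfolding m1 S'(3) Zv_def .
    also have "\<dots> \<le> sqrt I * (B ^ d * I) / 6"
      using E1.third_moment[OF S'(1,2) f B] unfolding m1 S'(3) I_def by simp
    finally have 1: "cmod (Z.E (\<lambda>x. iexp (FR f S R x)) - Zv) \<le> sqrt I * (B ^ d * I) / 6" .
    have "cmod (Z.E (\<lambda>x. iexp (FR f S (insert j R) x)) - Zv) \<le> Z.E (\<lambda>x. \<bar>FR f S (insert j R) x - FR f S' (insert j R) x\<bar> ^ 3) / 6"
      using E2.lindeberg_local[OF S'(1,2), of f] unfolding m2 S'(3) eq Zv_def .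
    also have "\<dots> \<le> sqrt I * (B ^ d * I) / 6"
      using E2.third_moment[OF S'(1,2) f B] unfolding m2 S'(3) I_def by simp
    finally have 2: "cmod (Z.E (\<lambda>x. iexp (FR f S (insert j R) x)) - Zv) \<le> sqrt I * (B ^ d * I) / 6" .
    have 3: "cmod (Z.E (\<lambda>x. iexp (FR f S R x)) - Z.E (\<lambda>x. iexp (FR f S {} x)))
     \<le> (\<Sum>j\<in>R. sqrt (infl (\<lambda>_::nat. \<Lambda>) f S j) * (B ^ d * infl (\<lambda>_. \<Lambda>) f S j) / 3)"
      using insert by auto
    have "cmod (Z.E (\<lambda>x. iexp (FR f S (insert j R) x)) - Z.E (\<lambda>x. iexp (FR f S {} x))) \<le>
       cmod (Z.E (\<lambda>x. iexp (FR f S (insert j R) x)) - Zv) + cmod (Z.E (\<lambda>x. iexp (FR f S R x)) - Zv) +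
       cmod (Z.E (\<lambda>x. iexp (FR f S R x)) - Z.E (\<lambda>x. iexp (FR f S {} x)))"
      by norm
    also have "\<dots> \<le> sqrt I * (B ^ d * I) / 3 + (\<Sum>j\<in>R. sqrt (infl (\<lambda>_::nat. \<Lambda>) f S j) * (B ^ d * infl (\<lambda>_. \<Lambda>) f S j) / 3)"
      using 1 2 3 by linarith
    finally show ?case using insert.hyps by (simp add: I_def)
  qed
qed

text \<open>A coefficient contributes to the influences of the blocks that it uses, of which there
  are at most \<open>d\<close>.\<close>

lemma sum_infl:
  assumes f: "\<And>m. f m \<noteq> 0 \<Longrightarrow> card m \<le> d" and S: "finite S"
  shows "(\<Sum>j\<in>S. infl (\<lambda>_::nat. \<Lambda>) f S j) \<le> real d * (\<Sum>m\<in>Kset (\<lambda>_. \<Lambda>) S. (f m)\<^sup>2)"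
proof -
  have "(\<Sum>j\<in>S. infl (\<lambda>_::nat. \<Lambda>) f S j) = (\<Sum>m\<in>Kset (\<lambda>_. \<Lambda>) S. \<Sum>j\<in>S. if j \<in> fst ` m then (f m)\<^sup>2 else 0)"
    unfolding infl_def by (rule sum.swap)
  also have "\<dots> \<le> (\<Sum>m\<in>Kset (\<lambda>_. \<Lambda>) S. real d * (f m)\<^sup>2)"
  proof (rule sum_mono)
    fix m assume m: "m \<in> Kset (\<lambda>_::nat. \<Lambda>) S"
    have fm: "finite m" using Kset_finite_mem[OF m S] X.fin_\<Lambda> by auto
    have "(\<Sum>j\<in>S. if j \<in> fst ` m then (f m)\<^sup>2 else 0) = real (card (S \<inter> fst ` m)) * (f m)\<^sup>2"
      using S by (subst sum.inter_restrict[symmetric]) auto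
    also have "card (S \<inter> fst ` m) \<le> card (fst ` m)" using fm by (intro card_mono) auto
    also have "card (fst ` m) \<le> card m" using fm by (rule card_image_le)
    finally show "(\<Sum>j\<in>S. if j \<in> fst ` m then (f m)\<^sup>2 else 0) \<le> real d * (f m)\<^sup>2"
      using f[of m] by (cases "f m = 0") (auto elim!: order_trans intro!: mult_right_mono)
  qed
  finally show ?thesis by (simp add: sum_distrib_left)
qed

lemma E_transfer:
  fixes h :: "(nat \<Rightarrow> real) \<Rightarrow> 'b::{banach, second_countable_topology}"
  assumes "h \<in> borel_measurable X.P"
  shows "Z.E (\<lambda>x. h (\<lambda>j. x (Inl j))) = X.E h"
proof -
  have d: "distr (PiM UNIV (DD \<mu> :: nat + nat \<times> nat \<Rightarrow> real measure)) X.P (\<lambda>x j. x (Inl j)) = X.P"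
    using distr_PiM_reindex[of UNIV "DD \<mu> :: nat + nat \<times> nat \<Rightarrow> real measure" Inl UNIV] Z.prob_D
    by (simp add: DD_def restrict_def)
  have m: "(\<lambda>x j. x (Inl j)) \<in> measurable (PiM UNIV (DD \<mu> :: nat + nat \<times> nat \<Rightarrow> real measure)) X.P"
  proof (rule measurable_PiM_single')
    fix i :: nat
    have "(\<lambda>x. x (Inl i)) \<in> measurable (PiM UNIV (DD \<mu> :: nat + nat \<times> nat \<Rightarrow> real measure)) (DD \<mu> (Inl i))" by simp
    then show "(\<lambda>x. x (Inl i)) \<in> measurable (PiM UNIV (DD \<mu> :: nat + nat \<times> nat \<Rightarrow> real measure)) \<mu>" by (simp add: DD_def)
  qed auto
  from integral_distr[OF m assms] show ?thesis by (simp add: d)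
qed

text \<open>The contraction form \<open>T\<close> of the Gaussian setting, taken over
  \<open>Kset\<close> for the coefficients of any multilinear form.\<close>

definition Tf :: "(('j \<times> nat) set \<Rightarrow> real) \<Rightarrow> 'j set \<Rightarrow> (('j \<times> nat) set \<Rightarrow> real) \<Rightarrow> (('j \<times> nat) set \<Rightarrow> real) \<Rightarrow> real" where
  "Tf f S u w = (\<Sum>m\<in>Kset (\<lambda>_. \<Lambda>) S. \<Sum>\<alpha>\<in>Pow m - {{}, m}. f m * u \<alpha> * w (m - \<alpha>))"

definition nrm :: "'j set \<Rightarrow> (('j \<times> nat) set \<Rightarrow> real) \<Rightarrow> real" where
  "nrm S u = sqrt (\<Sum>m\<in>Kset (\<lambda>_. \<Lambda>) S. (u m)\<^sup>2)"

text \<open>For v = (j, l), test the form with the indicator of {v} and with the coefficients of the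
  larger sets containing v, shifted by removal of v. The value is the sum a of the squares of these
  coefficients, so a \<le> |\<epsilon>| sqrt a; the remaining set {v} is controlled by
  \<open>\<eta>\<close>.\<close>

lemma infl_bound:
  assumes S: "finite S" and T: "\<And>u w. \<bar>Tf f S u w\<bar> \<le> \<epsilon> * nrm S u * nrm S w"
    and sg: "\<And>j l. \<bar>f {(j, l)}\<bar> \<le> \<eta>"
  shows "infl (\<lambda>_::nat. \<Lambda>) f S j \<le> real (card \<Lambda>) * (\<epsilon>\<^sup>2 + \<eta>\<^sup>2)"
proof -
  let ?K = "Kset (\<lambda>_::nat. \<Lambda>) S"
  have fK: "finite ?K" using finite_Kset[OF S] X.fin_\<Lambda> by auto
  have fin\<Lambda>: "finite \<Lambda>" using X.fin_\<Lambda> .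
  have fm: "finite m" if "m \<in> ?K" for m using Kset_finite_mem[OF that S] fin\<Lambda> by auto
  have eta2: "(f {(j, l)})\<^sup>2 \<le> \<eta>\<^sup>2" for l using sg[of j l] by (metis abs_ge_zero power2_abs power_mono)
  have "infl (\<lambda>_::nat. \<Lambda>) f S j \<le> (\<Sum>m\<in>?K. \<Sum>l\<in>\<Lambda>. if (j, l) \<in> m then (f m)\<^sup>2 else 0)"
    unfolding infl_def
  proof (rule sum_mono)
    fix m assume m: "m \<in> ?K"
    show "(if j \<in> fst ` m then (f m)\<^sup>2 else 0) \<le> (\<Sum>l\<in>\<Lambda>. if (j, l) \<in> m then (f m)\<^sup>2 else 0)"
    proof (cases "j \<in> fst ` m")
      case True
      then obtain l where l: "(j, l) \<in> m" by auto
      then have "l \<in> \<Lambda>" using m by (auto simp: Kset_def)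
      then have "(if (j, l) \<in> m then (f m)\<^sup>2 else 0) \<le> (\<Sum>l\<in>\<Lambda>. if (j, l) \<in> m then (f m)\<^sup>2 else 0)"
        by (intro member_le_sum fin\<Lambda>) auto
      then show ?thesis using True l by simp
    qed (auto intro: sum_nonneg)
  qed
  also have "\<dots> = (\<Sum>l\<in>\<Lambda>. \<Sum>m\<in>?K. if (j, l) \<in> m then (f m)\<^sup>2 else 0)" by (rule sum.swap)
  also have "\<dots> \<le> (\<Sum>l\<in>\<Lambda>. \<epsilon>\<^sup>2 + \<eta>\<^sup>2)"
  proof (rule sum_mono)
    fix l assume "l \<in> \<Lambda>"
    let ?v = "(j, l)"
    define A where "A = {m \<in> ?K. ?v \<in> m \<and> m \<noteq> {?v}}"
    define a where "a = (\<Sum>m\<in>A. (f m)\<^sup>2)"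
    have a0: "a \<ge> 0" unfolding a_def by (intro sum_nonneg) auto
    define u where "u \<alpha> = (of_bool (\<alpha> = {?v}) :: real)" for \<alpha>
    define w where "w \<beta> = (if ?v \<notin> \<beta> \<and> insert ?v \<beta> \<in> A then f (insert ?v \<beta>) else 0)" for \<beta>
    have inj: "inj_on (\<lambda>m. m - {?v}) A" unfolding inj_on_def A_def by (auto; metis insert_Diff insert_iff)
    have nu: "(nrm S u) \<le> 1"
    proof -
      have "(\<Sum>m\<in>?K. (u m)\<^sup>2) = (\<Sum>m\<in>?K. if m = {?v} then 1 else 0)" by (intro sum.cong) (auto simp: u_def)
      also have "\<dots> \<le> 1" using fK by (simp add: sum.delta')
      finally show ?thesis unfolding nrm_def using real_sqrt_le_mono by fastforce
    qed
    have nw: "nrm S w \<le> sqrt a"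
    proof -
      have sub: "{m \<in> ?K. w m \<noteq> 0} \<subseteq> (\<lambda>m. m - {?v}) ` A"
      proof
        fix m assume "m \<in> {m \<in> ?K. w m \<noteq> 0}"
        then have "?v \<notin> m" "insert ?v m \<in> A" by (auto simp: w_def split: if_splits)
        then show "m \<in> (\<lambda>m. m - {?v}) ` A" by (intro image_eqI[of _ _ "insert ?v m"]) auto
      qed
      have "(\<Sum>m\<in>?K. (w m)\<^sup>2) = (\<Sum>m\<in>{m \<in> ?K. w m \<noteq> 0}. (w m)\<^sup>2)"
        using fK by (intro sum.mono_neutral_right) auto
      also have "\<dots> \<le> (\<Sum>m\<in>(\<lambda>m. m - {?v}) ` A. (w m)\<^sup>2)"
        using fK sub by (intro sum_mono2) (auto simp: A_def)
      also have "\<dots> = a" unfolding a_def sum.reindex[OF inj] o_def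
        by (intro sum.cong refl) (auto simp: w_def A_def insert_absorb)
      finally show ?thesis unfolding nrm_def by (rule real_sqrt_le_mono)
    qed
    have "Tf f S u w = (\<Sum>m\<in>?K. if m \<in> A then (f m)\<^sup>2 else 0)"
      unfolding Tf_def
    proof (intro sum.cong refl)
      fix m assume m: "m \<in> ?K"
      have "(\<Sum>\<alpha>\<in>Pow m - {{}, m}. f m * u \<alpha> * w (m - \<alpha>)) = (\<Sum>\<alpha>\<in>Pow m - {{}, m}. if \<alpha> = {?v} then f m * w (m - {?v}) else 0)"
        by (intro sum.cong refl) (auto simp: u_def)
      also have "\<dots> = (if {?v} \<in> Pow m - {{}, m} then f m * w (m - {?v}) else 0)"
        using fm[OF m] by (subst sum.delta) auto
      also have "\<dots> = (if m \<in> A then (f m)\<^sup>2 else 0)"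
        using m by (auto simp: A_def w_def insert_absorb power2_eq_square)
      finally show "(\<Sum>\<alpha>\<in>Pow m - {{}, m}. f m * u \<alpha> * w (m - \<alpha>)) = (if m \<in> A then (f m)\<^sup>2 else 0)" .
    qed
    also have "\<dots> = a" unfolding a_def A_def using fK by (subst sum.inter_filter[symmetric]) (auto intro!: sum.cong)
    finally have "a = Tf f S u w" ..
    also have "\<dots> \<le> \<epsilon> * nrm S u * nrm S w" using T[of u w] by simp
    also have "\<dots> \<le> \<bar>\<epsilon>\<bar> * 1 * sqrt a" using nu nw by (intro mult_mono) (auto simp: nrm_def intro!: sum_nonneg)
    finally have "sqrt a * sqrt a \<le> \<bar>\<epsilon>\<bar> * sqrt a" using a0 by simp
    then have "sqrt a \<le> \<bar>\<epsilon>\<bar>"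
      using a0 by (cases "a = 0") (simp, metis mult_right_le_imp_le real_sqrt_gt_zero order_le_imp_less_or_eq)
    then have "(sqrt a)\<^sup>2 \<le> \<bar>\<epsilon>\<bar>\<^sup>2" using a0 by (intro power_mono) auto
    then have a: "a \<le> \<epsilon>\<^sup>2" using a0 by simp
    have "(\<Sum>m\<in>?K. if ?v \<in> m then (f m)\<^sup>2 else 0) = (\<Sum>m\<in>{m \<in> ?K. ?v \<in> m}. (f m)\<^sup>2)"
      using fK by (rule sum.inter_filter[symmetric])
    also have "\<dots> \<le> (\<Sum>m\<in>insert {?v} A. (f m)\<^sup>2)"
      using fK by (intro sum_mono2) (auto simp: A_def)
    also have "\<dots> = (f {?v})\<^sup>2 + a" unfolding a_def using fK by (subst sum.insert) (auto simp: A_def)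
    finally show "(\<Sum>m\<in>?K. if ?v \<in> m then (f m)\<^sup>2 else 0) \<le> \<epsilon>\<^sup>2 + \<eta>\<^sup>2" using a eta2[of l] by linarith
  qed
  finally show ?thesis by simp
qed

text \<open>Small contractions and small singleton coefficients make all influences small. After the
  Lindeberg replacement the form is a square-free Gaussian polynomial whose moments satisfy the
  Gaussian recursion up to o(1). The variances need only be bounded, so the Gaussian to compare with
  varies with n.\<close>

theorem multilinear_clt:
  fixes f :: "'n \<Rightarrow> (nat \<times> nat) set \<Rightarrow> real" and S :: "'n \<Rightarrow> nat set"
  assumes S: "\<And>n. finite (S n)"
    and f: "\<And>n m. f n m \<noteq> 0 \<Longrightarrow> m \<in> Kset (\<lambda>_. \<Lambda>) (S n) \<and> m \<noteq> {} \<and> card m \<le> d"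
    and fB: "\<And>n. (\<Sum>m\<in>Kset (\<lambda>_. \<Lambda>) (S n). (f n m)\<^sup>2) \<le> B"
    and T: "\<And>n u w. \<bar>Tf (f n) (S n) u w\<bar> \<le> \<epsilon> n * nrm (S n) u * nrm (S n) w"
    and \<epsilon>: "\<And>n. \<epsilon> n \<ge> 0" "(\<epsilon> \<longlongrightarrow> 0) F"
    and \<eta>: "\<And>n j l. \<bar>f n {(j, l)}\<bar> \<le> \<eta> n" "(\<eta> \<longlongrightarrow> 0) F"
  shows "((\<lambda>n. X.E (\<lambda>x. iexp (X.ml (f n) (S n) x)) - exp (- (\<Sum>m\<in>Kset (\<lambda>_. \<Lambda>) (S n). (f n m)\<^sup>2) / 2)) \<longlongrightarrow> 0) F"
proof -
  let ?i = "\<lambda>n. infl (\<lambda>_::nat. \<Lambda>) (f n) (S n)"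
  let ?FR = "\<lambda>n. FR (f n) (S n)"
  let ?K = "\<lambda>n. Kset (\<lambda>_::nat. \<Lambda>) (S n)"
  have fin\<Lambda>: "finite \<Lambda>" using X.fin_\<Lambda> .
  define s2 where "s2 n = (\<Sum>m\<in>?K n. (f n m)\<^sup>2)" for n
  have s20: "s2 n \<ge> 0" for n unfolding s2_def by (intro sum_nonneg) auto
  define b where "b = 4 + 3 * \<bar>max \<kappa> 3\<bar> * real (max L 1) ^ 3"
  have b4: "b \<ge> 4" by (simp add: b_def)
  have "3 * max \<kappa> 3 * real (max L 1) ^ 3 \<le> 3 * \<bar>max \<kappa> 3\<bar> * real (max L 1) ^ 3" by (intro mult_right_mono) auto
  also have "\<dots> \<le> b" by (simp add: b_def)
  also have "\<dots> \<le> b\<^sup>2" using b4 by (simp add: power2_eq_square)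
  finally have b2: "b\<^sup>2 \<ge> 3 * max \<kappa> 3 * real (max L 1) ^ 3" .
  have card_f: "f n m \<noteq> 0 \<Longrightarrow> card m \<le> d" for n m using f by blast
  define \<iota> where "\<iota> n = real (card \<Lambda>) * ((\<epsilon> n)\<^sup>2 + (\<eta> n)\<^sup>2)" for n
  have \<iota>0: "(\<iota> \<longlongrightarrow> 0) F"
    unfolding \<iota>_def[abs_def] using \<epsilon>(2) \<eta>(2) by (auto intro!: tendsto_eq_intros)
  have i\<iota>: "?i n j \<le> \<iota> n" for n j
    unfolding \<iota>_def by (rule infl_bound[OF S T \<eta>(1)])
  have i0: "?i n j \<ge> 0" for n j unfolding infl_def by (intro sum_nonneg) auto
  \<comment> \<open>One factor sqrt of the influence is replaced by its uniform bound; what is left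
    sums to at most the degree times the total square sum.\<close>
  have lind: "cmod (Z.E (\<lambda>x. iexp (?FR n (S n) x)) - Z.E (\<lambda>x. iexp (?FR n {} x))) \<le> sqrt (\<iota> n) * (b ^ d * (real d * B))" for n
  proof -
    have "cmod (Z.E (\<lambda>x. iexp (?FR n (S n) x)) - Z.E (\<lambda>x. iexp (?FR n {} x)))
     \<le> (\<Sum>j\<in>S n. sqrt (?i n j) * (b ^ d * ?i n j) / 3)"
      by (rule lindeberg[OF card_f b4 b2 S order_refl])
    also have "\<dots> \<le> (\<Sum>j\<in>S n. sqrt (\<iota> n) * (b ^ d * ?i n j))"
    proof (rule sum_mono)
      fix j
      have "sqrt (?i n j) * (b ^ d * ?i n j) / 3 \<le> sqrt (?i n j) * (b ^ d * ?i n j)"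
        using i0[of n j] b4 by (simp add: mult_nonneg_nonneg)
      also have "\<dots> \<le> sqrt (\<iota> n) * (b ^ d * ?i n j)"
        using i0[of n j] i\<iota>[of n j] b4 by (intro mult_right_mono real_sqrt_le_mono) auto
      finally show "sqrt (?i n j) * (b ^ d * ?i n j) / 3 \<le> sqrt (\<iota> n) * (b ^ d * ?i n j)" .
    qed
    also have "\<dots> = sqrt (\<iota> n) * (b ^ d * (\<Sum>j\<in>S n. ?i n j))" by (simp add: sum_distrib_left)
    also have "\<dots> \<le> sqrt (\<iota> n) * (b ^ d * (real d * B))"
    proof (intro mult_left_mono)
      have "(\<Sum>j\<in>S n. ?i n j) \<le> real d * (\<Sum>m\<in>?K n. (f n m)\<^sup>2)"
        by (rule sum_infl[OF card_f S])
      also have "\<dots> \<le> real d * B" by (intro mult_left_mono fB) auto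
      finally show "(\<Sum>j\<in>S n. ?i n j) \<le> real d * B" .
      show "0 \<le> sqrt (\<iota> n)" by (simp add: \<iota>_def)
    qed (use b4 in auto)
    finally show ?thesis .
  qed
  \<comment> \<open>With all blocks Gaussian the form is square-free in the variables of
    \<open>V n\<close>. Coefficients vanish outside \<open>Kset\<close>, so sums over
    \<open>Pow (V n)\<close> agree with those over index sets.\<close>
  define V where "V n = S n \<times> \<Lambda>" for n
  have f0: "m \<notin> ?K n \<Longrightarrow> f n m = 0" for n m using f by blast
  have KV: "?K n \<subseteq> Pow (V n)" for n by (auto simp: Kset_def V_def)
  have finV: "finite (V n)" for n using S fin\<Lambda> by (simp add: V_def)
  have gs: "gauss (DD \<mu>) Inr (V n) (f n) d" for n
  proof
    show "f n m \<noteq> 0 \<Longrightarrow> m \<subseteq> V n \<and> m \<noteq> {} \<and> card m \<le> d" for m using f[of n m] KV[of n] by auto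
  qed (use finV in \<open>auto simp: DD_def\<close>)
  have FG: "gauss.dF Inr (V n) (f n) {} x = ?FR n (S n) x" for n x
  proof -
    interpret gauss "DD \<mu>" Inr "V n" "f n" d by (rule gs)
    have "dF {} x = (\<Sum>m\<in>?K n. f n m * xm m x)" unfolding F_eq
      by (rule sum.mono_neutral_right) (use finV KV f0 in auto)
    also have "\<dots> = ?FR n (S n) x" unfolding FR_def
    proof (intro sum.cong refl arg_cong2[where f = "(*)"])
      fix m assume "m \<in> ?K n"
      then show "xm m x = mprod (zR e (S n)) m x"
        unfolding xm_def mprod_def by (intro prod.cong refl) (auto simp: zR_def Kset_def)
    qed
    finally show ?thesis .
  qed
  have s2V: "gauss.\<sigma>2 (V n) (f n) = s2 n" for n
  proof -
    interpret gauss "DD \<mu>" Inr "V n" "f n" d by (rule gs)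
    show ?thesis unfolding \<sigma>2_def s2_def
      by (rule sum.mono_neutral_right) (use finV KV f0 in auto)
  qed
  have TV: "\<bar>gauss.T (V n) (f n) u w\<bar> \<le> \<epsilon> n * sqrt (\<Sum>\<alpha>\<in>Pow (V n). (u \<alpha>)\<^sup>2) * sqrt (\<Sum>\<alpha>\<in>Pow (V n). (w \<alpha>)\<^sup>2)" for n u w
  proof -
    interpret gauss "DD \<mu>" Inr "V n" "f n" d by (rule gs)
    have "T u w = Tf (f n) (S n) u w" unfolding T_def Tf_def
      by (rule sum.mono_neutral_right) (use finV KV f0 in \<open>auto intro!: sum.neutral\<close>)
    moreover have "nrm (S n) u \<le> sqrt (\<Sum>\<alpha>\<in>Pow (V n). (u \<alpha>)\<^sup>2)" for u
      unfolding nrm_def by (intro real_sqrt_le_mono sum_mono2) (use finV KV in auto)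
    moreover have "0 \<le> nrm (S n) u" for u unfolding nrm_def by (simp add: sum_nonneg)
    ultimately show ?thesis
      using T[of n u w] \<epsilon>(1)[of n] by (auto intro!: order_trans[OF T] mult_mono mult_nonneg_nonneg sum_nonneg)
  qed
  obtain C1 where C1: "C1 \<ge> 0" "\<And>A A'. A \<in> pol UNIV d \<Longrightarrow> A' \<in> pol UNIV d \<Longrightarrow>
     Z.E (\<lambda>x. (A x * A' x)\<^sup>2) \<le> C1 * Z.E (\<lambda>x. (A x)\<^sup>2) * Z.E (\<lambda>x. (A' x)\<^sup>2)"
    by (rule Z.pol_mult_L2[OF fin_range_DD, of d]) (rule that)
  define G where "G n = gauss.dF (Inr :: nat \<times> nat \<Rightarrow> nat + nat \<times> nat) (V n) (f n) {}" for n
  have Gint: "integrable (PiM UNIV (DD \<mu>)) (\<lambda>x. G n x ^ k)" for n k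
  proof -
    interpret gauss "DD \<mu>" Inr "V n" "f n" d by (rule gs)
    show ?thesis unfolding G_def by (rule Z.pol_integrable_power[OF dF_pol])
  qed
  have rec: "((\<lambda>n. Z.E (\<lambda>x. G n x ^ Suc (Suc q)) - real (Suc q) * s2 n * Z.E (\<lambda>x. G n x ^ q)) \<longlongrightarrow> 0) F" for q
  proof -
    \<comment> \<open>One constant for the finitely many orders in the recursion, independent of n
      by hypercontractivity and the bound on the variances.\<close>
    have "\<exists>C. \<forall>k\<le>Suc (2 * q). \<forall>A\<in>pol UNIV (2 * d). Z.E (\<lambda>x. (A x)\<^sup>2) \<le> C1 * (2 ^ d * B)\<^sup>2 \<longrightarrow> Z.E (\<lambda>x. (1 + (A x)\<^sup>2) ^ k) \<le> C"
    proof -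
      have "\<forall>k. \<exists>C. \<forall>A\<in>pol UNIV (2 * d). Z.E (\<lambda>x. (A x)\<^sup>2) \<le> C1 * (2 ^ d * B)\<^sup>2 \<longrightarrow> Z.E (\<lambda>x. (1 + (A x)\<^sup>2) ^ k) \<le> C"
        using Z.pol_moment_bound[OF fin_range_DD] by blast
      then obtain Ck where Ck: "\<And>k A. A \<in> pol UNIV (2 * d) \<Longrightarrow> Z.E (\<lambda>x. (A x)\<^sup>2) \<le> C1 * (2 ^ d * B)\<^sup>2 \<Longrightarrow> Z.E (\<lambda>x. (1 + (A x)\<^sup>2) ^ k) \<le> Ck k" by metis
      have "Ck k \<le> Max (Ck ` {..Suc (2 * q)})" if "k \<le> Suc (2 * q)" for k
        using that by (intro Max_ge) auto
      then show ?thesis using Ck by (intro exI[of _ "Max (Ck ` {..Suc (2 * q)})"]) (meson order_trans)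
    qed
    then obtain C where C: "\<And>k A. k \<le> Suc (2 * q) \<Longrightarrow> A \<in> pol UNIV (2 * d) \<Longrightarrow> Z.E (\<lambda>x. (A x)\<^sup>2) \<le> C1 * (2 ^ d * B)\<^sup>2 \<Longrightarrow> Z.E (\<lambda>x. (1 + (A x)\<^sup>2) ^ k) \<le> C"
      by blast
    define K where "K = real (Suc q) * (sqrt C * sqrt B) + real (Suc q) * (2 * (2 ^ d) ^ q * C)"
    have bd: "\<bar>Z.E (\<lambda>x. G n x ^ Suc (Suc q)) - real (Suc q) * s2 n * Z.E (\<lambda>x. G n x ^ q)\<bar> \<le> \<epsilon> n * K" for n
    proof -
      interpret gauss "DD \<mu>" Inr "V n" "f n" d by (rule gs)
      have s: "\<sigma>2 \<le> B" using fB[of n] s2V[of n] by (simp add: s2_def)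
      have s0: "\<sigma>2 \<ge> 0" using s20[of n] s2V[of n] by simp
      have "Z.E (\<lambda>x. (Q x)\<^sup>2) \<le> C1 * (2 ^ d * \<sigma>2)\<^sup>2" by (rule E_Q_sq[OF C1])
      also have "\<dots> \<le> C1 * (2 ^ d * B)\<^sup>2" using s s0 C1(1) by (intro mult_left_mono power_mono) auto
      finally have "Z.E (\<lambda>x. (1 + (Q x)\<^sup>2) ^ k) \<le> C" if "k \<le> Suc (2 * q)" for k
        using C[OF that Q_pol] by blast
      from moment_rec[OF \<epsilon>(1) TV this s] show ?thesis unfolding G_def K_def s2V .
    qed
    have "((\<lambda>n. \<epsilon> n * K) \<longlongrightarrow> 0) F" using \<epsilon>(2) by (auto intro!: tendsto_eq_intros)
    then show ?thesis by (rule Lim_null_comparison[rotated]) (use bd in auto)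
  qed
  define mu where "mu k = (\<integral>y. y ^ k \<partial>std_normal_distribution)" for k
  have mom: "((\<lambda>n. Z.E (\<lambda>x. G n x ^ k) - sqrt (s2 n) ^ k * mu k) \<longlongrightarrow> 0) F" for k
  proof (induction k rule: nat_less_induct)
    case (1 k)
    show ?case
    proof (cases k)
      case 0
      have "mu 0 = 1" unfolding mu_def using std_normal_distribution_even_moments(1)[of 0] by simp
      then show ?thesis using 0 by simp
    next
      case (Suc k')
      show ?thesis
      proof (cases k')
        case 0
        have "Z.E (\<lambda>x. G n x ^ Suc 0) = 0" for n
        proof -
          interpret gauss "DD \<mu>" Inr "V n" "f n" d by (rule gs)
          have "\<Gamma> 0 x = 0" for x unfolding \<Gamma>_def by (intro sum.neutral) (auto simp: f_empty)
          then have "\<Gamma> 0 = (\<lambda>_. 0)" by (rule ext)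
          then show ?thesis unfolding G_def E_F_power by simp
        qed
        moreover have "mu (Suc 0) = 0" unfolding mu_def using integral_std_normal_distribution_moment_odd[of 1] by simp
        ultimately show ?thesis using Suc 0 by simp
      next
        case (Suc q)
        have k: "k = Suc (Suc q)" using Suc \<open>k = Suc k'\<close> by simp
        have IH: "((\<lambda>n. Z.E (\<lambda>x. G n x ^ q) - sqrt (s2 n) ^ q * mu q) \<longlongrightarrow> 0) F" using 1 k by auto
        have bs: "Bfun s2 F" unfolding Bfun_def
        proof (intro exI[of _ "\<bar>B\<bar> + 1"] conjI always_eventually allI)
          show "norm (s2 n) \<le> \<bar>B\<bar> + 1" for n using s20[of n] fB[of n] by (simp add: s2_def)
        qed auto
        \<comment> \<open>Bounded variances times the null sequence of the induction hypothesis: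
          inside the recursion, the moment of order q may be replaced by its Gaussian value.\<close>
        have "((\<lambda>n. (real (Suc q) * s2 n) * (Z.E (\<lambda>x. G n x ^ q) - sqrt (s2 n) ^ q * mu q)) \<longlongrightarrow> 0) F"
        proof (rule Lim_null_comparison)
          show "((\<lambda>n. (real (Suc q) * \<bar>B\<bar>) * \<bar>Z.E (\<lambda>x. G n x ^ q) - sqrt (s2 n) ^ q * mu q\<bar>) \<longlongrightarrow> 0) F"
            using tendsto_mult_left[OF tendsto_rabs_zero[OF IH], of "real (Suc q) * \<bar>B\<bar>"] by simp
          show "\<forall>\<^sub>F n in F. norm ((real (Suc q) * s2 n) * (Z.E (\<lambda>x. G n x ^ q) - sqrt (s2 n) ^ q * mu q)) \<le> (real (Suc q) * \<bar>B\<bar>) * \<bar>Z.E (\<lambda>x. G n x ^ q) - sqrt (s2 n) ^ q * mu q\<bar>"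
            using s20 fB by (intro always_eventually allI) (auto simp: abs_mult s2_def intro!: mult_right_mono mult_left_mono order_trans[OF fB])
        qed
        from tendsto_add[OF rec[of q] this]
        have "((\<lambda>n. Z.E (\<lambda>x. G n x ^ Suc (Suc q)) - real (Suc q) * s2 n * (sqrt (s2 n) ^ q * mu q)) \<longlongrightarrow> 0) F"
          by (simp add: algebra_simps)
        moreover have "real (Suc q) * s2 n * (sqrt (s2 n) ^ q * mu q) = sqrt (s2 n) ^ Suc (Suc q) * mu (Suc (Suc q))" for n
        proof -
          have "mu (Suc (Suc q)) = real (Suc q) * mu q" unfolding mu_def by (rule std_normal_moment_rec)
          moreover have "sqrt (s2 n) ^ Suc (Suc q) = s2 n * sqrt (s2 n) ^ q" using s20[of n] by (simp add: mult.assoc[symmetric])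
          ultimately show ?thesis by (simp only: mult_ac)
        qed
        ultimately show ?thesis unfolding k by (simp only:)
      qed
    qed
  qed
  have "((\<lambda>n. Z.E (\<lambda>x. iexp (G n x)) - exp (- (sqrt (s2 n))\<^sup>2 / 2)) \<longlongrightarrow> 0) F"
    by (rule Z.D.P.char_of_gaussian_moments[OF Gint _ _ mom[unfolded mu_def], of B])
       (use s20 fB in \<open>auto simp: s2_def\<close>)
  then have g: "((\<lambda>n. Z.E (\<lambda>x. iexp (?FR n (S n) x)) - exp (- s2 n / 2)) \<longlongrightarrow> 0) F"
    using s20 by (simp add: G_def FG)
  have "((\<lambda>n. sqrt (\<iota> n) * (b ^ d * (real d * B))) \<longlongrightarrow> 0) F"
    using tendsto_mult_right[OF tendsto_real_sqrt[OF \<iota>0]] by simp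
  then have l: "((\<lambda>n. Z.E (\<lambda>x. iexp (?FR n (S n) x)) - Z.E (\<lambda>x. iexp (?FR n {} x))) \<longlongrightarrow> 0) F"
    by (rule Lim_null_comparison[rotated]) (use lind in auto)
  have tr: "Z.E (\<lambda>x. iexp (?FR n {} x)) = X.E (\<lambda>x. iexp (X.ml (f n) (S n) x))" for n
  proof -
    have "?FR n {} x = X.ml (f n) (S n) (\<lambda>j. x (Inl j))" for x
      unfolding FR_def X.ml_def mprod_def by (simp add: zR_def X.xi_def)
    moreover have "(\<lambda>x. iexp (X.ml (f n) (S n) x)) \<in> borel_measurable X.P"
    proof -
      obtain k where "X.ml (f n) (S n) \<in> pol (\<Union> ((\<lambda>i. {i}) ` S n)) k" using X.ml_pol[OF S[of n]] by blast
      then have [measurable]: "X.ml (f n) (S n) \<in> borel_measurable X.P" by (rule X.pol_meas)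
      show ?thesis by measurable
    qed
    ultimately show ?thesis using E_transfer[of "\<lambda>x. iexp (X.ml (f n) (S n) x)"] by simp
  qed
  from tendsto_diff[OF g l] show ?thesis by (simp add: tr s2_def)
qed

end

section \<open>Ultrafilter limits of polynomials\<close>

text \<open>Zorn's lemma for the proper filters below \<open>sequentially\<close>, ordered by
  refinement; a maximal one decides every predicate, since otherwise the predicate could be used to
  refine it.\<close>

lemma ultrafilter_exists:
  "\<exists>U::nat filter. U \<noteq> bot \<and> U \<le> sequentially \<and> (\<forall>P. eventually P U \<or> eventually (\<lambda>n. \<not> P n) U)"
proof -
  define A where "A = {F::nat filter. F \<noteq> bot \<and> F \<le> sequentially}"
  define R where "R = (\<lambda>F G :: nat filter. G \<le> F)"
  have "\<exists>m\<in>A. \<forall>a\<in>A. R m a \<longrightarrow> a = m"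
  proof (rule predicate_Zorn)
    show "partial_order_on A (relation_of R A)"
      by (rule partial_order_on_relation_ofI) (auto simp: R_def)
    fix C assume "C \<in> Chains (relation_of R A)"
    then have CA: "C \<subseteq> A" and ch: "\<And>F G. F \<in> C \<Longrightarrow> G \<in> C \<Longrightarrow> F \<le> G \<or> G \<le> F"
      by (auto simp: Chains_def relation_of_def R_def)
    show "\<exists>u\<in>A. \<forall>a\<in>C. R a u"
    proof (cases "C = {}")
      case True
      then show ?thesis by (intro bexI[of _ sequentially]) (auto simp: A_def)
    next
      case False
      \<comment> \<open>For a chain, an event of the infimum is already an event of one member, so
        the infimum remains proper.\<close>
      have ev: "eventually Q (Inf C) \<longleftrightarrow> (\<exists>b\<in>C. eventually Q b)" for Q
        by (rule eventually_Inf_base[OF False]) (use ch in \<open>metis inf.absorb1 inf.absorb2 order_refl\<close>)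
      have "Inf C \<noteq> bot"
        using ev[of "\<lambda>_. False"] CA by (auto simp: A_def trivial_limit_def)
      moreover have "Inf C \<le> sequentially"
        using False CA by (metis (mono_tags, lifting) A_def Inf_lower2 all_not_in_conv mem_Collect_eq subsetD)
      ultimately show ?thesis by (intro bexI[of _ "Inf C"]) (auto simp: A_def R_def intro: Inf_lower)
    qed
  qed
  then obtain U where U: "U \<in> A" and mx: "\<And>F. F \<in> A \<Longrightarrow> F \<le> U \<Longrightarrow> F = U" by (auto simp: R_def)
  have "eventually P U \<or> eventually (\<lambda>n. \<not> P n) U" for P
  proof (rule disjCI)
    assume n: "\<not> eventually (\<lambda>n. \<not> P n) U"
    define F where "F = inf U (principal {n. P n})"
    have "F \<noteq> bot" using n by (auto simp: F_def trivial_limit_def eventually_inf_principal)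
    moreover have "F \<le> sequentially" using U by (auto simp: F_def A_def intro: le_infI1)
    ultimately have "F = U" by (intro mx) (auto simp: A_def F_def)
    moreover have "eventually P F" by (simp add: F_def eventually_inf_principal)
    ultimately show "eventually P U" by simp
  qed
  then show ?thesis using U by (auto simp: A_def)
qed

locale ultra = iidlaw \<mu> e \<Lambda> L \<kappa> for \<mu> e \<Lambda> L \<kappa> +
  fixes U :: "nat filter"
  assumes U_bot: "U \<noteq> bot" and U_seq: "U \<le> sequentially"
    and U_ultra: "\<And>P. eventually P U \<or> eventually (\<lambda>n. \<not> P n) U"
begin

abbreviation "EE \<equiv> X.E"

lemma U_not_iff: "\<not> eventually P U \<longleftrightarrow> eventually (\<lambda>n. \<not> P n) U"
proof (rule iffI, goal_cases)
  case 2
  show ?case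
  proof
  assume "eventually P U"
  with 2 have "eventually (\<lambda>_. False) U" by eventually_elim simp
  then show False using U_bot by (simp add: eventually_False)
  qed
qed (use U_ultra in blast)

text \<open>The image filter on a compact interval has a cluster point, which the ultrafilter
  property turns into a limit.\<close>

lemma ultra_convergent:
  fixes f :: "nat \<Rightarrow> real"
  assumes "\<forall>\<^sub>F n in U. \<bar>f n\<bar> \<le> B"
  shows "\<exists>l. (f \<longlongrightarrow> l) U"
proof -
  have "compact {-B..B}" by simp
  moreover have "filtermap f U \<noteq> bot" using U_bot by (simp add: filtermap_bot_iff)
  moreover have "eventually (\<lambda>y. y \<in> {-B..B}) (filtermap f U)"
    using assms by (simp add: eventually_filtermap) (auto elim: eventually_mono)
  ultimately obtain l where l: "inf (nhds l) (filtermap f U) \<noteq> bot"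
    unfolding compact_filter by blast
  have "(f \<longlongrightarrow> l) U"
    unfolding filterlim_iff
  proof (intro allI impI)
    fix Q assume Q: "eventually Q (nhds l)"
    show "\<forall>\<^sub>F x in U. Q (f x)"
    proof (rule ccontr)
      assume "\<not> (\<forall>\<^sub>F x in U. Q (f x))"
      then have "eventually (\<lambda>y. \<not> Q y) (filtermap f U)" by (simp add: U_not_iff eventually_filtermap)
      with Q have "eventually (\<lambda>_. False) (inf (nhds l) (filtermap f U))"
        unfolding eventually_inf by blast
      with l show False by (simp add: trivial_limit_def)
    qed
  qed
  then show ?thesis ..
qed

text \<open>Diagonal choice: at n the witness meets the longest satisfiable initial segment of the
  conditions, cut off at n; a given condition lies below the cut for U-almost every n because U
  refines \<open>sequentially\<close>. This is the countable saturation of ultraproducts.\<close>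

lemma saturation:
  assumes "\<And>N::nat. \<forall>\<^sub>F n in U. \<exists>z. \<forall>i\<le>N. Q i n z"
  shows "\<exists>Z. \<forall>i. \<forall>\<^sub>F n in U. Q i n (Z n)"
proof -
  define ok where "ok n N \<longleftrightarrow> (\<exists>z. \<forall>i\<le>N. Q i n z)" for n N
  \<comment> \<open>The set may be empty for some n; the maximum is used only where the set contains
    the condition in question.\<close>
  define Nn where "Nn n = Max {N. N \<le> n \<and> ok n N}" for n
  define Z where "Z n = (SOME z. \<forall>i\<le>Nn n. Q i n z)" for n
  have "\<forall>\<^sub>F n in U. Q i n (Z n)" for i
  proof -
    have "\<forall>\<^sub>F n in U. i \<le> n" using U_seq eventually_ge_at_top[of i] by (rule filter_leD)
    moreover have "\<forall>\<^sub>F n in U. ok n i" using assms[of i] by (simp add: ok_def)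
    ultimately show ?thesis
    proof eventually_elim
      case (elim n)
      have fin: "finite {N. N \<le> n \<and> ok n N}" by simp
      have i: "i \<in> {N. N \<le> n \<and> ok n N}" using elim by simp
      have "Nn n \<in> {N. N \<le> n \<and> ok n N}" unfolding Nn_def by (rule Max_in[OF fin]) (use i in auto)
      then have "ok n (Nn n)" by simp
      then have "\<forall>i\<le>Nn n. Q i n (Z n)" unfolding ok_def Z_def by (rule someI_ex)
      moreover have "i \<le> Nn n" unfolding Nn_def by (rule Max_ge[OF fin i])
      ultimately show ?case by blast
    qed
  qed
  then show ?thesis by blast
qed

text \<open>Representatives for the L^2 ultraproduct of the polynomials of degree at most
  \<open>k\<close>. The bound is imposed at every n, so that no exceptional indices have to be
  carried along.\<close>

definition CC :: "nat \<Rightarrow> (nat \<Rightarrow> (nat \<Rightarrow> real) \<Rightarrow> real) set" where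
  "CC k = {F. (\<forall>n. F n \<in> pol UNIV k) \<and> (\<exists>B. \<forall>n. EE (\<lambda>x. (F n x)\<^sup>2) \<le> B)}"

lemma CC_pol: "F \<in> CC k \<Longrightarrow> F n \<in> pol UNIV k"
  by (auto simp: CC_def)

lemma CC_bound: "F \<in> CC k \<Longrightarrow> \<exists>B\<ge>0. \<forall>n. EE (\<lambda>x. (F n x)\<^sup>2) \<le> B"
proof -
  assume "F \<in> CC k"
  then obtain B where B: "\<And>n. EE (\<lambda>x. (F n x)\<^sup>2) \<le> B" by (auto simp: CC_def)
  have "0 \<le> EE (\<lambda>x. (F 0 x)\<^sup>2)" by (intro integral_nonneg_AE) auto
  then have "0 \<le> B" using B[of 0] by linarith
  then show ?thesis using B by blast
qed

lemma CC_I: "(\<And>n. F n \<in> pol UNIV k) \<Longrightarrow> (\<And>n. EE (\<lambda>x. (F n x)\<^sup>2) \<le> B) \<Longrightarrow> F \<in> CC k"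
  by (auto simp: CC_def)

lemma CC_mono: "F \<in> CC k \<Longrightarrow> k \<le> k' \<Longrightarrow> F \<in> CC k'"
  by (auto simp: CC_def intro: pol_mono)

lemma CC_const: "(\<lambda>n x. c) \<in> CC k"
  by (rule CC_I[of _ _ "c\<^sup>2"]) (auto intro: pol_const)

lemma L2_add_le:
  assumes A: "A \<in> pol UNIV k" and B: "B \<in> pol UNIV k'"
  shows "EE (\<lambda>x. (A x + B x)\<^sup>2) \<le> 2 * EE (\<lambda>x. (A x)\<^sup>2) + 2 * EE (\<lambda>x. (B x)\<^sup>2)"
proof -
  have i: "integrable X.P (\<lambda>x. (A x)\<^sup>2)" "integrable X.P (\<lambda>x. (B x)\<^sup>2)"
    using X.pol_integrable_power A B by blast+
  have "(\<lambda>x. A x + B x) \<in> pol UNIV (max k k')" by (intro pol_add pol_mono[OF A] pol_mono[OF B]) auto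
  then have "EE (\<lambda>x. (A x + B x)\<^sup>2) \<le> EE (\<lambda>x. 2 * (A x)\<^sup>2 + 2 * (B x)\<^sup>2)"
  proof (intro integral_mono)
    fix x show "(A x + B x)\<^sup>2 \<le> 2 * (A x)\<^sup>2 + 2 * (B x)\<^sup>2"
      using sum_squares_bound[of "A x" "B x"] by (simp add: power2_sum)
  qed (use i X.pol_integrable_power in auto)
  also have "\<dots> = 2 * EE (\<lambda>x. (A x)\<^sup>2) + 2 * EE (\<lambda>x. (B x)\<^sup>2)" using i by simp
  finally show ?thesis .
qed

lemma CC_add: "F \<in> CC k \<Longrightarrow> G \<in> CC k \<Longrightarrow> (\<lambda>n x. F n x + G n x) \<in> CC k"
proof -
  assume F: "F \<in> CC k" and G: "G \<in> CC k"
  from CC_bound[OF F] CC_bound[OF G] obtain B B' where B: "\<And>n. EE (\<lambda>x. (F n x)\<^sup>2) \<le> B" "\<And>n. EE (\<lambda>x. (G n x)\<^sup>2) \<le> B'" by blast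
  show ?thesis
  proof (rule CC_I)
    show "(\<lambda>x. F n x + G n x) \<in> pol UNIV k" for n by (intro pol_add CC_pol F G)
    show "EE (\<lambda>x. (F n x + G n x)\<^sup>2) \<le> 2 * B + 2 * B'" for n
      using L2_add_le[OF CC_pol[OF F, of n] CC_pol[OF G, of n]] B[of n] by linarith
  qed
qed

lemma CC_scale: "F \<in> CC k \<Longrightarrow> (\<lambda>n x. c * F n x) \<in> CC k"
proof -
  assume F: "F \<in> CC k"
  from CC_bound[OF F] obtain B where B: "\<And>n. EE (\<lambda>x. (F n x)\<^sup>2) \<le> B" by blast
  show ?thesis
  proof (rule CC_I)
    show "(\<lambda>x. c * F n x) \<in> pol UNIV k" for n by (intro pol_scale CC_pol F)
    show "EE (\<lambda>x. (c * F n x)\<^sup>2) \<le> c\<^sup>2 * B" for n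
      using mult_left_mono[OF B[of n], of "c\<^sup>2"] by (simp add: power_mult_distrib)
  qed
qed

lemma CC_diff: "F \<in> CC k \<Longrightarrow> G \<in> CC k \<Longrightarrow> (\<lambda>n x. F n x - G n x) \<in> CC k"
  using CC_add[OF _ CC_scale[of G k "-1"]] by simp

lemma fin_range: "finite (range (\<lambda>_::nat. \<mu>))" by simp

lemma mult_L2:
  obtains C where "C \<ge> 0" "\<And>A B. A \<in> pol UNIV k \<Longrightarrow> B \<in> pol UNIV k \<Longrightarrow>
     EE (\<lambda>x. (A x * B x)\<^sup>2) \<le> C * EE (\<lambda>x. (A x)\<^sup>2) * EE (\<lambda>x. (B x)\<^sup>2)"
  by (rule X.pol_mult_L2[OF fin_range, of k]) (rule that)

text \<open>Hypercontractivity is what keeps a product of L^2-bounded sequences bounded in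
  L^2.\<close>

lemma CC_mult: "F \<in> CC a \<Longrightarrow> G \<in> CC b \<Longrightarrow> (\<lambda>n x. F n x * G n x) \<in> CC (a + b)"
proof -
  assume F: "F \<in> CC a" and G: "G \<in> CC b"
  from CC_bound[OF F] CC_bound[OF G] obtain B B' where B: "B \<ge> 0" "\<And>n. EE (\<lambda>x. (F n x)\<^sup>2) \<le> B" "\<And>n. EE (\<lambda>x. (G n x)\<^sup>2) \<le> B'" by blast
  obtain C where C: "C \<ge> 0" "\<And>A B. A \<in> pol UNIV (max a b) \<Longrightarrow> B \<in> pol UNIV (max a b) \<Longrightarrow>
     EE (\<lambda>x. (A x * B x)\<^sup>2) \<le> C * EE (\<lambda>x. (A x)\<^sup>2) * EE (\<lambda>x. (B x)\<^sup>2)" by (rule mult_L2) (rule that)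
  show ?thesis
  proof (rule CC_I)
    show "(\<lambda>x. F n x * G n x) \<in> pol UNIV (a + b)" for n by (intro pol_mult CC_pol F G)
    show "EE (\<lambda>x. (F n x * G n x)\<^sup>2) \<le> C * B * B'" for n
    proof -
      have "EE (\<lambda>x. (F n x * G n x)\<^sup>2) \<le> C * EE (\<lambda>x. (F n x)\<^sup>2) * EE (\<lambda>x. (G n x)\<^sup>2)"
        by (intro C pol_mono[OF CC_pol[OF F]] pol_mono[OF CC_pol[OF G]]) auto
      also have "\<dots> \<le> C * B * B'"
        using B C(1) by (intro mult_mono mult_left_mono) (auto intro!: integral_nonneg_AE)
      finally show ?thesis .
    qed
  qed
qed

lemma CC_var: "(\<lambda>n x. x (J n)) \<in> CC 1"
proof (rule CC_I)
  show "(\<lambda>x. x (J n)) \<in> pol UNIV 1" for n by (rule pol_coord) auto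
  show "EE (\<lambda>x. (x (J n))\<^sup>2) \<le> (\<integral>y. y\<^sup>2 \<partial>\<mu>)" for n
    using X.E_coord(1)[of "\<lambda>y. y\<^sup>2" "J n"] by simp
qed

text \<open>Inner product of the ultraproduct. It is only positive semidefinite, since sequences at
  distance 0 along U are not identified.\<close>

definition ip :: "(nat \<Rightarrow> (nat \<Rightarrow> real) \<Rightarrow> real) \<Rightarrow> (nat \<Rightarrow> (nat \<Rightarrow> real) \<Rightarrow> real) \<Rightarrow> real" where
  "ip F G = Lim U (\<lambda>n. EE (\<lambda>x. F n x * G n x))"

lemma ip_tendsto:
  assumes F: "F \<in> CC k" and G: "G \<in> CC k'"
  shows "((\<lambda>n. EE (\<lambda>x. F n x * G n x)) \<longlongrightarrow> ip F G) U"
proof -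
  from CC_bound[OF F] CC_bound[OF G] obtain B B' where B: "\<And>n. EE (\<lambda>x. (F n x)\<^sup>2) \<le> B" "\<And>n. EE (\<lambda>x. (G n x)\<^sup>2) \<le> B'" by blast
  have "\<bar>EE (\<lambda>x. F n x * G n x)\<bar> \<le> sqrt B * sqrt B'" for n
    by (rule order_trans[OF X.pol_Cauchy_Schwarz(2)[OF CC_pol[OF F] CC_pol[OF G]]])
       (intro mult_mono real_sqrt_le_mono B, auto intro!: integral_nonneg_AE order_trans[OF _ B(1)[of n]])
  then have "\<exists>l. ((\<lambda>n. EE (\<lambda>x. F n x * G n x)) \<longlongrightarrow> l) U" by (intro ultra_convergent always_eventually) auto
  then show ?thesis unfolding ip_def using tendsto_Lim[OF U_bot] by blast
qed

lemma ip_eqI: "((\<lambda>n. EE (\<lambda>x. F n x * G n x)) \<longlongrightarrow> l) U \<Longrightarrow> ip F G = l"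
  unfolding ip_def using tendsto_Lim[OF U_bot] by blast

lemma CC_int: "F \<in> CC k \<Longrightarrow> G \<in> CC k' \<Longrightarrow> integrable X.P (\<lambda>x. F n x * G n x)"
  using X.pol_integrable_mult CC_pol by blast

lemma ip_add: "F \<in> CC k \<Longrightarrow> G \<in> CC k \<Longrightarrow> H \<in> CC k' \<Longrightarrow> ip (\<lambda>n x. F n x + G n x) H = ip F H + ip G H"
proof (rule ip_eqI)
  assume a: "F \<in> CC k" "G \<in> CC k" "H \<in> CC k'"
  have "EE (\<lambda>x. (F n x + G n x) * H n x) = EE (\<lambda>x. F n x * H n x) + EE (\<lambda>x. G n x * H n x)" for n
    using CC_int[OF a(1,3)] CC_int[OF a(2,3)] by (simp add: distrib_right)
  then show "((\<lambda>n. EE (\<lambda>x. (F n x + G n x) * H n x)) \<longlongrightarrow> ip F H + ip G H) U"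
    using tendsto_add[OF ip_tendsto[OF a(1,3)] ip_tendsto[OF a(2,3)]] by simp
qed

lemma ip_scale: "F \<in> CC k \<Longrightarrow> H \<in> CC k' \<Longrightarrow> ip (\<lambda>n x. c * F n x) H = c * ip F H"
proof (rule ip_eqI)
  assume a: "F \<in> CC k" "H \<in> CC k'"
  show "((\<lambda>n. EE (\<lambda>x. c * F n x * H n x)) \<longlongrightarrow> c * ip F H) U"
    using tendsto_mult_left[OF ip_tendsto[OF a], of c] by (simp add: mult.assoc)
qed

lemma ip_sym: "ip F G = ip G F"
  by (simp add: ip_def mult.commute)

lemma ip_nonneg: "F \<in> CC k \<Longrightarrow> ip F F \<ge> 0"
  by (rule tendsto_lowerbound[OF ip_tendsto _ U_bot]) (auto intro!: always_eventually integral_nonneg_AE)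

lemma ip_sum:
  assumes "\<And>t. t \<in> T \<Longrightarrow> F t \<in> CC k" "H \<in> CC k'"
  shows "(\<lambda>n x. \<Sum>t\<in>T. F t n x) \<in> CC k \<and> ip (\<lambda>n x. \<Sum>t\<in>T. F t n x) H = (\<Sum>t\<in>T. ip (F t) H)"
  using assms(1)
proof (induction T rule: infinite_finite_induct)
  case (insert t T)
  then show ?case using CC_add[of "F t" k "\<lambda>n x. \<Sum>t\<in>T. F t n x"] ip_add[of "F t" k "\<lambda>n x. \<Sum>t\<in>T. F t n x" H k'] assms(2) by simp
qed (auto simp: CC_const intro!: ip_eqI)

text \<open>The generators of the second kind. Total degree exactly \<open>k\<close> in the first
  condition also covers smaller total degrees, because \<open>CC\<close> grows with the degree; the
  power \<open>l = 0\<close> in the second makes the sequence asymptotically centred.\<close>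

definition HH :: "nat \<Rightarrow> (nat \<Rightarrow> (nat \<Rightarrow> real) \<Rightarrow> real) set" where
  "HH k = {R \<in> CC k.
     (\<forall>a b G H. 1 \<le> a \<longrightarrow> 1 \<le> b \<longrightarrow> a + b = k \<longrightarrow> G \<in> CC a \<longrightarrow> H \<in> CC b \<longrightarrow>
        ((\<lambda>n. EE (\<lambda>x. R n x * (G n x * H n x))) \<longlongrightarrow> 0) U) \<and>
     (\<forall>J l. l \<le> k \<longrightarrow> ((\<lambda>n. EE (\<lambda>x. R n x * x (J n) ^ l)) \<longlongrightarrow> 0) U)}"

text \<open>The algebra generated by both kinds of generators, each counted with its own degree.
  This formal degree bounds the degree in the X_j (\<open>AA_CC\<close>) as well as the degree as a
  polynomial in the generators (\<open>AA_pol\<close>).\<close>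

inductive AA :: "nat \<Rightarrow> (nat \<Rightarrow> (nat \<Rightarrow> real) \<Rightarrow> real) \<Rightarrow> bool" where
  AA_const: "AA k (\<lambda>n x. c)"
| AA_var: "AA 1 (\<lambda>n x. x (J n))"
| AA_gen: "R \<in> HH k \<Longrightarrow> 1 \<le> k \<Longrightarrow> AA k R"
| AA_add: "AA k A \<Longrightarrow> AA k B \<Longrightarrow> AA k (\<lambda>n x. A n x + B n x)"
| AA_mult: "AA a A \<Longrightarrow> AA b B \<Longrightarrow> AA (a + b) (\<lambda>n x. A n x * B n x)"
| AA_mono: "AA k A \<Longrightarrow> k \<le> k' \<Longrightarrow> AA k' A"

lemma AA_CC: "AA k A \<Longrightarrow> A \<in> CC k"
  by (induction rule: AA.induct) (auto intro: CC_const CC_var[simplified] CC_add CC_mult CC_mono simp: HH_def)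

lemma AA_scale: "AA k A \<Longrightarrow> AA k (\<lambda>n x. c * A n x)"
  using AA_mult[OF AA_const[of 0 c]] by simp

lemma AA_power: "AA l (\<lambda>n x. x (J n) ^ l)"
proof (induction l)
  case 0
  then show ?case by (simp add: AA_const)
next
  case (Suc l)
  then show ?case using AA_mult[OF AA_var[of J] Suc] by simp
qed

definition clA :: "nat \<Rightarrow> (nat \<Rightarrow> (nat \<Rightarrow> real) \<Rightarrow> real) set" where
  "clA k = {F. \<forall>\<epsilon>>0. \<exists>A. AA k A \<and> (\<forall>\<^sub>F n in U. EE (\<lambda>x. (F n x - A n x)\<^sup>2) < \<epsilon>)}"

text \<open>In degree 0 the sequence consists of bounded constants, and their ultralimit is the
  approximant.\<close>

lemma density_0:
  assumes F: "F \<in> CC 0"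
  shows "F \<in> clA 0"
proof -
  have "\<forall>n. \<exists>c. F n = (\<lambda>_. c)" using CC_pol[OF F] pol_degree_0 by blast
  then obtain c where c: "\<And>n. F n = (\<lambda>_. c n)" by metis
  from CC_bound[OF F] obtain B where B: "B \<ge> 0" "\<And>n. EE (\<lambda>x. (F n x)\<^sup>2) \<le> B" by blast
  have "\<bar>c n\<bar> \<le> sqrt B" for n using B(2)[of n] by (simp add: c real_le_rsqrt)
  then obtain l where l: "(c \<longlongrightarrow> l) U" using ultra_convergent[of c "sqrt B"] by auto
  show ?thesis unfolding clA_def
  proof (intro CollectI allI impI exI conjI)
    fix \<epsilon> :: real assume "\<epsilon> > 0"
    show "AA 0 (\<lambda>n x. l)" by (rule AA_const)
    have "((\<lambda>n. (c n - l)\<^sup>2) \<longlongrightarrow> 0) U" using l by (auto intro!: tendsto_eq_intros)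
    then have "\<forall>\<^sub>F n in U. (c n - l)\<^sup>2 < \<epsilon>" using \<open>\<epsilon> > 0\<close> by (rule order_tendstoD)
    then show "\<forall>\<^sub>F n in U. EE (\<lambda>x. (F n x - l)\<^sup>2) < \<epsilon>" by (simp add: c)
  qed
qed

text \<open>Orthogonality passes from products within the algebra to products of limits of it,
  because multiplication is continuous in L^2 for bounded degree.\<close>

lemma orth_products:
  assumes R: "R \<in> CC k" and o: "\<And>A. AA k A \<Longrightarrow> ip R A = 0"
    and G: "G \<in> clA a" "G \<in> CC a" and H: "H \<in> clA b" "H \<in> CC b" and ab: "a + b = k"
  shows "((\<lambda>n. EE (\<lambda>x. R n x * (G n x * H n x))) \<longlongrightarrow> 0) U"
proof -
  have GH: "(\<lambda>n x. G n x * H n x) \<in> CC k" using CC_mult[OF G(2) H(2)] ab by simp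
  have lim: "((\<lambda>n. EE (\<lambda>x. R n x * (G n x * H n x))) \<longlongrightarrow> ip R (\<lambda>n x. G n x * H n x)) U"
    by (rule ip_tendsto[OF R GH])
  obtain C where C: "C \<ge> 0" "\<And>A B. A \<in> pol UNIV (max a b) \<Longrightarrow> B \<in> pol UNIV (max a b) \<Longrightarrow>
     EE (\<lambda>x. (A x * B x)\<^sup>2) \<le> C * EE (\<lambda>x. (A x)\<^sup>2) * EE (\<lambda>x. (B x)\<^sup>2)" by (rule mult_L2) (rule that)
  from CC_bound[OF R] obtain BR where BR: "BR \<ge> 0" "\<And>n. EE (\<lambda>x. (R n x)\<^sup>2) \<le> BR" by blast
  from CC_bound[OF H(2)] obtain BH where BH: "BH \<ge> 0" "\<And>n. EE (\<lambda>x. (H n x)\<^sup>2) \<le> BH" by blast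
  have "\<bar>ip R (\<lambda>n x. G n x * H n x)\<bar> \<le> t" if t: "t > 0" for t
  proof -
    \<comment> \<open>\<open>e1\<close> is matched to bounds for R and H that are known in advance;
      \<open>e2\<close> has to wait for the choice of G', whose bound it involves.\<close>
    define e1 where "e1 = (t / 2)\<^sup>2 / (BR * (C * BH) + 1)"
    have p1: "BR * (C * BH) + 1 > 0" using BR(1) BH(1) C(1) by (simp add: add_nonneg_pos)
    have e1: "e1 > 0" unfolding e1_def using t p1 by simp
    obtain G' where G': "AA a G'" "\<forall>\<^sub>F n in U. EE (\<lambda>x. (G n x - G' n x)\<^sup>2) < e1" using G(1) e1 by (auto simp: clA_def)
    note G'C = AA_CC[OF G'(1)]
    from CC_bound[OF G'C] obtain BG where BG: "BG \<ge> 0" "\<And>n. EE (\<lambda>x. (G' n x)\<^sup>2) \<le> BG" by blast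
    define e2 where "e2 = (t / 2)\<^sup>2 / (BR * (C * BG) + 1)"
    have p2: "BR * (C * BG) + 1 > 0" using BR(1) BG(1) C(1) by (simp add: add_nonneg_pos)
    have e2: "e2 > 0" unfolding e2_def using t p2 by simp
    obtain H' where H': "AA b H'" "\<forall>\<^sub>F n in U. EE (\<lambda>x. (H n x - H' n x)\<^sup>2) < e2" using H(1) e2 by (auto simp: clA_def)
    note H'C = AA_CC[OF H'(1)]
    have "AA k (\<lambda>n x. G' n x * H' n x)" using AA_mult[OF G'(1) H'(1)] ab by simp
    note A = this
    have l0: "((\<lambda>n. EE (\<lambda>x. R n x * (G' n x * H' n x))) \<longlongrightarrow> 0) U"
      using ip_tendsto[OF R AA_CC[OF A]] o[OF A] by simp
    have d1: "(\<lambda>n x. G n x - G' n x) \<in> CC a" and d2: "(\<lambda>n x. H n x - H' n x) \<in> CC b"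
      by (intro CC_diff G H G'C H'C)+
    have cs: "\<bar>EE (\<lambda>x. R n x * (A x * B x))\<bar> \<le> t / 2"
      if A: "A \<in> pol UNIV a" and B: "B \<in> pol UNIV b" and bd: "EE (\<lambda>x. (A x)\<^sup>2) * EE (\<lambda>x. (B x)\<^sup>2) * (BR * C) \<le> (t / 2)\<^sup>2" for A B n
    proof -
      have "(EE (\<lambda>x. R n x * (A x * B x)))\<^sup>2 \<le> EE (\<lambda>x. (R n x)\<^sup>2) * EE (\<lambda>x. (A x * B x)\<^sup>2)"
        by (rule X.pol_Cauchy_Schwarz(1)[OF CC_pol[OF R] pol_mult[OF A B]])
      also have "\<dots> \<le> BR * (C * EE (\<lambda>x. (A x)\<^sup>2) * EE (\<lambda>x. (B x)\<^sup>2))"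
        by (intro mult_mono BR C pol_mono[OF A] pol_mono[OF B]) (auto intro!: integral_nonneg_AE)
      also have "\<dots> \<le> (t / 2)\<^sup>2" using bd by (simp add: mult_ac)
      finally show ?thesis using t by (simp add: abs_le_square_iff[symmetric])
    qed
    have "\<forall>\<^sub>F n in U. \<bar>EE (\<lambda>x. R n x * (G n x * H n x)) - EE (\<lambda>x. R n x * (G' n x * H' n x))\<bar> \<le> t"
      using G'(2) H'(2)
    proof eventually_elim
      case (elim n)
      have "EE (\<lambda>x. R n x * (G n x * H n x)) - EE (\<lambda>x. R n x * (G' n x * H' n x)) =
         EE (\<lambda>x. R n x * (G n x * H n x) - R n x * (G' n x * H' n x))"
        using CC_int[OF R GH] CC_int[OF R AA_CC[OF A]] by simp
      also have "\<dots> = EE (\<lambda>x. R n x * ((G n x - G' n x) * H n x) + R n x * (G' n x * (H n x - H' n x)))"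
        by (intro Bochner_Integration.integral_cong refl) (simp add: algebra_simps)
      also have "\<dots> = EE (\<lambda>x. R n x * ((G n x - G' n x) * H n x)) + EE (\<lambda>x. R n x * (G' n x * (H n x - H' n x)))"
        using CC_int[OF R CC_mult[OF d1 H(2)]] CC_int[OF R CC_mult[OF G'C d2]] by simp
      finally have eq: "EE (\<lambda>x. R n x * (G n x * H n x)) - EE (\<lambda>x. R n x * (G' n x * H' n x)) =
         EE (\<lambda>x. R n x * ((G n x - G' n x) * H n x)) + EE (\<lambda>x. R n x * (G' n x * (H n x - H' n x)))" .
      have "EE (\<lambda>x. (G n x - G' n x)\<^sup>2) * EE (\<lambda>x. (H n x)\<^sup>2) * (BR * C) \<le> e1 * BH * (BR * C)"
        using elim e1 BH BR C by (intro mult_right_mono mult_mono) (auto intro!: integral_nonneg_AE)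
      also have "\<dots> \<le> e1 * (BR * (C * BH) + 1)" using e1 by (simp add: algebra_simps)
      also have "\<dots> = (t / 2)\<^sup>2" using p1 by (simp add: e1_def)
      finally have 1: "\<bar>EE (\<lambda>x. R n x * ((G n x - G' n x) * H n x))\<bar> \<le> t / 2"
        by (intro cs CC_pol[OF d1] CC_pol[OF H(2)])
      have "EE (\<lambda>x. (G' n x)\<^sup>2) * EE (\<lambda>x. (H n x - H' n x)\<^sup>2) * (BR * C) \<le> BG * e2 * (BR * C)"
        using elim e2 BG BR C by (intro mult_right_mono mult_mono) (auto intro!: integral_nonneg_AE)
      also have "\<dots> \<le> e2 * (BR * (C * BG) + 1)" using e2 by (simp add: algebra_simps)
      also have "\<dots> = (t / 2)\<^sup>2" using p2 by (simp add: e2_def)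
      finally have 2: "\<bar>EE (\<lambda>x. R n x * (G' n x * (H n x - H' n x)))\<bar> \<le> t / 2"
        by (intro cs CC_pol[OF G'C] CC_pol[OF d2])
      show ?case unfolding eq using 1 2 by linarith
    qed
    then show ?thesis
      using tendsto_upperbound[OF tendsto_rabs[OF tendsto_diff[OF lim l0]] _ U_bot, of t] by simp
  qed
  then have "ip R (\<lambda>n x. G n x * H n x) = 0" by (meson abs_le_zero_iff field_le_epsilon add_0 order_refl dense_ge)
  then show ?thesis using lim by simp
qed

text \<open>Strong induction on the degree. R represents the limit of the residuals F - A i of a
  minimising sequence and is orthogonal to the algebra. Factors of degrees a, b \<ge> 1 with a + b =
  k are approximable by the induction hypothesis, so \<open>orth_products\<close> puts R into
  \<open>HH k\<close>, and A i + R approximates F from within the algebra.\<close>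

theorem density: "F \<in> CC k \<Longrightarrow> F \<in> clA k"
proof (induction k arbitrary: F rule: less_induct)
  case (less k)
  show ?case
  proof (cases "k = 0")
    case True
    then show ?thesis using density_0 less.prems by simp
  next
    case False
    note F = less.prems
    define dst where "dst A = ip (\<lambda>n x. F n x - A n x) (\<lambda>n x. F n x - A n x)" for A
    define \<delta> where "\<delta> = Inf (dst ` {A. AA k A})"
    have FA: "(\<lambda>n x. F n x - A n x) \<in> CC k" if "AA k A" for A by (intro CC_diff F AA_CC that)
    have ne: "dst ` {A. AA k A} \<noteq> {}" using AA_const[of k 0] by blast
    have bb: "bdd_below (dst ` {A. AA k A})" by (rule bdd_belowI[of _ 0]) (auto simp: dst_def intro!: ip_nonneg FA)
    have \<delta>: "\<delta> \<le> dst A" if "AA k A" for A unfolding \<delta>_def using bb that by (intro cInf_lower) auto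
    have "\<forall>i::nat. \<exists>A. AA k A \<and> dst A < \<delta> + 1 / real (Suc i)"
    proof
      fix i :: nat
      have "Inf (dst ` {A. AA k A}) < \<delta> + 1 / real (Suc i)" unfolding \<delta>_def by simp
      then show "\<exists>A. AA k A \<and> dst A < \<delta> + 1 / real (Suc i)" using cInf_lessD[OF ne] by blast
    qed
    then obtain A where A: "\<And>i. AA k (A i)" "\<And>i. dst (A i) < \<delta> + 1 / real (Suc i)" by metis
    note AC = AA_CC[OF A(1)]
    have dlim: "((\<lambda>n. EE (\<lambda>x. (F n x - B n x)\<^sup>2)) \<longlongrightarrow> dst B) U" if "AA k B" for B
      using ip_tendsto[OF FA[OF that] FA[OF that]] by (simp add: dst_def power2_eq_square)
    let ?D = "\<lambda>i n x. F n x - A i n x"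
    have close: "\<forall>\<^sub>F n in U. EE (\<lambda>x. (A i n x - A N n x)\<^sup>2) \<le> 5 / real (Suc i)" if "i \<le> N" for i N
    proof -
      \<comment> \<open>Midpoint for the parallelogram identity: its distance to F is at least the
        infimum, so two nearly minimising sequences are close to each other.\<close>
      define M where "M = (\<lambda>n x. (1/2) * A i n x + (1/2) * A N n x)"
      have M: "AA k M" unfolding M_def by (intro AA_add AA_scale A)
      have eq: "EE (\<lambda>x. (A i n x - A N n x)\<^sup>2) = 2 * EE (\<lambda>x. (?D i n x)\<^sup>2) + 2 * EE (\<lambda>x. (?D N n x)\<^sup>2) - 4 * EE (\<lambda>x. (F n x - M n x)\<^sup>2)" for n
      proof -
        have sq: "integrable X.P (\<lambda>x. (F n x - B n x)\<^sup>2)" if "AA k B" for B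
          using CC_int[OF FA[OF that] FA[OF that], of n] by (simp add: power2_eq_square)
        have "EE (\<lambda>x. (A i n x - A N n x)\<^sup>2) = EE (\<lambda>x. 2 * (?D i n x)\<^sup>2 + 2 * (?D N n x)\<^sup>2 - 4 * (F n x - M n x)\<^sup>2)"
          by (intro Bochner_Integration.integral_cong refl) (simp add: M_def power2_eq_square field_simps)
        also have "\<dots> = 2 * EE (\<lambda>x. (?D i n x)\<^sup>2) + 2 * EE (\<lambda>x. (?D N n x)\<^sup>2) - 4 * EE (\<lambda>x. (F n x - M n x)\<^sup>2)"
          using sq[OF A(1)] sq[OF M] by simp
        finally show ?thesis .
      qed
      have "((\<lambda>n. EE (\<lambda>x. (A i n x - A N n x)\<^sup>2)) \<longlongrightarrow> 2 * dst (A i) + 2 * dst (A N) - 4 * dst M) U"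
        unfolding eq by (intro tendsto_intros dlim A M)
      moreover have "2 * dst (A i) + 2 * dst (A N) - 4 * dst M < 5 / real (Suc i)"
      proof -
        have "1 / real (Suc N) \<le> 1 / real (Suc i)" using that by (intro divide_left_mono) auto
        then have "2 * dst (A i) + 2 * dst (A N) - 4 * dst M < 4 * (1 / real (Suc i))"
          using A(2)[of i] A(2)[of N] \<delta>[OF M] by linarith
        also have "\<dots> \<le> 5 / real (Suc i)" by (simp add: field_simps)
        finally show ?thesis .
      qed
      ultimately show ?thesis by (auto dest: order_tendstoD(2) elim!: eventually_mono)
    qed
    \<comment> \<open>Condition i asks for closeness to F - A i. Finitely many conditions are met at
      once by F - A N with N the largest index involved.\<close>
    define Q where "Q i n z \<longleftrightarrow> z \<in> pol UNIV k \<and> EE (\<lambda>x. (z x - ?D i n x)\<^sup>2) \<le> 5 / real (Suc i)" for i n z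
    have "\<exists>Z. \<forall>i. \<forall>\<^sub>F n in U. Q i n (Z n)"
    proof (rule saturation)
      fix N
      have "\<forall>\<^sub>F n in U. \<forall>i\<in>{..N}. EE (\<lambda>x. (A i n x - A N n x)\<^sup>2) \<le> 5 / real (Suc i)"
        by (rule eventually_ball_finite) (use close in \<open>auto simp del: of_nat_Suc\<close>)
      then show "\<forall>\<^sub>F n in U. \<exists>z. \<forall>i\<le>N. Q i n z"
      proof eventually_elim
        case (elim n)
        show ?case
        proof (intro exI allI impI)
          fix i assume "i \<le> N"
          then show "Q i n (\<lambda>x. F n x - A N n x)" unfolding Q_def
            using elim CC_pol[OF FA[OF A(1)], of n N] by auto
        qed
      qed
    qed
    then obtain Z where Z: "\<And>i. \<forall>\<^sub>F n in U. Q i n (Z n)" by blast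
    from CC_bound[OF FA[OF A(1)[of 0]]] obtain B where B: "B \<ge> 0" "\<And>n. EE (\<lambda>x. (?D 0 n x)\<^sup>2) \<le> B" by blast
    \<comment> \<open>Indices at which already condition 0 fails get the value 0; this keeps the L^2
      bound valid at every n.\<close>
    define R where "R n = (if Q 0 n (Z n) then Z n else (\<lambda>_. 0))" for n
    have RQ: "\<forall>\<^sub>F n in U. Q i n (R n)" for i
      using Z[of i] Z[of 0] by eventually_elim (simp add: R_def)
    have R: "R \<in> CC k"
    proof (rule CC_I)
      show Rp: "R n \<in> pol UNIV k" for n by (auto simp: R_def Q_def pol_const)
      show "EE (\<lambda>x. (R n x)\<^sup>2) \<le> 10 + 2 * B" for n
      proof (cases "Q 0 n (Z n)")
        case True
        then have q: "EE (\<lambda>x. (R n x - ?D 0 n x)\<^sup>2) \<le> 5" by (simp add: R_def Q_def)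
        have "EE (\<lambda>x. ((R n x - ?D 0 n x) + ?D 0 n x)\<^sup>2) \<le> 2 * EE (\<lambda>x. (R n x - ?D 0 n x)\<^sup>2) + 2 * EE (\<lambda>x. (?D 0 n x)\<^sup>2)"
          by (rule L2_add_le[of _ k _ k]) (intro pol_diff Rp CC_pol[OF FA[OF A(1)]] CC_pol[OF F] CC_pol[OF AC])+
        then show ?thesis using q B(2)[of n] by simp
      next
        case False
        then show ?thesis using B(1) by (simp add: R_def)
      qed
    qed
    have orth: "ip R W = 0" if W: "AA k W" for W
    proof -
      note WC = AA_CC[OF W]
      define c where "c = ip W W"
      have c0: "c \<ge> 0" unfolding c_def by (rule ip_nonneg[OF WC])
      \<comment> \<open>A i is within 1/(i+1) of the infimum, so adding t W gains no more than that;
        the best t bounds the inner product of the residual with W.\<close>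
      have bi: "(ip (?D i) W)\<^sup>2 \<le> c / real (Suc i)" for i
      proof -
        define b where "b = ip (?D i) W"
        note FAi = FA[OF A(1)[of i]]
        have q: "2 * t * b - t\<^sup>2 * c \<le> 1 / real (Suc i)" for t
        proof -
          have AW: "AA k (\<lambda>n x. A i n x + t * W n x)" by (intro AA_add AA_scale A W)
          have "EE (\<lambda>x. (F n x - (A i n x + t * W n x))\<^sup>2) =
              EE (\<lambda>x. ?D i n x * ?D i n x) - 2 * t * EE (\<lambda>x. ?D i n x * W n x) + t\<^sup>2 * EE (\<lambda>x. W n x * W n x)" for n
          proof -
            have "EE (\<lambda>x. (F n x - (A i n x + t * W n x))\<^sup>2) =
               EE (\<lambda>x. ?D i n x * ?D i n x - 2 * t * (?D i n x * W n x) + t\<^sup>2 * (W n x * W n x))"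
              by (intro Bochner_Integration.integral_cong refl) (simp add: power2_eq_square algebra_simps)
            then show ?thesis using CC_int[OF FAi FAi] CC_int[OF FAi WC] CC_int[OF WC WC] by simp
          qed
          then have "((\<lambda>n. EE (\<lambda>x. (F n x - (A i n x + t * W n x))\<^sup>2)) \<longlongrightarrow> dst (A i) - 2 * t * b + t\<^sup>2 * c) U"
            unfolding dst_def b_def c_def by (simp only:) (intro tendsto_intros ip_tendsto[OF FAi FAi] ip_tendsto[OF FAi WC] ip_tendsto[OF WC WC])
          then have "dst (\<lambda>n x. A i n x + t * W n x) = dst (A i) - 2 * t * b + t\<^sup>2 * c"
            using dlim[OF AW] tendsto_unique[OF U_bot] by blast
          then show ?thesis using \<delta>[OF AW] A(2)[of i] by simp
        qed
        show ?thesis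
        proof (cases "c = 0")
          case True
          have "b = 0"
          proof (rule ccontr)
            assume "b \<noteq> 0"
            then show False using q[of "1 / b"] True by (simp add: field_simps)
          qed
          then show ?thesis using True by (simp add: b_def)
        next
          case False
          then have "c > 0" using c0 by simp
          have "2 * (b / c) * b - (b / c)\<^sup>2 * c \<le> 1 / real (Suc i)" by (rule q)
          also have "2 * (b / c) * b - (b / c)\<^sup>2 * c = b\<^sup>2 / c" using False by (simp add: power2_eq_square field_simps)
          finally have "b\<^sup>2 / c * c \<le> 1 / real (Suc i) * c" using \<open>c > 0\<close> by (intro mult_right_mono) auto
          then show ?thesis using False by (simp add: b_def)
        qed
      qed
      have di: "(ip R W - ip (?D i) W)\<^sup>2 \<le> 5 / real (Suc i) * c" for i
      proof -
        note FAi = FA[OF A(1)[of i]]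
        have "\<forall>\<^sub>F n in U. (EE (\<lambda>x. R n x * W n x) - EE (\<lambda>x. ?D i n x * W n x))\<^sup>2 \<le> 5 / real (Suc i) * EE (\<lambda>x. W n x * W n x)"
          using RQ[of i]
        proof eventually_elim
          case (elim n)
          have "EE (\<lambda>x. R n x * W n x) - EE (\<lambda>x. ?D i n x * W n x) = EE (\<lambda>x. (R n x - ?D i n x) * W n x)"
            unfolding left_diff_distrib[of "R n _"] using CC_int[OF R WC] CC_int[OF FAi WC] by simp
          moreover have "(EE (\<lambda>x. (R n x - ?D i n x) * W n x))\<^sup>2 \<le> EE (\<lambda>x. (R n x - ?D i n x)\<^sup>2) * EE (\<lambda>x. (W n x)\<^sup>2)"
            by (rule X.pol_Cauchy_Schwarz(1)[OF CC_pol[OF CC_diff[OF R FAi]] CC_pol[OF WC]])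
          moreover have "\<dots> \<le> 5 / real (Suc i) * EE (\<lambda>x. (W n x)\<^sup>2)"
            using elim by (intro mult_right_mono) (auto simp: Q_def intro!: integral_nonneg_AE)
          ultimately show ?case by (simp add: power2_eq_square)
        qed
        then show ?thesis unfolding c_def
          by (intro tendsto_le[OF U_bot _ _ ]) (auto intro!: tendsto_intros ip_tendsto R WC FAi)
      qed
      \<comment> \<open>The constant is 2 * 5 + 2 * 1, from the two preceding estimates.\<close>
      have "(ip R W)\<^sup>2 \<le> 12 * c * (1 / real (Suc i))" for i
      proof -
        have "(ip R W)\<^sup>2 \<le> 2 * (ip R W - ip (?D i) W)\<^sup>2 + 2 * (ip (?D i) W)\<^sup>2"
          using sum_squares_bound[of "ip R W - ip (?D i) W" "ip (?D i) W"]
          by (simp add: power2_eq_square algebra_simps)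
        moreover have "2 * (ip R W - ip (?D i) W)\<^sup>2 \<le> 10 * (c * (1 / real (Suc i)))" using di[of i] by simp
        moreover have "2 * (ip (?D i) W)\<^sup>2 \<le> 2 * (c * (1 / real (Suc i)))" using bi[of i] by simp
        ultimately have "(ip R W)\<^sup>2 \<le> 12 * (c * (1 / real (Suc i)))" by argo
        then show ?thesis by (simp only: mult.assoc)
      qed
      moreover have "(\<lambda>i. 12 * c * (1 / real (Suc i))) \<longlonglongrightarrow> 12 * c * 0"
        by (intro tendsto_intros LIMSEQ_Suc lim_1_over_n)
      ultimately have "(ip R W)\<^sup>2 \<le> 0" by (intro LIMSEQ_le_const[of _ 0]) auto
      then show ?thesis by simp
    qed
    have "R \<in> HH k" unfolding HH_def
    proof (intro CollectI conjI allI impI R)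
      fix a b G H assume ab: "1 \<le> a" "1 \<le> b" "a + b = k" and G: "G \<in> CC a" and H: "H \<in> CC b"
      show "((\<lambda>n. EE (\<lambda>x. R n x * (G n x * H n x))) \<longlongrightarrow> 0) U"
        by (rule orth_products[OF R orth less.IH[OF _ G] G less.IH[OF _ H] H ab(3)]) (use ab in auto)
    next
      fix J l assume "l \<le> k"
      then have "AA k (\<lambda>n x. x (J n) ^ l)" using AA_mono[OF AA_power] by blast
      from ip_tendsto[OF R AA_CC[OF this]] orth[OF this]
      show "((\<lambda>n. EE (\<lambda>x. R n x * x (J n) ^ l)) \<longlongrightarrow> 0) U" by simp
    qed
    then have AR: "AA k R" using False by (intro AA_gen) auto
    show ?thesis unfolding clA_def
    proof (intro CollectI allI impI)
      fix \<epsilon> :: real assume "\<epsilon> > 0"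
      then obtain i where i: "5 / \<epsilon> < real i" using reals_Archimedean2 by blast
      then have i5: "5 / real (Suc i) < \<epsilon>" using \<open>\<epsilon> > 0\<close> by (simp add: field_simps)
      show "\<exists>A. AA k A \<and> (\<forall>\<^sub>F n in U. EE (\<lambda>x. (F n x - A n x)\<^sup>2) < \<epsilon>)"
      proof (intro exI conjI)
        show "AA k (\<lambda>n x. A i n x + R n x)" by (intro AA_add A AR)
        show "\<forall>\<^sub>F n in U. EE (\<lambda>x. (F n x - (A i n x + R n x))\<^sup>2) < \<epsilon>"
          using RQ[of i]
        proof eventually_elim
          case (elim n)
          have "(F n x - (A i n x + R n x))\<^sup>2 = (R n x - ?D i n x)\<^sup>2" for x by (simp add: power2_eq_square algebra_simps)
          then show ?case using elim i5 by (simp add: Q_def)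
        qed
      qed
    qed
  qed
qed

end

section \<open>Asymptotic normality of the generators\<close>

lemma cmod_iexp_diff: "cmod (iexp x - iexp y) \<le> \<bar>x - y\<bar>"
proof -
  have "iexp x - iexp y = iexp y * (iexp (x - y) - 1)"
    by (simp add: right_diff_distrib exp_add[symmetric] algebra_simps)
  then have "cmod (iexp x - iexp y) = cmod (iexp (x - y) - 1)" by (simp add: norm_mult del: of_real_diff)
  also have "\<dots> \<le> \<bar>x - y\<bar>" using iexp_approx1[of "x - y" 0] by (simp del: of_real_diff)
  finally show ?thesis .
qed

lemma (in prob_space) iexp_cos_sin:
  assumes [measurable]: "f \<in> borel_measurable M"
  shows "(\<integral>\<omega>. iexp (f \<omega>) \<partial>M) = complex_of_real (\<integral>\<omega>. cos (f \<omega>) \<partial>M) + \<i> * complex_of_real (\<integral>\<omega>. sin (f \<omega>) \<partial>M)"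
proof -
  have i: "integrable M (\<lambda>\<omega>. iexp (f \<omega>))" by (rule integrable_const_bound[of _ 1]) auto
  show ?thesis by (rule complex_eqI) (use integral_Re[OF i] integral_Im[OF i] in \<open>simp_all add: Re_exp Im_exp\<close>)
qed

lemma (in prob_space) L1_le_L2:
  fixes h :: "'a \<Rightarrow> real"
  assumes [measurable]: "h \<in> borel_measurable M"
    and d: "(\<integral>\<^sup>+\<omega>. ennreal ((h \<omega>)\<^sup>2) \<partial>M) \<le> ennreal (\<delta>\<^sup>2)" and \<delta>: "\<delta> \<ge> 0"
  shows "integrable M (\<lambda>\<omega>. \<bar>h \<omega>\<bar>) \<and> (\<integral>\<omega>. \<bar>h \<omega>\<bar> \<partial>M) \<le> \<delta>"
proof -
  have sq: "integrable M (\<lambda>\<omega>. \<bar>h \<omega>\<bar>\<^sup>2)"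
  proof (rule integrableI_bounded)
    have "(\<integral>\<^sup>+\<omega>. ennreal (norm (\<bar>h \<omega>\<bar>\<^sup>2)) \<partial>M) \<le> ennreal (\<delta>\<^sup>2)" using d by simp
    also have "\<dots> < \<infinity>" by simp
    finally show "(\<integral>\<^sup>+\<omega>. ennreal (norm (\<bar>h \<omega>\<bar>\<^sup>2)) \<partial>M) < \<infinity>" .
  qed measurable
  have i: "integrable M (\<lambda>\<omega>. \<bar>h \<omega>\<bar>)" by (rule square_integrable_imp_integrable[OF _ sq]) measurable
  have "ennreal (\<integral>\<omega>. \<bar>h \<omega>\<bar>\<^sup>2 \<partial>M) \<le> ennreal (\<delta>\<^sup>2)"
    using d nn_integral_eq_integral[OF sq] by simp
  then have "(\<integral>\<omega>. \<bar>h \<omega>\<bar>\<^sup>2 \<partial>M) \<le> \<delta>\<^sup>2" by (simp add: ennreal_le_iff)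
  moreover have "(\<integral>\<omega>. \<bar>h \<omega>\<bar> \<partial>M)\<^sup>2 \<le> (\<integral>\<omega>. \<bar>h \<omega>\<bar>\<^sup>2 \<partial>M)"
    using variance_eq[OF i sq] variance_positive[of "\<lambda>\<omega>. \<bar>h \<omega>\<bar>"] by simp
  ultimately have "(\<integral>\<omega>. \<bar>h \<omega>\<bar> \<partial>M) \<le> \<delta>" using \<delta> by (meson order_trans power2_le_imp_le)
  with i show ?thesis by blast
qed

text \<open>The map y \<mapsto> exp(i y) is 1-Lipschitz, so characteristic functions are stable
  under L^2 perturbations. The distance is a nonnegative integral, as in
  \<open>poly_chaos\<close>.\<close>

lemma (in prob_space) iexp_sum_close:
  fixes f g :: "'i \<Rightarrow> 'a \<Rightarrow> real"
  assumes [measurable]: "\<And>i. f i \<in> borel_measurable M" "\<And>i. g i \<in> borel_measurable M"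
    and d: "\<And>i. i \<in> T \<Longrightarrow> (\<integral>\<^sup>+\<omega>. ennreal ((f i \<omega> - g i \<omega>)\<^sup>2) \<partial>M) \<le> ennreal (\<delta>\<^sup>2)" and \<delta>: "\<delta> \<ge> 0"
  shows "cmod ((\<integral>\<omega>. iexp (\<Sum>i\<in>T. \<tau> i * f i \<omega>) \<partial>M) - (\<integral>\<omega>. iexp (\<Sum>i\<in>T. \<tau> i * g i \<omega>) \<partial>M)) \<le> (\<Sum>i\<in>T. \<bar>\<tau> i\<bar>) * \<delta>"
proof -
  have L1: "integrable M (\<lambda>\<omega>. \<bar>f i \<omega> - g i \<omega>\<bar>) \<and> (\<integral>\<omega>. \<bar>f i \<omega> - g i \<omega>\<bar> \<partial>M) \<le> \<delta>" if i: "i \<in> T" for i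
    using L1_le_L2[OF _ d[OF i] \<delta>] by measurable
  have int: "integrable M (\<lambda>\<omega>. iexp (\<Sum>i\<in>T. \<tau> i * u i \<omega>))" if [measurable]: "\<And>i. u i \<in> borel_measurable M" for u :: "'i \<Rightarrow> 'a \<Rightarrow> real"
    by (rule integrable_const_bound[of _ 1]) auto
  have "cmod ((\<integral>\<omega>. iexp (\<Sum>i\<in>T. \<tau> i * f i \<omega>) \<partial>M) - (\<integral>\<omega>. iexp (\<Sum>i\<in>T. \<tau> i * g i \<omega>) \<partial>M)) =
     cmod (\<integral>\<omega>. iexp (\<Sum>i\<in>T. \<tau> i * f i \<omega>) - iexp (\<Sum>i\<in>T. \<tau> i * g i \<omega>) \<partial>M)"
    using int[of f] int[of g] by (subst Bochner_Integration.integral_diff) auto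
  also have "\<dots> \<le> (\<integral>\<omega>. cmod (iexp (\<Sum>i\<in>T. \<tau> i * f i \<omega>) - iexp (\<Sum>i\<in>T. \<tau> i * g i \<omega>)) \<partial>M)"
    by (rule integral_norm_bound)
  also have "\<dots> \<le> (\<integral>\<omega>. (\<Sum>i\<in>T. \<bar>\<tau> i\<bar> * \<bar>f i \<omega> - g i \<omega>\<bar>) \<partial>M)"
  proof (rule integral_mono)
    fix \<omega>
    have "cmod (iexp (\<Sum>i\<in>T. \<tau> i * f i \<omega>) - iexp (\<Sum>i\<in>T. \<tau> i * g i \<omega>)) \<le> \<bar>(\<Sum>i\<in>T. \<tau> i * f i \<omega>) - (\<Sum>i\<in>T. \<tau> i * g i \<omega>)\<bar>"
      by (rule cmod_iexp_diff)
    also have "\<dots> \<le> (\<Sum>i\<in>T. \<bar>\<tau> i * (f i \<omega> - g i \<omega>)\<bar>)"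
      by (simp add: sum_subtractf[symmetric] right_diff_distrib[symmetric] sum_abs)
    finally show "cmod (iexp (\<Sum>i\<in>T. \<tau> i * f i \<omega>) - iexp (\<Sum>i\<in>T. \<tau> i * g i \<omega>)) \<le> (\<Sum>i\<in>T. \<bar>\<tau> i\<bar> * \<bar>f i \<omega> - g i \<omega>\<bar>)"
      by (simp add: abs_mult)
  qed (use L1 int[of f] int[of g] in auto)
  also have "\<dots> = (\<Sum>i\<in>T. \<bar>\<tau> i\<bar> * (\<integral>\<omega>. \<bar>f i \<omega> - g i \<omega>\<bar> \<partial>M))"
    using L1 by (subst Bochner_Integration.integral_sum) auto
  also have "\<dots> \<le> (\<Sum>i\<in>T. \<bar>\<tau> i\<bar> * \<delta>)" using L1 by (intro sum_mono mult_left_mono) auto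
  finally show ?thesis by (simp add: sum_distrib_right)
qed

section \<open>Contractions and pairs of index sets in disjoint coordinates\<close>

context iidlaw begin

abbreviation "KL \<equiv> Kset (\<lambda>_::nat. \<Lambda>)"

lemma fin\<Lambda>: "finite \<Lambda>" using X.fin_\<Lambda> .

lemma fin_KL: "finite S \<Longrightarrow> finite (KL S)" using finite_Kset[of S "\<lambda>_. \<Lambda>"] fin\<Lambda> by simp

lemma fin_KL_mem: "finite S \<Longrightarrow> m \<in> KL S \<Longrightarrow> finite m" using Kset_finite_mem[of m "\<lambda>_. \<Lambda>" S] fin\<Lambda> by simp

lemma KL_restrict: "B \<subseteq> S \<Longrightarrow> KL B = {m \<in> KL S. fst ` m \<subseteq> B}"
  by (auto simp: Kset_def)

lemma KL_Un:
  assumes "\<alpha> \<in> KL S" "\<beta> \<in> KL S" "fst ` \<alpha> \<inter> fst ` \<beta> = {}"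
  shows "\<alpha> \<union> \<beta> \<in> KL S" "\<alpha> \<inter> \<beta> = {}"
proof -
  show "\<alpha> \<inter> \<beta> = {}" using assms(3) by auto
  have "inj_on fst (\<alpha> \<union> \<beta>)"
    using assms by (auto simp: Kset_def inj_on_Un)
  then show "\<alpha> \<union> \<beta> \<in> KL S" using assms(1,2) by (auto simp: Kset_def)
qed

text \<open>A splitting of an index set is an ordered pair of index sets with disjoint blocks. The
  values 0 at the empty set cancel the improper splittings, so that the sum may run over all such
  pairs.\<close>

lemma Tf_pairs:
  assumes S: "finite S" and u: "u {} = 0" and w: "w {} = 0"
  shows "Tf f S u w = (\<Sum>\<alpha>\<in>KL S. \<Sum>\<beta>\<in>KL S. if fst ` \<alpha> \<inter> fst ` \<beta> = {} then f (\<alpha> \<union> \<beta>) * u \<alpha> * w \<beta> else 0)"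
proof -
  let ?K = "KL S"
  have fK: "finite ?K" by (rule fin_KL[OF S])
  have "Tf f S u w = (\<Sum>m\<in>?K. \<Sum>\<alpha>\<in>Pow m. f m * u \<alpha> * w (m - \<alpha>))"
    unfolding Tf_def
  proof (rule sum.cong[OF refl])
    fix m assume "m \<in> ?K"
    then have "finite (Pow m)" using fin_KL_mem[OF S] by simp
    then show "(\<Sum>\<alpha>\<in>Pow m - {{}, m}. f m * u \<alpha> * w (m - \<alpha>)) = (\<Sum>\<alpha>\<in>Pow m. f m * u \<alpha> * w (m - \<alpha>))"
      by (rule sum.mono_neutral_left) (use u w in auto)
  qed
  also have "\<dots> = (\<Sum>(m, \<alpha>)\<in>Sigma ?K Pow. f m * u \<alpha> * w (m - \<alpha>))"
    by (rule sum.Sigma) (use fK fin_KL_mem[OF S] in auto)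
  also have "\<dots> = (\<Sum>(\<alpha>, \<beta>)\<in>{(\<alpha>, \<beta>) \<in> ?K \<times> ?K. fst ` \<alpha> \<inter> fst ` \<beta> = {}}. f (\<alpha> \<union> \<beta>) * u \<alpha> * w \<beta>)"
  proof (rule sum.reindex_bij_witness[where i = "\<lambda>(\<alpha>, \<beta>). (\<alpha> \<union> \<beta>, \<alpha>)" and j = "\<lambda>(m, \<alpha>). (\<alpha>, m - \<alpha>)"])
    fix a assume "a \<in> Sigma ?K Pow"
    then obtain m \<alpha> where a: "a = (m, \<alpha>)" "m \<in> ?K" "\<alpha> \<subseteq> m" by auto
    have "fst ` \<alpha> \<inter> fst ` (m - \<alpha>) = {}"
      using a inj_on_image_Int[of fst m \<alpha> "m - \<alpha>"] by (auto simp: Kset_def)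
    moreover have "\<alpha> \<in> ?K" "m - \<alpha> \<in> ?K" using a by (auto intro: Kset_subset)
    ultimately show "(case a of (m, \<alpha>) \<Rightarrow> (\<alpha>, m - \<alpha>)) \<in> {(\<alpha>, \<beta>) \<in> ?K \<times> ?K. fst ` \<alpha> \<inter> fst ` \<beta> = {}}" using a by simp
    show "(case case a of (m, \<alpha>) \<Rightarrow> (\<alpha>, m - \<alpha>) of (\<alpha>, \<beta>) \<Rightarrow> (\<alpha> \<union> \<beta>, \<alpha>)) = a" using a by auto
    have "\<alpha> \<union> (m - \<alpha>) = m" using a by auto
    then show "(case case a of (m, \<alpha>) \<Rightarrow> (\<alpha>, m - \<alpha>) of (\<alpha>, \<beta>) \<Rightarrow> f (\<alpha> \<union> \<beta>) * u \<alpha> * w \<beta>) = (case a of (m, \<alpha>) \<Rightarrow> f m * u \<alpha> * w (m - \<alpha>))"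
      using a by simp
  next
    fix b assume "b \<in> {(\<alpha>, \<beta>) \<in> ?K \<times> ?K. fst ` \<alpha> \<inter> fst ` \<beta> = {}}"
    then obtain \<alpha> \<beta> where b: "b = (\<alpha>, \<beta>)" "\<alpha> \<in> ?K" "\<beta> \<in> ?K" "fst ` \<alpha> \<inter> fst ` \<beta> = {}" by auto
    note KL_Un[OF b(2-4)]
    then show "(case b of (\<alpha>, \<beta>) \<Rightarrow> (\<alpha> \<union> \<beta>, \<alpha>)) \<in> Sigma ?K Pow"
      "(case case b of (\<alpha>, \<beta>) \<Rightarrow> (\<alpha> \<union> \<beta>, \<alpha>) of (m, \<alpha>) \<Rightarrow> (\<alpha>, m - \<alpha>)) = b" using b by auto
  qed
  also have "\<dots> = (\<Sum>p\<in>?K \<times> ?K. if fst ` fst p \<inter> fst ` snd p = {} then f (fst p \<union> snd p) * u (fst p) * w (snd p) else 0)"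
    unfolding case_prod_beta prod.collapse by (rule sum.inter_filter) (use fK in simp)
  also have "\<dots> = (\<Sum>\<alpha>\<in>?K. \<Sum>\<beta>\<in>?K. if fst ` \<alpha> \<inter> fst ` \<beta> = {} then f (\<alpha> \<union> \<beta>) * u \<alpha> * w \<beta> else 0)"
    unfolding sum.cartesian_product by (simp add: case_prod_beta)
  finally show ?thesis .
qed

text \<open>The coordinates outside \<open>A\<close> and \<open>A'\<close> are free. In
  probabilistic terms, a uniformly random \<open>B\<close> contains \<open>A\<close> and avoids
  \<open>A'\<close> with probability 2^-(card A + card A').\<close>

lemma card_between:
  assumes S: "finite S" and A: "A \<subseteq> S" "A' \<subseteq> S" "A \<inter> A' = {}"
  shows "2 ^ (card A + card A') * card {B \<in> Pow S. A \<subseteq> B \<and> A' \<subseteq> S - B} = 2 ^ card S"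
proof -
  have "bij_betw (\<lambda>B. B \<union> A) (Pow (S - A - A')) {B \<in> Pow S. A \<subseteq> B \<and> A' \<subseteq> S - B}"
    by (rule bij_betw_byWitness[where f' = "\<lambda>B. B - A"]) (use A in auto)
  then have "card {B \<in> Pow S. A \<subseteq> B \<and> A' \<subseteq> S - B} = card (Pow (S - A - A'))" by (simp add: bij_betw_same_card)
  also have "\<dots> = 2 ^ card (S - A - A')" using S by (simp add: card_Pow)
  finally have 1: "card {B \<in> Pow S. A \<subseteq> B \<and> A' \<subseteq> S - B} = 2 ^ card (S - A - A')" .
  have "card S = card (A \<union> A') + card (S - (A \<union> A'))"
    using A S by (metis card_Un_disjoint finite_Diff finite_subset Diff_disjoint Un_least Un_Diff_cancel subset_Un_eq)
  also have "card (A \<union> A') = card A + card A'" using A S finite_subset by (intro card_Un_disjoint) auto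
  finally show ?thesis unfolding 1 by (simp add: power_add Diff_eq Int_assoc)
qed

text \<open>Averaging over all bipartitions of the coordinates reduces products of overlapping monomials to
  products in disjoint sets of variables.\<close>

lemma bipartition:
  assumes S: "finite S" and u: "u {} = 0" and w: "w {} = 0"
  shows "\<exists>B\<subseteq>S. \<bar>Tf f S u w\<bar> \<le> \<bar>\<Sum>\<alpha>\<in>KL B. \<Sum>\<beta>\<in>KL (S - B). f (\<alpha> \<union> \<beta>) * (2 ^ card \<alpha> * u \<alpha>) * (2 ^ card \<beta> * w \<beta>)\<bar>"
proof (rule ccontr)
  let ?K = "KL S"
  define tm where "tm B = (\<Sum>\<alpha>\<in>KL B. \<Sum>\<beta>\<in>KL (S - B). f (\<alpha> \<union> \<beta>) * (2 ^ card \<alpha> * u \<alpha>) * (2 ^ card \<beta> * w \<beta>))" for B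
  define g where "g \<alpha> \<beta> = f (\<alpha> \<union> \<beta>) * (2 ^ card \<alpha> * u \<alpha>) * (2 ^ card \<beta> * w \<beta>)" for \<alpha> \<beta>
  assume "\<not> ?thesis"
  then have lt: "\<bar>tm B\<bar> < \<bar>Tf f S u w\<bar>" if "B \<in> Pow S" for B using that unfolding tm_def by (auto simp: not_le)
  have fK: "finite ?K" by (rule fin_KL[OF S])
  have tm: "tm B = (\<Sum>\<alpha>\<in>?K. \<Sum>\<beta>\<in>?K. if fst ` \<alpha> \<subseteq> B \<and> fst ` \<beta> \<subseteq> S - B then g \<alpha> \<beta> else 0)" if B: "B \<in> Pow S" for B
  proof -
    have B1: "KL B = {m \<in> ?K. fst ` m \<subseteq> B}" using B by (intro KL_restrict) auto
    have B2: "KL (S - B) = {m \<in> ?K. fst ` m \<subseteq> S - B}" by (intro KL_restrict) auto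
    have "tm B = (\<Sum>\<alpha>\<in>?K. if fst ` \<alpha> \<subseteq> B then (\<Sum>\<beta>\<in>?K. if fst ` \<beta> \<subseteq> S - B then g \<alpha> \<beta> else 0) else 0)"
      unfolding tm_def B1 B2 g_def[symmetric] using fK by (simp only: sum.inter_filter)
    also have "\<dots> = (\<Sum>\<alpha>\<in>?K. \<Sum>\<beta>\<in>?K. if fst ` \<alpha> \<subseteq> B \<and> fst ` \<beta> \<subseteq> S - B then g \<alpha> \<beta> else 0)"
      by (intro sum.cong refl) auto
    finally show ?thesis .
  qed
  \<comment> \<open>The weights 2^card compensate the probability that a random \<open>B\<close>
    separates the two index sets; overlapping pairs are never separated.\<close>
  have cnt: "g \<alpha> \<beta> * real (card {B \<in> Pow S. fst ` \<alpha> \<subseteq> B \<and> fst ` \<beta> \<subseteq> S - B}) =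
      2 ^ card S * (if fst ` \<alpha> \<inter> fst ` \<beta> = {} then f (\<alpha> \<union> \<beta>) * u \<alpha> * w \<beta> else 0)" if ab: "\<alpha> \<in> ?K" "\<beta> \<in> ?K" for \<alpha> \<beta>
  proof (cases "fst ` \<alpha> \<inter> fst ` \<beta> = {}")
    case True
    have c: "card (fst ` \<alpha>) = card \<alpha>" "card (fst ` \<beta>) = card \<beta>" using ab by (auto simp: Kset_def card_image)
    have "fst ` \<alpha> \<subseteq> S" "fst ` \<beta> \<subseteq> S" using ab by (auto simp: Kset_def)
    from card_between[OF S this True] have "2 ^ (card \<alpha> + card \<beta>) * card {B \<in> Pow S. fst ` \<alpha> \<subseteq> B \<and> fst ` \<beta> \<subseteq> S - B} = 2 ^ card S" by (simp add: c)
    then have "real (2 ^ (card \<alpha> + card \<beta>) * card {B \<in> Pow S. fst ` \<alpha> \<subseteq> B \<and> fst ` \<beta> \<subseteq> S - B}) = real (2 ^ card S)" by (simp only:)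
    then have "2 ^ (card \<alpha> + card \<beta>) * real (card {B \<in> Pow S. fst ` \<alpha> \<subseteq> B \<and> fst ` \<beta> \<subseteq> S - B}) = 2 ^ card S" by simp
    then have "(f (\<alpha> \<union> \<beta>) * u \<alpha> * w \<beta>) * (2 ^ (card \<alpha> + card \<beta>) * real (card {B \<in> Pow S. fst ` \<alpha> \<subseteq> B \<and> fst ` \<beta> \<subseteq> S - B})) = (f (\<alpha> \<union> \<beta>) * u \<alpha> * w \<beta>) * 2 ^ card S" by simp
    then show ?thesis using True by (simp add: g_def power_add mult_ac)
  next
    case False
    then have e: "{B \<in> Pow S. fst ` \<alpha> \<subseteq> B \<and> fst ` \<beta> \<subseteq> S - B} = {}" by blast
    show ?thesis unfolding e using False by simp
  qed
  have "(\<Sum>B\<in>Pow S. tm B) = (\<Sum>B\<in>Pow S. \<Sum>\<alpha>\<in>?K. \<Sum>\<beta>\<in>?K. if fst ` \<alpha> \<subseteq> B \<and> fst ` \<beta> \<subseteq> S - B then g \<alpha> \<beta> else 0)"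
    by (intro sum.cong refl tm)
  also have "\<dots> = (\<Sum>\<alpha>\<in>?K. \<Sum>\<beta>\<in>?K. \<Sum>B\<in>Pow S. if fst ` \<alpha> \<subseteq> B \<and> fst ` \<beta> \<subseteq> S - B then g \<alpha> \<beta> else 0)"
    by (subst sum.swap, intro sum.cong refl, rule sum.swap)
  also have "\<dots> = (\<Sum>\<alpha>\<in>?K. \<Sum>\<beta>\<in>?K. g \<alpha> \<beta> * real (card {B \<in> Pow S. fst ` \<alpha> \<subseteq> B \<and> fst ` \<beta> \<subseteq> S - B}))"
    using S by (intro sum.cong refl) (subst sum.inter_filter[symmetric], auto)
  also have "\<dots> = (\<Sum>\<alpha>\<in>?K. \<Sum>\<beta>\<in>?K. 2 ^ card S * (if fst ` \<alpha> \<inter> fst ` \<beta> = {} then f (\<alpha> \<union> \<beta>) * u \<alpha> * w \<beta> else 0))"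
    by (intro sum.cong refl cnt)
  also have "\<dots> = 2 ^ card S * Tf f S u w"
    unfolding Tf_pairs[where f = f and S = S and u = u and w = w, OF S u w] sum_distrib_left ..
  finally have eq: "(\<Sum>B\<in>Pow S. tm B) = 2 ^ card S * Tf f S u w" .
  have "\<bar>\<Sum>B\<in>Pow S. tm B\<bar> \<le> (\<Sum>B\<in>Pow S. \<bar>tm B\<bar>)" by (rule sum_abs)
  also have "\<dots> < (\<Sum>B\<in>Pow S. \<bar>Tf f S u w\<bar>)" by (rule sum_strict_mono) (use S lt in auto)
  also have "\<dots> = 2 ^ card S * \<bar>Tf f S u w\<bar>" using S by (simp add: card_Pow)
  finally show False unfolding eq by (simp add: abs_mult)
qed

lemma Tf_linear: "Tf (\<lambda>m. c * f m + c' * f' m) S u w = c * Tf f S u w + c' * Tf f' S u w"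
  unfolding Tf_def sum_distrib_left sum.distrib[symmetric] by (intro sum.cong refl) (simp add: algebra_simps)

lemma nrm_nonneg: "nrm S u \<ge> 0" by (simp add: nrm_def sum_nonneg)

lemma nrm_ge:
  assumes "finite S" "\<alpha> \<in> KL S"
  shows "\<bar>u \<alpha>\<bar> \<le> nrm S u"
proof -
  have "(u \<alpha>)\<^sup>2 \<le> (\<Sum>m\<in>KL S. (u m)\<^sup>2)" using assms by (intro member_le_sum) (auto intro: fin_KL)
  then show ?thesis unfolding nrm_def by (metis real_sqrt_abs real_sqrt_le_mono)
qed

lemma Tf_zero:
  fixes S :: "nat set"
  assumes "finite S" "nrm S u = 0 \<or> nrm S w = 0"
  shows "Tf f S u w = 0"
  unfolding Tf_def
proof (intro sum.neutral ballI)
  fix m \<alpha> assume m: "m \<in> KL S" "\<alpha> \<in> Pow m - {{}, m}"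
  then have "\<alpha> \<in> KL S" "m - \<alpha> \<in> KL S" by (auto intro: Kset_subset)
  then show "f m * u \<alpha> * w (m - \<alpha>) = 0" using nrm_ge[OF assms(1), of \<alpha> u] nrm_ge[OF assms(1), of "m - \<alpha>" w] assms(2) by auto
qed

lemma ml_weight_pol:
  assumes "finite B" "\<And>\<alpha>. g \<alpha> \<noteq> 0 \<Longrightarrow> weight \<alpha> = a"
  shows "X.ml g B \<in> pol UNIV a"
  unfolding X.ml_def[abs_def]
proof (rule pol_sum)
  fix m assume m: "m \<in> KL B"
  show "(\<lambda>x. g m * mprod X.xi m x) \<in> pol UNIV a"
  proof (cases "g m = 0")
    case False
    then have "weight m = a" using assms by simp
    then show ?thesis using pol_UNIV_I[OF X.xi_mprod_pol[OF m assms(1)]] by (intro pol_scale) simp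
  qed (simp add: pol_const)
qed

lemma iexp_diff_le:
  assumes A: "A \<in> pol UNIV k" and B: "B \<in> pol UNIV k'" and C: "C \<in> pol UNIV kc"
  shows "cmod (X.E (\<lambda>x. iexp (C x + A x)) - X.E (\<lambda>x. iexp (C x + B x))) \<le> sqrt (X.E (\<lambda>x. (A x - B x)\<^sup>2))"
proof -
  define \<delta> where "\<delta> = sqrt (X.E (\<lambda>x. (A x - B x)\<^sup>2))"
  have AB: "(\<lambda>x. A x - B x) \<in> pol UNIV (max k k')" by (intro pol_diff pol_mono[OF A] pol_mono[OF B]) auto
  have i: "integrable X.P (\<lambda>x. (A x - B x)\<^sup>2)" by (rule X.pol_integrable_power[OF AB])
  have m: "(\<lambda>x. C x + A x) \<in> borel_measurable X.P" "(\<lambda>x. C x + B x) \<in> borel_measurable X.P"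
    using X.pol_meas A B C by (auto intro: borel_measurable_add)
  have "cmod (X.E (\<lambda>x. iexp (\<Sum>_\<in>{()}. 1 * (C x + A x))) - X.E (\<lambda>x. iexp (\<Sum>_\<in>{()}. 1 * (C x + B x)))) \<le> (\<Sum>_\<in>{()}. \<bar>1\<bar>) * \<delta>"
    by (rule X.D.P.iexp_sum_close[OF m]) (auto simp: \<delta>_def nn_integral_eq_integral[OF i])
  then show ?thesis by (simp add: \<delta>_def)
qed

lemma iexp_coords:
  assumes "finite I" "inj_on j I"
  shows "X.E (\<lambda>x. iexp (\<Sum>i\<in>I. \<tau> i * x (j i))) = (\<Prod>i\<in>I. char \<mu> (\<tau> i))"
  using assms
proof (induction rule: finite_induct)
  case (insert i I)
  have m: "(\<lambda>x. \<Sum>i\<in>I. \<tau> i * x (j i)) \<in> borel_measurable X.P" by measurable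
  have "X.E (\<lambda>x. iexp (\<tau> i * x (j i)) * iexp (\<Sum>i\<in>I. \<tau> i * x (j i))) = X.E (\<lambda>x. iexp (\<tau> i * x (j i))) * X.E (\<lambda>x. iexp (\<Sum>i\<in>I. \<tau> i * x (j i)))"
  proof (rule X.fac(1)[of "{j i}" _ "j ` I"])
    show "dep {j i} (\<lambda>x. iexp (\<tau> i * x (j i)))" by (simp add: dep_def)
    show "dep (j ` I) (\<lambda>x. iexp (\<Sum>i\<in>I. \<tau> i * x (j i)))" by (simp add: dep_def)
    show "{j i} \<inter> j ` I = {}" using insert by auto
  qed (intro X.integrable_iexp; measurable)+
  also have "X.E (\<lambda>x. iexp (\<tau> i * x (j i))) = char \<mu> (\<tau> i)"
    using X.E_coord(1)[of "\<lambda>y. iexp (\<tau> i * y)" "j i"] by (simp add: char_def)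
  also have "X.E (\<lambda>x. iexp (\<Sum>i\<in>I. \<tau> i * x (j i))) = (\<Prod>i\<in>I. char \<mu> (\<tau> i))" using insert by auto
  finally show ?case using insert.hyps by (simp add: exp_add distrib_left)
qed simp

end

context ultra begin

text \<open>If smallness fails on a set of the ultrafilter, choose violating data there together
  with a splitting from \<open>bipartition\<close>. The normalised vectors, placed on the two
  halves, define L^2-bounded polynomials G and H of degrees a and b. They share no variable, so
  products of their monomials are again orthonormal monomials, and the pairing of G H with R exceeds
  \<epsilon>, against membership in \<open>HH k\<close>.\<close>

lemma T_small:
  assumes R: "R \<in> HH k" and ab: "1 \<le> a" "1 \<le> b" "a + b \<le> k" and \<epsilon>: "\<epsilon> > 0"
  shows "\<forall>\<^sub>F n in U. \<forall>S u w. finite S \<longrightarrow> (\<forall>\<alpha>. u \<alpha> \<noteq> 0 \<longrightarrow> weight \<alpha> = a) \<longrightarrow> (\<forall>\<beta>. w \<beta> \<noteq> 0 \<longrightarrow> weight \<beta> = b) \<longrightarrow>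
     \<bar>Tf (X.cf (R n)) S u w\<bar> \<le> \<epsilon> * nrm S u * nrm S w"
proof (rule ccontr)
  let ?c = "\<lambda>n. X.cf (R n)"
  define bad where "bad n S u w \<longleftrightarrow> finite S \<and> (\<forall>\<alpha>. u \<alpha> \<noteq> 0 \<longrightarrow> weight \<alpha> = a) \<and> (\<forall>\<beta>. w \<beta> \<noteq> 0 \<longrightarrow> weight \<beta> = b) \<and>
     \<bar>Tf (?c n) S u w\<bar> > \<epsilon> * nrm S u * nrm S w" for n S u w
  assume "\<not> ?thesis"
  then have bad: "\<forall>\<^sub>F n in U. \<exists>S u w. bad n S u w" unfolding U_not_iff bad_def by (auto simp: not_le elim!: eventually_mono)
  define good where "good n \<longleftrightarrow> (\<exists>S u w. bad n S u w)" for n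
  have "\<forall>n. \<exists>S u w. good n \<longrightarrow> bad n S u w" unfolding good_def by blast
  then obtain S u w where b: "\<And>n. good n \<Longrightarrow> bad n (S n) (u n) (w n)" by metis
  have w0: "u n {} = 0" "w n {} = 0" if "good n" for n
    using b[OF that] ab unfolding bad_def by (auto simp: weight_def)
  define Bi where "Bi n B \<longleftrightarrow> B \<subseteq> S n \<and> \<bar>Tf (?c n) (S n) (u n) (w n)\<bar> \<le>
     \<bar>\<Sum>\<alpha>\<in>KL B. \<Sum>\<beta>\<in>KL (S n - B). ?c n (\<alpha> \<union> \<beta>) * (2 ^ card \<alpha> * u n \<alpha>) * (2 ^ card \<beta> * w n \<beta>)\<bar>" for n B
  have "\<exists>B. good n \<longrightarrow> Bi n B" for n
  proof (cases "good n")
    case True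
    then have "finite (S n)" using b[of n] by (simp add: bad_def)
    from bipartition[where S = "S n" and u = "u n" and w = "w n" and f = "?c n", OF this w0[OF True]] show ?thesis
      unfolding Bi_def by blast
  qed simp
  then obtain B where Bi: "\<And>n. good n \<Longrightarrow> Bi n (B n)" by metis
  have B: "B n \<subseteq> S n" "\<bar>Tf (?c n) (S n) (u n) (w n)\<bar> \<le>
     \<bar>\<Sum>\<alpha>\<in>KL (B n). \<Sum>\<beta>\<in>KL (S n - B n). ?c n (\<alpha> \<union> \<beta>) * (2 ^ card \<alpha> * u n \<alpha>) * (2 ^ card \<beta> * w n \<beta>)\<bar>" if "good n" for n
    using Bi[OF that] unfolding Bi_def by blast+
  \<comment> \<open>The weight 2^(card \<alpha>) comes from \<open>bipartition\<close> and is at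
    most 2^a, as the cardinality is at most the weight. Indices without a violation get the zero
    vector.\<close>
  define gg where "gg n \<alpha> = (if good n then 2 ^ card \<alpha> * u n \<alpha> / nrm (S n) (u n) else 0)" for n \<alpha>
  define hh where "hh n \<beta> = (if good n then 2 ^ card \<beta> * w n \<beta> / nrm (S n) (w n) else 0)" for n \<beta>
  define BB where "BB n = (if good n then B n else {})" for n
  define BC where "BC n = (if good n then S n - B n else {})" for n
  have finB: "finite (BB n)" "finite (BC n)" for n
  proof -
    have "finite (S n)" if "good n" using b[OF that] by (simp add: bad_def)
    then show "finite (BB n)" "finite (BC n)"
      by (cases "good n"; simp add: BB_def BC_def finite_subset[OF B(1)])+
  qed
  define G where "G n = X.ml (gg n) (BB n)" for n
  define H where "H n = X.ml (hh n) (BC n)" for n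
  have bnd: "(\<Sum>\<alpha>\<in>KL T. (2 ^ card \<alpha> * v \<alpha> / nrm S v)\<^sup>2) \<le> (2 ^ c)\<^sup>2"
    if T: "T \<subseteq> S" "finite S" and v: "\<forall>\<alpha>. v \<alpha> \<noteq> 0 \<longrightarrow> weight \<alpha> = c" for T S v c
  proof (cases "nrm S v = 0")
    case False
    then have np: "nrm S v > 0" using nrm_nonneg[of S v] by simp
    have "(\<Sum>\<alpha>\<in>KL T. (2 ^ card \<alpha> * v \<alpha> / nrm S v)\<^sup>2) \<le> (\<Sum>\<alpha>\<in>KL S. (2 ^ c)\<^sup>2 * (v \<alpha>)\<^sup>2 / (nrm S v)\<^sup>2)"
    proof (rule order_trans[OF sum_mono sum_mono2])
      fix \<alpha> assume \<alpha>: "\<alpha> \<in> KL T"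
      show "(2 ^ card \<alpha> * v \<alpha> / nrm S v)\<^sup>2 \<le> (2 ^ c)\<^sup>2 * (v \<alpha>)\<^sup>2 / (nrm S v)\<^sup>2"
      proof (cases "v \<alpha> = 0")
        case False
        then have "card \<alpha> \<le> c" using v X.card_le_weight[OF \<alpha>] by auto
        then have "(2 ^ card \<alpha>)\<^sup>2 \<le> ((2::real) ^ c)\<^sup>2" by (intro power_mono power_increasing) auto
        then show ?thesis by (simp add: power_divide power_mult_distrib divide_right_mono mult_right_mono)
      qed simp
    qed (use T fin_KL Kset_mono[OF T(1)] in auto)
    also have "\<dots> = (2 ^ c)\<^sup>2 * ((\<Sum>\<alpha>\<in>KL S. (v \<alpha>)\<^sup>2) / (nrm S v)\<^sup>2)"
      by (simp add: sum_distrib_left sum_divide_distrib)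
    also have "(\<Sum>\<alpha>\<in>KL S. (v \<alpha>)\<^sup>2) = (nrm S v)\<^sup>2" by (simp add: nrm_def sum_nonneg)
    finally show ?thesis using np by simp
  qed simp
  have Gc: "G \<in> CC a"
  proof (rule CC_I)
    show "G n \<in> pol UNIV a" for n unfolding G_def
      by (rule ml_weight_pol[OF finB(1)]) (use b[of n] in \<open>auto simp: gg_def bad_def split: if_splits\<close>)
    show "EE (\<lambda>x. (G n x)\<^sup>2) \<le> (2 ^ a)\<^sup>2" for n
    proof -
      have "EE (\<lambda>x. (G n x)\<^sup>2) = (\<Sum>\<alpha>\<in>KL (BB n). (gg n \<alpha>)\<^sup>2)"
        using X.ml_inner[OF finB(1), of "gg n" n "gg n"] by (simp add: G_def power2_eq_square)
      also have "\<dots> \<le> (2 ^ a)\<^sup>2"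
        using bnd[of "B n" "S n" "u n" a] b[of n] B(1)[of n] by (cases "good n") (auto simp: BB_def gg_def bad_def)
      finally show ?thesis .
    qed
  qed
  have Hc: "H \<in> CC b"
  proof (rule CC_I)
    show "H n \<in> pol UNIV b" for n unfolding H_def
      by (rule ml_weight_pol[OF finB(2)]) (use b[of n] in \<open>auto simp: hh_def bad_def split: if_splits\<close>)
    show "EE (\<lambda>x. (H n x)\<^sup>2) \<le> (2 ^ b)\<^sup>2" for n
    proof -
      have "EE (\<lambda>x. (H n x)\<^sup>2) = (\<Sum>\<alpha>\<in>KL (BC n). (hh n \<alpha>)\<^sup>2)"
        using X.ml_inner[OF finB(2), of "hh n" n "hh n"] by (simp add: H_def power2_eq_square)
      also have "\<dots> \<le> (2 ^ b)\<^sup>2"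
        using bnd[of "S n - B n" "S n" "w n" b] b[of n] by (cases "good n") (auto simp: BC_def hh_def bad_def)
      finally show ?thesis .
    qed
  qed
  have RC: "R \<in> CC k" using R by (auto simp: HH_def)
  \<comment> \<open>\<open>HH\<close> asks for total degree exactly k, while only a + b \<le> k is
    known; H is therefore read as a sequence of degree k - a.\<close>
  have "H \<in> CC (k - a)" using ab by (intro CC_mono[OF Hc]) auto
  then have lim: "((\<lambda>n. EE (\<lambda>x. R n x * (G n x * H n x))) \<longlongrightarrow> 0) U"
  proof -
    have "\<forall>a b G H. 1 \<le> a \<longrightarrow> 1 \<le> b \<longrightarrow> a + b = k \<longrightarrow> G \<in> CC a \<longrightarrow> H \<in> CC b \<longrightarrow>
        ((\<lambda>n. EE (\<lambda>x. R n x * (G n x * H n x))) \<longlongrightarrow> 0) U" using R unfolding HH_def by blast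
    from this[rule_format, of a "k - a" G H] show ?thesis using Gc ab \<open>H \<in> CC (k - a)\<close> by simp
  qed
  have big: "\<bar>EE (\<lambda>x. R n x * (G n x * H n x))\<bar> > \<epsilon>" if gd: "good n" for n
  proof -
    let ?S = "S n" and ?u = "u n" and ?w = "w n"
    have bd: "finite ?S" "\<bar>Tf (?c n) ?S ?u ?w\<bar> > \<epsilon> * nrm ?S ?u * nrm ?S ?w" using b[OF gd] by (auto simp: bad_def)
    have np: "nrm ?S ?u > 0" "nrm ?S ?w > 0"
      using Tf_zero[OF bd(1)] bd(2) \<epsilon> nrm_nonneg[of ?S ?u] nrm_nonneg[of ?S ?w] by (auto simp: less_le)
    have BS: "BB n = B n" "BC n = ?S - B n" using gd by (auto simp: BB_def BC_def)
    have mp: "mprod X.xi \<alpha> x * mprod X.xi \<beta> x = mprod X.xi (\<alpha> \<union> \<beta>) x" if "\<alpha> \<in> KL (B n)" "\<beta> \<in> KL (?S - B n)" for \<alpha> \<beta> x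
    proof -
      have "finite \<alpha>" "finite \<beta>"
        using fin_KL_mem[OF finB(1)[of n, unfolded BS] that(1)] fin_KL_mem[OF finB(2)[of n, unfolded BS] that(2)] by auto
      moreover have "\<alpha> \<inter> \<beta> = {}" using that by (auto simp: Kset_def)
      ultimately show ?thesis by (simp add: mprod_Un)
    qed
    have int: "integrable X.P (\<lambda>x. R n x * mprod X.xi (\<alpha> \<union> \<beta>) x)" if "\<alpha> \<in> KL (B n)" "\<beta> \<in> KL (?S - B n)" for \<alpha> \<beta>
    proof -
      have "\<alpha> \<in> KL ?S" "\<beta> \<in> KL ?S" using that Kset_mono[OF B(1)[OF gd]] Kset_mono[of "?S - B n" ?S] by auto
      moreover have "fst ` \<alpha> \<inter> fst ` \<beta> = {}" using that by (auto simp: Kset_def)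
      ultimately have "\<alpha> \<union> \<beta> \<in> KL ?S" by (rule KL_Un)
      then show ?thesis using X.pol_integrable_mult[OF CC_pol[OF RC] X.xi_mprod_pol[OF _ bd(1)]] by blast
    qed
    have "EE (\<lambda>x. R n x * (G n x * H n x)) =
       EE (\<lambda>x. \<Sum>\<alpha>\<in>KL (B n). \<Sum>\<beta>\<in>KL (?S - B n). (gg n \<alpha> * hh n \<beta>) * (R n x * mprod X.xi (\<alpha> \<union> \<beta>) x))"
    proof (intro Bochner_Integration.integral_cong refl)
      fix x
      have "G n x * H n x = (\<Sum>\<alpha>\<in>KL (B n). \<Sum>\<beta>\<in>KL (?S - B n). (gg n \<alpha> * mprod X.xi \<alpha> x) * (hh n \<beta> * mprod X.xi \<beta> x))"
        unfolding G_def H_def X.ml_def BS by (rule sum_product)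
      then show "R n x * (G n x * H n x) = (\<Sum>\<alpha>\<in>KL (B n). \<Sum>\<beta>\<in>KL (?S - B n). (gg n \<alpha> * hh n \<beta>) * (R n x * mprod X.xi (\<alpha> \<union> \<beta>) x))"
        by (simp only: sum_distrib_left) (intro sum.cong refl, simp add: mp[symmetric] mult_ac)
    qed
    also have "\<dots> = (\<Sum>\<alpha>\<in>KL (B n). \<Sum>\<beta>\<in>KL (?S - B n). (gg n \<alpha> * hh n \<beta>) * ?c n (\<alpha> \<union> \<beta>))"
      using int by (simp add: Bochner_Integration.integral_sum X.cf_def)
    also have "\<dots> = (\<Sum>\<alpha>\<in>KL (B n). \<Sum>\<beta>\<in>KL (?S - B n). ?c n (\<alpha> \<union> \<beta>) * (2 ^ card \<alpha> * ?u \<alpha>) * (2 ^ card \<beta> * ?w \<beta>)) / (nrm ?S ?u * nrm ?S ?w)"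
      unfolding sum_divide_distrib by (intro sum.cong refl) (use gd in \<open>simp add: gg_def hh_def mult_ac\<close>)
    finally have "\<bar>EE (\<lambda>x. R n x * (G n x * H n x))\<bar> \<ge> \<bar>Tf (?c n) ?S ?u ?w\<bar> / (nrm ?S ?u * nrm ?S ?w)"
      using B(2)[OF gd] np by (simp add: abs_divide abs_mult divide_right_mono)
    moreover have "\<bar>Tf (?c n) ?S ?u ?w\<bar> / (nrm ?S ?u * nrm ?S ?w) > \<epsilon>"
      using bd(2) np by (simp add: pos_less_divide_eq mult.assoc)
    ultimately show ?thesis by linarith
  qed
  have "\<forall>\<^sub>F n in U. \<bar>EE (\<lambda>x. R n x * (G n x * H n x))\<bar> < \<epsilon>"
    using tendsto_rabs_zero[OF lim] \<epsilon> by (rule order_tendstoD)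
  moreover have "\<forall>\<^sub>F n in U. good n" using bad by (simp add: good_def)
  ultimately have "\<forall>\<^sub>F n in U. False" by eventually_elim (use big in force)
  then show False using U_bot by (simp add: eventually_False)
qed

abbreviation Tle :: "((nat \<times> nat) set \<Rightarrow> real) \<Rightarrow> real \<Rightarrow> bool" where
  "Tle f \<epsilon> \<equiv> \<forall>S u w. finite S \<longrightarrow> \<bar>Tf f S u w\<bar> \<le> \<epsilon> * nrm S u * nrm S w"

definition AH :: "(nat \<Rightarrow> (nat \<Rightarrow> real) \<Rightarrow> real) set" where
  "AH = {R \<in> CC L. (\<forall>\<epsilon>>0. \<forall>\<^sub>F n in U. Tle (X.cf (R n)) \<epsilon>) \<and>
     (\<forall>\<epsilon>>0. \<forall>\<^sub>F n in U. \<forall>j. \<forall>l\<in>\<Lambda>. \<bar>X.cf (R n) {(j, l)}\<bar> \<le> \<epsilon>) \<and>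
     ((\<lambda>n. X.cf (R n) {}) \<longlongrightarrow> 0) U}"

lemma cf_weight:
  assumes "A \<in> pol UNIV k" "k \<le> L" "finite S" "m \<in> KL S" "weight m > k"
  shows "X.cf A m = 0"
  by (rule X.expansion[OF assms(1,2)]) (use assms in blast)

text \<open>For contractions, \<open>u\<close> and \<open>w\<close> are split by weight and
  \<open>T_small\<close> is applied to each pair of weights with sum at most \<open>k\<close>;
  coefficients of larger weight vanish. The singleton coefficient at (j, l) is a combination of the
  E R x_j^i with i \<le> l, which the second condition of \<open>HH\<close> makes small.\<close>

lemma HH_AH:
  assumes R: "R \<in> HH k" and k: "k \<le> L"
  shows "R \<in> AH"
proof -
  let ?c = "\<lambda>n. X.cf (R n)"
  have RC: "R \<in> CC k" using R by (auto simp: HH_def)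
  have RL: "R \<in> CC L" using CC_mono[OF RC k] .
  have pw: "((\<lambda>n. EE (\<lambda>x. R n x * x (J n) ^ l)) \<longlongrightarrow> 0) U" if "l \<le> k" for J l
    using R that by (auto simp: HH_def)
  have T: "\<forall>\<^sub>F n in U. Tle (?c n) \<epsilon>" if \<epsilon>: "\<epsilon> > 0" for \<epsilon>
  proof -
    \<comment> \<open>At most k^2 pairs of weights share the error; the added 1 keeps the
      denominator positive.\<close>
    define \<epsilon>' where "\<epsilon>' = \<epsilon> / (real k * real k + 1)"
    have kk: "real k * real k + 1 > 0" by (simp add: add_nonneg_pos)
    have e': "\<epsilon>' > 0" unfolding \<epsilon>'_def using \<epsilon> kk by simp
    define AB where "AB = {(a, b). 1 \<le> a \<and> 1 \<le> b \<and> a + b \<le> k}"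
    have fAB: "finite AB" by (rule finite_subset[of _ "{1..k} \<times> {1..k}"]) (auto simp: AB_def)
    have cAB: "real (card AB) \<le> real k * real k"
    proof -
      have "card AB \<le> card ({1..k} \<times> {1..k})" by (rule card_mono) (auto simp: AB_def)
      then show ?thesis by (simp add: card_cartesian_product flip: of_nat_mult)
    qed
    have "\<forall>\<^sub>F n in U. \<forall>p\<in>AB. \<forall>S u w. finite S \<longrightarrow> (\<forall>\<alpha>. u \<alpha> \<noteq> 0 \<longrightarrow> weight \<alpha> = fst p) \<longrightarrow> (\<forall>\<beta>. w \<beta> \<noteq> 0 \<longrightarrow> weight \<beta> = snd p) \<longrightarrow>
       \<bar>Tf (?c n) S u w\<bar> \<le> \<epsilon>' * nrm S u * nrm S w"
    proof (rule eventually_ball_finite[OF fAB], rule ballI)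
      fix p assume p: "p \<in> AB"
      show "\<forall>\<^sub>F n in U. \<forall>S u w. finite S \<longrightarrow> (\<forall>\<alpha>. u \<alpha> \<noteq> 0 \<longrightarrow> weight \<alpha> = fst p) \<longrightarrow> (\<forall>\<beta>. w \<beta> \<noteq> 0 \<longrightarrow> weight \<beta> = snd p) \<longrightarrow>
       \<bar>Tf (?c n) S u w\<bar> \<le> \<epsilon>' * nrm S u * nrm S w"
        by (rule T_small[OF R _ _ _ e']) (use p in \<open>auto simp: AB_def\<close>)
    qed
    then show ?thesis
    proof eventually_elim
      case (elim n)
      show ?case
      proof (intro allI impI)
        fix S :: "nat set" and u w :: "(nat \<times> nat) set \<Rightarrow> real" assume S: "finite S"
        define ua where "ua a \<alpha> = (if weight \<alpha> = a then u \<alpha> else 0)" for a \<alpha>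
        define wb where "wb b \<alpha> = (if weight \<alpha> = b then w \<alpha> else 0)" for b \<alpha>
        have nu: "nrm S (ua a) \<le> nrm S u" for a unfolding nrm_def ua_def by (intro real_sqrt_le_mono sum_mono) auto
        have nw: "nrm S (wb b) \<le> nrm S w" for b unfolding nrm_def wb_def by (intro real_sqrt_le_mono sum_mono) auto
        have "Tf (?c n) S u w = (\<Sum>p\<in>AB. Tf (?c n) S (ua (fst p)) (wb (snd p)))"
        proof -
          have "(\<Sum>p\<in>AB. Tf (?c n) S (ua (fst p)) (wb (snd p))) =
             (\<Sum>m\<in>KL S. \<Sum>\<alpha>\<in>Pow m - {{}, m}. \<Sum>p\<in>AB. ?c n m * ua (fst p) \<alpha> * wb (snd p) (m - \<alpha>))"
            unfolding Tf_def by (subst sum.swap, intro sum.cong refl, rule sum.swap)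
          also have "\<dots> = Tf (?c n) S u w" unfolding Tf_def
          proof (intro sum.cong refl)
            fix m \<alpha> assume m: "m \<in> KL S" and \<alpha>: "\<alpha> \<in> Pow m - {{}, m}"
            show "(\<Sum>p\<in>AB. ?c n m * ua (fst p) \<alpha> * wb (snd p) (m - \<alpha>)) = ?c n m * u \<alpha> * w (m - \<alpha>)"
            proof (cases "weight m \<le> k")
              case False
              then have "?c n m = 0" using cf_weight[OF CC_pol[OF RC] k S m] by simp
              then show ?thesis by simp
            next
              case True
              have fm: "finite m" using fin_KL_mem[OF S m] .
              have wt: "weight \<alpha> + weight (m - \<alpha>) = weight m"
                unfolding weight_def using fm \<alpha> sum.subset_diff[of \<alpha> m snd] by simp
              have pos: "weight \<beta> \<ge> 1" if "\<beta> \<in> KL S" "\<beta> \<noteq> {}" for \<beta>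
                using X.card_le_weight[OF that(1)] that(2) fin_KL_mem[OF S that(1)] card_gt_0_iff[of \<beta>] by linarith
              have "\<alpha> \<in> KL S" "m - \<alpha> \<in> KL S" "\<alpha> \<noteq> {}" "m - \<alpha> \<noteq> {}" using m \<alpha> by (auto intro: Kset_subset)
              then have pAB: "(weight \<alpha>, weight (m - \<alpha>)) \<in> AB" using wt True pos by (auto simp: AB_def)
              have "(\<Sum>p\<in>AB. ?c n m * ua (fst p) \<alpha> * wb (snd p) (m - \<alpha>)) =
                 (\<Sum>p\<in>AB. if p = (weight \<alpha>, weight (m - \<alpha>)) then ?c n m * u \<alpha> * w (m - \<alpha>) else 0)"
                by (intro sum.cong refl) (auto simp: ua_def wb_def prod_eq_iff)
              also have "\<dots> = ?c n m * u \<alpha> * w (m - \<alpha>)" using pAB fAB by (subst sum.delta) auto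
              finally show ?thesis .
            qed
          qed
          finally show ?thesis by simp
        qed
        also have "\<bar>\<dots>\<bar> \<le> (\<Sum>p\<in>AB. \<bar>Tf (?c n) S (ua (fst p)) (wb (snd p))\<bar>)" by (rule sum_abs)
        also have "\<dots> \<le> (\<Sum>p\<in>AB. \<epsilon>' * nrm S u * nrm S w)"
        proof (rule sum_mono)
          fix p assume "p \<in> AB"
          then have "\<bar>Tf (?c n) S (ua (fst p)) (wb (snd p))\<bar> \<le> \<epsilon>' * nrm S (ua (fst p)) * nrm S (wb (snd p))"
            using elim S by (auto simp: ua_def wb_def)
          also have "\<dots> \<le> \<epsilon>' * nrm S u * nrm S w" using nu nw e' nrm_nonneg by (intro mult_mono) auto
          finally show "\<bar>Tf (?c n) S (ua (fst p)) (wb (snd p))\<bar> \<le> \<epsilon>' * nrm S u * nrm S w" .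
        qed
        also have "\<dots> = (real (card AB) * \<epsilon>') * (nrm S u * nrm S w)" by simp
        also have "\<dots> \<le> \<epsilon> * (nrm S u * nrm S w)"
        proof (intro mult_right_mono)
          have "real (card AB) * \<epsilon>' \<le> (real k * real k + 1) * \<epsilon>'" using cAB e' by (intro mult_right_mono) auto
          also have "\<dots> = \<epsilon>" using kk by (simp add: \<epsilon>'_def)
          finally show "real (card AB) * \<epsilon>' \<le> \<epsilon>" .
        qed (simp add: nrm_nonneg)
        finally show "\<bar>Tf (?c n) S u w\<bar> \<le> \<epsilon> * nrm S u * nrm S w" by (simp add: mult.assoc)
      qed
    qed
  qed
  have sg: "\<forall>\<^sub>F n in U. \<forall>j. \<forall>l\<in>\<Lambda>. \<bar>?c n {(j, l)}\<bar> \<le> \<epsilon>" if \<epsilon>: "\<epsilon> > 0" for \<epsilon>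
  proof -
    have "\<forall>\<^sub>F n in U. \<forall>j. \<bar>?c n {(j, l)}\<bar> \<le> \<epsilon>" if l: "l \<in> \<Lambda>" for l
    proof (cases "l \<le> k")
      case False
      have "?c n {(j, l)} = 0" for n j
        by (rule cf_weight[OF CC_pol[OF RC] k, of "{j}"]) (use l False in \<open>auto simp: Kset_def weight_def\<close>)
      then show ?thesis using \<epsilon> by simp
    next
      case True
      show ?thesis
      proof (rule ccontr)
        assume "\<not> ?thesis"
        then have ev: "\<forall>\<^sub>F n in U. \<exists>j. \<bar>?c n {(j, l)}\<bar> > \<epsilon>" unfolding U_not_iff by (simp add: not_le)
        \<comment> \<open>Picking a violating coordinate at each n reduces the claim, uniform in j,
          to a single coordinate sequence.\<close>
        define J where "J n = (SOME j. \<bar>?c n {(j, l)}\<bar> > \<epsilon>)" for n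
        have J: "\<bar>?c n {(J n, l)}\<bar> > \<epsilon>" if "\<exists>j. \<bar>?c n {(j, l)}\<bar> > \<epsilon>" for n
          using someI_ex[OF that] unfolding J_def .
        have "?c n {(J n, l)} = (\<Sum>i\<le>degree (e l). coeff (e l) i * EE (\<lambda>x. R n x * x (J n) ^ i))" for n
        proof -
          have "integrable X.P (\<lambda>x. R n x * x (J n) ^ i)" for i
            by (rule X.pol_integrable_mult[OF CC_pol[OF RC] pol_power[OF pol_coord[of "J n" UNIV 1]]]) auto
          then have "(\<Sum>i\<le>degree (e l). coeff (e l) i * EE (\<lambda>x. R n x * x (J n) ^ i)) = EE (\<lambda>x. \<Sum>i\<le>degree (e l). coeff (e l) i * (R n x * x (J n) ^ i))"
            by (simp add: Bochner_Integration.integral_sum)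
          also have "\<dots> = ?c n {(J n, l)}"
            unfolding X.cf_def mprod_def X.xi_def poly_altdef
            by (intro Bochner_Integration.integral_cong refl) (simp add: sum_distrib_left mult_ac)
          finally show ?thesis by simp
        qed
        moreover have "((\<lambda>n. \<Sum>i\<le>degree (e l). coeff (e l) i * EE (\<lambda>x. R n x * x (J n) ^ i)) \<longlongrightarrow> (\<Sum>i\<le>degree (e l). coeff (e l) i * 0)) U"
        proof (intro tendsto_intros pw)
          fix i assume "i \<in> {..degree (e l)}"
          then show "i \<le> k" using X.e_deg[of l] True by simp
        qed
        ultimately have "((\<lambda>n. ?c n {(J n, l)}) \<longlongrightarrow> 0) U" by simp
        from order_tendstoD(2)[OF tendsto_rabs_zero[OF this] \<epsilon>]
        have "\<forall>\<^sub>F n in U. False" using ev by eventually_elim (use J in force)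
        then show False using U_bot by (simp add: eventually_False)
      qed
    qed
    then have "\<forall>\<^sub>F n in U. \<forall>l\<in>\<Lambda>. \<forall>j. \<bar>?c n {(j, l)}\<bar> \<le> \<epsilon>"
      by (intro eventually_ball_finite fin\<Lambda>) auto
    then show ?thesis by eventually_elim auto
  qed
  have mean: "((\<lambda>n. ?c n {}) \<longlongrightarrow> 0) U"
    using pw[of 0 "\<lambda>_. 0"] by (simp add: X.cf_def)
  show ?thesis unfolding AH_def using RL T sg mean by blast
qed

lemma cf_add: "A \<in> pol UNIV k \<Longrightarrow> B \<in> pol UNIV k \<Longrightarrow> finite S \<Longrightarrow> m \<in> KL S \<Longrightarrow> X.cf (\<lambda>x. A x + B x) m = X.cf A m + X.cf B m"
  unfolding X.cf_def distrib_right
  by (intro Bochner_Integration.integral_add X.pol_integrable_mult[OF _ X.xi_mprod_pol])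

lemma cf_scale: "X.cf (\<lambda>x. c * A x) m = c * X.cf A m"
  unfolding X.cf_def by (simp add: mult.assoc)

lemma AH_lin:
  assumes R: "R \<in> AH" and R': "R' \<in> AH"
  shows "(\<lambda>n x. c * R n x + R' n x) \<in> AH"
proof -
  let ?R = "\<lambda>n x. c * R n x + R' n x"
  have C: "(\<lambda>n x. c * R n x) \<in> CC L" "R' \<in> CC L" using R R' by (auto simp: AH_def intro: CC_scale)
  have cf: "X.cf (?R n) m = c * X.cf (R n) m + X.cf (R' n) m" if "finite S" "m \<in> KL S" for n m S
    using cf_add[OF CC_pol[OF C(1)] CC_pol[OF C(2)] that] cf_scale by simp
  have T: "Tf (X.cf (?R n)) S u w = c * Tf (X.cf (R n)) S u w + Tf (X.cf (R' n)) S u w" if "finite S" for n S u w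
  proof -
    have "Tf (X.cf (?R n)) S u w = Tf (\<lambda>m. c * X.cf (R n) m + 1 * X.cf (R' n) m) S u w"
      unfolding Tf_def by (intro sum.cong refl) (simp add: cf[OF that])
    then show ?thesis unfolding Tf_linear by simp
  qed
  show ?thesis unfolding AH_def
  proof (intro CollectI conjI allI impI)
    show "?R \<in> CC L" by (intro CC_add C)
    have "X.cf (?R n) {} = c * X.cf (R n) {} + X.cf (R' n) {}" for n by (rule cf[of "{}"]) auto
    then show "((\<lambda>n. X.cf (?R n) {}) \<longlongrightarrow> 0) U"
      using R R' by (auto simp: AH_def intro!: tendsto_eq_intros)
    fix \<epsilon> :: real assume \<epsilon>: "\<epsilon> > 0"
    define \<delta> where "\<delta> = \<epsilon> / (\<bar>c\<bar> + 1)"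
    have "\<bar>c\<bar> + 1 > 0" by simp
    then have "\<delta> > 0" "(\<bar>c\<bar> + 1) * \<delta> = \<epsilon>" using \<epsilon> by (simp_all add: \<delta>_def)
    then have \<delta>: "\<delta> > 0" "\<bar>c\<bar> * \<delta> + \<delta> = \<epsilon>" by (simp_all add: distrib_right)
    have le: "\<bar>c * t + t'\<bar> \<le> \<epsilon> * r" if "\<bar>t\<bar> \<le> \<delta> * r" "\<bar>t'\<bar> \<le> \<delta> * r" for t t' r
    proof -
      have "\<bar>c * t + t'\<bar> \<le> \<bar>c\<bar> * \<bar>t\<bar> + \<bar>t'\<bar>" by (simp add: abs_mult[symmetric])
      also have "\<dots> \<le> \<bar>c\<bar> * (\<delta> * r) + \<delta> * r" using that by (intro add_mono mult_left_mono) auto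
      finally show ?thesis unfolding \<delta>(2)[symmetric] by (simp add: algebra_simps)
    qed
    have "\<forall>\<^sub>F n in U. Tle (X.cf (R n)) \<delta>" "\<forall>\<^sub>F n in U. Tle (X.cf (R' n)) \<delta>"
      using R R' \<delta>(1) unfolding AH_def by blast+
    then show "\<forall>\<^sub>F n in U. Tle (X.cf (?R n)) \<epsilon>"
    proof eventually_elim
      case (elim n)
      show ?case
      proof (intro allI impI)
        fix S u w assume S: "finite (S::nat set)"
        show "\<bar>Tf (X.cf (?R n)) S u w\<bar> \<le> \<epsilon> * nrm S u * nrm S w"
          unfolding T[OF S] mult.assoc by (rule le) (use elim S in \<open>auto simp: mult.assoc\<close>)
      qed
    qed
    have "\<forall>\<^sub>F n in U. \<forall>j. \<forall>l\<in>\<Lambda>. \<bar>X.cf (R n) {(j, l)}\<bar> \<le> \<delta>" "\<forall>\<^sub>F n in U. \<forall>j. \<forall>l\<in>\<Lambda>. \<bar>X.cf (R' n) {(j, l)}\<bar> \<le> \<delta>"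
      using R R' \<delta>(1) unfolding AH_def by blast+
    then show "\<forall>\<^sub>F n in U. \<forall>j. \<forall>l\<in>\<Lambda>. \<bar>X.cf (?R n) {(j, l)}\<bar> \<le> \<epsilon>"
    proof eventually_elim
      case (elim n)
      show ?case
      proof (intro allI ballI)
        fix j l assume l: "l \<in> \<Lambda>"
        have c: "X.cf (?R n) {(j, l)} = c * X.cf (R n) {(j, l)} + X.cf (R' n) {(j, l)}"
          by (rule cf[of "{j}"]) (use l in \<open>auto simp: Kset_def\<close>)
        show "\<bar>X.cf (?R n) {(j, l)}\<bar> \<le> \<epsilon>" unfolding c using le[of _ 1] elim l by simp
      qed
    qed
  qed
qed

lemma AH_zero: "(\<lambda>n x. 0) \<in> AH"
  unfolding AH_def by (auto simp: CC_const X.cf_def Tf_def nrm_nonneg)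

lemma AH_sum: "(\<And>t. t \<in> T \<Longrightarrow> R t \<in> AH) \<Longrightarrow> (\<lambda>n x. \<Sum>t\<in>T. c t * R t n x) \<in> AH"
proof (induction T rule: infinite_finite_induct)
  case (insert t T)
  then show ?case using AH_lin[of "R t" "\<lambda>n x. \<Sum>t\<in>T. c t * R t n x" "c t"] by simp
qed (auto simp: AH_zero)

text \<open>R is replaced by a multilinear form that avoids the finitely many coordinates
  \<open>J i n\<close>. Vanishing influences make this change small in L^2, and afterwards
  coordinates and form are exactly independent, so the characteristic function factors.\<close>

lemma joint_char:
  fixes J :: "'c \<Rightarrow> nat \<Rightarrow> nat" and \<tau> :: "'c \<Rightarrow> real"
  assumes R: "R \<in> AH" and I: "finite I" and inj: "\<forall>\<^sub>F n in U. inj_on (\<lambda>i. J i n) I"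
  shows "((\<lambda>n. EE (\<lambda>x. iexp ((\<Sum>i\<in>I. \<tau> i * x (J i n)) + R n x))) \<longlongrightarrow>
     (\<Prod>i\<in>I. char \<mu> (\<tau> i)) * exp (- ip R R / 2)) U"
proof -
  let ?c = "\<lambda>n. X.cf (R n)"
  have RC: "R \<in> CC L" using R by (auto simp: AH_def)
  have "\<forall>n. \<exists>S. finite S \<and> (AE x in X.P. R n x = X.ml (?c n) S x)"
  proof
    fix n
    show "\<exists>S. finite S \<and> (AE x in X.P. R n x = X.ml (?c n) S x)"
      by (rule X.expansion[OF CC_pol[OF RC, of n] order_refl]) blast
  qed
  from choice[OF this] obtain S where S: "\<And>n. finite (S n)" and ex: "\<And>n. AE x in X.P. R n x = X.ml (?c n) (S n) x" by blast
  \<comment> \<open>Saturation turns smallness for every fixed bound into one null sequence that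
    dominates contractions and singletons at the same index.\<close>
  define Q where "Q i n z \<longleftrightarrow> 0 \<le> z \<and> z \<le> 1 / real (Suc i) \<and>
     (Tle (?c n) z) \<and>
     (\<forall>j. \<forall>l\<in>\<Lambda>. \<bar>?c n {(j, l)}\<bar> \<le> z)" for i :: nat and n z
  have "\<exists>Z. \<forall>i. \<forall>\<^sub>F n in U. Q i n (Z n)"
  proof (rule saturation)
    fix N :: nat
    have p: "1 / real (Suc N) > 0" by simp
    have "\<forall>\<^sub>F n in U. Tle (?c n) (1 / real (Suc N))"
      "\<forall>\<^sub>F n in U. \<forall>j. \<forall>l\<in>\<Lambda>. \<bar>?c n {(j, l)}\<bar> \<le> 1 / real (Suc N)"
      using R p unfolding AH_def by blast+
    then show "\<forall>\<^sub>F n in U. \<exists>z. \<forall>i\<le>N. Q i n z"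
    proof eventually_elim
      case (elim n)
      show ?case
      proof (intro exI allI impI)
        fix i assume "i \<le> N"
        then have "1 / real (Suc N) \<le> 1 / real (Suc i)" by (intro divide_left_mono) auto
        then show "Q i n (1 / real (Suc N))" using elim unfolding Q_def by auto
      qed
    qed
  qed
  then obtain Z where Z: "\<And>i. \<forall>\<^sub>F n in U. Q i n (Z n)" by blast
  define ok where "ok n \<longleftrightarrow> Q 0 n (Z n)" for n
  have ok: "\<forall>\<^sub>F n in U. ok n" using Z[of 0] by (simp add: ok_def)
  define z where "z n = (if ok n then Z n else 0)" for n
  have z0: "z n \<ge> 0" for n by (auto simp: z_def ok_def Q_def)
  have zlim: "(z \<longlongrightarrow> 0) U"
  proof (rule tendstoI)
    fix r :: real assume "r > 0"
    then obtain i where i: "1 / real (Suc i) < r" using nat_approx_posE by blast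
    show "\<forall>\<^sub>F n in U. dist (z n) 0 < r"
      using Z[of i] by eventually_elim (use i \<open>r > 0\<close> in \<open>auto simp: z_def Q_def simp del: of_nat_Suc\<close>)
  qed
  \<comment> \<open>Coefficients are set to 0 at exceptional indices and at the empty set, so that
    the hypotheses of \<open>multilinear_clt\<close> hold at every n. Exceptional indices are
    invisible along U, and the constant coefficient tends to 0.\<close>
  define f where "f n m = (if ok n \<and> m \<in> KL (S n) \<and> m \<noteq> {} then ?c n m else 0)" for n m
  let ?F = "\<lambda>n. X.ml (f n) (S n)"
  obtain B where B: "B \<ge> 0" "\<And>n. EE (\<lambda>x. (R n x)\<^sup>2) \<le> B" using CC_bound[OF RC] by blast
  have meas: "X.ml g T \<in> borel_measurable X.P" if "finite T" for g T
    using X.ml_pol[OF that, of g] X.pol_meas by blast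
  have [measurable]: "R n \<in> borel_measurable X.P" for n using X.pol_meas[OF CC_pol[OF RC]] .
  have pars: "EE (\<lambda>x. (R n x)\<^sup>2) = (\<Sum>m\<in>KL (S n). (?c n m)\<^sup>2)" for n
  proof -
    note [measurable] = meas[OF S[of n], of "?c n"]
    have "EE (\<lambda>x. (R n x)\<^sup>2) = EE (\<lambda>x. X.ml (?c n) (S n) x * X.ml (?c n) (S n) x)"
      by (rule integral_cong_AE) (measurable, use ex[of n] in \<open>auto elim!: AE_mp simp: power2_eq_square\<close>)
    also have "\<dots> = (\<Sum>m\<in>KL (S n). (?c n m)\<^sup>2)" unfolding X.ml_inner[OF S] by (simp add: power2_eq_square)
    finally show ?thesis .
  qed
  have card_f: "card m \<le> L" if "f n m \<noteq> 0" for n m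
  proof -
    have m: "m \<in> KL (S n)" "?c n m \<noteq> 0" using that by (auto simp: f_def split: if_splits)
    then have "weight m \<le> L" using cf_weight[OF CC_pol[OF RC] order_refl S] by (meson not_le)
    then show ?thesis using X.card_le_weight[OF m(1)] by simp
  qed
  have fB: "(\<Sum>m\<in>KL (S n). (f n m)\<^sup>2) \<le> B" for n
    by (rule order_trans[OF _ B(2)[of n, unfolded pars]]) (intro sum_mono, auto simp: f_def)
  have Tb: "\<bar>Tf (f n) (S n) u w\<bar> \<le> z n * nrm (S n) u * nrm (S n) w" for n u w
  proof (cases "ok n")
    case True
    have "Tf (f n) (S n) u w = Tf (?c n) (S n) u w" unfolding Tf_def by (intro sum.cong refl) (auto simp: f_def True)
    then show ?thesis using True S by (simp add: z_def ok_def Q_def)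
  next
    case False
    then show ?thesis by (simp add: Tf_def f_def z_def)
  qed
  have sg: "\<bar>f n {(j, l)}\<bar> \<le> z n" for n j l
    using z0[of n] by (auto simp: f_def z_def ok_def Q_def Kset_def)
  have clt: "((\<lambda>n. EE (\<lambda>x. iexp (?F n x)) - exp (- (\<Sum>m\<in>KL (S n). (f n m)\<^sup>2) / 2)) \<longlongrightarrow> 0) U"
    by (rule multilinear_clt[where d = L and B = B and \<epsilon> = z and \<eta> = z]) (use S card_f fB Tb z0 zlim sg in \<open>auto simp: f_def split: if_splits\<close>)
  define c0 where "c0 n = ?c n {}" for n
  have c0: "(c0 \<longlongrightarrow> 0) U" using R by (auto simp: AH_def c0_def[abs_def])
  have s2: "\<forall>\<^sub>F n in U. (\<Sum>m\<in>KL (S n). (f n m)\<^sup>2) = EE (\<lambda>x. R n x * R n x) - (c0 n)\<^sup>2"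
    using ok
  proof eventually_elim
    case (elim n)
    have "(\<Sum>m\<in>KL (S n). (?c n m)\<^sup>2) = (?c n {})\<^sup>2 + (\<Sum>m\<in>KL (S n) - {{}}. (?c n m)\<^sup>2)"
      by (rule sum.remove) (auto intro: fin_KL S)
    also have "(\<Sum>m\<in>KL (S n) - {{}}. (?c n m)\<^sup>2) = (\<Sum>m\<in>KL (S n). (f n m)\<^sup>2)"
      by (rule sum.mono_neutral_cong_left) (use S elim in \<open>auto simp: f_def intro: fin_KL\<close>)
    finally show ?case using pars[of n] by (simp add: c0_def power2_eq_square)
  qed
  have "((\<lambda>n. EE (\<lambda>x. R n x * R n x) - (c0 n)\<^sup>2) \<longlongrightarrow> ip R R - 0\<^sup>2) U" by (intro tendsto_intros ip_tendsto[OF RC RC] c0)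
  then have s2lim: "((\<lambda>n. \<Sum>m\<in>KL (S n). (f n m)\<^sup>2) \<longlongrightarrow> ip R R) U"
    using filterlim_cong[OF refl refl s2] by simp
  have exlim: "((\<lambda>n. complex_of_real (exp (- (\<Sum>m\<in>KL (S n). (f n m)\<^sup>2) / 2))) \<longlongrightarrow> complex_of_real (exp (- ip R R / 2))) U"
    by (intro tendsto_intros s2lim) simp
  have F: "((\<lambda>n. EE (\<lambda>x. iexp (?F n x))) \<longlongrightarrow> exp (- ip R R / 2)) U"
    using tendsto_add[OF clt exlim] by simp
  define Jn where "Jn n = (\<lambda>i. J i n) ` I" for n
  \<comment> \<open>Monomials touching a coordinate \<open>J i n\<close> are dropped; their square
    sum is at most the sum of the influences of these coordinates.\<close>
  define f' where "f' n m = (if fst ` m \<inter> Jn n = {} then f n m else 0)" for n m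
  let ?G = "\<lambda>n. X.ml (f' n) (S n)"
  define \<iota> where "\<iota> n = real (card I) * (real (card \<Lambda>) * ((z n)\<^sup>2 + (z n)\<^sup>2))" for n
  have \<iota>: "(\<iota> \<longlongrightarrow> 0) U" unfolding \<iota>_def[abs_def] using zlim by (auto intro!: tendsto_eq_intros)
  have mlp: "\<exists>k. X.ml g T \<in> pol UNIV k" if "finite T" for g T using X.ml_pol[OF that, of g] pol_UNIV_I by blast
  have d1: "EE (\<lambda>x. (?F n x - ?G n x)\<^sup>2) \<le> \<iota> n" for n
  proof -
    have "?F n x - ?G n x = X.ml (\<lambda>m. f n m - f' n m) (S n) x" for x
      by (simp add: X.ml_def sum_subtractf left_diff_distrib)
    then have "EE (\<lambda>x. (?F n x - ?G n x)\<^sup>2) = (\<Sum>m\<in>KL (S n). (f n m - f' n m) * (f n m - f' n m))"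
      by (simp add: power2_eq_square X.ml_inner[OF S])
    also have "\<dots> \<le> (\<Sum>m\<in>KL (S n). \<Sum>j\<in>Jn n. if j \<in> fst ` m then (f n m)\<^sup>2 else 0)"
    proof (rule sum_mono)
      fix m
      show "(f n m - f' n m) * (f n m - f' n m) \<le> (\<Sum>j\<in>Jn n. if j \<in> fst ` m then (f n m)\<^sup>2 else 0)"
      proof (cases "fst ` m \<inter> Jn n = {}")
        case False
        then obtain j where j: "j \<in> Jn n" "j \<in> fst ` m" by auto
        have "(if j \<in> fst ` m then (f n m)\<^sup>2 else 0) \<le> (\<Sum>j\<in>Jn n. if j \<in> fst ` m then (f n m)\<^sup>2 else 0)"
          by (rule member_le_sum[of j]) (use j I in \<open>auto simp: Jn_def\<close>)
        then show ?thesis using False j by (simp add: f'_def power2_eq_square)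
      qed (auto simp: f'_def intro!: sum_nonneg)
    qed
    also have "\<dots> = (\<Sum>j\<in>Jn n. infl (\<lambda>_. \<Lambda>) (f n) (S n) j)" unfolding infl_def by (rule sum.swap)
    also have "\<dots> \<le> (\<Sum>j\<in>Jn n. real (card \<Lambda>) * ((z n)\<^sup>2 + (z n)\<^sup>2))"
      by (intro sum_mono infl_bound[OF S Tb sg])
    also have "\<dots> = real (card (Jn n)) * (real (card \<Lambda>) * ((z n)\<^sup>2 + (z n)\<^sup>2))" by simp
    also have "\<dots> \<le> \<iota> n" unfolding \<iota>_def using card_image_le[OF I, of "\<lambda>i. J i n"]
      by (intro mult_right_mono) (auto simp: Jn_def)
    finally show ?thesis .
  qed
  define Cx where "Cx n x = (\<Sum>i\<in>I. \<tau> i * x (J i n))" for n and x :: "nat \<Rightarrow> real"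
  have Cp: "Cx n \<in> pol UNIV 1" for n unfolding Cx_def[abs_def] by (intro pol_sum pol_scale pol_coord) auto
  have F': "((\<lambda>n. EE (\<lambda>x. iexp (?G n x))) \<longlongrightarrow> exp (- ip R R / 2)) U"
  proof -
    have "cmod (EE (\<lambda>x. iexp (0 + ?F n x)) - EE (\<lambda>x. iexp (0 + ?G n x))) \<le> sqrt (\<iota> n)" for n
    proof -
      obtain k k' where "?F n \<in> pol UNIV k" "?G n \<in> pol UNIV k'" using mlp[OF S] by metis
      from iexp_diff_le[OF this pol_const[of 0 UNIV 0]] show ?thesis using real_sqrt_le_mono[OF d1[of n]] by linarith
    qed
    then have b: "\<forall>\<^sub>F n in U. norm (EE (\<lambda>x. iexp (?F n x)) - EE (\<lambda>x. iexp (?G n x))) \<le> sqrt (\<iota> n)"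
      by (intro always_eventually allI) (simp only: add_0_left)
    have "((\<lambda>n. sqrt (\<iota> n)) \<longlongrightarrow> 0) U" using tendsto_real_sqrt[OF \<iota>] by simp
    from tendsto_diff[OF F Lim_null_comparison[OF b this]] show ?thesis by (simp only: diff_diff_eq2 diff_zero diff_add_cancel) simp
  qed
  have prod: "\<forall>\<^sub>F n in U. EE (\<lambda>x. iexp (Cx n x + ?G n x)) = (\<Prod>i\<in>I. char \<mu> (\<tau> i)) * EE (\<lambda>x. iexp (?G n x))"
    using inj
  proof eventually_elim
    case (elim n)
    note [measurable] = meas[OF S[of n], of "f' n"] X.pol_meas[OF Cp[of n]]
    have "EE (\<lambda>x. iexp (Cx n x + ?G n x)) = EE (\<lambda>x. iexp (Cx n x) * iexp (?G n x))"
      by (simp add: exp_add distrib_left)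
    also have "\<dots> = EE (\<lambda>x. iexp (Cx n x)) * EE (\<lambda>x. iexp (?G n x))"
    proof (rule X.fac(1)[of "Jn n" _ "- Jn n"])
      show "dep (Jn n) (\<lambda>x. iexp (Cx n x))" by (auto simp: dep_def Cx_def Jn_def intro!: arg_cong[of _ _ "\<lambda>t. exp (\<i> * t)"] sum.cong)
      show "dep (- Jn n) (\<lambda>x. iexp (?G n x))"
      proof -
        have "?G n x = ?G n y" if xy: "\<forall>i\<in>- Jn n. x i = y i" for x y
          unfolding X.ml_def
        proof (intro sum.cong refl)
          fix m
          have "mprod X.xi m x = mprod X.xi m y" if "fst ` m \<inter> Jn n = {}"
            unfolding mprod_def X.xi_def
          proof (intro prod.cong refl)
            fix v assume "v \<in> m"
            then have "fst v \<in> - Jn n" using that by auto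
            then show "poly (e (snd v)) (x (fst v)) = poly (e (snd v)) (y (fst v))" using xy by simp
          qed
          then show "f' n m * mprod X.xi m x = f' n m * mprod X.xi m y" by (simp add: f'_def)
        qed
        then show ?thesis unfolding dep_def by metis
      qed
    qed (auto intro!: X.integrable_iexp)
    also have "EE (\<lambda>x. iexp (Cx n x)) = (\<Prod>i\<in>I. char \<mu> (\<tau> i))" unfolding Cx_def by (rule iexp_coords[OF I elim])
    finally show ?case .
  qed
  have "((\<lambda>n. (\<Prod>i\<in>I. char \<mu> (\<tau> i)) * EE (\<lambda>x. iexp (?G n x))) \<longlongrightarrow> (\<Prod>i\<in>I. char \<mu> (\<tau> i)) * exp (- ip R R / 2)) U"
    by (intro tendsto_intros F')
  then have P': "((\<lambda>n. EE (\<lambda>x. iexp (Cx n x + ?G n x))) \<longlongrightarrow> (\<Prod>i\<in>I. char \<mu> (\<tau> i)) * exp (- ip R R / 2)) U"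
    using filterlim_cong[OF refl refl prod] by simp
  have d2: "\<forall>\<^sub>F n in U. cmod (EE (\<lambda>x. iexp (Cx n x + R n x)) - EE (\<lambda>x. iexp (Cx n x + ?G n x))) \<le> sqrt (2 * (c0 n)\<^sup>2 + 2 * \<iota> n)"
    using ok
  proof eventually_elim
    case (elim n)
    obtain k k' where k: "?F n \<in> pol UNIV k" "?G n \<in> pol UNIV k'" using mlp[OF S] by metis
    note [measurable] = meas[OF S[of n], of "f n"] meas[OF S[of n], of "f' n"]
    have eq: "X.ml (?c n) (S n) x = c0 n + ?F n x" for x
    proof -
      have "X.ml (?c n) (S n) x = ?c n {} * mprod X.xi {} x + (\<Sum>m\<in>KL (S n) - {{}}. ?c n m * mprod X.xi m x)"
        unfolding X.ml_def by (rule sum.remove) (auto intro: fin_KL S)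
      also have "(\<Sum>m\<in>KL (S n) - {{}}. ?c n m * mprod X.xi m x) = ?F n x"
        unfolding X.ml_def by (rule sum.mono_neutral_cong_left) (use S elim in \<open>auto simp: f_def intro: fin_KL\<close>)
      finally show ?thesis by (simp add: c0_def)
    qed
    have "EE (\<lambda>x. (R n x - ?G n x)\<^sup>2) = EE (\<lambda>x. (c0 n + (?F n x - ?G n x))\<^sup>2)"
    proof (rule integral_cong_AE)
      show "AE x in X.P. (R n x - ?G n x)\<^sup>2 = (c0 n + (?F n x - ?G n x))\<^sup>2"
        using ex[of n] by eventually_elim (simp only: eq add_diff_eq)
    qed measurable
    also have "\<dots> \<le> 2 * EE (\<lambda>x. (c0 n)\<^sup>2) + 2 * EE (\<lambda>x. (?F n x - ?G n x)\<^sup>2)"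
      by (rule L2_add_le[of _ 0 _ "max k k'"]) (intro pol_const pol_diff pol_mono[OF k(1)] pol_mono[OF k(2)]; simp)+
    also have "\<dots> \<le> 2 * (c0 n)\<^sup>2 + 2 * \<iota> n" using d1[of n] by simp
    finally have "sqrt (EE (\<lambda>x. (R n x - ?G n x)\<^sup>2)) \<le> sqrt (2 * (c0 n)\<^sup>2 + 2 * \<iota> n)" by (rule real_sqrt_le_mono)
    with iexp_diff_le[OF CC_pol[OF RC, of n] k(2) Cp[of n]] show ?case by linarith
  qed
  have "((\<lambda>n. sqrt (2 * (c0 n)\<^sup>2 + 2 * \<iota> n)) \<longlongrightarrow> sqrt (2 * 0\<^sup>2 + 2 * 0)) U" by (intro tendsto_intros c0 \<iota>)
  then have "((\<lambda>n. sqrt (2 * (c0 n)\<^sup>2 + 2 * \<iota> n)) \<longlongrightarrow> 0) U" by simp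
  then have "((\<lambda>n. EE (\<lambda>x. iexp (Cx n x + R n x)) - EE (\<lambda>x. iexp (Cx n x + ?G n x))) \<longlongrightarrow> 0) U"
    by (rule Lim_null_comparison[OF d2])
  from tendsto_add[OF this P'] show ?thesis by (simp add: Cx_def)
qed

end

section \<open>Characteristic functions of random vectors\<close>

lemma pol_bounded:
  assumes "A \<in> pol T k"
  shows "\<exists>C\<ge>0. \<forall>x. (\<forall>i\<in>T. \<bar>x i\<bar> \<le> c) \<longrightarrow> \<bar>A x\<bar> \<le> C"
  using assms
proof (induction rule: pol_induct)
  case (pol_const a k)
  then show ?case by (intro exI[of _ "\<bar>a\<bar>"]) auto
next
  case (pol_var A k i)
  then obtain C where C: "C \<ge> 0" "\<And>x. (\<forall>i\<in>T. \<bar>x i\<bar> \<le> c) \<Longrightarrow> \<bar>A x\<bar> \<le> C" by auto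
  have "\<bar>x i * A x\<bar> \<le> \<bar>c\<bar> * C" if "\<forall>i\<in>T. \<bar>x i\<bar> \<le> c" for x
    using C(2)[OF that] that pol_var(2) C(1) unfolding abs_mult by (intro mult_mono) auto
  then show ?case using C(1) by (intro exI[of _ "\<bar>c\<bar> * C"]) auto
next
  case (pol_add A k B)
  then obtain C C' where C: "C \<ge> 0" "\<And>x. (\<forall>i\<in>T. \<bar>x i\<bar> \<le> c) \<Longrightarrow> \<bar>A x\<bar> \<le> C"
    and C': "C' \<ge> 0" "\<And>x. (\<forall>i\<in>T. \<bar>x i\<bar> \<le> c) \<Longrightarrow> \<bar>B x\<bar> \<le> C'" by auto
  have "\<bar>A x + B x\<bar> \<le> C + C'" if "\<forall>i\<in>T. \<bar>x i\<bar> \<le> c" for x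
    using C(2)[OF that] C'(2)[OF that] by linarith
  then show ?case using C(1) C'(1) by (intro exI[of _ "C + C'"]) auto
qed

lemma pol_Lipschitz:
  assumes "A \<in> pol T k" "finite T"
  shows "\<exists>C\<ge>0. \<forall>x y. (\<forall>i\<in>T. \<bar>x i\<bar> \<le> c \<and> \<bar>y i\<bar> \<le> c) \<longrightarrow> \<bar>A x - A y\<bar> \<le> C * (\<Sum>i\<in>T. \<bar>x i - y i\<bar>)"
  using assms(1)
proof (induction rule: pol_induct)
  case (pol_const a k)
  then show ?case by (intro exI[of _ 0]) auto
next
  case (pol_var A k i)
  then obtain C where C: "C \<ge> 0" "\<And>x y. (\<forall>i\<in>T. \<bar>x i\<bar> \<le> c \<and> \<bar>y i\<bar> \<le> c) \<Longrightarrow> \<bar>A x - A y\<bar> \<le> C * (\<Sum>i\<in>T. \<bar>x i - y i\<bar>)" by auto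
  obtain C' where C': "C' \<ge> 0" "\<And>x. (\<forall>i\<in>T. \<bar>x i\<bar> \<le> c) \<Longrightarrow> \<bar>A x\<bar> \<le> C'" using pol_bounded[OF pol_var(1), of c] by blast
  have "\<bar>x i * A x - y i * A y\<bar> \<le> (C' + \<bar>c\<bar> * C) * (\<Sum>i\<in>T. \<bar>x i - y i\<bar>)" if xy: "\<forall>i\<in>T. \<bar>x i\<bar> \<le> c \<and> \<bar>y i\<bar> \<le> c" for x y
  proof -
    define s where "s = (\<Sum>i\<in>T. \<bar>x i - y i\<bar>)"
    have s: "\<bar>x i - y i\<bar> \<le> s" unfolding s_def using assms(2) pol_var(2) by (intro member_le_sum) auto
    have "x i * A x - y i * A y = (x i - y i) * A x + y i * (A x - A y)" by (simp add: algebra_simps)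
    then have "\<bar>x i * A x - y i * A y\<bar> \<le> \<bar>x i - y i\<bar> * \<bar>A x\<bar> + \<bar>y i\<bar> * \<bar>A x - A y\<bar>" by (metis abs_mult abs_triangle_ineq)
    also have "\<dots> \<le> s * C' + \<bar>c\<bar> * (C * s)"
    proof (intro add_mono mult_mono s)
      show "\<bar>A x\<bar> \<le> C'" using C'(2) xy by blast
      show "\<bar>y i\<bar> \<le> \<bar>c\<bar>" using xy pol_var(2) by auto
      show "\<bar>A x - A y\<bar> \<le> C * s" unfolding s_def by (rule C(2)[OF xy])
    qed (use s in auto)
    finally show ?thesis by (simp add: s_def algebra_simps)
  qed
  then show ?case using C(1) C'(1) by (intro exI[of _ "C' + \<bar>c\<bar> * C"]) auto
next
  case (pol_add A k B)
  then obtain C C' where C: "C \<ge> 0" "\<And>x y. (\<forall>i\<in>T. \<bar>x i\<bar> \<le> c \<and> \<bar>y i\<bar> \<le> c) \<Longrightarrow> \<bar>A x - A y\<bar> \<le> C * (\<Sum>i\<in>T. \<bar>x i - y i\<bar>)"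
    and C': "C' \<ge> 0" "\<And>x y. (\<forall>i\<in>T. \<bar>x i\<bar> \<le> c \<and> \<bar>y i\<bar> \<le> c) \<Longrightarrow> \<bar>B x - B y\<bar> \<le> C' * (\<Sum>i\<in>T. \<bar>x i - y i\<bar>)" by auto
  have "\<bar>(A x + B x) - (A y + B y)\<bar> \<le> (C + C') * (\<Sum>i\<in>T. \<bar>x i - y i\<bar>)" if xy: "\<forall>i\<in>T. \<bar>x i\<bar> \<le> c \<and> \<bar>y i\<bar> \<le> c" for x y
    using C(2)[OF xy] C'(2)[OF xy] by (simp add: distrib_right)
  then show ?case using C(1) C'(1) by (intro exI[of _ "C + C'"]) auto
qed

lemma pol_continuous: "A \<in> pol T k \<Longrightarrow> continuous_on S A"
  by (induction rule: pol_induct) (auto intro!: continuous_intros continuous_on_subset[OF continuous_on_product_coordinates])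

lemma sin_iexp: "complex_of_real (sin y) = (iexp y - iexp (- y)) / (2 * \<i>)"
proof -
  have "sin (complex_of_real y) = (exp (\<i> * y) - exp (- (\<i> * y))) / (2 * \<i>)"
    by (rule sin_exp_eq)
  then show ?thesis by (simp add: sin_of_real[symmetric])
qed

lemma sin_approx: fixes y :: real shows "\<bar>sin y - y\<bar> \<le> y\<^sup>2 / 2"
proof -
  have "cmod (iexp y - (1 + \<i> * y)) \<le> y\<^sup>2 / 2"
    using iexp_approx1[of y 1] by (simp add: power2_eq_square)
  moreover have "Im (iexp y - (1 + \<i> * y)) = sin y - y" by (simp add: Im_exp)
  ultimately show ?thesis using abs_Im_le_cmod[of "iexp y - (1 + \<i> * y)"] by simp
qed

lemma iexp_shift:
  assumes "finite T" "i \<in> T" and that: "a = s * v i"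
  shows "iexp a * iexp (\<Sum>l\<in>T. \<tau> l * v l) = iexp (\<Sum>l\<in>T. (\<tau>(i := \<tau> i + s)) l * v l)"
proof -
  have "(\<Sum>l\<in>T. (\<tau>(i := \<tau> i + s)) l * v l) = (\<Sum>l\<in>T. \<tau> l * v l + (if l = i then s * v i else 0))"
    by (intro sum.cong refl) (auto simp: algebra_simps)
  also have "\<dots> = (\<Sum>l\<in>T. \<tau> l * v l) + a" using assms that by (simp add: sum.distrib)
  finally show ?thesis by (simp add: exp_add[symmetric] algebra_simps)
qed

context prob_space begin

lemma integral_close:
  fixes f g :: "'a \<Rightarrow> real"
  assumes i: "integrable M f" "integrable M g" and c: "\<And>\<omega>. \<bar>f \<omega> - g \<omega>\<bar> \<le> c"
  shows "\<bar>(\<integral>\<omega>. f \<omega> \<partial>M) - (\<integral>\<omega>. g \<omega> \<partial>M)\<bar> \<le> c"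
proof -
  have "\<bar>\<integral>\<omega>. f \<omega> - g \<omega> \<partial>M\<bar> \<le> (\<integral>\<omega>. \<bar>f \<omega> - g \<omega>\<bar> \<partial>M)" by (rule integral_abs_bound)
  also have "\<dots> \<le> (\<integral>\<omega>. c \<partial>M)" by (rule integral_mono) (use i c in auto)
  finally show ?thesis using i by (simp add: prob_space)
qed

lemma sin_pol_int:
  assumes [measurable]: "\<And>i. V i \<in> borel_measurable M" and A: "A \<in> pol T k"
  shows "integrable M (\<lambda>\<omega>. complex_of_real (A (\<lambda>i. sin (V i \<omega> / c))) * iexp (\<Sum>i\<in>T'. \<tau> i * V i \<omega>))"
proof -
  obtain C where C: "\<And>x. (\<forall>i\<in>T. \<bar>x i\<bar> \<le> 1) \<Longrightarrow> \<bar>A x\<bar> \<le> C" using pol_bounded[OF A, of 1] by blast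
  have [measurable]: "(\<lambda>\<omega>. A (\<lambda>i. sin (V i \<omega> / c))) \<in> borel_measurable M" by (rule pol_measurable[OF A]) measurable
  show ?thesis by (rule integrable_const_bound[of _ C]) (auto simp: norm_mult intro!: C)
qed

text \<open>A factor sin(v/c) is a difference of two exponentials, each of which shifts the
  frequency of coordinate \<open>i\<close> by 1/c or -1/c.\<close>

lemma sin_pol_var:
  assumes V: "\<And>i. V i \<in> borel_measurable M" and T: "finite T" "i \<in> T" and A: "A \<in> pol T k"
  shows "(\<integral>\<omega>. complex_of_real (sin (V i \<omega> / c) * A (\<lambda>i. sin (V i \<omega> / c))) * iexp (\<Sum>i\<in>T. \<tau> i * V i \<omega>) \<partial>M) =
     (\<integral>\<omega>. complex_of_real (A (\<lambda>i. sin (V i \<omega> / c))) * iexp (\<Sum>l\<in>T. (\<tau>(i := \<tau> i + 1 / c)) l * V l \<omega>) \<partial>M) * (1 / (2 * \<i>)) -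
     (\<integral>\<omega>. complex_of_real (A (\<lambda>i. sin (V i \<omega> / c))) * iexp (\<Sum>l\<in>T. (\<tau>(i := \<tau> i + - 1 / c)) l * V l \<omega>) \<partial>M) * (1 / (2 * \<i>))"
proof -
  have eq: "complex_of_real (sin (v i / c) * a) * iexp (\<Sum>i\<in>T. \<tau> i * v i) =
     (complex_of_real a * iexp (\<Sum>l\<in>T. (\<tau>(i := \<tau> i + 1 / c)) l * v l)) * (1 / (2 * \<i>)) - (complex_of_real a * iexp (\<Sum>l\<in>T. (\<tau>(i := \<tau> i + - 1 / c)) l * v l)) * (1 / (2 * \<i>))" for v a
  proof -
    have 1: "iexp (v i / c) * iexp (\<Sum>i\<in>T. \<tau> i * v i) = iexp (\<Sum>l\<in>T. (\<tau>(i := \<tau> i + 1 / c)) l * v l)"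
      by (rule iexp_shift[OF T]) simp
    have 2: "iexp (- (v i / c)) * iexp (\<Sum>i\<in>T. \<tau> i * v i) = iexp (\<Sum>l\<in>T. (\<tau>(i := \<tau> i + - 1 / c)) l * v l)"
      by (rule iexp_shift[OF T]) simp
    show ?thesis unfolding of_real_mult sin_iexp 1[symmetric] 2[symmetric] by (simp add: field_simps)
  qed
  show ?thesis
    unfolding eq[of "\<lambda>i. V i _"] integral_mult_left_zero[symmetric]
    by (rule Bochner_Integration.integral_diff) (intro integrable_mult_left sin_pol_int[OF V A])+
qed

end

locale vec_conv =
  fixes M :: "'n \<Rightarrow> 'a measure" and V :: "'n \<Rightarrow> nat \<Rightarrow> 'a \<Rightarrow> real"
    and N :: "'b measure" and W :: "nat \<Rightarrow> 'b \<Rightarrow> real" and F :: "'n filter"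
  assumes prob_M: "\<And>n. prob_space (M n)" and prob_N: "prob_space N"
    and V_meas[measurable]: "\<And>n i. V n i \<in> borel_measurable (M n)"
    and W_meas[measurable]: "\<And>i. W i \<in> borel_measurable N"
    and char_conv: "\<And>T \<tau>. finite T \<Longrightarrow> ((\<lambda>n. \<integral>\<omega>. iexp (\<Sum>i\<in>T. \<tau> i * V n i \<omega>) \<partial>M n) \<longlongrightarrow> (\<integral>\<omega>. iexp (\<Sum>i\<in>T. \<tau> i * W i \<omega>) \<partial>N)) F"
begin

text \<open>Polynomials in the sin(v/c) are trigonometric polynomials. The exponential factor with
  arbitrary \<open>\<tau>\<close> is carried along so that the induction hypothesis absorbs the
  shifted frequencies.\<close>

lemma sin_pol_conv:
  assumes A: "A \<in> pol T k" and T: "finite T"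
  shows "((\<lambda>n. \<integral>\<omega>. complex_of_real (A (\<lambda>i. sin (V n i \<omega> / c))) * iexp (\<Sum>i\<in>T. \<tau> i * V n i \<omega>) \<partial>M n) \<longlongrightarrow>
     (\<integral>\<omega>. complex_of_real (A (\<lambda>i. sin (W i \<omega> / c))) * iexp (\<Sum>i\<in>T. \<tau> i * W i \<omega>) \<partial>N)) F"
  using A
proof (induction arbitrary: \<tau> rule: pol_induct)
  case (pol_const a k)
  show ?case unfolding integral_mult_right_zero by (intro tendsto_intros char_conv T)
next
  case (pol_var A k i)
  show ?case
    unfolding prob_space.sin_pol_var[where M = "M _" and V = "V _", OF prob_M V_meas T pol_var(2,1)] prob_space.sin_pol_var[where V = W, OF prob_N W_meas T pol_var(2,1)]
    by (intro tendsto_intros pol_var.IH)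
next
  case (pol_add A k B)
  have "(\<integral>\<omega>. complex_of_real (A (\<lambda>i. sin (H i \<omega> / c)) + B (\<lambda>i. sin (H i \<omega> / c))) * iexp (\<Sum>i\<in>T. \<tau> i * H i \<omega>) \<partial>K) =
      (\<integral>\<omega>. complex_of_real (A (\<lambda>i. sin (H i \<omega> / c))) * iexp (\<Sum>i\<in>T. \<tau> i * H i \<omega>) \<partial>K) +
      (\<integral>\<omega>. complex_of_real (B (\<lambda>i. sin (H i \<omega> / c))) * iexp (\<Sum>i\<in>T. \<tau> i * H i \<omega>) \<partial>K)"
    if "prob_space K" "\<And>i. H i \<in> borel_measurable K" for K :: "'k measure" and H
    unfolding of_real_add distrib_right
    by (rule Bochner_Integration.integral_add) (rule prob_space.sin_pol_int[OF that(1,2) pol_add(1)] prob_space.sin_pol_int[OF that(1,2) pol_add(2)])+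
  note this[where K1 = "M _" and H1 = "V _", OF prob_M V_meas] this[OF prob_N W_meas]
  then show ?case by (simp only:) (intro tendsto_intros pol_add.IH)
qed

lemma sin_pol_conv_real:
  assumes A: "A \<in> pol T k"
  shows "((\<lambda>n. \<integral>\<omega>. A (\<lambda>i. sin (V n i \<omega> / c)) \<partial>M n) \<longlongrightarrow> (\<integral>\<omega>. A (\<lambda>i. sin (W i \<omega> / c)) \<partial>N)) F"
proof -
  obtain T' where T': "finite T'" "A \<in> pol T' k" using pol_finite[OF A] by blast
  have "((\<lambda>n. complex_of_real (\<integral>\<omega>. A (\<lambda>i. sin (V n i \<omega> / c)) \<partial>M n)) \<longlongrightarrow> complex_of_real (\<integral>\<omega>. A (\<lambda>i. sin (W i \<omega> / c)) \<partial>N)) F"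
    using sin_pol_conv[OF T'(2,1), of c "\<lambda>_. 0"] by simp
  then show ?thesis using tendsto_of_real_iff by blast
qed

text \<open>The vectors with entries sin(v/c) lie in the compact cube of sequences in [-1, 1], where
  Stone-Weierstrass approximates a continuous function by polynomials uniformly. This takes the
  place of a tightness argument and handles infinitely many coordinates at once.\<close>

lemma clamp_conv:
  fixes \<Phi> :: "(nat \<Rightarrow> real) \<Rightarrow> real"
  assumes cont: "continuous_on UNIV \<Phi>" and b: "\<And>x. \<bar>\<Phi> x\<bar> \<le> b"
    and mM: "\<And>n. (\<lambda>\<omega>. \<Phi> (\<lambda>i. c * sin (V n i \<omega> / c))) \<in> borel_measurable (M n)"
    and mN: "(\<lambda>\<omega>. \<Phi> (\<lambda>i. c * sin (W i \<omega> / c))) \<in> borel_measurable N"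
  shows "((\<lambda>n. \<integral>\<omega>. \<Phi> (\<lambda>i. c * sin (V n i \<omega> / c)) \<partial>M n) \<longlongrightarrow> (\<integral>\<omega>. \<Phi> (\<lambda>i. c * sin (W i \<omega> / c)) \<partial>N)) F"
proof (rule tendstoI)
  fix r :: real assume r: "r > 0"
  define K where "K = {x :: nat \<Rightarrow> real. \<forall>i. x i \<in> {-1..1}}"
  have cK: "compact K"
  proof -
    have "compactin (product_topology (\<lambda>_::nat. euclideanreal) UNIV) (PiE UNIV (\<lambda>_. {-1..1}))"
      unfolding compactin_PiE by (auto simp: compactin_euclidean_iff)
    then show ?thesis unfolding euclidean_product_topology compactin_euclidean_iff
      by (simp add: K_def PiE_def Pi_def)
  qed
  interpret R: function_ring_on "\<Union>k. pol UNIV k" K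
  proof
    show "compact K" by (rule cK)
    fix f g :: "(nat \<Rightarrow> real) \<Rightarrow> real"
    show "f \<in> (\<Union>k. pol UNIV k) \<Longrightarrow> continuous_on K f" by (auto intro: pol_continuous)
    assume "f \<in> (\<Union>k. pol UNIV k)" "g \<in> (\<Union>k. pol UNIV k)"
    then obtain k k' where fg: "f \<in> pol UNIV k" "g \<in> pol UNIV k'" by auto
    show "(\<lambda>x. f x + g x) \<in> (\<Union>k. pol UNIV k)"
      using pol_add[OF pol_mono[OF fg(1) order_refl, of "max k k'"] pol_mono[OF fg(2) order_refl, of "max k k'"]] by auto
    show "(\<lambda>x. f x * g x) \<in> (\<Union>k. pol UNIV k)" using pol_mult[OF fg] by auto
  next
    show "(\<lambda>_. a) \<in> (\<Union>k. pol UNIV k)" for a by (auto intro: pol_const)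
  next
    fix x y :: "nat \<Rightarrow> real" assume "x \<noteq> y"
    then obtain i where "x i \<noteq> y i" by auto
    then show "\<exists>f\<in>(\<Union>k. pol UNIV k). f x \<noteq> f y"
      using pol_coord[of i UNIV 1] by (intro bexI[of _ "\<lambda>x. x i"]) auto
  qed
  have "continuous_on K (\<lambda>x. \<Phi> (\<lambda>i. c * x i))"
  proof (rule continuous_on_compose2[OF cont])
    show "continuous_on K (\<lambda>x i. c * x i)"
      by (rule continuous_on_coordinatewise_then_product) (intro continuous_intros continuous_on_subset[OF continuous_on_product_coordinates], auto)
  qed auto
  then obtain A where A: "A \<in> (\<Union>k. pol UNIV k)" "\<And>x. x \<in> K \<Longrightarrow> \<bar>\<Phi> (\<lambda>i. c * x i) - A x\<bar> < r / 3"
    using R.Stone_Weierstrass_basic[of "\<lambda>x. \<Phi> (\<lambda>i. c * x i)" "r / 3"] r by auto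
  then obtain k where Ak: "A \<in> pol UNIV k" by auto
  have inK: "(\<lambda>i. sin (v i / c)) \<in> K" for v by (auto simp: K_def)
  have close: "\<bar>(\<integral>\<omega>. \<Phi> (\<lambda>i. c * sin (H i \<omega> / c)) \<partial>K') - (\<integral>\<omega>. A (\<lambda>i. sin (H i \<omega> / c)) \<partial>K')\<bar> \<le> r / 3"
    if K': "prob_space K'" and H: "\<And>i. H i \<in> borel_measurable K'" and m: "(\<lambda>\<omega>. \<Phi> (\<lambda>i. c * sin (H i \<omega> / c))) \<in> borel_measurable K'" for K' :: "'k measure" and H
  proof (rule prob_space.integral_close[OF K'])
    show "integrable K' (\<lambda>\<omega>. \<Phi> (\<lambda>i. c * sin (H i \<omega> / c)))"
      by (rule finite_measure.integrable_const_bound[OF prob_space.finite_measure[OF K'], of _ b]) (use b m in auto)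
    show "integrable K' (\<lambda>\<omega>. A (\<lambda>i. sin (H i \<omega> / c)))"
      using prob_space.sin_pol_int[OF K' H Ak, where T' = "{}" and c = c] by (simp add: complex_of_real_integrable_eq)
    show "\<bar>\<Phi> (\<lambda>i. c * sin (H i \<omega> / c)) - A (\<lambda>i. sin (H i \<omega> / c))\<bar> \<le> r / 3" for \<omega>
      using A(2)[OF inK, of "\<lambda>i. H i \<omega>"] by simp
  qed
  note dM = close[OF prob_M V_meas mM] and dN = close[OF prob_N W_meas mN]
  have "\<forall>\<^sub>F n in F. dist (\<integral>\<omega>. A (\<lambda>i. sin (V n i \<omega> / c)) \<partial>M n) (\<integral>\<omega>. A (\<lambda>i. sin (W i \<omega> / c)) \<partial>N) < r / 3"
    using sin_pol_conv_real[OF Ak, of c] r by (intro tendstoD) auto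
  then show "\<forall>\<^sub>F n in F. dist (\<integral>\<omega>. \<Phi> (\<lambda>i. c * sin (V n i \<omega> / c)) \<partial>M n) (\<integral>\<omega>. \<Phi> (\<lambda>i. c * sin (W i \<omega> / c)) \<partial>N) < r"
  proof eventually_elim
    case (elim n)
    then show ?case using dM[of n] dN unfolding dist_real_def by linarith
  qed
qed

end

text \<open>With c = n + 1 and t = v/c the error is c |sin t - t|, at most v^2 / (2 c).\<close>

lemma clamp_limit: "(\<lambda>n. real (Suc n) * sin (v / real (Suc n))) \<longlonglongrightarrow> v"
proof (rule LIM_zero_cancel, rule Lim_null_comparison)
  show "\<forall>\<^sub>F n in sequentially. norm (real (Suc n) * sin (v / real (Suc n)) - v) \<le> v\<^sup>2 / 2 * (1 / real (Suc n))"
  proof (intro always_eventually allI)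
    fix n
    define c where "c = real (Suc n)"
    have c: "c > 0" by (simp add: c_def)
    have "\<bar>c * sin (v / c) - v\<bar> = c * \<bar>sin (v / c) - v / c\<bar>"
      using c abs_mult[of c "sin (v / c) - v / c"] by (simp add: right_diff_distrib)
    also have "\<dots> \<le> c * ((v / c)\<^sup>2 / 2)" using c by (intro mult_left_mono sin_approx) auto
    also have "\<dots> = v\<^sup>2 / 2 * (1 / c)" using c by (simp add: power2_eq_square)
    finally show "norm (real (Suc n) * sin (v / real (Suc n)) - v) \<le> v\<^sup>2 / 2 * (1 / real (Suc n))" by (simp add: c_def)
  qed
  have "(\<lambda>n. v\<^sup>2 / 2 * (1 / real (Suc n))) \<longlonglongrightarrow> v\<^sup>2 / 2 * 0"
    by (intro tendsto_intros LIMSEQ_Suc lim_1_over_n)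
  then show "(\<lambda>n. v\<^sup>2 / 2 * (1 / real (Suc n))) \<longlonglongrightarrow> 0" by simp
qed

lemma tendsto_coordinatewise:
  fixes f :: "'a \<Rightarrow> nat \<Rightarrow> real"
  assumes "\<And>i. ((\<lambda>n. f n i) \<longlongrightarrow> l i) F"
  shows "(f \<longlongrightarrow> l) F"
proof -
  have "limitin (product_topology (\<lambda>_. euclideanreal) UNIV) f l F"
    unfolding limitin_componentwise using assms by simp
  then show ?thesis by (simp add: euclidean_product_topology)
qed

lemma vec_measurable_borel:
  fixes V :: "nat \<Rightarrow> 'a \<Rightarrow> real"
  assumes "\<And>i. V i \<in> borel_measurable M"
  shows "(\<lambda>\<omega> i. V i \<omega>) \<in> borel_measurable M"
proof -
  have "(\<lambda>\<omega> i. V i \<omega>) \<in> measurable M (PiM UNIV (\<lambda>_. borel))"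
    by (rule measurable_PiM_single') (use assms in auto)
  then show ?thesis using measurable_cong_sets[OF refl sets_PiM_equal_borel] by blast
qed

text \<open>\<open>clamp_conv\<close> for constant sequences gives equality for every clamped
  version, and dominated convergence removes the clamp as c tends to infinity.\<close>

lemma char_unique:
  fixes V :: "nat \<Rightarrow> 'a \<Rightarrow> real" and W :: "nat \<Rightarrow> 'b \<Rightarrow> real" and \<Phi> :: "(nat \<Rightarrow> real) \<Rightarrow> real"
  assumes "prob_space M" "prob_space N" and V: "\<And>i. V i \<in> borel_measurable M" and W: "\<And>i. W i \<in> borel_measurable N"
    and ch: "\<And>T \<tau>. finite T \<Longrightarrow> (\<integral>\<omega>. iexp (\<Sum>i\<in>T. \<tau> i * V i \<omega>) \<partial>M) = (\<integral>\<omega>. iexp (\<Sum>i\<in>T. \<tau> i * W i \<omega>) \<partial>N)"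
    and cont: "continuous_on UNIV \<Phi>" and b: "\<And>x. \<bar>\<Phi> x\<bar> \<le> b"
  shows "(\<integral>\<omega>. \<Phi> (\<lambda>i. V i \<omega>) \<partial>M) = (\<integral>\<omega>. \<Phi> (\<lambda>i. W i \<omega>) \<partial>N)"
proof -
  interpret M: prob_space M by fact
  interpret N: prob_space N by fact
  interpret vc: vec_conv "\<lambda>_::nat. M" "\<lambda>_. V" N W sequentially
    by unfold_locales (use assms in auto)
  note [measurable] = V W
  have \<Phi>m[measurable]: "\<Phi> \<in> borel_measurable borel" by (rule borel_measurable_continuous_onI[OF cont])
  have mV: "(\<lambda>\<omega>. \<Phi> (\<lambda>i. h (V i \<omega>))) \<in> borel_measurable M" if [measurable]: "h \<in> borel_measurable borel" for h :: "real \<Rightarrow> real"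
    by (rule measurable_compose[OF vec_measurable_borel \<Phi>m]) measurable
  have mW: "(\<lambda>\<omega>. \<Phi> (\<lambda>i. h (W i \<omega>))) \<in> borel_measurable N" if [measurable]: "h \<in> borel_measurable borel" for h :: "real \<Rightarrow> real"
    by (rule measurable_compose[OF vec_measurable_borel \<Phi>m]) measurable
  have eq: "(\<integral>\<omega>. \<Phi> (\<lambda>i. c * sin (V i \<omega> / c)) \<partial>M) = (\<integral>\<omega>. \<Phi> (\<lambda>i. c * sin (W i \<omega> / c)) \<partial>N)" for c
  proof -
    have "(\<lambda>n::nat. \<integral>\<omega>. \<Phi> (\<lambda>i. c * sin (V i \<omega> / c)) \<partial>M) \<longlonglongrightarrow> (\<integral>\<omega>. \<Phi> (\<lambda>i. c * sin (W i \<omega> / c)) \<partial>N)"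
      by (rule vc.clamp_conv[OF cont b]) (rule mV mW; measurable)+
    then show ?thesis by (simp add: LIMSEQ_const_iff)
  qed
  have lim: "(\<lambda>n. \<Phi> (\<lambda>i. real (Suc n) * sin (v i / real (Suc n)))) \<longlonglongrightarrow> \<Phi> v" for v
  proof -
    have "(\<lambda>n. (\<lambda>i. real (Suc n) * sin (v i / real (Suc n)))) \<longlonglongrightarrow> v"
      by (rule tendsto_coordinatewise) (rule clamp_limit)
    then show ?thesis by (rule continuous_on_tendsto_compose[OF cont]) auto
  qed
  have "(\<lambda>n. \<integral>\<omega>. \<Phi> (\<lambda>i. real (Suc n) * sin (V i \<omega> / real (Suc n))) \<partial>M) \<longlonglongrightarrow> (\<integral>\<omega>. \<Phi> (\<lambda>i. V i \<omega>) \<partial>M)"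
    by (rule integral_dominated_convergence[where w = "\<lambda>_. b"]) (use b lim mV[of "\<lambda>x. x"] mV in auto)
  moreover have "(\<lambda>n. \<integral>\<omega>. \<Phi> (\<lambda>i. real (Suc n) * sin (W i \<omega> / real (Suc n))) \<partial>N) \<longlonglongrightarrow> (\<integral>\<omega>. \<Phi> (\<lambda>i. W i \<omega>) \<partial>N)"
    by (rule integral_dominated_convergence[where w = "\<lambda>_. b"]) (use b lim mW[of "\<lambda>x. x"] mW in auto)
  ultimately show ?thesis unfolding eq using LIMSEQ_unique by blast
qed

context vec_conv begin

text \<open>The clamp is removed uniformly in n: where the relevant coordinates are at most
  \<open>q\<close> in modulus, it is nearly the identity and \<open>A\<close> is Lipschitz;
  elsewhere Chebyshev's inequality with the L^2 bounds applies.\<close>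

lemma Lipschitz_conv:
  fixes g :: "real \<Rightarrow> real"
  assumes g: "\<And>x y. \<bar>g x - g y\<bar> \<le> \<bar>x - y\<bar>" and b: "\<And>x. \<bar>g x\<bar> \<le> b"
    and A: "A \<in> pol T k"
    and L2: "\<And>i. \<exists>B. \<forall>n. integrable (M n) (\<lambda>\<omega>. (V n i \<omega>)\<^sup>2) \<and> (\<integral>\<omega>. (V n i \<omega>)\<^sup>2 \<partial>M n) \<le> B"
  shows "((\<lambda>n. \<integral>\<omega>. g (A (\<lambda>i. V n i \<omega>)) \<partial>M n) \<longlongrightarrow> (\<integral>\<omega>. g (A (\<lambda>i. W i \<omega>)) \<partial>N)) F"
proof (rule tendstoI)
  fix r :: real assume r: "r > 0"
  obtain T' where T': "finite T'" "A \<in> pol T' k" using pol_finite[OF A] by blast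
  obtain Bf where Bf: "\<And>i n. integrable (M n) (\<lambda>\<omega>. (V n i \<omega>)\<^sup>2)" "\<And>i n. (\<integral>\<omega>. (V n i \<omega>)\<^sup>2 \<partial>M n) \<le> Bf i" using L2 by metis
  have gc: "continuous_on UNIV g"
    unfolding continuous_on_iff dist_real_def using g by (meson order_le_less_trans UNIV_I)
  have gm[measurable]: "g \<in> borel_measurable borel" by (rule borel_measurable_continuous_onI[OF gc])
  have b0: "b \<ge> 0" using b[of 0] by linarith
  have Am: "(\<lambda>\<omega>. A (\<lambda>i. h (V n i \<omega>))) \<in> borel_measurable (M n)" "(\<lambda>\<omega>. A (\<lambda>i. h (W i \<omega>))) \<in> borel_measurable N"
    if [measurable]: "h \<in> borel_measurable borel" for h n by (rule pol_measurable[OF A]; measurable)+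
  define SB where "SB = (\<Sum>i\<in>T'. \<bar>Bf i\<bar>)"
  have SB0: "SB \<ge> 0" unfolding SB_def by (intro sum_nonneg) auto
  \<comment> \<open>Chosen such that the Chebyshev term 2 b SB / q^2 is at most r/8.\<close>
  define q where "q = sqrt (16 * (b + 1) * (SB + 1) / r)"
  have q: "q > 0" "q\<^sup>2 = 16 * (b + 1) * (SB + 1) / r" using b0 SB0 r by (auto simp: q_def)
  obtain C where C: "C \<ge> 0" "\<And>x y. (\<forall>i\<in>T'. \<bar>x i\<bar> \<le> q \<and> \<bar>y i\<bar> \<le> q) \<Longrightarrow> \<bar>A x - A y\<bar> \<le> C * (\<Sum>i\<in>T'. \<bar>x i - y i\<bar>)"
    using pol_Lipschitz[OF T'(2,1), of q] by blast
  define \<Phi> where "\<Phi> v = g (A v)" for v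
  have \<Phi>c: "continuous_on UNIV \<Phi>" unfolding \<Phi>_def[abs_def] by (rule continuous_on_compose2[OF gc pol_continuous[OF A]]) auto
  have limN: "(\<lambda>n. \<integral>\<omega>. \<Phi> (\<lambda>i. real (Suc n) * sin (W i \<omega> / real (Suc n))) \<partial>N) \<longlonglongrightarrow> (\<integral>\<omega>. \<Phi> (\<lambda>i. W i \<omega>) \<partial>N)"
  proof (rule integral_dominated_convergence[where w = "\<lambda>_. b"])
    interpret N: prob_space N by (rule prob_N)
    show "integrable N (\<lambda>_. b)" by simp
    show "AE x in N. (\<lambda>n. \<Phi> (\<lambda>i. real (Suc n) * sin (W i x / real (Suc n)))) \<longlonglongrightarrow> \<Phi> (\<lambda>i. W i x)"
    proof (rule AE_I2)
      fix x
      have "(\<lambda>n. (\<lambda>i. real (Suc n) * sin (W i x / real (Suc n)))) \<longlonglongrightarrow> (\<lambda>i. W i x)"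
        by (rule tendsto_coordinatewise) (rule clamp_limit)
      then show "(\<lambda>n. \<Phi> (\<lambda>i. real (Suc n) * sin (W i x / real (Suc n)))) \<longlonglongrightarrow> \<Phi> (\<lambda>i. W i x)"
        by (rule continuous_on_tendsto_compose[OF \<Phi>c]) auto
    qed
  qed (use b Am(2) Am(2)[of "\<lambda>x. x"] in \<open>auto simp: \<Phi>_def\<close>)
  then have 1: "\<forall>\<^sub>F m in sequentially. dist (\<integral>\<omega>. \<Phi> (\<lambda>i. real (Suc m) * sin (W i \<omega> / real (Suc m))) \<partial>N) (\<integral>\<omega>. \<Phi> (\<lambda>i. W i \<omega>) \<partial>N) < r / 4"
    using r by (intro tendstoD) auto
  have "(\<lambda>m. C * (\<Sum>i\<in>T'. q\<^sup>2 / 2 * (1 / real (Suc m)))) \<longlonglongrightarrow> C * (\<Sum>i\<in>T'. q\<^sup>2 / 2 * 0)"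
    by (intro tendsto_intros LIMSEQ_Suc lim_1_over_n)
  then have "\<forall>\<^sub>F m in sequentially. C * (\<Sum>i\<in>T'. q\<^sup>2 / 2 * (1 / real (Suc m))) < r / 4"
    using r by (intro order_tendstoD(2)) auto
  from eventually_happens[OF eventually_conj[OF 1 this]] obtain m where
    m1: "dist (\<integral>\<omega>. \<Phi> (\<lambda>i. real (Suc m) * sin (W i \<omega> / real (Suc m))) \<partial>N) (\<integral>\<omega>. \<Phi> (\<lambda>i. W i \<omega>) \<partial>N) < r / 4"
    and m2: "C * (\<Sum>i\<in>T'. q\<^sup>2 / 2 * (1 / real (Suc m))) < r / 4" by auto
  define c where "c = real (Suc m)"
  have c: "c \<ge> 1" by (simp add: c_def)
  have dM: "\<bar>(\<integral>\<omega>. \<Phi> (\<lambda>i. V n i \<omega>) \<partial>M n) - (\<integral>\<omega>. \<Phi> (\<lambda>i. c * sin (V n i \<omega> / c)) \<partial>M n)\<bar> \<le> r / 4 + r / 8" for n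
  proof -
    interpret Mn: prob_space "M n" by (rule prob_M)
    have i1: "integrable (M n) (\<lambda>\<omega>. \<Phi> (\<lambda>i. V n i \<omega>))"
      by (rule Mn.integrable_const_bound[of _ b]) (use b Am(1)[of "\<lambda>x. x" n] in \<open>auto simp: \<Phi>_def\<close>)
    have i2: "integrable (M n) (\<lambda>\<omega>. \<Phi> (\<lambda>i. c * sin (V n i \<omega> / c)))"
      by (rule Mn.integrable_const_bound[of _ b]) (use b Am(1)[of "\<lambda>x. c * sin (x / c)" n] in \<open>auto simp: \<Phi>_def\<close>)
    have pw: "\<bar>\<Phi> v - \<Phi> (\<lambda>i. c * sin (v i / c))\<bar> \<le> r / 4 + 2 * b / q\<^sup>2 * (\<Sum>i\<in>T'. (v i)\<^sup>2)" for v
    proof (cases "\<forall>i\<in>T'. \<bar>v i\<bar> \<le> q")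
      case True
      have d: "\<bar>v i - c * sin (v i / c)\<bar> \<le> q\<^sup>2 / 2 * (1 / c)" if "i \<in> T'" for i
      proof -
        have "\<bar>v i - c * sin (v i / c)\<bar> = c * \<bar>sin (v i / c) - v i / c\<bar>"
          using c abs_mult[of c "sin (v i / c) - v i / c"] by (simp add: right_diff_distrib abs_minus_commute)
        also have "\<dots> \<le> c * ((v i / c)\<^sup>2 / 2)" using c by (intro mult_left_mono sin_approx) auto
        also have "\<dots> = (v i)\<^sup>2 / 2 * (1 / c)" using c by (simp add: power2_eq_square)
        also have "\<dots> \<le> q\<^sup>2 / 2 * (1 / c)" using True that c q(1) by (intro mult_right_mono divide_right_mono) (auto simp: abs_le_square_iff[symmetric])
        finally show ?thesis .
      qed
      have "\<bar>c * sin (v i / c)\<bar> \<le> q" if "i \<in> T'" for i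
      proof -
        have "\<bar>c * sin (v i / c)\<bar> = c * \<bar>sin (v i / c)\<bar>" using c by (simp add: abs_mult)
        also have "\<dots> \<le> c * \<bar>v i / c\<bar>" using c by (intro mult_left_mono abs_sin_x_le_abs_x) auto
        also have "\<dots> = \<bar>v i\<bar>" using c by simp
        finally show ?thesis using True that by force
      qed
      then have "\<bar>A v - A (\<lambda>i. c * sin (v i / c))\<bar> \<le> C * (\<Sum>i\<in>T'. \<bar>v i - c * sin (v i / c)\<bar>)"
        using True by (intro C(2)) auto
      also have "\<dots> \<le> C * (\<Sum>i\<in>T'. q\<^sup>2 / 2 * (1 / c))" using C(1) d by (intro mult_left_mono sum_mono) auto
      also have "\<dots> \<le> r / 4" using m2 unfolding c_def by simp
      finally have "\<bar>\<Phi> v - \<Phi> (\<lambda>i. c * sin (v i / c))\<bar> \<le> r / 4" using g unfolding \<Phi>_def by (meson order_trans)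
      moreover have "0 \<le> 2 * b / q\<^sup>2 * (\<Sum>i\<in>T'. (v i)\<^sup>2)" using b0 by (intro mult_nonneg_nonneg sum_nonneg) auto
      ultimately show ?thesis by linarith
    next
      case False
      then obtain i where i: "i \<in> T'" "\<bar>v i\<bar> > q" by (auto simp: not_le)
      have "q\<^sup>2 \<le> (v i)\<^sup>2" using i(2) q(1) by (simp add: abs_le_square_iff[symmetric])
      also have "\<dots> \<le> (\<Sum>i\<in>T'. (v i)\<^sup>2)" using i T'(1) by (intro member_le_sum) auto
      finally have "2 * b / q\<^sup>2 * q\<^sup>2 \<le> 2 * b / q\<^sup>2 * (\<Sum>i\<in>T'. (v i)\<^sup>2)" using b0 by (intro mult_left_mono) auto
      moreover have "2 * b / q\<^sup>2 * q\<^sup>2 = 2 * b" using q(1) by simp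
      moreover have "\<bar>\<Phi> v - \<Phi> (\<lambda>i. c * sin (v i / c))\<bar> \<le> 2 * b"
        using b[of "A v"] b[of "A (\<lambda>i. c * sin (v i / c))"] unfolding \<Phi>_def by linarith
      ultimately show ?thesis using r by linarith
    qed
    have "\<bar>(\<integral>\<omega>. \<Phi> (\<lambda>i. V n i \<omega>) \<partial>M n) - (\<integral>\<omega>. \<Phi> (\<lambda>i. c * sin (V n i \<omega> / c)) \<partial>M n)\<bar> = \<bar>\<integral>\<omega>. \<Phi> (\<lambda>i. V n i \<omega>) - \<Phi> (\<lambda>i. c * sin (V n i \<omega> / c)) \<partial>M n\<bar>"
      using i1 i2 by simp
    also have "\<dots> \<le> (\<integral>\<omega>. \<bar>\<Phi> (\<lambda>i. V n i \<omega>) - \<Phi> (\<lambda>i. c * sin (V n i \<omega> / c))\<bar> \<partial>M n)" by (rule integral_abs_bound)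
    also have "\<dots> \<le> (\<integral>\<omega>. r / 4 + 2 * b / q\<^sup>2 * (\<Sum>i\<in>T'. (V n i \<omega>)\<^sup>2) \<partial>M n)"
      by (rule integral_mono) (use i1 i2 Bf(1) pw in auto)
    also have "\<dots> = r / 4 + 2 * b / q\<^sup>2 * (\<Sum>i\<in>T'. \<integral>\<omega>. (V n i \<omega>)\<^sup>2 \<partial>M n)"
      using Bf(1) by (simp add: Bochner_Integration.integral_sum Mn.prob_space)
    also have "\<dots> \<le> r / 4 + 2 * b / q\<^sup>2 * SB"
      unfolding SB_def using b0 by (intro add_left_mono mult_left_mono sum_mono order_trans[OF Bf(2) abs_ge_self]) auto
    also have "2 * b / q\<^sup>2 * SB \<le> r / 8"
    proof -
      have "2 * b * SB * 8 \<le> 16 * (b + 1) * (SB + 1)" using b0 SB0 by (simp add: algebra_simps)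
      then have "2 * b * SB * 8 * r \<le> 16 * (b + 1) * (SB + 1) * r" using r by (intro mult_right_mono) auto
      moreover have "16 * (b + 1) * (SB + 1) > 0" using b0 SB0 by simp
      ultimately show ?thesis unfolding q(2) using r by (simp add: field_simps)
    qed
    finally show ?thesis by simp
  qed
  have cl: "((\<lambda>n. \<integral>\<omega>. \<Phi> (\<lambda>i. c * sin (V n i \<omega> / c)) \<partial>M n) \<longlongrightarrow> (\<integral>\<omega>. \<Phi> (\<lambda>i. c * sin (W i \<omega> / c)) \<partial>N)) F"
  proof (rule clamp_conv[OF \<Phi>c])
    show "\<bar>\<Phi> x\<bar> \<le> b" for x by (simp add: \<Phi>_def b)
  qed (use Am[of "\<lambda>x. c * sin (x / c)"] in \<open>auto simp: \<Phi>_def\<close>)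
  have "\<forall>\<^sub>F n in F. dist (\<integral>\<omega>. \<Phi> (\<lambda>i. c * sin (V n i \<omega> / c)) \<partial>M n) (\<integral>\<omega>. \<Phi> (\<lambda>i. c * sin (W i \<omega> / c)) \<partial>N) < r / 4"
    using r by (intro tendstoD[OF cl]) auto
  then show "\<forall>\<^sub>F n in F. dist (\<integral>\<omega>. g (A (\<lambda>i. V n i \<omega>)) \<partial>M n) (\<integral>\<omega>. g (A (\<lambda>i. W i \<omega>)) \<partial>N) < r"
  proof eventually_elim
    case (elim n)
    show ?case using dM[of n] elim m1 r unfolding \<Phi>_def c_def[symmetric] dist_real_def by linarith
  qed
qed

end

lemma (in prodspace) iexp_prod:
  assumes "finite I"
  shows "E (\<lambda>x. iexp (\<Sum>j\<in>I. \<sigma> j * x j)) = (\<Prod>j\<in>I. char (D j) (\<sigma> j))"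
  using assms
proof (induction rule: finite_induct)
  case (insert i I)
  have "E (\<lambda>x. iexp (\<sigma> i * x i) * iexp (\<Sum>j\<in>I. \<sigma> j * x j)) = E (\<lambda>x. iexp (\<sigma> i * x i)) * E (\<lambda>x. iexp (\<Sum>j\<in>I. \<sigma> j * x j))"
  proof (rule fac(1)[of "{i}" _ I])
    show "dep {i} (\<lambda>x. iexp (\<sigma> i * x i))" by (simp add: dep_def)
    show "dep I (\<lambda>x. iexp (\<Sum>j\<in>I. \<sigma> j * x j))" by (simp add: dep_def)
    show "integrable P (\<lambda>x. iexp (\<sigma> i * x i))" "integrable P (\<lambda>x. iexp (\<Sum>j\<in>I. \<sigma> j * x j))"
      by (rule D.P.integrable_const_bound[of _ 1]; simp)+
  qed (use insert in auto)
  also have "E (\<lambda>x. iexp (\<sigma> i * x i)) = char (D i) (\<sigma> i)"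
    using E_coord(1)[of "\<lambda>y. iexp (\<sigma> i * y)" i] by (simp add: char_def)
  also have "E (\<lambda>x. iexp (\<Sum>j\<in>I. \<sigma> j * x j)) = (\<Prod>j\<in>I. char (D j) (\<sigma> j))" using insert by auto
  finally show ?case using insert.hyps by (simp add: exp_add distrib_left)
qed simp

text \<open>The geometric rate makes the increments summable in L^1, hence the sequence converges
  almost surely; Fatou's lemma transfers the L^2 estimate to the limit.\<close>

lemma (in prob_space) L2_complete:
  fixes q :: "nat \<Rightarrow> 'a \<Rightarrow> real"
  assumes [measurable]: "\<And>m. q m \<in> borel_measurable M"
    and ca: "\<And>m m'. m \<le> m' \<Longrightarrow> (\<integral>\<^sup>+\<omega>. ennreal ((q m' \<omega> - q m \<omega>)\<^sup>2) \<partial>M) \<le> ennreal (4 / 4 ^ m)"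
  shows "\<exists>G\<in>borel_measurable M. \<forall>m. (\<integral>\<^sup>+\<omega>. ennreal ((G \<omega> - q m \<omega>)\<^sup>2) \<partial>M) \<le> ennreal (4 / 4 ^ m)"
proof -
  define G where "G \<omega> = lim (\<lambda>m. q m \<omega>)" for \<omega>
  have Gm[measurable]: "G \<in> borel_measurable M" unfolding G_def[abs_def] by measurable
  have step: "(\<integral>\<^sup>+\<omega>. ennreal \<bar>q (Suc m) \<omega> - q m \<omega>\<bar> \<partial>M) \<le> ennreal ((1/2) ^ m * 5)" for m
  proof -
    \<comment> \<open>Arithmetic-geometric mean inequality, with weights that balance an increment
      of L^2 size about 2^-m.\<close>
    have pw: "ennreal \<bar>t\<bar> \<le> ennreal (2 ^ m * t\<^sup>2 + (1/2) ^ m)" for t :: real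
    proof (rule ennreal_leI)
      have "0 \<le> 2 ^ m * (\<bar>t\<bar> - (1/2) ^ m)\<^sup>2" by simp
      also have "\<dots> = 2 ^ m * t\<^sup>2 - 2 * \<bar>t\<bar> * (2 ^ m * (1/2) ^ m) + (1/2) ^ m * (2 ^ m * (1/2) ^ m)"
        by (simp add: power2_eq_square algebra_simps)
      also have "2 ^ m * (1/2) ^ m = (1::real)" by (simp flip: power_mult_distrib)
      finally have "2 * \<bar>t\<bar> \<le> 2 ^ m * t\<^sup>2 + (1/2) ^ m" by simp
      then show "\<bar>t\<bar> \<le> 2 ^ m * t\<^sup>2 + (1/2) ^ m" using abs_ge_zero[of t] by linarith
    qed
    have "(\<integral>\<^sup>+\<omega>. ennreal \<bar>q (Suc m) \<omega> - q m \<omega>\<bar> \<partial>M) \<le> (\<integral>\<^sup>+\<omega>. ennreal (2 ^ m) * ennreal ((q (Suc m) \<omega> - q m \<omega>)\<^sup>2) + ennreal ((1/2) ^ m) \<partial>M)"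
      by (intro nn_integral_mono) (use pw in \<open>simp add: ennreal_mult[symmetric] ennreal_plus[symmetric] del: ennreal_plus\<close>)
    also have "\<dots> = ennreal (2 ^ m) * (\<integral>\<^sup>+\<omega>. ennreal ((q (Suc m) \<omega> - q m \<omega>)\<^sup>2) \<partial>M) + ennreal ((1/2) ^ m)"
      by (simp add: nn_integral_add nn_integral_cmult emeasure_space_1)
    also have "\<dots> \<le> ennreal (2 ^ m) * ennreal (4 / 4 ^ m) + ennreal ((1/2) ^ m)"
      by (intro add_right_mono mult_left_mono ca) auto
    also have "\<dots> = ennreal (2 ^ m * (4 / 4 ^ m) + (1/2) ^ m)" by (simp add: ennreal_mult[symmetric] ennreal_plus[symmetric] del: ennreal_plus)
    also have "2 ^ m * (4 / 4 ^ m) = (1/2) ^ m * (4::real)"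
      by (simp add: power_divide field_simps flip: power_mult_distrib)
    finally show ?thesis by (simp add: mult.commute)
  qed
  have "(\<integral>\<^sup>+\<omega>. suminf (\<lambda>m. ennreal \<bar>q (Suc m) \<omega> - q m \<omega>\<bar>) \<partial>M) = suminf (\<lambda>m. \<integral>\<^sup>+\<omega>. ennreal \<bar>q (Suc m) \<omega> - q m \<omega>\<bar> \<partial>M)"
    by (rule nn_integral_suminf) measurable
  also have "\<dots> \<le> suminf (\<lambda>m. ennreal ((1/2) ^ m * 5))" by (intro suminf_le step summableI allI)
  also have "\<dots> < \<infinity>"
    by (subst suminf_ennreal2) (auto intro!: summable_mult2 summable_geometric)
  finally have "AE \<omega> in M. suminf (\<lambda>m. ennreal \<bar>q (Suc m) \<omega> - q m \<omega>\<bar>) \<noteq> \<infinity>"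
    by (intro nn_integral_noteq_infinite) auto
  then have cv: "AE \<omega> in M. (\<lambda>m. q m \<omega>) \<longlonglongrightarrow> G \<omega>"
  proof eventually_elim
    case (elim \<omega>)
    have "summable (\<lambda>m. \<bar>q (Suc m) \<omega> - q m \<omega>\<bar>)"
      by (rule summable_suminf_not_top) (use elim in auto)
    then have "summable (\<lambda>m. q (Suc m) \<omega> - q m \<omega>)" by (rule summable_rabs_cancel)
    then have "convergent (\<lambda>n. \<Sum>m<n. q (Suc m) \<omega> - q m \<omega>)" by (simp add: summable_iff_convergent)
    then have "convergent (\<lambda>n. q n \<omega> - q 0 \<omega>)" using sum_lessThan_telescope[of "\<lambda>m. q m \<omega>"] by (simp only:)
    then have "convergent (\<lambda>n. (q n \<omega> - q 0 \<omega>) + q 0 \<omega>)" by (intro convergent_add convergent_const)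
    then show ?case unfolding G_def by (simp add: convergent_LIMSEQ_iff)
  qed
  have "(\<integral>\<^sup>+\<omega>. ennreal ((G \<omega> - q m \<omega>)\<^sup>2) \<partial>M) \<le> ennreal (4 / 4 ^ m)" for m
  proof -
    have "(\<integral>\<^sup>+\<omega>. ennreal ((G \<omega> - q m \<omega>)\<^sup>2) \<partial>M) = (\<integral>\<^sup>+\<omega>. liminf (\<lambda>m'. ennreal ((q m' \<omega> - q m \<omega>)\<^sup>2)) \<partial>M)"
    proof (rule nn_integral_cong_AE, use cv in eventually_elim)
      case (elim \<omega>)
      have "(\<lambda>m'. ennreal ((q m' \<omega> - q m \<omega>)\<^sup>2)) \<longlonglongrightarrow> ennreal ((G \<omega> - q m \<omega>)\<^sup>2)"
        by (intro tendsto_intros tendsto_ennrealI elim)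
      then show ?case by (rule lim_imp_Liminf[OF sequentially_bot, symmetric])
    qed
    also have "\<dots> \<le> liminf (\<lambda>m'. \<integral>\<^sup>+\<omega>. ennreal ((q m' \<omega> - q m \<omega>)\<^sup>2) \<partial>M)"
      by (rule nn_integral_liminf) measurable
    also have "\<dots> \<le> ennreal (4 / 4 ^ m)"
      by (rule Liminf_le[OF _ ]) (auto simp: eventually_sequentially intro!: exI[of _ m] ca)
    finally show ?thesis .
  qed
  then show ?thesis using Gm by blast
qed

section \<open>The limit as polynomials in the generators\<close>

context vec_conv begin

text \<open>Lower semicontinuity of the second moment under convergence in law: the truncated
  square, divided by 2c, is bounded and 1-Lipschitz, so its mean passes to the limit and inherits
  the bound; then c tends to infinity.\<close>

lemma L2_limit_le:
  assumes A: "A \<in> pol T k"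
    and L2: "\<And>i. \<exists>B. \<forall>n. integrable (M n) (\<lambda>\<omega>. (V n i \<omega>)\<^sup>2) \<and> (\<integral>\<omega>. (V n i \<omega>)\<^sup>2 \<partial>M n) \<le> B"
    and iM: "\<And>n. integrable (M n) (\<lambda>\<omega>. (A (\<lambda>i. V n i \<omega>))\<^sup>2)" and iN: "integrable N (\<lambda>\<omega>. (A (\<lambda>i. W i \<omega>))\<^sup>2)"
    and le: "\<forall>\<^sub>F n in F. (\<integral>\<omega>. (A (\<lambda>i. V n i \<omega>))\<^sup>2 \<partial>M n) \<le> B" and F: "F \<noteq> bot"
  shows "(\<integral>\<omega>. (A (\<lambda>i. W i \<omega>))\<^sup>2 \<partial>N) \<le> B"
proof -
  have Am[measurable]: "(\<lambda>\<omega>. A (\<lambda>i. V n i \<omega>)) \<in> borel_measurable (M n)" "(\<lambda>\<omega>. A (\<lambda>i. W i \<omega>)) \<in> borel_measurable N" for n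
    by (rule pol_measurable[OF A]; measurable)+
  have trunc: "(\<integral>\<omega>. (min \<bar>A (\<lambda>i. W i \<omega>)\<bar> c)\<^sup>2 \<partial>N) \<le> B" if c: "c > 0" for c
  proof -
    define g where "g t = (min \<bar>t\<bar> c)\<^sup>2 / (2 * c)" for t
    have "\<bar>g x - g y\<bar> \<le> \<bar>x - y\<bar>" for x y
    proof -
      define x' y' where "x' = min \<bar>x\<bar> c" "y' = min \<bar>y\<bar> c"
      have "\<bar>x'\<^sup>2 - y'\<^sup>2\<bar> = \<bar>x' - y'\<bar> * (x' + y')"
        using c unfolding x'_y'_def by (simp add: power2_eq_square square_diff_square_factored abs_mult)
      also have "\<dots> \<le> \<bar>x - y\<bar> * (2 * c)"
        using c unfolding x'_y'_def by (intro mult_mono) auto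
      finally show ?thesis using c unfolding g_def x'_y'_def[symmetric] diff_divide_distrib[symmetric] abs_divide
        by (simp add: divide_le_eq)
    qed
    moreover have "\<bar>g x\<bar> \<le> c\<^sup>2 / (2 * c)" for x
      unfolding g_def using c by (auto intro!: divide_right_mono power_mono)
    ultimately have lim: "((\<lambda>n. \<integral>\<omega>. g (A (\<lambda>i. V n i \<omega>)) \<partial>M n) \<longlongrightarrow> (\<integral>\<omega>. g (A (\<lambda>i. W i \<omega>)) \<partial>N)) F"
      by (rule Lipschitz_conv[OF _ _ A L2])
    have "(\<integral>\<omega>. g (A (\<lambda>i. W i \<omega>)) \<partial>N) \<le> B / (2 * c)"
    proof (rule tendsto_upperbound[OF lim _ F], use le in eventually_elim)
      case (elim n)
      have "(\<integral>\<omega>. g (A (\<lambda>i. V n i \<omega>)) \<partial>M n) \<le> (\<integral>\<omega>. (A (\<lambda>i. V n i \<omega>))\<^sup>2 / (2 * c) \<partial>M n)"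
      proof (rule integral_mono')
        show "integrable (M n) (\<lambda>\<omega>. (A (\<lambda>i. V n i \<omega>))\<^sup>2 / (2 * c))" using iM by simp
        fix \<omega>
        have "(min \<bar>A (\<lambda>i. V n i \<omega>)\<bar> c)\<^sup>2 \<le> \<bar>A (\<lambda>i. V n i \<omega>)\<bar>\<^sup>2" using c by (intro power_mono) auto
        then show "g (A (\<lambda>i. V n i \<omega>)) \<le> (A (\<lambda>i. V n i \<omega>))\<^sup>2 / (2 * c)"
          unfolding g_def using c by (intro divide_right_mono) auto
      qed (use c in auto)
      also have "\<dots> \<le> B / (2 * c)" using elim c by (simp add: divide_right_mono)
      finally show ?case .
    qed
    moreover have "(\<integral>\<omega>. g (A (\<lambda>i. W i \<omega>)) \<partial>N) = (\<integral>\<omega>. (min \<bar>A (\<lambda>i. W i \<omega>)\<bar> c)\<^sup>2 \<partial>N) / (2 * c)"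
      unfolding g_def by simp
    ultimately show ?thesis using c by (simp add: divide_le_cancel)
  qed
  have "(\<lambda>k. \<integral>\<omega>. (min \<bar>A (\<lambda>i. W i \<omega>)\<bar> (real (Suc k)))\<^sup>2 \<partial>N) \<longlonglongrightarrow> (\<integral>\<omega>. (A (\<lambda>i. W i \<omega>))\<^sup>2 \<partial>N)"
  proof (rule integral_dominated_convergence[OF _ _ iN])
    show "AE \<omega> in N. norm ((min \<bar>A (\<lambda>i. W i \<omega>)\<bar> (real (Suc k)))\<^sup>2) \<le> (A (\<lambda>i. W i \<omega>))\<^sup>2" for k
    proof (rule AE_I2)
      fix \<omega>
      have "(min \<bar>A (\<lambda>i. W i \<omega>)\<bar> (real (Suc k)))\<^sup>2 \<le> \<bar>A (\<lambda>i. W i \<omega>)\<bar>\<^sup>2" by (intro power_mono) auto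
      then show "norm ((min \<bar>A (\<lambda>i. W i \<omega>)\<bar> (real (Suc k)))\<^sup>2) \<le> (A (\<lambda>i. W i \<omega>))\<^sup>2" by simp
    qed
    show "AE \<omega> in N. (\<lambda>k. (min \<bar>A (\<lambda>i. W i \<omega>)\<bar> (real (Suc k)))\<^sup>2) \<longlonglongrightarrow> (A (\<lambda>i. W i \<omega>))\<^sup>2"
    proof (rule AE_I2, rule tendsto_eventually)
      fix \<omega>
      obtain K :: nat where K: "\<bar>A (\<lambda>i. W i \<omega>)\<bar> \<le> real K" using real_arch_simple by blast
      show "\<forall>\<^sub>F k in sequentially. (min \<bar>A (\<lambda>i. W i \<omega>)\<bar> (real (Suc k)))\<^sup>2 = (A (\<lambda>i. W i \<omega>))\<^sup>2"
        using eventually_ge_at_top[of K]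
      proof eventually_elim
        case (elim k)
        then have "\<bar>A (\<lambda>i. W i \<omega>)\<bar> \<le> real (Suc k)" using K by linarith
        then show ?case by (simp add: min_absorb1)
      qed
    qed
  qed measurable
  then show ?thesis by (rule LIMSEQ_le_const2) (use trunc in auto)
qed

end

text \<open>Even coordinates carry copies of X_0 and odd ones Gaussian variables, so that a single
  sequence provides infinitely many of each.\<close>

definition mixlaw :: "real measure \<Rightarrow> nat \<Rightarrow> real measure" where
  "mixlaw \<mu> j = (if even j then \<mu> else std_normal_distribution)"

context ultra begin

definition Gen :: "(nat \<Rightarrow> (nat \<Rightarrow> real) \<Rightarrow> real) set" where
  "Gen = {W. \<exists>J. W = (\<lambda>n x. x (J n))} \<union> AH"

text \<open>Every generator serves as the name of its own variable, which is then evaluated at the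
  value of that generator.\<close>

lemma AA_pol: "AA k A \<Longrightarrow> k \<le> L \<Longrightarrow> \<exists>p\<in>pol Gen k. \<forall>n x. A n x = p (\<lambda>W. W n x)"
proof (induction rule: AA.induct)
  case (AA_const k c)
  show ?case by (intro bexI[of _ "\<lambda>_. c"] pol_const) auto
next
  case (AA_var J)
  show ?case by (intro bexI[of _ "\<lambda>y. y (\<lambda>n x. x (J n))"] pol_coord) (auto simp: Gen_def)
next
  case (AA_gen R k)
  then show ?case by (intro bexI[of _ "\<lambda>y. y R"] pol_coord) (auto simp: Gen_def HH_AH)
next
  case (AA_add k A B)
  then obtain p q where "p \<in> pol Gen k" "q \<in> pol Gen k" "\<forall>n x. A n x = p (\<lambda>W. W n x)" "\<forall>n x. B n x = q (\<lambda>W. W n x)" by blast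
  then show ?case by (intro bexI[of _ "\<lambda>y. p y + q y"] pol_add) auto
next
  case (AA_mult a A b B)
  then obtain p q where "p \<in> pol Gen a" "q \<in> pol Gen b" "\<forall>n x. A n x = p (\<lambda>W. W n x)" "\<forall>n x. B n x = q (\<lambda>W. W n x)"
    by (metis add_leE)
  then show ?case by (intro bexI[of _ "\<lambda>y. p y * q y"] pol_mult) auto
next
  case (AA_mono k A k')
  then show ?case by (meson order_refl order_trans pol_mono)
qed

text \<open>Each \<open>F i\<close> at each accuracy involves finitely many generators, so countably
  many suffice and can be enumerated; the problem is thereby one about vectors indexed by the
  natural numbers.\<close>

lemma countable_generators:
  assumes F: "\<And>i::nat. F i \<in> CC d" and d: "d \<le> L"
  shows "\<exists>(W::nat \<Rightarrow> _) Q. (\<forall>s. W s \<in> Gen) \<and> (\<forall>i m. Q i m \<in> pol UNIV d) \<and>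
    (\<forall>i m. \<forall>\<^sub>F n in U. EE (\<lambda>x. (F i n x - Q i m (\<lambda>s. W s n x))\<^sup>2) < (1/4) ^ m)"
proof -
  define Pr where "Pr i m T p \<longleftrightarrow> finite T \<and> T \<subseteq> Gen \<and> p \<in> pol T d \<and> (\<forall>\<^sub>F n in U. EE (\<lambda>x. (F i n x - p (\<lambda>W. W n x))\<^sup>2) < (1/4) ^ m)" for i and m :: nat and T p
  have "\<exists>T p. Pr i m T p" for i m
  proof -
    obtain A where A: "AA d A" "\<forall>\<^sub>F n in U. EE (\<lambda>x. (F i n x - A n x)\<^sup>2) < (1/4) ^ m"
      using density[OF F[of i]] unfolding clA_def by (auto dest!: spec[of _ "(1/4) ^ m"])
    obtain p where p: "p \<in> pol Gen d" "\<And>n x. A n x = p (\<lambda>W. W n x)" using AA_pol[OF A(1) d] by blast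
    obtain T where "finite T" "T \<subseteq> Gen" "p \<in> pol T d" using pol_finite[OF p(1)] by blast
    with A(2) show ?thesis unfolding p(2) Pr_def by blast
  qed
  then obtain T p where "\<And>i m. Pr i m (T i m) (p i m)" by metis
  then have Tp: "\<And>i m. finite (T i m)" "\<And>i m. T i m \<subseteq> Gen" "\<And>i m. p i m \<in> pol (T i m) d"
    "\<And>i m. \<forall>\<^sub>F n in U. EE (\<lambda>x. (F i n x - p i m (\<lambda>W. W n x))\<^sup>2) < (1/4) ^ m"
    unfolding Pr_def by blast+
  \<comment> \<open>The additional coordinate sequence makes the set nonempty, as the enumeration
    requires.\<close>
  define S where "S = insert (\<lambda>n x. x 0) (\<Union>i m. T i m)"
  have S: "countable S" "S \<noteq> {}" "S \<subseteq> Gen"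
  proof -
    show "countable S" unfolding S_def by (intro countable_insert countable_UN countable_finite[OF Tp(1)]) auto
    have "(\<lambda>n x. x 0) \<in> Gen" unfolding Gen_def by (intro UnI1 CollectI exI[of _ "\<lambda>_. 0"]) simp
    then show "S \<subseteq> Gen" unfolding S_def using Tp(2) by blast
  qed (simp add: S_def)
  define W where "W = from_nat_into S"
  have rW: "range W = S" unfolding W_def by (rule range_from_nat_into[OF S(2,1)])
  define idx where "idx V = (SOME s. W s = V)" for V
  have idx: "W (idx V) = V" if "V \<in> S" for V
    unfolding idx_def using that rW by (metis (mono_tags, lifting) imageE someI_ex)
  define Q where "Q i m y = p i m (\<lambda>V. y (idx V))" for i m and y :: "nat \<Rightarrow> real"
  have "Q i m \<in> pol UNIV (d * 1)" for i m
    unfolding Q_def[abs_def] by (rule pol_comp[OF Tp(3)]) (auto intro: pol_coord)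
  moreover have "Q i m (\<lambda>s. W s n x) = p i m (\<lambda>V. V n x)" for i m n x
    unfolding Q_def proof (rule pol_dep[OF Tp(3)])
    fix V assume "V \<in> T i m"
    then have "W (idx V) = V" by (intro idx) (auto simp: S_def)
    then show "W (idx V) n x = V n x" by simp
  qed
  moreover have "W s \<in> Gen" for s using rW S(3) by auto
  ultimately show ?thesis using Tp(4) by (intro exI[of _ W] exI[of _ Q]) auto
qed

lemma ip_bilinear:
  assumes "A \<in> CC k" "A' \<in> CC k" "B \<in> CC k"
  shows "ip (\<lambda>n x. A n x + c * B n x) (\<lambda>n x. A' n x + c' * B n x) = ip A A' + c' * ip A B + c * ip A' B + c * c' * ip B B"
proof -
  have s: "(\<lambda>n x. b * B n x) \<in> CC k" for b using assms by (intro CC_scale)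
  have r: "ip G (\<lambda>n x. A' n x + c' * B n x) = ip G A' + c' * ip G B" if "G \<in> CC k" for G
    using ip_add[OF assms(2) s that] ip_scale[OF assms(3) that] ip_sym[of G] by simp
  show ?thesis
    unfolding ip_add[OF assms(1) s CC_add[OF assms(2) s]] ip_scale[OF assms(3) CC_add[OF assms(2) s]] r[OF assms(1)] r[OF assms(3)]
    unfolding ip_sym[of B A'] by (simp add: distrib_left)
qed

text \<open>Degenerate case of Cauchy-Schwarz: otherwise the squared length of A + t B would be -1
  for this t.\<close>

lemma ip_null:
  assumes A: "A \<in> CC k" and B: "B \<in> CC k" and 0: "ip B B = 0"
  shows "ip A B = 0"
proof (rule ccontr)
  assume n: "ip A B \<noteq> 0"
  define t where "t = - (ip A A + 1) / (2 * ip A B)"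
  have "0 \<le> ip (\<lambda>n x. A n x + t * B n x) (\<lambda>n x. A n x + t * B n x)"
    by (rule ip_nonneg[OF CC_add[OF A CC_scale[OF B]]])
  also have "\<dots> = ip A A + 2 * t * ip A B" unfolding ip_bilinear[OF A A B] 0 by simp
  also have "\<dots> = -1" using n by (simp add: t_def field_simps)
  finally show False by simp
qed

text \<open>Gram-Schmidt in the ultraproduct: \<open>V s i\<close> is \<open>R i\<close> after
  elimination of the first s directions, and \<open>K s\<close> is the corresponding Schur
  complement of the covariance. Column s of the factor is column s of \<open>K s\<close> divided by
  the root of the pivot. The factor is lower triangular, so each limit variable is a finite
  combination.\<close>

lemma Cholesky:
  assumes R: "\<And>i::nat. R i \<in> CC k"
  shows "\<exists>l. \<forall>i N. i < N \<longrightarrow> (\<forall>j. ip (R i) (R j) = (\<Sum>s<N. l i s * l j s)) \<and> (\<forall>s\<ge>N. l i s = (0::real))"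
proof -
  define V where "V = rec_nat R (\<lambda>s v i n x. v i n x + (- (ip (v i) (v s) / ip (v s) (v s))) * v s n x)"
  have V0: "V 0 = R" and VS: "V (Suc s) i = (\<lambda>n x. V s i n x + (- (ip (V s i) (V s s) / ip (V s s) (V s s))) * V s s n x)" for s i
    by (simp_all add: V_def)
  have VC: "V s i \<in> CC k" for s i
  proof (induction s arbitrary: i)
    case (Suc s)
    show ?case unfolding VS by (intro CC_add CC_scale Suc)
  qed (simp add: V0 R)
  define K where "K s i j = ip (V s i) (V s j)" for s i j
  have Ksym: "K s i j = K s j i" for s i j unfolding K_def by (rule ip_sym)
  have KS: "K (Suc s) i j = K s i j - K s i s * K s j s / K s s s" for s i j
  proof (cases "K s s s = 0")
    case False
    have "K (Suc s) i j = K s i j + - (K s j s / K s s s) * K s i s + - (K s i s / K s s s) * K s j s + - (K s i s / K s s s) * - (K s j s / K s s s) * K s s s"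
      unfolding K_def VS ip_bilinear[OF VC VC VC] ..
    moreover have "- (a / c) * - (b / c) * c = a * b / c" if "c \<noteq> 0" for a b c :: real using that by simp
    ultimately show ?thesis using False by (simp add: mult.commute)
  next
    case True
    then show ?thesis unfolding K_def VS ip_bilinear[OF VC VC VC] by simp
  qed
  have Knull: "K s s s = 0 \<Longrightarrow> K s i s = 0" for s i unfolding K_def by (rule ip_null[OF VC VC])
  have K0: "i < n \<Longrightarrow> K n i j = 0" for n i j
  proof (induction n arbitrary: i j)
    case (Suc n)
    show ?case
    proof (cases "i = n")
      case True
      show ?thesis
      proof (cases "K n n n = 0")
        case t: True
        then show ?thesis unfolding KS True using Knull[OF t] Ksym[of n n j] by simp
      next
        case False
        then show ?thesis unfolding KS True using Ksym[of n n j] by simp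
      qed
    next
      case False
      then have "i < n" using Suc.prems by simp
      then show ?thesis unfolding KS using Suc.IH by simp
    qed
  qed simp
  \<comment> \<open>A zero pivot gives 0 by the convention for division, which is the right value:
    by \<open>Knull\<close> the whole column vanishes then.\<close>
  define l where "l i s = K s i s / sqrt (K s s s)" for i s
  have Kp: "K s s s \<ge> 0" for s unfolding K_def by (rule ip_nonneg[OF VC])
  have ll: "l i s * l j s = K s i s * K s j s / K s s s" for i j s
    unfolding l_def using Kp[of s] by simp
  have sum: "K 0 i j = (\<Sum>s<N. l i s * l j s) + K N i j" for i j N
    by (induction N) (simp_all add: KS ll)
  show ?thesis
  proof (intro exI[of _ l] allI impI conjI)
    fix i N :: nat assume i: "i < N"
    show "ip (R i) (R j) = (\<Sum>s<N. l i s * l j s)" for j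
      using sum[of i j N] K0[OF i, of j] by (simp add: K_def V0)
    show "l i s = 0" if "N \<le> s" for s using K0[of i s s] i that by (simp add: l_def)
  qed
qed

lemma prodspace_mixlaw: "prodspace (mixlaw \<mu>)"
proof (rule prodspace.intro)
  fix i
  show "prob_space (mixlaw \<mu> i)"
    using X.prob_D real_distribution.axioms(1)[OF real_dist_normal_dist] by (auto simp: mixlaw_def)
  show "sets (mixlaw \<mu> i) = sets borel" using X.sets_D by (auto simp: mixlaw_def)
  show "integrable (mixlaw \<mu> i) (\<lambda>x. x ^ k)" for k
    using X.moments_D[of k] integrable_std_normal_distribution_moment[of k] by (auto simp: mixlaw_def)
qed

sublocale Y: prodspace "mixlaw \<mu>" by (rule prodspace_mixlaw)

text \<open>Along an ultrafilter two coordinate sequences agree almost everywhere or differ almost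
  everywhere. Agreement is an equivalence relation, whose classes will become independent variables;
  the least index represents its class.\<close>

lemma coordinate_representatives:
  fixes J :: "nat \<Rightarrow> nat \<Rightarrow> nat"
  shows "\<exists>rep. (\<forall>i. \<forall>\<^sub>F n in U. J (rep i) n = J i n) \<and> (\<forall>I. finite I \<longrightarrow> (\<forall>\<^sub>F n in U. inj_on (\<lambda>c. J c n) (rep ` I)))"
proof -
  define eqv where "eqv i j \<longleftrightarrow> (\<forall>\<^sub>F n in U. J i n = J j n)" for i j
  define rep where "rep i = (LEAST j. eqv j i)" for i
  have rep: "eqv (rep i) i" for i unfolding rep_def by (rule LeastI[of _ i]) (simp add: eqv_def)
  have tr: "eqv i j \<Longrightarrow> eqv j k \<Longrightarrow> eqv i k" for i j k unfolding eqv_def by (auto elim: eventually_elim2)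
  have sy: "eqv i j \<Longrightarrow> eqv j i" for i j unfolding eqv_def by (simp add: eq_commute)
  have cong: "rep i = rep j" if "eqv i j" for i j
    unfolding rep_def using tr that sy by (metis (mono_tags, lifting))
  have "\<forall>\<^sub>F n in U. inj_on (\<lambda>c. J c n) (rep ` I)" if I: "finite I" for I
  proof -
    have "\<forall>\<^sub>F n in U. \<forall>c\<in>rep ` I. \<forall>c'\<in>rep ` I. c \<noteq> c' \<longrightarrow> J c n \<noteq> J c' n"
    proof (intro eventually_ball_finite ballI finite_imageI I)
      fix c c' assume "c \<in> rep ` I" "c' \<in> rep ` I"
      then obtain i i' where i: "c = rep i" "c' = rep i'" by auto
      show "\<forall>\<^sub>F n in U. c \<noteq> c' \<longrightarrow> J c n \<noteq> J c' n"
      proof (cases "eqv c c'")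
        case True
        then have "eqv i i'" using rep sy tr i by metis
        then show ?thesis using cong i by simp
      next
        case False
        then have "\<forall>\<^sub>F n in U. J c n \<noteq> J c' n" unfolding eqv_def U_not_iff .
        then show ?thesis by eventually_elim simp
      qed
    qed
    then show ?thesis by eventually_elim (auto simp: inj_on_def)
  qed
  then show ?thesis using rep unfolding eqv_def by blast
qed

text \<open>Equivalent coordinate sequences share one variable with the law of X_0, and sequences of
  the second kind become Gaussian linear forms with the rows of the Cholesky factor as coefficients.
  By \<open>joint_char\<close> this has the right characteristic functions.\<close>

lemma generators_char:
  assumes W: "\<And>s. W s \<in> Gen"
  shows "\<exists>\<Theta>::nat \<Rightarrow> (nat \<Rightarrow> real) \<Rightarrow> real. (\<forall>s. \<Theta> s \<in> pol UNIV 1) \<and>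
    (\<forall>I \<tau>. finite I \<longrightarrow> ((\<lambda>n. EE (\<lambda>x. iexp (\<Sum>i\<in>I. \<tau> i * W i n x))) \<longlongrightarrow> Y.E (\<lambda>y. iexp (\<Sum>i\<in>I. \<tau> i * \<Theta> i y))) U)"
proof -
  define isc where "isc i \<longleftrightarrow> (\<exists>J. W i = (\<lambda>n x. x (J n)))" for i
  \<comment> \<open>Coordinate generators get the zero sequence here, so that
    \<open>Cholesky\<close> can be applied to a sequence over all indices.\<close>
  define R where "R i = (if isc i then (\<lambda>n x. 0) else W i)" for i
  have RA: "R i \<in> AH" for i using W[of i] AH_zero unfolding R_def isc_def Gen_def by auto
  then have RC: "R i \<in> CC L" for i unfolding AH_def by auto
  obtain l where l': "\<forall>i N. i < N \<longrightarrow> (\<forall>j. ip (R i) (R j) = (\<Sum>s<N. l i s * l j s)) \<and> (\<forall>s\<ge>N. l i s = (0::real))"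
    using Cholesky[of R, OF RC] by (elim exE)
  have l: "ip (R i) (R j) = (\<Sum>s<N. l i s * l j s)" "N \<le> s \<Longrightarrow> l i s = 0" if "i < N" for i j s N
    using l' that by blast+
  have "\<exists>J. isc i \<longrightarrow> W i = (\<lambda>n x. x (J n))" for i unfolding isc_def by blast
  then obtain J where J: "\<And>i. isc i \<Longrightarrow> W i = (\<lambda>n x. x (J i n))" by metis
  obtain rep where rep: "\<And>i. \<forall>\<^sub>F n in U. J (rep i) n = J i n" "\<And>I. finite I \<Longrightarrow> \<forall>\<^sub>F n in U. inj_on (\<lambda>c. J c n) (rep ` I)"
    using coordinate_representatives[of J] by blast
  \<comment> \<open>Index 2 c carries the law of X_0 and index 2 s + 1 is Gaussian, in agreement
    with \<open>mixlaw\<close>.\<close>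
  define \<Theta> where "\<Theta> i y = (if isc i then y (2 * rep i) else (\<Sum>s<Suc i. l i s * y (2 * s + 1)))" for i and y :: "nat \<Rightarrow> real"
  have \<Theta>p: "\<Theta> i \<in> pol UNIV 1" for i
    unfolding \<Theta>_def[abs_def] by (cases "isc i") (simp_all add: pol_coord pol_sum pol_scale del: sum.lessThan_Suc)
  have "((\<lambda>n. EE (\<lambda>x. iexp (\<Sum>i\<in>I. \<tau> i * W i n x))) \<longlongrightarrow> Y.E (\<lambda>y. iexp (\<Sum>i\<in>I. \<tau> i * \<Theta> i y))) U" if I: "finite I" for I \<tau>
  proof -
    define \<alpha> where "\<alpha> i = (if isc i then \<tau> i else 0)" for i
    define \<rho> where "\<rho> i = (if isc i then 0 else \<tau> i)" for i
    \<comment> \<open>Frequencies of equivalent coordinate sequences add up, since they belong to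
      the same limit variable.\<close>
    define \<alpha>' where "\<alpha>' c = (\<Sum>i\<in>{i\<in>I. rep i = c}. \<alpha> i)" for c
    define Rt where "Rt = (\<lambda>n x. \<Sum>i\<in>I. \<rho> i * R i n x)"
    obtain N where N: "\<And>i. i \<in> I \<Longrightarrow> i < N" using I finite_nat_set_iff_bounded by metis
    define \<sigma> where "\<sigma> s = (\<Sum>i\<in>I. \<rho> i * l i s)" for s
    have RtA: "Rt \<in> AH" unfolding Rt_def by (rule AH_sum) (rule RA)
    have ip: "ip Rt Rt = (\<Sum>s<N. (\<sigma> s)\<^sup>2)"
    proof -
      have "ip Rt Rt = (\<Sum>i\<in>I. \<rho> i * (\<Sum>j\<in>I. \<rho> j * ip (R j) (R i)))"
      proof -
        have 1: "ip Rt H = (\<Sum>i\<in>I. \<rho> i * ip (R i) H)" if H: "H \<in> CC L" for H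
          using ip_sum[of I "\<lambda>i n x. \<rho> i * R i n x" L H L] RC H ip_scale[OF RC H] CC_scale unfolding Rt_def by auto
        have "Rt \<in> CC L" using RtA unfolding AH_def by auto
        then show ?thesis using 1 RC ip_sym by (metis (mono_tags, lifting) sum.cong)
      qed
      also have "\<dots> = (\<Sum>i\<in>I. \<rho> i * (\<Sum>j\<in>I. \<rho> j * (\<Sum>s<N. l j s * l i s)))"
        using N by (intro sum.cong refl arg_cong2[where f = "(*)"] l(1))
      also have "\<dots> = (\<Sum>i\<in>I. \<Sum>s<N. \<Sum>j\<in>I. \<rho> i * (\<rho> j * (l j s * l i s)))"
        unfolding sum_distrib_left by (intro sum.cong refl sum.swap)
      also have "\<dots> = (\<Sum>s<N. (\<sigma> s)\<^sup>2)"
        unfolding \<sigma>_def power2_eq_square sum_product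
        by (subst sum.swap) (intro sum.cong refl, simp add: mult_ac)
      finally show ?thesis .
    qed
    have lim: "((\<lambda>n. EE (\<lambda>x. iexp ((\<Sum>c\<in>rep ` I. \<alpha>' c * x (J c n)) + Rt n x))) \<longlongrightarrow>
       (\<Prod>c\<in>rep ` I. char \<mu> (\<alpha>' c)) * exp (- ip Rt Rt / 2)) U"
      by (rule joint_char[OF RtA finite_imageI[OF I] rep(2)[OF I]])
    have grp: "(\<Sum>i\<in>I. \<alpha> i * z (rep i)) = (\<Sum>c\<in>rep ` I. \<alpha>' c * z c)" for z :: "nat \<Rightarrow> real"
      unfolding \<alpha>'_def sum_distrib_right
      by (subst sum.image_gen[OF I, of _ rep]) (intro sum.cong refl, auto)
    have ev: "\<forall>\<^sub>F n in U. EE (\<lambda>x. iexp ((\<Sum>c\<in>rep ` I. \<alpha>' c * x (J c n)) + Rt n x)) = EE (\<lambda>x. iexp (\<Sum>i\<in>I. \<tau> i * W i n x))"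
    proof -
      have "\<forall>\<^sub>F n in U. \<forall>i\<in>I. J (rep i) n = J i n" by (intro eventually_ball_finite I ballI rep(1))
      then show ?thesis
      proof eventually_elim
        case (elim n)
        have "(\<Sum>c\<in>rep ` I. \<alpha>' c * x (J c n)) + Rt n x = (\<Sum>i\<in>I. \<tau> i * W i n x)" for x
        proof -
          have "(\<Sum>c\<in>rep ` I. \<alpha>' c * x (J c n)) = (\<Sum>i\<in>I. \<alpha> i * x (J i n))"
            using grp[of "\<lambda>c. x (J c n)"] elim by (metis (mono_tags, lifting) sum.cong)
          moreover have "\<alpha> i * x (J i n) + \<rho> i * R i n x = \<tau> i * W i n x" for i
            using J[of i] by (simp add: \<alpha>_def \<rho>_def R_def)
          ultimately show ?thesis unfolding Rt_def by (simp add: sum.distrib[symmetric])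
        qed
        then show ?case by presburger
      qed
    qed
    have tgt: "Y.E (\<lambda>y. iexp (\<Sum>i\<in>I. \<tau> i * \<Theta> i y)) = (\<Prod>c\<in>rep ` I. char \<mu> (\<alpha>' c)) * exp (- ip Rt Rt / 2)"
    proof -
      define v where "v j = (if even j then \<alpha>' (j div 2) else \<sigma> (j div 2))" for j
      define S0 where "S0 = (\<lambda>c. 2 * c) ` (rep ` I)"
      define S1 where "S1 = (\<lambda>s. 2 * s + 1) ` {..<N}"
      have fin: "finite S0" "finite S1" unfolding S0_def S1_def using I by auto
      have disj: "S0 \<inter> S1 = {}" unfolding S0_def S1_def by (auto, presburger)
      have inj0: "inj_on (\<lambda>c::nat. 2 * c) (rep ` I)" and inj1: "inj_on (\<lambda>s::nat. 2 * s + 1) {..<N}" by (auto simp: inj_on_def)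
      have "(\<Sum>i\<in>I. \<tau> i * \<Theta> i y) = (\<Sum>j\<in>S0 \<union> S1. v j * y j)" for y
      proof -
        have \<Theta>N: "\<tau> i * \<Theta> i y = \<alpha> i * y (2 * rep i) + (\<Sum>s<N. \<rho> i * l i s * y (2 * s + 1))" if i: "i \<in> I" for i
        proof (cases "isc i")
          case True
          then show ?thesis by (simp add: \<alpha>_def \<rho>_def \<Theta>_def)
        next
          case False
          have "(\<Sum>s<N. l i s * y (2 * s + 1)) = (\<Sum>s<Suc i. l i s * y (2 * s + 1))"
            by (rule sum.mono_neutral_right) (use N[OF i] l(2)[of i "Suc i"] in auto)
          then show ?thesis using False by (simp add: \<alpha>_def \<rho>_def \<Theta>_def mult.assoc flip: sum_distrib_left del: sum.lessThan_Suc)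
        qed
        have "(\<Sum>i\<in>I. \<tau> i * \<Theta> i y) = (\<Sum>i\<in>I. \<alpha> i * y (2 * rep i)) + (\<Sum>i\<in>I. \<Sum>s<N. \<rho> i * l i s * y (2 * s + 1))"
          by (simp add: \<Theta>N sum.distrib)
        also have "(\<Sum>i\<in>I. \<alpha> i * y (2 * rep i)) = (\<Sum>c\<in>rep ` I. \<alpha>' c * y (2 * c))" using grp[of "\<lambda>c. y (2 * c)"] .
        also have "(\<Sum>i\<in>I. \<Sum>s<N. \<rho> i * l i s * y (2 * s + 1)) = (\<Sum>s<N. \<sigma> s * y (2 * s + 1))"
          unfolding \<sigma>_def sum_distrib_right by (rule sum.swap)
        also have "(\<Sum>c\<in>rep ` I. \<alpha>' c * y (2 * c)) = (\<Sum>j\<in>S0. v j * y j)"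
          unfolding S0_def sum.reindex[OF inj0] by (simp add: v_def)
        also have "(\<Sum>s<N. \<sigma> s * y (2 * s + 1)) = (\<Sum>j\<in>S1. v j * y j)"
          unfolding S1_def sum.reindex[OF inj1] by (simp add: v_def)
        finally show ?thesis using sum.union_disjoint[OF fin disj] by metis
      qed
      then have "Y.E (\<lambda>y. iexp (\<Sum>i\<in>I. \<tau> i * \<Theta> i y)) = Y.E (\<lambda>y. iexp (\<Sum>j\<in>S0 \<union> S1. v j * y j))" by presburger
      also have "\<dots> = (\<Prod>j\<in>S0 \<union> S1. char (mixlaw \<mu> j) (v j))" by (rule Y.iexp_prod) (use fin in auto)
      also have "\<dots> = (\<Prod>j\<in>S0. char (mixlaw \<mu> j) (v j)) * (\<Prod>j\<in>S1. char (mixlaw \<mu> j) (v j))"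
        by (rule prod.union_disjoint[OF fin disj])
      also have "(\<Prod>j\<in>S0. char (mixlaw \<mu> j) (v j)) = (\<Prod>c\<in>rep ` I. char \<mu> (\<alpha>' c))"
        unfolding S0_def prod.reindex[OF inj0] by (simp add: v_def mixlaw_def)
      also have "(\<Prod>j\<in>S1. char (mixlaw \<mu> j) (v j)) = (\<Prod>s<N. complex_of_real (exp (- (\<sigma> s)\<^sup>2 / 2)))"
        unfolding S1_def prod.reindex[OF inj1] by (simp add: v_def mixlaw_def char_std_normal_distribution)
      also have "\<dots> = complex_of_real (exp (- (\<Sum>s<N. (\<sigma> s)\<^sup>2) / 2))"
        by (simp add: exp_sum[symmetric] sum_divide_distrib sum_negf flip: of_real_prod)
      finally show ?thesis unfolding ip .
    qed
    show ?thesis unfolding tgt by (rule Lim_transform_eventually[OF lim ev])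
  qed
  then show ?thesis using \<Theta>p by (intro exI[of _ \<Theta>]) blast
qed

text \<open>The polynomial \<open>Q i m\<close> is evaluated at the limit variables instead of the
  generators. Second moments of differences do not increase in the limit, so this is a Cauchy
  sequence in m with a limit G i. Characteristic functions are compared in three steps: F with its
  approximation, the approximation with its limit, the latter with G.\<close>

theorem limit_polynomials:
  assumes F: "\<And>i::nat. F i \<in> CC d" and d: "d \<le> L"
  shows "\<exists>G. (\<forall>i. G i \<in> poly_chaos (Y.P) (\<lambda>j y. y j) d) \<and>
    (\<forall>I \<tau>. finite I \<longrightarrow> ((\<lambda>n. EE (\<lambda>x. iexp (\<Sum>i\<in>I. \<tau> i * F i n x))) \<longlongrightarrow> Y.E (\<lambda>y. iexp (\<Sum>i\<in>I. \<tau> i * G i y))) U)"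
proof -
  obtain W Q where W: "\<And>s::nat. W s \<in> Gen" and Q: "\<And>i m. Q i m \<in> pol UNIV d"
    and FQ: "\<And>i m. \<forall>\<^sub>F n in U. EE (\<lambda>x. (F i n x - Q i m (\<lambda>s. W s n x))\<^sup>2) < (1/4) ^ m"
    using countable_generators[of F, OF F d] by blast
  obtain \<Theta> :: "nat \<Rightarrow> (nat \<Rightarrow> real) \<Rightarrow> real" where \<Theta>: "\<And>s. \<Theta> s \<in> pol UNIV 1"
    and lim: "\<And>I \<tau>. finite I \<Longrightarrow> ((\<lambda>n. EE (\<lambda>x. iexp (\<Sum>i\<in>I. \<tau> i * W i n x))) \<longlongrightarrow> Y.E (\<lambda>y. iexp (\<Sum>i\<in>I. \<tau> i * \<Theta> i y))) U"
    using generators_char[of W, OF W] by (elim exE conjE) blast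
  have WC: "\<exists>k. W s \<in> CC k" for s
    using W[of s] unfolding Gen_def
  proof (elim UnE CollectE exE)
    show "\<exists>k. W s \<in> CC k" if "W s = (\<lambda>n x. x (J n))" for J using CC_var[of J] that by auto
    show "\<exists>k. W s \<in> CC k" if "W s \<in> AH" using that unfolding AH_def by blast
  qed
  then obtain kw where kw: "\<And>s. W s \<in> CC (kw s)" by metis
  interpret vc: vec_conv "\<lambda>_::nat. X.P" "\<lambda>n i. W i n" "Y.P" \<Theta> U
  proof
    show "W i n \<in> borel_measurable (X.P)" for i n by (rule X.pol_meas[OF CC_pol[OF kw]])
    show "\<Theta> i \<in> borel_measurable (Y.P)" for i by (rule Y.pol_meas[OF \<Theta>])
  qed (use X.D.P.prob_space_axioms Y.D.P.prob_space_axioms lim in auto)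
  have L2: "\<exists>B. \<forall>n. integrable (X.P) (\<lambda>\<omega>. (W i n \<omega>)\<^sup>2) \<and> EE (\<lambda>\<omega>. (W i n \<omega>)\<^sup>2) \<le> B" for i
    using CC_bound[OF kw[of i]] X.pol_integrable_power[OF CC_pol[OF kw[of i]]] by blast
  have QW: "\<exists>k. (\<lambda>x. A (\<lambda>s. W s n x)) \<in> pol UNIV k" if "A \<in> pol UNIV d" for A n
  proof -
    obtain T where T: "finite T" "A \<in> pol T d" using pol_finite[OF \<open>A \<in> pol UNIV d\<close>] by blast
    have "(\<lambda>x. A (\<lambda>s. W s n x)) \<in> pol UNIV (d * (\<Sum>s\<in>T. kw s))"
    proof (rule pol_comp[OF T(2)])
      show "W s n \<in> pol UNIV (\<Sum>s\<in>T. kw s)" if "s \<in> T" for s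
        by (rule pol_mono[OF CC_pol[OF kw]]) (use T that in \<open>auto intro: member_le_sum\<close>)
    qed
    then show ?thesis ..
  qed
  define q where "q i m y = Q i m (\<lambda>s. \<Theta> s y)" for i m y
  have comp\<Theta>: "(\<lambda>y. A (\<lambda>s. \<Theta> s y)) \<in> pol UNIV d" if "A \<in> pol UNIV d" for A
    using pol_comp[OF that, of \<Theta> UNIV 1] \<Theta> by simp
  have qp: "q i m \<in> pol UNIV d" for i m unfolding q_def[abs_def] by (rule comp\<Theta>[OF Q])
  \<comment> \<open>Both approximations are within (1/4)^m of F in squared L^2 distance along U, and
    the factor 2 from the squared sum gives 4 / 4^m in total.\<close>
  have cauchy: "Y.E (\<lambda>y. (q i m' y - q i m y)\<^sup>2) \<le> 4 / 4 ^ m" if m: "m \<le> m'" for i m m'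
  proof -
    define A where "A y = Q i m' y - Q i m y" for y
    have A: "A \<in> pol UNIV d" unfolding A_def[abs_def] by (intro pol_diff Q)
    have "Y.E (\<lambda>y. (A (\<lambda>s. \<Theta> s y))\<^sup>2) \<le> 4 / 4 ^ m"
    proof (rule vc.L2_limit_le[OF A L2])
      show "integrable (X.P) (\<lambda>\<omega>. (A (\<lambda>i. W i n \<omega>))\<^sup>2)" for n
        using QW[OF A, of n] X.pol_integrable_power by blast
      show "integrable (Y.P) (\<lambda>\<omega>. (A (\<lambda>i. \<Theta> i \<omega>))\<^sup>2)" by (rule Y.pol_integrable_power[OF comp\<Theta>[OF A]])
      show "\<forall>\<^sub>F n in U. EE (\<lambda>x. (A (\<lambda>i. W i n x))\<^sup>2) \<le> 4 / 4 ^ m"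
        using FQ[of i m] FQ[of i m']
      proof eventually_elim
        case (elim n)
        obtain a b where ab: "(\<lambda>x. Q i m (\<lambda>s. W s n x)) \<in> pol UNIV a" "(\<lambda>x. Q i m' (\<lambda>s. W s n x)) \<in> pol UNIV b"
          using QW[OF Q] by blast
        define k where "k = d + a + b"
        have ps: "(\<lambda>x. Q i m (\<lambda>s. W s n x)) \<in> pol UNIV k" "(\<lambda>x. Q i m' (\<lambda>s. W s n x)) \<in> pol UNIV k" "F i n \<in> pol UNIV k"
          by (rule pol_mono[OF ab(1)] pol_mono[OF ab(2)] pol_mono[OF CC_pol[OF F]]; simp add: k_def)+
        have "EE (\<lambda>x. (A (\<lambda>i. W i n x))\<^sup>2) = EE (\<lambda>x. ((F i n x - Q i m (\<lambda>s. W s n x)) + (- 1) * (F i n x - Q i m' (\<lambda>s. W s n x)))\<^sup>2)"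
          unfolding A_def by (simp add: algebra_simps)
        also have "\<dots> \<le> 2 * EE (\<lambda>x. (F i n x - Q i m (\<lambda>s. W s n x))\<^sup>2) + 2 * EE (\<lambda>x. ((- 1) * (F i n x - Q i m' (\<lambda>s. W s n x)))\<^sup>2)"
          by (rule L2_add_le[of _ k _ k]) (intro pol_scale pol_diff ps)+
        also have "\<dots> \<le> 2 * (1/4) ^ m + 2 * (1/4) ^ m'" using elim by (simp add: power2_commute)
        also have "\<dots> \<le> 2 * (1/4) ^ m + 2 * (1/4) ^ m" using m by (intro add_left_mono mult_left_mono power_decreasing) auto
        finally show ?case by (simp add: power_divide)
      qed
    qed (rule U_bot)
    then show ?thesis unfolding A_def q_def .
  qed
  define Gp where "Gp i G \<longleftrightarrow> G \<in> borel_measurable (Y.P) \<and> (\<forall>m. (\<integral>\<^sup>+y. ennreal ((G y - q i m y)\<^sup>2) \<partial>Y.P) \<le> ennreal (4 / 4 ^ m))" for i G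
  have "\<exists>G\<in>borel_measurable (Y.P). \<forall>m. (\<integral>\<^sup>+y. ennreal ((G y - q i m y)\<^sup>2) \<partial>Y.P) \<le> ennreal (4 / 4 ^ m)" for i
  proof (rule Y.D.P.L2_complete)
    show "q i m \<in> borel_measurable (Y.P)" for m by (rule Y.pol_meas[OF qp])
    fix m m' :: nat assume m: "m \<le> m'"
    have "integrable (Y.P) (\<lambda>y. (q i m' y - q i m y)\<^sup>2)" by (rule Y.pol_integrable_power[OF pol_diff[OF qp qp]])
    from nn_integral_eq_integral[OF this] cauchy[OF m]
    show "(\<integral>\<^sup>+y. ennreal ((q i m' y - q i m y)\<^sup>2) \<partial>Y.P) \<le> ennreal (4 / 4 ^ m)" by (simp add: ennreal_leI)
  qed
  then have "\<exists>G. Gp i G" for i unfolding Gp_def by blast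
  then obtain G where "\<And>i. Gp i (G i)" by metis
  then have G[measurable]: "\<And>i. G i \<in> borel_measurable (Y.P)"
    and Gq: "\<And>i m. (\<integral>\<^sup>+y. ennreal ((G i y - q i m y)\<^sup>2) \<partial>Y.P) \<le> ennreal (4 / 4 ^ m)"
    unfolding Gp_def by blast+
  have qm[measurable]: "q i m \<in> borel_measurable (Y.P)" for i m by (rule Y.pol_meas[OF qp])
  have "G i \<in> poly_chaos (Y.P) (\<lambda>j y. y j) d" for i
    unfolding poly_chaos_def
  proof (intro CollectI conjI allI impI)
    show "integrable (Y.P) (\<lambda>y. (G i y)\<^sup>2)"
    proof (rule Bochner_Integration.integrable_bound)
      have "integrable (Y.P) (\<lambda>y. (G i y - q i 0 y)\<^sup>2)"
      proof (rule integrableI_bounded)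
        have "(\<integral>\<^sup>+y. ennreal (norm ((G i y - q i 0 y)\<^sup>2)) \<partial>Y.P) \<le> ennreal (4 / 4 ^ 0)"
          using Gq[of i 0] by simp
        also have "\<dots> < \<infinity>" by simp
        finally show "(\<integral>\<^sup>+y. ennreal (norm ((G i y - q i 0 y)\<^sup>2)) \<partial>Y.P) < \<infinity>" .
      qed measurable
      then show "integrable (Y.P) (\<lambda>y. 2 * (G i y - q i 0 y)\<^sup>2 + 2 * (q i 0 y)\<^sup>2)"
        using Y.pol_integrable_power[OF qp[of i 0], of 2] by auto
      have "(G i y)\<^sup>2 \<le> 2 * (G i y - q i 0 y)\<^sup>2 + 2 * (q i 0 y)\<^sup>2" for y
        using zero_le_power2[of "(G i y - q i 0 y) - q i 0 y"] by (simp add: power2_eq_square algebra_simps)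
      then show "AE y in Y.P. norm ((G i y)\<^sup>2) \<le> norm (2 * (G i y - q i 0 y)\<^sup>2 + 2 * (q i 0 y)\<^sup>2)" by simp
    qed measurable
    fix \<epsilon> :: real assume \<epsilon>: "\<epsilon> > 0"
    have "(\<lambda>m. 4 * (1/4) ^ m) \<longlonglongrightarrow> 4 * (0::real)" by (intro tendsto_intros LIMSEQ_realpow_zero) auto
    then have "\<forall>\<^sub>F m in sequentially. 4 * (1/4) ^ m < \<epsilon>" using \<epsilon> by (intro order_tendstoD(2)) auto
    then obtain m :: nat where m: "4 * (1/4) ^ m < \<epsilon>" by (auto dest: eventually_happens)
    obtain p where p: "degree_le d p" "\<And>z. eval_rpoly p z = q i m z" using pol_rpoly[OF qp[of i m]] by blast
    have "(\<integral>\<^sup>+y. ennreal ((G i y - eval_rpoly p (\<lambda>j. y j))\<^sup>2) \<partial>Y.P) \<le> ennreal (4 / 4 ^ m)"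
      unfolding p(2) by (rule Gq)
    also have "\<dots> < ennreal \<epsilon>" using m by (intro ennreal_lessI \<epsilon>) (simp add: power_divide)
    finally show "\<exists>p. degree_le d p \<and> (\<integral>\<^sup>+y. ennreal ((G i y - eval_rpoly p (\<lambda>j. y j))\<^sup>2) \<partial>Y.P) < ennreal \<epsilon>"
      using p(1) by blast
  qed (rule G)
  moreover have "((\<lambda>n. EE (\<lambda>x. iexp (\<Sum>i\<in>I. \<tau> i * F i n x))) \<longlongrightarrow> Y.E (\<lambda>y. iexp (\<Sum>i\<in>I. \<tau> i * G i y))) U" if I: "finite I" for I \<tau>
  proof (rule tendstoI)
    fix r :: real assume r: "r > 0"
    define S where "S = (\<Sum>i\<in>I. \<bar>\<tau> i\<bar>)"
    have "(\<lambda>m. S * (2 * (1/2) ^ m)) \<longlonglongrightarrow> S * (2 * 0)" by (intro tendsto_intros LIMSEQ_realpow_zero) auto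
    then have "\<forall>\<^sub>F m in sequentially. S * (2 * (1/2) ^ m) < r / 3" using r by (intro order_tendstoD(2)) auto
    then obtain m :: nat where m: "S * (2 * (1/2) ^ m) < r / 3" by (auto dest: eventually_happens)
    have S0: "S \<ge> 0" unfolding S_def by (intro sum_nonneg) auto
    have m': "S * (1/2) ^ m < r / 3"
    proof -
      have "0 \<le> S * (1/2) ^ m" using S0 by simp
      then show ?thesis using m by simp
    qed
    have dN: "cmod (Y.E (\<lambda>y. iexp (\<Sum>i\<in>I. \<tau> i * G i y)) - Y.E (\<lambda>y. iexp (\<Sum>i\<in>I. \<tau> i * q i m y))) \<le> S * (2 * (1/2) ^ m)"
      unfolding S_def
    proof (rule Y.D.P.iexp_sum_close)
      have "(2 * (1/2) ^ m)\<^sup>2 = 4 / (4::real) ^ m" by (simp add: power_mult_distrib power_divide flip: power_mult) (simp add: power_mult mult.commute[of m])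
      then show "(\<integral>\<^sup>+y. ennreal ((G i y - q i m y)\<^sup>2) \<partial>Y.P) \<le> ennreal ((2 * (1/2) ^ m)\<^sup>2)" for i using Gq by simp
    qed auto
    define A where "A y = (\<Sum>i\<in>I. \<tau> i * Q i m y)" for y
    have A: "A \<in> pol UNIV d" unfolding A_def[abs_def] by (intro pol_sum pol_scale Q)
    \<comment> \<open>Real and imaginary parts are treated separately, because
      \<open>Lipschitz_conv\<close> is about real functions.\<close>
    have cs: "\<bar>cos x - cos y\<bar> \<le> \<bar>x - y\<bar>" "\<bar>sin x - sin y\<bar> \<le> \<bar>x - y\<bar>" for x y :: real
      using cmod_iexp_diff[of x y] abs_Re_le_cmod[of "iexp x - iexp y"] abs_Im_le_cmod[of "iexp x - iexp y"] by (auto simp: Re_exp Im_exp)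
    obtain ka where ka: "\<And>n. (\<lambda>x. A (\<lambda>s. W s n x)) \<in> pol UNIV (ka n)" using QW[OF A] by metis
    have Am[measurable]: "(\<lambda>x. A (\<lambda>s. W s n x)) \<in> borel_measurable (X.P)" "(\<lambda>y. A (\<lambda>s. \<Theta> s y)) \<in> borel_measurable (Y.P)" for n
      by (rule X.pol_meas[OF ka] Y.pol_meas[OF comp\<Theta>[OF A]])+
    have Eq: "EE (\<lambda>x. iexp (A (\<lambda>s. W s n x))) = complex_of_real (EE (\<lambda>x. cos (A (\<lambda>s. W s n x)))) + \<i> * complex_of_real (EE (\<lambda>x. sin (A (\<lambda>s. W s n x))))" for n
      by (rule X.D.P.iexp_cos_sin) measurable
    have EqY: "Y.E (\<lambda>y. iexp (A (\<lambda>s. \<Theta> s y))) = complex_of_real (Y.E (\<lambda>y. cos (A (\<lambda>s. \<Theta> s y)))) + \<i> * complex_of_real (Y.E (\<lambda>y. sin (A (\<lambda>s. \<Theta> s y))))"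
      by (rule Y.D.P.iexp_cos_sin) measurable
    have "((\<lambda>n. EE (\<lambda>x. iexp (A (\<lambda>s. W s n x)))) \<longlongrightarrow> Y.E (\<lambda>y. iexp (A (\<lambda>s. \<Theta> s y)))) U"
      unfolding Eq EqY
      by (intro tendsto_intros vc.Lipschitz_conv[where b = 1, OF cs(1) _ A L2] vc.Lipschitz_conv[where b = 1, OF cs(2) _ A L2]) auto
    then have "\<forall>\<^sub>F n in U. dist (EE (\<lambda>x. iexp (A (\<lambda>s. W s n x)))) (Y.E (\<lambda>y. iexp (A (\<lambda>s. \<Theta> s y)))) < r / 3"
      using r by (intro tendstoD) auto
    moreover have "\<forall>\<^sub>F n in U. \<forall>i\<in>I. EE (\<lambda>x. (F i n x - Q i m (\<lambda>s. W s n x))\<^sup>2) < (1/4) ^ m"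
      by (intro eventually_ball_finite I ballI FQ)
    ultimately show "\<forall>\<^sub>F n in U. dist (EE (\<lambda>x. iexp (\<Sum>i\<in>I. \<tau> i * F i n x))) (Y.E (\<lambda>y. iexp (\<Sum>i\<in>I. \<tau> i * G i y))) < r"
    proof eventually_elim
      case (elim n)
      have "cmod (EE (\<lambda>x. iexp (\<Sum>i\<in>I. \<tau> i * F i n x)) - EE (\<lambda>x. iexp (\<Sum>i\<in>I. \<tau> i * Q i m (\<lambda>s. W s n x)))) \<le> S * (1/2) ^ m"
        unfolding S_def
      proof (rule X.D.P.iexp_sum_close)
        show "F i n \<in> borel_measurable (X.P)" for i by (rule X.pol_meas[OF CC_pol[OF F]])
        show "(\<lambda>x. Q i m (\<lambda>s. W s n x)) \<in> borel_measurable (X.P)" for i using QW[OF Q] X.pol_meas by blast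
        fix i assume i: "i \<in> I"
        obtain a where a: "(\<lambda>x. Q i m (\<lambda>s. W s n x)) \<in> pol UNIV a" using QW[OF Q] by blast
        have int: "integrable (X.P) (\<lambda>x. (F i n x - Q i m (\<lambda>s. W s n x))\<^sup>2)"
          by (rule X.pol_integrable_power[OF pol_diff[OF pol_mono[OF CC_pol[OF F] order_refl, of "d + a"] pol_mono[OF a order_refl, of "d + a"]]]) auto
        have "((1/2) ^ m)\<^sup>2 = (1/4::real) ^ m" by (simp add: power_divide flip: power_mult) (simp add: power_mult mult.commute[of m])
        then show "(\<integral>\<^sup>+x. ennreal ((F i n x - Q i m (\<lambda>s. W s n x))\<^sup>2) \<partial>X.P) \<le> ennreal (((1/2) ^ m)\<^sup>2)"
          using nn_integral_eq_integral[OF int] bspec[OF elim(2) i] by (simp add: ennreal_leI)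
      qed auto
      moreover have "EE (\<lambda>x. iexp (\<Sum>i\<in>I. \<tau> i * Q i m (\<lambda>s. W s n x))) = EE (\<lambda>x. iexp (A (\<lambda>s. W s n x)))"
        "Y.E (\<lambda>y. iexp (\<Sum>i\<in>I. \<tau> i * q i m y)) = Y.E (\<lambda>y. iexp (A (\<lambda>s. \<Theta> s y)))" unfolding A_def q_def by simp_all
      ultimately have 1: "dist (EE (\<lambda>x. iexp (\<Sum>i\<in>I. \<tau> i * F i n x))) (EE (\<lambda>x. iexp (A (\<lambda>s. W s n x)))) < r / 3"
        and 2: "dist (Y.E (\<lambda>y. iexp (\<Sum>i\<in>I. \<tau> i * G i y))) (Y.E (\<lambda>y. iexp (A (\<lambda>s. \<Theta> s y)))) < r / 3"
        using m m' dN unfolding dist_norm by auto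
      have "dist a e < r" if "dist a b < r / 3" "dist b c < r / 3" "dist e c < r / 3" for a b c e :: complex
        using dist_triangle[of a e b] dist_triangle[of b e c] that unfolding dist_commute[of e c] by linarith
      from this[OF 1 elim(1) 2] show ?case .
    qed
  qed
  ultimately show ?thesis by blast
qed

end

section \<open>Convergence in law\<close>

text \<open>Marginal laws live on extensional functions over \<open>I\<close>, while the test
  functions act on whole sequences; extension by 0 is a continuous passage from the former to the
  latter.\<close>

definition zero_ext :: "nat set \<Rightarrow> (nat \<Rightarrow> real) \<Rightarrow> nat \<Rightarrow> real" where
  "zero_ext I x = (\<lambda>i. if i \<in> I then x i else 0)"

lemma zero_ext_measurable: "zero_ext I \<in> borel_measurable (PiM I (\<lambda>_. borel))"
  unfolding zero_ext_def[abs_def] proof (rule vec_measurable_borel)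
  show "(\<lambda>x. if i \<in> I then x i else 0) \<in> borel_measurable (PiM I (\<lambda>_. borel))" for i by (cases "i \<in> I") auto
qed

lemma marginal_integral:
  assumes cont: "continuous_on UNIV (\<Phi> :: (nat \<Rightarrow> real) \<Rightarrow> real)" and [measurable]: "\<And>i. F i \<in> borel_measurable M"
  shows "(\<integral>x. \<Phi> (zero_ext I x) \<partial>marginal_law M F I) = (\<integral>\<omega>. \<Phi> (zero_ext I (\<lambda>i. F i \<omega>)) \<partial>M)"
proof -
  have "(\<integral>x. \<Phi> (zero_ext I x) \<partial>marginal_law M F I) = (\<integral>\<omega>. \<Phi> (zero_ext I (\<lambda>i\<in>I. F i \<omega>)) \<partial>M)"
    unfolding marginal_law_def
  proof (rule integral_distr)
    show "(\<lambda>\<omega>. \<lambda>i\<in>I. F i \<omega>) \<in> measurable M (PiM I (\<lambda>_. borel))" by (rule measurable_restrict) measurable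
    show "(\<lambda>x. \<Phi> (zero_ext I x)) \<in> borel_measurable (PiM I (\<lambda>_. borel))"
      by (rule measurable_compose[OF zero_ext_measurable borel_measurable_continuous_onI[OF cont]])
  qed
  also have "(\<lambda>\<omega>. zero_ext I (\<lambda>i\<in>I. F i \<omega>)) = (\<lambda>\<omega>. zero_ext I (\<lambda>i. F i \<omega>))" by (intro ext) (simp add: zero_ext_def)
  finally show ?thesis by metis
qed

lemma law_conv_dep:
  fixes \<Phi> :: "(nat \<Rightarrow> real) \<Rightarrow> real"
  assumes lc: "converges_in_law_to M F N G" and I: "finite I"
    and cont: "continuous_on UNIV \<Phi>" and b: "\<And>x. \<bar>\<Phi> x\<bar> \<le> b" and dep: "dep I \<Phi>"
    and F: "\<And>i n. F i n \<in> borel_measurable M" and G: "\<And>i. G i \<in> borel_measurable N"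
  shows "(\<lambda>n. \<integral>\<omega>. \<Phi> (\<lambda>i. F i n \<omega>) \<partial>M) \<longlonglongrightarrow> (\<integral>\<omega>. \<Phi> (\<lambda>i. G i \<omega>) \<partial>N)"
proof -
  let ?g = "\<lambda>x. \<Phi> (zero_ext I x)"
  have "continuous_map (product_topology (\<lambda>_. euclideanreal) I) euclidean (zero_ext I)"
    unfolding euclidean_product_topology[symmetric] continuous_map_componentwise_UNIV
    by (auto simp: zero_ext_def intro: continuous_map_product_projection)
  then have "continuous_map (product_topology (\<lambda>_. euclideanreal) I) euclideanreal (\<Phi> \<circ> zero_ext I)"
    by (rule continuous_map_compose) (use cont in simp)
  then have "continuous_map (product_topology (\<lambda>_. euclideanreal) I) euclideanreal ?g" by (simp add: o_def)
  moreover have "bounded (?g ` (I \<rightarrow>\<^sub>E UNIV))" using b by (auto intro!: boundedI)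
  ultimately have lim: "(\<lambda>n. \<integral>x. ?g x \<partial>marginal_law M (\<lambda>i. F i n) I) \<longlonglongrightarrow> (\<integral>x. ?g x \<partial>marginal_law N G I)"
    using lc I unfolding converges_in_law_to_def weak_conv_on_def by blast
  have z: "\<Phi> (zero_ext I x) = \<Phi> x" for x by (rule depD[OF dep]) (simp add: zero_ext_def)
  have "(\<integral>x. ?g x \<partial>marginal_law M (\<lambda>i. F i n) I) = (\<integral>\<omega>. \<Phi> (\<lambda>i. F i n \<omega>) \<partial>M)" for n
    using marginal_integral[of \<Phi> "\<lambda>i. F i n" M I, OF cont F] unfolding z .
  moreover have "(\<integral>x. ?g x \<partial>marginal_law N G I) = (\<integral>\<omega>. \<Phi> (\<lambda>i. G i \<omega>) \<partial>N)"
    using marginal_integral[of \<Phi> G N I, OF cont G] unfolding z .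
  ultimately show ?thesis using lim by (simp only:)
qed

text \<open>A test function over \<open>I\<close>, composed with the restriction to
  \<open>I\<close>, is a bounded continuous function of whole sequences, so
  \<open>char_unique\<close> allows the limit vector to be exchanged for one with the same
  characteristic functions.\<close>

lemma law_conv_eq:
  assumes lc: "converges_in_law_to M F N G" and pr: "prob_space N" "prob_space N'"
    and G: "\<And>i. G i \<in> borel_measurable N" and G': "\<And>i. G' i \<in> borel_measurable N'"
    and ch: "\<And>T \<tau>. finite T \<Longrightarrow> (\<integral>\<omega>. iexp (\<Sum>i\<in>T. \<tau> i * G i \<omega>) \<partial>N) = (\<integral>\<omega>. iexp (\<Sum>i\<in>T. \<tau> i * G' i \<omega>) \<partial>N')"
  shows "converges_in_law_to M F N' G'"
  unfolding converges_in_law_to_def weak_conv_on_def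
proof (intro allI impI)
  fix I :: "nat set" and g
  assume I: "finite I" and g: "continuous_map (product_topology (\<lambda>_. euclideanreal) I) euclideanreal g"
    and bd: "bounded (g ` (I \<rightarrow>\<^sub>E UNIV))"
  define \<Phi> where "\<Phi> w = g (restrict w I)" for w
  have "continuous_map (product_topology (\<lambda>_. euclideanreal) UNIV) (product_topology (\<lambda>_. euclideanreal) I) (\<lambda>w. restrict w I)"
    unfolding continuous_map_componentwise by (auto intro: continuous_map_product_projection)
  from continuous_map_compose[OF this g] have cont: "continuous_on UNIV \<Phi>"
    unfolding euclidean_product_topology \<Phi>_def[abs_def] by (simp add: o_def)
  obtain b where "\<And>x. x \<in> I \<rightarrow>\<^sub>E UNIV \<Longrightarrow> \<bar>g x\<bar> \<le> b" using bd unfolding bounded_iff by auto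
  then have b: "\<bar>\<Phi> w\<bar> \<le> b" for w by (simp add: \<Phi>_def)
  have g\<Phi>: "g x = \<Phi> (zero_ext I x)" if "x \<in> I \<rightarrow>\<^sub>E UNIV" for x
  proof -
    have "restrict (zero_ext I x) I = x" using that by (auto simp: zero_ext_def fun_eq_iff PiE_def extensional_def)
    then show ?thesis by (simp add: \<Phi>_def)
  qed
  have eq: "(\<integral>x. g x \<partial>marginal_law L H I) = (\<integral>\<omega>. \<Phi> (\<lambda>i. H i \<omega>) \<partial>L)" if H: "\<And>i. H i \<in> borel_measurable L" for L :: "'z measure" and H
  proof -
    have "(\<integral>x. g x \<partial>marginal_law L H I) = (\<integral>x. \<Phi> (zero_ext I x) \<partial>marginal_law L H I)"
      by (rule Bochner_Integration.integral_cong) (simp_all add: marginal_law_def space_PiM g\<Phi>)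
    also have "\<dots> = (\<integral>\<omega>. \<Phi> (zero_ext I (\<lambda>i. H i \<omega>)) \<partial>L)" by (rule marginal_integral[OF cont H])
    also have "(\<lambda>\<omega>. \<Phi> (zero_ext I (\<lambda>i. H i \<omega>))) = (\<lambda>\<omega>. \<Phi> (\<lambda>i. H i \<omega>))"
      unfolding \<Phi>_def zero_ext_def by (intro ext arg_cong[where f = g]) auto
    finally show ?thesis .
  qed
  have "(\<integral>x. g x \<partial>marginal_law N G I) = (\<integral>x. g x \<partial>marginal_law N' G' I)"
    unfolding eq[of G, OF G] eq[of G', OF G'] by (rule char_unique[OF pr G G' ch cont b])
  moreover have "(\<lambda>n. \<integral>x. g x \<partial>marginal_law M (\<lambda>i. F i n) I) \<longlonglongrightarrow> (\<integral>x. g x \<partial>marginal_law N G I)"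
    using lc I g bd unfolding converges_in_law_to_def weak_conv_on_def by blast
  ultimately show "(\<lambda>n. \<integral>x. g x \<partial>marginal_law M (\<lambda>i. F i n) I) \<longlonglongrightarrow> (\<integral>x. g x \<partial>marginal_law N' G' I)" by simp
qed

lemma law_conv_char:
  assumes lc: "converges_in_law_to M F N G" and pr: "prob_space M" "prob_space N" and I: "finite I"
    and F: "\<And>i n. F i n \<in> borel_measurable M" and G: "\<And>i. G i \<in> borel_measurable N"
  shows "(\<lambda>n. \<integral>\<omega>. iexp (\<Sum>i\<in>I. \<tau> i * F i n \<omega>) \<partial>M) \<longlonglongrightarrow> (\<integral>\<omega>. iexp (\<Sum>i\<in>I. \<tau> i * G i \<omega>) \<partial>N)"
proof -
  note [measurable] = F G
  have c: "continuous_on UNIV (\<lambda>w::nat \<Rightarrow> real. f (\<Sum>i\<in>I. \<tau> i * w i))" if "continuous_on UNIV f" for f :: "real \<Rightarrow> real"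
    by (rule continuous_on_compose2[OF that]) (auto intro!: continuous_intros continuous_on_subset[OF continuous_on_product_coordinates])
  have d: "dep I (\<lambda>w::nat \<Rightarrow> real. f (\<Sum>i\<in>I. \<tau> i * w i))" for f :: "real \<Rightarrow> real"
    unfolding dep_def by (intro allI impI arg_cong[where f = f] sum.cong) auto
  have "(\<lambda>n. \<integral>\<omega>. cos (\<Sum>i\<in>I. \<tau> i * F i n \<omega>) \<partial>M) \<longlonglongrightarrow> (\<integral>\<omega>. cos (\<Sum>i\<in>I. \<tau> i * G i \<omega>) \<partial>N)"
    by (rule law_conv_dep[where b = 1, OF lc I c _ d F G]) (auto intro: continuous_intros)
  moreover have "(\<lambda>n. \<integral>\<omega>. sin (\<Sum>i\<in>I. \<tau> i * F i n \<omega>) \<partial>M) \<longlonglongrightarrow> (\<integral>\<omega>. sin (\<Sum>i\<in>I. \<tau> i * G i \<omega>) \<partial>N)"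
    by (rule law_conv_dep[where b = 1, OF lc I c _ d F G]) (auto intro: continuous_intros)
  moreover have "(\<integral>\<omega>. iexp (\<Sum>i\<in>I. \<tau> i * F i n \<omega>) \<partial>M) = complex_of_real (\<integral>\<omega>. cos (\<Sum>i\<in>I. \<tau> i * F i n \<omega>) \<partial>M) + \<i> * complex_of_real (\<integral>\<omega>. sin (\<Sum>i\<in>I. \<tau> i * F i n \<omega>) \<partial>M)" for n
    by (rule prob_space.iexp_cos_sin[OF pr(1)]) measurable
  moreover have "(\<integral>\<omega>. iexp (\<Sum>i\<in>I. \<tau> i * G i \<omega>) \<partial>N) = complex_of_real (\<integral>\<omega>. cos (\<Sum>i\<in>I. \<tau> i * G i \<omega>) \<partial>N) + \<i> * complex_of_real (\<integral>\<omega>. sin (\<Sum>i\<in>I. \<tau> i * G i \<omega>) \<partial>N)"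
    by (rule prob_space.iexp_cos_sin[OF pr(2)]) measurable
  ultimately show ?thesis by (simp only:) (intro tendsto_intros)
qed

text \<open>Paley--Zygmund: by hypercontractivity a polynomial of bounded degree cannot have a large second
  moment while being small with high probability.\<close>

lemma (in prodspace) tight_L2_bounded:
  assumes fin: "finite (range D)" and B: "\<And>n. B n \<in> pol UNIV d"
    and tight: "\<And>\<delta>. \<delta> > 0 \<Longrightarrow> \<exists>K>0. \<forall>\<^sub>F n in sequentially. E (\<lambda>x. min 1 (\<bar>B n x\<bar> / K)) \<le> \<delta>"
  shows "\<exists>C. \<forall>\<^sub>F n in sequentially. E (\<lambda>x. (B n x)\<^sup>2) \<le> C"
proof -
  obtain C where C: "C \<ge> 0" "\<And>A. A \<in> pol UNIV d \<Longrightarrow> E (\<lambda>x. A x ^ 4) \<le> C * (E (\<lambda>x. (A x)\<^sup>2))\<^sup>2"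
    using hypercontractive[OF fin] by metis
  \<comment> \<open>With this level the mean of B^2 h is at most half of the second moment; as h = 1
    wherever |B| exceeds K, the other half is at most K^2.\<close>
  obtain K where K: "K > 0" and ev: "\<forall>\<^sub>F n in sequentially. E (\<lambda>x. min 1 (\<bar>B n x\<bar> / K)) \<le> 1 / (4 * (C + 1))"
    using tight[of "1 / (4 * (C + 1))"] C(1) by auto
  have "\<forall>\<^sub>F n in sequentially. E (\<lambda>x. (B n x)\<^sup>2) \<le> 2 * K\<^sup>2"
    using ev
  proof eventually_elim
    case (elim n)
    define s where "s = E (\<lambda>x. (B n x)\<^sup>2)"
    define h where "h x = min 1 (\<bar>B n x\<bar> / K)" for x
    have h: "0 \<le> h x" "h x \<le> 1" for x using K by (auto simp: h_def)
    have [measurable]: "B n \<in> borel_measurable P" by (rule pol_meas[OF B])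
    have [measurable]: "h \<in> borel_measurable P" unfolding h_def[abs_def] by measurable
    have ih: "integrable P h" by (rule D.P.integrable_const_bound[of _ 1]) (use h in auto)
    have h1: "(h x)\<^sup>2 \<le> h x" for x using mult_left_mono[OF h(2) h(1), of x x] by (simp add: power2_eq_square)
    have ih2: "integrable P (\<lambda>x. (h x)\<^sup>2)" by (rule D.P.integrable_const_bound[of _ 1]) (use h in \<open>auto simp: power_le_one\<close>)
    have i4: "integrable P (\<lambda>x. ((B n x)\<^sup>2)\<^sup>2)" using pol_integrable_power[OF B, of n 4] by (simp flip: power_mult)
    have CS: "(E (\<lambda>x. (B n x)\<^sup>2 * h x))\<^sup>2 \<le> E (\<lambda>x. ((B n x)\<^sup>2)\<^sup>2) * E (\<lambda>x. (h x)\<^sup>2)"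
      "integrable P (\<lambda>x. (B n x)\<^sup>2 * h x)"
      by (rule integral_Cauchy_Schwarz[OF _ _ i4 ih2]; measurable)+
    have s0: "s \<ge> 0" unfolding s_def by simp
    have "(E (\<lambda>x. (B n x)\<^sup>2 * h x))\<^sup>2 \<le> (C * s\<^sup>2) * (1 / (4 * (C + 1)))"
    proof (rule order_trans[OF CS(1)], rule mult_mono)
      show "E (\<lambda>x. ((B n x)\<^sup>2)\<^sup>2) \<le> C * s\<^sup>2" using C(2)[OF B[of n]] unfolding s_def by (simp flip: power_mult)
      have "E (\<lambda>x. (h x)\<^sup>2) \<le> E h" by (rule integral_mono[OF ih2 ih h1])
      also have "\<dots> \<le> 1 / (4 * (C + 1))" using elim unfolding h_def[abs_def] .
      finally show "E (\<lambda>x. (h x)\<^sup>2) \<le> 1 / (4 * (C + 1))" .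
    qed (use C(1) in auto)
    also have "\<dots> \<le> (s / 2)\<^sup>2"
    proof -
      have "C / (C + 1) \<le> 1" using C(1) by simp
      then have "C / (C + 1) * (s\<^sup>2 / 4) \<le> 1 * (s\<^sup>2 / 4)" by (rule mult_right_mono) simp
      then show ?thesis by (simp add: power_divide mult_ac)
    qed
    finally have half: "E (\<lambda>x. (B n x)\<^sup>2 * h x) \<le> s / 2" using power2_le_imp_le[of _ "s / 2"] s0 by simp
    have "s \<le> E (\<lambda>x. K\<^sup>2 + (B n x)\<^sup>2 * h x)"
      unfolding s_def
    proof (rule integral_mono)
      show "integrable P (\<lambda>x. (B n x)\<^sup>2)" by (rule pol_integrable_power[OF B])
      show "integrable P (\<lambda>x. K\<^sup>2 + (B n x)\<^sup>2 * h x)" using CS(2) by simp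
      fix x
      show "(B n x)\<^sup>2 \<le> K\<^sup>2 + (B n x)\<^sup>2 * h x"
      proof (cases "\<bar>B n x\<bar> \<le> K")
        case True
        then have "(B n x)\<^sup>2 \<le> K\<^sup>2" using K by (simp add: abs_le_square_iff[symmetric])
        then show ?thesis using h(1)[of x] by (simp add: add_increasing2)
      next
        case False
        then have "h x = 1" using K by (simp add: h_def)
        then show ?thesis by simp
      qed
    qed
    also have "\<dots> = K\<^sup>2 + E (\<lambda>x. (B n x)\<^sup>2 * h x)" using CS(2) by (simp add: D.P.prob_space)
    finally show ?case using half unfolding s_def by linarith
  qed
  then show ?thesis by blast
qed

theorem theorem4p1:
  fixes M :: "'a measure" and X :: "nat \<Rightarrow> 'a \<Rightarrow> real"
    and F :: "nat \<Rightarrow> nat \<Rightarrow> 'a \<Rightarrow> real" and d :: nat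
  assumes "prob_space M"
    and "prob_space.indep_vars M (\<lambda>_. borel) X UNIV"
    and "\<And>j. distr M borel (X j) = distr M borel (X 0)"
    and "\<And>j k. integrable M (\<lambda>\<omega>. X j \<omega> ^ k)"
    and "\<And>j. prob_space.expectation M (X j) = 0"
    and "\<And>j. prob_space.variance M (X j) = 1"
    and "\<And>i n. F i n \<in> poly_chaos M X d"
    and "converges_in_law M F"
  shows "\<exists>(N :: (nat \<Rightarrow> real) measure) (Y :: nat \<Rightarrow> (nat \<Rightarrow> real) \<Rightarrow> real)
            (G :: nat \<Rightarrow> (nat \<Rightarrow> real) \<Rightarrow> real).
           prob_space N \<and>
           prob_space.indep_vars N (\<lambda>_. borel) Y UNIV \<and>
           (\<forall>j. distr N borel (Y j) = distr M borel (X 0) \<or>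
                distr N borel (Y j) = std_normal_distribution) \<and>
           (\<forall>i. G i \<in> poly_chaos N Y d) \<and>
           converges_in_law_to M F N G"
proof -
  interpret M: prob_space M by fact
  define \<mu> where "\<mu> = distr M borel (X 0)"
  have X[measurable]: "X j \<in> borel_measurable M" for j using assms(2) unfolding M.indep_vars_def by auto
  have ps: "prodspace (\<lambda>_::nat. \<mu>)"
  proof (rule prodspace.intro)
    show "prob_space \<mu>" unfolding \<mu>_def by (rule M.prob_space_distr) measurable
    show "sets \<mu> = sets borel" by (simp add: \<mu>_def)
    show "integrable \<mu> (\<lambda>x. x ^ k)" for k unfolding \<mu>_def using assms(4)[of 0 k] by (subst integrable_distr_eq) auto
  qed
  obtain e \<Lambda> \<kappa> where onb: "onbspace (\<lambda>_::nat. \<mu>) e \<Lambda> d \<kappa>" "\<And>i j. e i = e j \<and> \<Lambda> i = \<Lambda> j"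
    using prodspace.obtain_onbspace[OF ps, of d] by auto
  have "e = (\<lambda>_. e 0)" "\<Lambda> = (\<lambda>_. \<Lambda> 0)" using onb(2) by blast+
  then have onb': "onbspace (\<lambda>_::nat. \<mu>) (\<lambda>_. e 0) (\<lambda>_. \<Lambda> 0) d \<kappa>" using onb(1) by simp
  obtain U :: "nat filter" where U: "U \<noteq> bot" "U \<le> sequentially" "\<And>P. eventually P U \<or> eventually (\<lambda>n. \<not> P n) U"
    using ultrafilter_exists by blast
  interpret ultra \<mu> "e 0" "\<Lambda> 0" d \<kappa> U by (intro ultra.intro iidlaw.intro ultra_axioms.intro onb' U)
  let ?P = "PiM UNIV (\<lambda>_::nat. \<mu>)"
  let ?N = "PiM UNIV (mixlaw \<mu>)"
  let ?X = "\<lambda>\<omega> j. X j \<omega>"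
  have Xm[measurable]: "?X \<in> measurable M ?P"
  proof -
    have "?X \<in> measurable M (PiM UNIV (\<lambda>_. borel))" by (rule measurable_PiM_single') auto
    then show ?thesis using measurable_cong_sets[OF refl sets_PiM_cong[OF refl X.sets_D]] by blast
  qed
  \<comment> \<open>By independence and equality of the laws the sequence has the product law, so
    expectations can be computed on the canonical space.\<close>
  have joint: "distr M ?P ?X = ?P"
  proof -
    have "distr M (PiM UNIV (\<lambda>_. borel)) (\<lambda>\<omega>. \<lambda>j\<in>UNIV. X j \<omega>) = PiM UNIV (\<lambda>j. distr M borel (X j))"
      using assms(2) by (subst (asm) M.indep_vars_iff_distr_eq_PiM) auto
    also have "PiM UNIV (\<lambda>j. distr M borel (X j)) = ?P" unfolding \<mu>_def by (rule PiM_cong[OF refl]) (rule assms(3))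
    also have "distr M (PiM UNIV (\<lambda>_. borel)) (\<lambda>\<omega>. \<lambda>j\<in>UNIV. X j \<omega>) = distr M ?P ?X"
      by (rule distr_cong) (auto intro!: sets_PiM_cong simp: X.sets_D)
    finally show ?thesis .
  qed
  have transfer: "(\<integral>\<omega>. f (?X \<omega>) \<partial>M) = integral\<^sup>L ?P f" if "f \<in> borel_measurable ?P" for f :: "(nat \<Rightarrow> real) \<Rightarrow> 'c::{banach, second_countable_topology}"
    using integral_distr[OF Xm that] unfolding joint by simp
  have Fm[measurable]: "F i n \<in> borel_measurable M" for i n using assms(7)[of i n] unfolding poly_chaos_def by auto
  \<comment> \<open>F i n belongs to a closure; a genuine polynomial at L^2 distance at most 1/(n+1)
    takes its place with the same limit in law.\<close>
  define near where "near i n B \<longleftrightarrow> B \<in> pol UNIV d \<and> (\<integral>\<^sup>+\<omega>. ennreal ((F i n \<omega> - B (?X \<omega>))\<^sup>2) \<partial>M) \<le> ennreal ((1 / real (Suc n))\<^sup>2)" for i n B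
  have "\<exists>B. near i n B" for i n
  proof -
    have "(1 / real (Suc n))\<^sup>2 > 0" by simp
    then obtain p where "degree_le d p" "(\<integral>\<^sup>+\<omega>. ennreal ((F i n \<omega> - eval_rpoly p (?X \<omega>))\<^sup>2) \<partial>M) < ennreal ((1 / real (Suc n))\<^sup>2)"
      using assms(7)[of i n] unfolding poly_chaos_def by blast
    then show ?thesis unfolding near_def using eval_rpoly_pol less_imp_le by blast
  qed
  then obtain B where "\<And>i n. near i n (B i n)" by metis
  then have B: "\<And>i n. B i n \<in> pol UNIV d"
    and BF: "\<And>i n. (\<integral>\<^sup>+\<omega>. ennreal ((F i n \<omega> - B i n (?X \<omega>))\<^sup>2) \<partial>M) \<le> ennreal ((1 / real (Suc n))\<^sup>2)"
    unfolding near_def by blast+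
  have Bm[measurable]: "B i n \<in> borel_measurable ?P" for i n by (rule X.pol_meas[OF B])
  obtain \<nu> :: "(nat \<Rightarrow> real) measure" where \<nu>: "prob_space \<nu>" "sets \<nu> = sets (PiM UNIV (\<lambda>_. borel))"
    and lc: "converges_in_law_to M F \<nu> (\<lambda>i x. x i)" using assms(8) unfolding converges_in_law_def by blast
  interpret \<nu>: prob_space \<nu> by fact
  have \<nu>m[measurable]: "(\<lambda>x. x i) \<in> borel_measurable \<nu>" for i
    using measurable_component_singleton[of i UNIV "\<lambda>_. borel"] unfolding measurable_cong_sets[OF \<nu>(2) refl] by simp
  have "\<exists>C. \<forall>\<^sub>F n in sequentially. EE (\<lambda>x. (B i n x)\<^sup>2) \<le> C" for i
  proof (rule X.tight_L2_bounded[OF fin_range B])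
    fix \<delta> :: real assume \<delta>: "\<delta> > 0"
    \<comment> \<open>A continuous substitute for the indicator of |y| > K. For K \<ge> 1 it is
      1-Lipschitz, which carries tightness over from F to its polynomial approximation.\<close>
    define h where "h K y = min 1 (\<bar>y\<bar> / K)" for K y :: real
    have [measurable]: "h K \<in> borel_measurable borel" for K unfolding h_def[abs_def] by measurable
    have "(\<lambda>k. \<integral>x. h (real (Suc k)) (x i) \<partial>\<nu>) \<longlonglongrightarrow> (\<integral>x. 0 \<partial>\<nu>)"
    proof (rule integral_dominated_convergence[where w = "\<lambda>_. 1"])
      show "AE x in \<nu>. (\<lambda>k. h (real (Suc k)) (x i)) \<longlonglongrightarrow> 0"
      proof (rule AE_I2)
        fix x :: "nat \<Rightarrow> real"
        have "(\<lambda>k. min 1 (\<bar>x i\<bar> * (1 / real (Suc k)))) \<longlonglongrightarrow> min 1 (\<bar>x i\<bar> * 0)"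
          by (intro tendsto_intros LIMSEQ_Suc lim_1_over_n)
        then show "(\<lambda>k. h (real (Suc k)) (x i)) \<longlonglongrightarrow> 0" by (simp add: h_def)
      qed
    qed (auto simp: h_def)
    then have "\<forall>\<^sub>F k in sequentially. (\<integral>x. h (real (Suc k)) (x i) \<partial>\<nu>) < \<delta> / 2" using \<delta> by (intro order_tendstoD(2)) auto
    then obtain k where k: "(\<integral>x. h (real (Suc k)) (x i) \<partial>\<nu>) < \<delta> / 2" by (auto dest: eventually_happens)
    define K where "K = real (Suc k)"
    have K: "K \<ge> 1" by (simp add: K_def)
    have "(\<lambda>n. \<integral>\<omega>. h K (F i n \<omega>) \<partial>M) \<longlonglongrightarrow> (\<integral>x. h K (x i) \<partial>\<nu>)"
    proof (rule law_conv_dep[where I = "{i}" and \<Phi> = "\<lambda>w. h K (w i)" and b = 1, OF lc])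
      show "continuous_on UNIV (\<lambda>w::nat \<Rightarrow> real. h K (w i))"
        unfolding h_def using K by (intro continuous_intros continuous_on_subset[OF continuous_on_product_coordinates]) auto
    qed (use K in \<open>auto simp: h_def dep_def\<close>)
    then have "\<forall>\<^sub>F n in sequentially. (\<integral>\<omega>. h K (F i n \<omega>) \<partial>M) < \<delta> / 2" using k unfolding K_def by (rule order_tendstoD(2))
    moreover have "\<forall>\<^sub>F n in sequentially. 1 / real (Suc n) < \<delta> / 2"
      using \<delta> by (intro order_tendstoD(2)[OF LIMSEQ_Suc[OF lim_1_over_n]]) auto
    ultimately have "\<forall>\<^sub>F n in sequentially. EE (\<lambda>x. h K (B i n x)) \<le> \<delta>"
    proof eventually_elim
      case (elim n)
      have L1: "integrable M (\<lambda>\<omega>. \<bar>F i n \<omega> - B i n (?X \<omega>)\<bar>)" "(\<integral>\<omega>. \<bar>F i n \<omega> - B i n (?X \<omega>)\<bar> \<partial>M) \<le> 1 / real (Suc n)"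
        using M.L1_le_L2[OF _ BF[of i n]] by auto
      have ih: "integrable M (\<lambda>\<omega>. h K (u \<omega>))" if [measurable]: "u \<in> borel_measurable M" for u
        by (rule M.integrable_const_bound[of _ 1]) (use K in \<open>auto simp: h_def\<close>)
      have hl: "h K y \<le> h K z + \<bar>z - y\<bar>" for y z
      proof -
        have "\<bar>y\<bar> / K \<le> \<bar>z\<bar> / K + \<bar>z - y\<bar> / K" using K by (simp add: add_divide_distrib[symmetric] divide_right_mono)
        also have "\<bar>z - y\<bar> / K \<le> \<bar>z - y\<bar>" using K by (simp add: divide_le_eq mult_le_cancel_left1)
        finally show ?thesis unfolding h_def by linarith
      qed
      have "EE (\<lambda>x. h K (B i n x)) = (\<integral>\<omega>. h K (B i n (?X \<omega>)) \<partial>M)" by (subst transfer) measurable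
      also have "\<dots> \<le> (\<integral>\<omega>. h K (F i n \<omega>) + \<bar>F i n \<omega> - B i n (?X \<omega>)\<bar> \<partial>M)"
        by (rule integral_mono) (use ih L1(1) hl in auto)
      also have "\<dots> = (\<integral>\<omega>. h K (F i n \<omega>) \<partial>M) + (\<integral>\<omega>. \<bar>F i n \<omega> - B i n (?X \<omega>)\<bar> \<partial>M)"
        using ih[of "F i n"] L1(1) by simp
      finally show ?case using elim L1(2) by linarith
    qed
    then show "\<exists>K>0. \<forall>\<^sub>F n in sequentially. EE (\<lambda>x. min 1 (\<bar>B i n x\<bar> / K)) \<le> \<delta>" using K unfolding h_def by (intro exI[of _ K]) auto
  qed
  then obtain C where C: "\<And>i. \<forall>\<^sub>F n in sequentially. EE (\<lambda>x. (B i n x)\<^sup>2) \<le> C i" by metis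
  \<comment> \<open>The L^2 bound holds from some n on; other terms are set to 0, which does not
    show along U.\<close>
  define B' where "B' i n = (if EE (\<lambda>x. (B i n x)\<^sup>2) \<le> C i then B i n else (\<lambda>_. 0))" for i n
  have B'C: "B' i \<in> CC d" for i
    by (rule CC_I[of _ _ "max 0 (C i)"]) (use B in \<open>auto simp: B'_def pol_const\<close>)
  obtain G where G: "\<And>i. G i \<in> poly_chaos ?N (\<lambda>j y. y j) d"
    and Glim: "\<And>I \<tau>. finite I \<Longrightarrow> ((\<lambda>n. EE (\<lambda>x. iexp (\<Sum>i\<in>I. \<tau> i * B' i n x))) \<longlongrightarrow> Y.E (\<lambda>y. iexp (\<Sum>i\<in>I. \<tau> i * G i y))) U"
    using limit_polynomials[of B', OF B'C order_refl] by (elim exE conjE) blast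
  have Gm: "G i \<in> borel_measurable ?N" for i using G[of i] unfolding poly_chaos_def by auto
  \<comment> \<open>The characteristic functions of F converge along the whole sequence by
    hypothesis, so their limit agrees with the limit along U of those of the approximating
    polynomials.\<close>
  have ch: "(\<integral>x. iexp (\<Sum>i\<in>I. \<tau> i * x i) \<partial>\<nu>) = Y.E (\<lambda>y. iexp (\<Sum>i\<in>I. \<tau> i * G i y))" if I: "finite I" for I \<tau>
  proof -
    have "(\<lambda>n. (\<integral>\<omega>. iexp (\<Sum>i\<in>I. \<tau> i * F i n \<omega>) \<partial>M) - EE (\<lambda>x. iexp (\<Sum>i\<in>I. \<tau> i * B i n x))) \<longlonglongrightarrow> 0"
    proof (rule Lim_null_comparison)
      show "\<forall>\<^sub>F n in sequentially. norm ((\<integral>\<omega>. iexp (\<Sum>i\<in>I. \<tau> i * F i n \<omega>) \<partial>M) - EE (\<lambda>x. iexp (\<Sum>i\<in>I. \<tau> i * B i n x))) \<le> (\<Sum>i\<in>I. \<bar>\<tau> i\<bar>) * (1 / real (Suc n))"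
      proof (intro always_eventually allI)
        fix n
        have "EE (\<lambda>x. iexp (\<Sum>i\<in>I. \<tau> i * B i n x)) = (\<integral>\<omega>. iexp (\<Sum>i\<in>I. \<tau> i * B i n (?X \<omega>)) \<partial>M)" by (subst transfer) measurable
        then show "norm ((\<integral>\<omega>. iexp (\<Sum>i\<in>I. \<tau> i * F i n \<omega>) \<partial>M) - EE (\<lambda>x. iexp (\<Sum>i\<in>I. \<tau> i * B i n x))) \<le> (\<Sum>i\<in>I. \<bar>\<tau> i\<bar>) * (1 / real (Suc n))"
          using M.iexp_sum_close[of "\<lambda>i. F i n" "\<lambda>i \<omega>. B i n (?X \<omega>)" I "1 / real (Suc n)" \<tau>] BF by simp
      qed
      have "(\<lambda>n. (\<Sum>i\<in>I. \<bar>\<tau> i\<bar>) * (1 / real (Suc n))) \<longlonglongrightarrow> (\<Sum>i\<in>I. \<bar>\<tau> i\<bar>) * 0" by (intro tendsto_intros LIMSEQ_Suc lim_1_over_n)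
      then show "(\<lambda>n. (\<Sum>i\<in>I. \<bar>\<tau> i\<bar>) * (1 / real (Suc n))) \<longlonglongrightarrow> 0" by simp
    qed
    from tendsto_diff[OF law_conv_char[OF lc M.prob_space_axioms \<nu>(1) I Fm \<nu>m, of \<tau>] this]
    have "(\<lambda>n. EE (\<lambda>x. iexp (\<Sum>i\<in>I. \<tau> i * B i n x))) \<longlonglongrightarrow> (\<integral>x. iexp (\<Sum>i\<in>I. \<tau> i * x i) \<partial>\<nu>)" by simp
    then have "((\<lambda>n. EE (\<lambda>x. iexp (\<Sum>i\<in>I. \<tau> i * B i n x))) \<longlongrightarrow> (\<integral>x. iexp (\<Sum>i\<in>I. \<tau> i * x i) \<partial>\<nu>)) U"
      by (rule tendsto_mono[OF U_seq])
    moreover have "\<forall>\<^sub>F n in U. EE (\<lambda>x. iexp (\<Sum>i\<in>I. \<tau> i * B i n x)) = EE (\<lambda>x. iexp (\<Sum>i\<in>I. \<tau> i * B' i n x))"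
    proof -
      have "\<forall>\<^sub>F n in U. \<forall>i\<in>I. EE (\<lambda>x. (B i n x)\<^sup>2) \<le> C i"
        by (intro eventually_ball_finite I ballI filter_leD[OF U_seq] C)
      then show ?thesis
      proof eventually_elim
        case (elim n)
        then have "(\<Sum>i\<in>I. \<tau> i * B i n x) = (\<Sum>i\<in>I. \<tau> i * B' i n x)" for x by (intro sum.cong) (auto simp: B'_def)
        then show ?case by presburger
      qed
    qed
    ultimately have "((\<lambda>n. EE (\<lambda>x. iexp (\<Sum>i\<in>I. \<tau> i * B' i n x))) \<longlongrightarrow> (\<integral>x. iexp (\<Sum>i\<in>I. \<tau> i * x i) \<partial>\<nu>)) U"
      by (rule Lim_transform_eventually)
    then show ?thesis using Glim[OF I] tendsto_unique[OF U_bot] by blast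
  qed
  have "converges_in_law_to M F ?N G"
    by (rule law_conv_eq[OF lc \<nu>(1) Y.D.P.prob_space_axioms \<nu>m Gm ch])
  moreover have "Y.D.P.indep_vars (\<lambda>_. borel) (\<lambda>j y. y j) UNIV"
    using Y.indep_coords unfolding Y.D.P.indep_vars_def Y.sets_D by simp
  moreover have "distr ?N borel (\<lambda>y. y j) = mixlaw \<mu> j" for j
    using Y.distr_coord[of j] distr_cong[OF refl Y.sets_D[of j], of ?N "\<lambda>y. y j" "\<lambda>y. y j"] by simp
  ultimately show ?thesis
    using G Y.D.P.prob_space_axioms by (intro exI[of _ ?N] exI[of _ "\<lambda>j y. y j"] exI[of _ G]) (auto simp: mixlaw_def \<mu>_def)
qed

end
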